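(* Let $p$ be a prime. Then the group $C_2^5\times C_p$ is a $\mathrm{DCI}$-group if and only if $p\neq 2$.
   Context: $C_n$ denotes the cyclic group of order $n$. For a finite group $G$ and $S\subseteq G$, the Cayley digraph $\mathrm{Cay}(G,S)$ has vertex set $G$ and arc set $\{(g,sg): g\in G, s\in S\}$. Two Cayley digraphs $\mathrm{Cay}(G,S)$ and $\mathrm{Cay}(G,T)$ are Cayley isomorphic if some automorphism of the group $G$ is a digraph isomorphism between them (equivalently $T=S^\varphi$ for some $\varphi\in\mathrm{Aut}(G)$). A subset $S\subseteq G$ is a CI-subset if for every $T\subseteq G$, $\mathrm{Cay}(G,S)\cong \mathrm{Cay}(G,T)$ implies that they are Cayley isomorphic. A finite group $G$ is a $\mathrm{DCI}$-group if every subset of $G$ is a CI-subset. *)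

theory Defs
  imports
    "HOL-Algebra.Bij"
    "HOL-Algebra.Elementary_Groups"
    "HOL-Algebra.Product_Groups"
    "HOL-Computational_Algebra.Primes"
    "Graph_Theory.Digraph_Isomorphism"
    "Graph_Theory.Pair_Digraph"
begin

definition group_power :: "('a, 'b) monoid_scheme \<Rightarrow> nat \<Rightarrow> (nat \<Rightarrow> 'a) monoid" where
  "group_power G n = product_group {..<n} (\<lambda>_. G)"

definition cayley_digraph :: "('a, 'b) monoid_scheme \<Rightarrow> 'a set \<Rightarrow> 'a pair_pre_digraph" where
  "cayley_digraph G S =
    \<lparr> pverts = carrier G, parcs = {(g, s \<otimes>\<^bsub>G\<^esub> g) | g s. g \<in> carrier G \<and> s \<in> S} \<rparr>"

text \<open>The first two conjuncts are the body of \<^const>\<open>digraph_iso\<close>, unfolded so that the vertex map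
  can be required to be a group automorphism.\<close>

definition cayley_isomorphic :: "('a, 'b) monoid_scheme \<Rightarrow> 'a set \<Rightarrow> 'a set \<Rightarrow> bool" where
  "cayley_isomorphic G S T \<longleftrightarrow>
    (\<exists>f. pre_digraph.digraph_isomorphism (with_proj (cayley_digraph G S)) f \<and>
         with_proj (cayley_digraph G T) = app_iso f (with_proj (cayley_digraph G S)) \<and>
         iso_verts f \<in> auto G)"

definition CI_subset :: "('a, 'b) monoid_scheme \<Rightarrow> 'a set \<Rightarrow> bool" where
  "CI_subset G S \<longleftrightarrow> S \<subseteq> carrier G \<and>
    (\<forall>T. T \<subseteq> carrier G \<longrightarrow>
      digraph_iso (with_proj (cayley_digraph G S)) (with_proj (cayley_digraph G T)) \<longrightarrow>
      cayley_isomorphic G S T)"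

definition DCI_group :: "('a, 'b) monoid_scheme \<Rightarrow> bool" where
  "DCI_group G \<longleftrightarrow> group G \<and> finite (carrier G) \<and> (\<forall>S. S \<subseteq> carrier G \<longrightarrow> CI_subset G S)"

end

theory Submission
  imports Defs "HOL-Combinatorics.Permutations" "HOL-Algebra.Sylow" "HOL-Algebra.Group_Action" "HOL-Library.Cardinality"
begin

text \<open>
  Babai's criterion reduces the claim for odd \<open>p\<close> to a conjugacy statement. Let \<open>A\<close> be the automorphism
  group of a Cayley digraph of \<open>G = E \<times> P\<close> with \<open>E\<close> elementary abelian of order 32 and \<open>P\<close> of order \<open>p\<close>;
  the only property of \<open>A\<close> that is used is that it is 2-closed. One has to conjugate, inside \<open>A\<close>, an
  arbitrary regular subgroup \<open>H = E' \<times> P'\<close> isomorphic to \<open>G\<close> onto \<open>G\<close>.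

  Counting walks of length \<open>p\<close> modulo \<open>p\<close> yields a subgroup \<open>L\<close> of \<open>E\<close>, depending only on \<open>A\<close>, whose orbits are blocks
  and such that \<open>P\<close> may be rotated independently on the orbits of \<open>L \<times> P\<close>. Sylow's theorem for these rotation
  groups makes the orbits of \<open>L \<times> P\<close> and \<open>L' \<times> P'\<close> coincide, and a Fourier argument over the integers, using
  that a unit modulo \<open>p\<close> is a unit of the localised group ring of a cyclic group of order \<open>p\<close>, lets one assume that
  \<open>P'\<close> acts on every orbit of \<open>L \<times> P\<close> by powers of the generator of \<open>P\<close>.

  After a second Sylow argument, \<open>E\<close> and \<open>E'\<close> generate a 2-group with an orbit of length 32, so that one is left
  with a pair of regular elementary abelian subgroups of a 2-group of permutations of \<open>E\<close>. For such a pair and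
  an invariant subgroup of index 2, either one can rotate one half so that \<open>E \<inter> E'\<close> grows, or \<open>E'\<close> acts by
  translations on another subgroup of index 2; both cases produce an element of \<open>A\<close> that moves \<open>H\<close> closer to \<open>G\<close>.

  For \<open>p = 2\<close> a quadric and a cubic hypersurface in a 6-dimensional space over the field with two elements
  define isomorphic Cayley digraphs but are not linearly equivalent.
\<close>

section \<open>Group actions\<close>

lemma group_actionI:
  assumes "group G"
    and closed: "\<And>g x. g \<in> carrier G \<Longrightarrow> x \<in> E \<Longrightarrow> \<phi> g x \<in> E"
    and one: "\<And>x. x \<in> E \<Longrightarrow> \<phi> \<one>\<^bsub>G\<^esub> x = x"
    and mult: "\<And>g h x. \<lbrakk>g \<in> carrier G; h \<in> carrier G; x \<in> E\<rbrakk> \<Longrightarrow> \<phi> (g \<otimes>\<^bsub>G\<^esub> h) x = \<phi> g (\<phi> h x)"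
  shows "group_action G E (\<lambda>g. restrict (\<phi> g) E)"
proof -
  interpret group G by fact
  have Bij: "restrict (\<phi> g) E \<in> Bij E" if g: "g \<in> carrier G" for g
  proof -
    have "\<phi> (inv\<^bsub>G\<^esub> g) (\<phi> g x) = x" "\<phi> g (\<phi> (inv\<^bsub>G\<^esub> g) x) = x" if "x \<in> E" for x
      using g that mult[of "inv\<^bsub>G\<^esub> g" g x] mult[of g "inv\<^bsub>G\<^esub> g" x] one by simp_all
    then have "bij_betw (\<phi> g) E E"
      using g closed by (intro bij_betwI[where g="\<phi> (inv\<^bsub>G\<^esub> g)"]) auto
    then show ?thesis by (simp add: Bij_def cong: bij_betw_cong)
  qed
  have "(\<lambda>g. restrict (\<phi> g) E) \<in> hom G (BijGroup E)"
  proof (rule homI)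
    fix g h assume gh: "g \<in> carrier G" "h \<in> carrier G"
    have "restrict (\<phi> (g \<otimes>\<^bsub>G\<^esub> h)) E = compose E (restrict (\<phi> g) E) (restrict (\<phi> h) E)"
      using gh closed mult by (auto simp: compose_def fun_eq_iff)
    then show "restrict (\<phi> (g \<otimes>\<^bsub>G\<^esub> h)) E = restrict (\<phi> g) E \<otimes>\<^bsub>BijGroup E\<^esub> restrict (\<phi> h) E"
      using Bij gh by (simp add: BijGroup_def)
  qed (use Bij in \<open>simp add: BijGroup_def\<close>)
  then show ?thesis
    by (intro group_action.intro group_hom.intro group_hom_axioms.intro group_BijGroup group_axioms)
qed

lemma (in group_action) card_orbit_prime_power:
  fixes p :: nat
  assumes "prime p" "order G dvd p ^ k" "x \<in> E"
  shows "\<exists>j. card (orbit G \<phi> x) = p ^ j"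
proof -
  have "card (orbit G \<phi> x) dvd order G"
    using orbit_stabilizer_theorem[OF assms(3)] by (metis dvd_triv_left)
  then show ?thesis using assms divides_primepow_nat dvd_trans by blast
qed

lemma (in group_action) p_group_card_nonfixed:
  fixes p :: nat
  assumes "prime p" "order G = p ^ k" "finite E"
  shows "p dvd card (E - {x \<in> E. \<forall>g\<in>carrier G. \<phi> g x = x})" (is "_ dvd card (E - ?F)")
proof -
  let ?C = "{B \<in> orbits G E \<phi>. card B \<noteq> 1}"
  have fixed_iff: "x \<in> ?F \<longleftrightarrow> card B = 1" if B: "B \<in> orbits G E \<phi>" "x \<in> B" for B x
  proof -
    have x: "x \<in> E" using that orbits_coverture by blast
    then have "x \<in> orbit G \<phi> x" "orbit G \<phi> x \<in> orbits G E \<phi>"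
      using orbit_refl unfolding orbits_def by auto
    with B disjoint_union have O_eq: "B = orbit G \<phi> x" by blast
    show ?thesis
    proof
      assume "x \<in> ?F"
      then have "B = {x}"
        using B(2) unfolding O_eq orbit_def by auto
      then show "card B = 1" by simp
    next
      assume "card B = 1"
      then have "B = {x}" using B(2) by (auto simp: card_1_singleton_iff)
      then show "x \<in> ?F" using x unfolding O_eq orbit_def by blast
    qed
  qed
  have "\<Union> ?C = E - ?F"
    using orbits_coverture fixed_iff by blast
  moreover have "p dvd card (\<Union> ?C)"
  proof (rule dvd_partition)
    show "finite (\<Union> ?C)" using assms(3) orbits_coverture by (metis (lifting) \<open>\<Union> ?C = E - ?F\<close> finite_Diff)
    show "\<forall>B\<in>?C. p dvd card B"
    proof
      fix B assume B: "B \<in> ?C"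
      then obtain x where "x \<in> E" "B = orbit G \<phi> x" unfolding orbits_def by blast
      with card_orbit_prime_power[OF assms(1), of k x] assms(2) obtain j where "card B = p ^ j" by auto
      with B show "p dvd card B" by (cases j) auto
    qed
  qed (use disjoint_union in blast)
  ultimately show ?thesis by simp
qed

lemma p_group_fixed_point:
  fixes p :: nat
  assumes "group_action G E (\<lambda>g. restrict (\<phi> g) E)" "prime p" "order G = p ^ k"
    and E: "finite E" "\<not> p dvd card E"
  obtains x where "x \<in> E" "\<And>g. g \<in> carrier G \<Longrightarrow> \<phi> g x = x"
proof -
  let ?F = "{x \<in> E. \<forall>g\<in>carrier G. restrict (\<phi> g) E x = x}"
  have "p dvd card (E - ?F)" by (rule group_action.p_group_card_nonfixed[OF assms(1-3) E(1)])
  then have "?F \<noteq> {}" using E(2) by (metis Diff_empty)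
  then obtain x where "x \<in> E" "\<forall>g\<in>carrier G. restrict (\<phi> g) E x = x" by blast
  then show thesis using that[of x] by simp
qed

lemma card_cyclic_nonfixed:
  fixes p :: nat
  assumes fin: "finite S" and p: "prime p" and f: "\<And>x. x \<in> S \<Longrightarrow> f x \<in> S"
    and fp: "\<And>x. x \<in> S \<Longrightarrow> (f ^^ p) x = x"
  shows "p dvd card (S - {x \<in> S. f x = x})"
proof -
  let ?Z = "integer_mod_group p" and ?\<phi> = "\<lambda>i. restrict (f ^^ nat i) S"
  have p_gt: "p > 1" using p prime_gt_1_nat by blast
  then have carrier: "carrier ?Z = {0..<int p}" by (simp add: carrier_integer_mod_group)
  have pow_mem: "(f ^^ n) x \<in> S" if "x \<in> S" for n x using that f by (induction n) auto
  interpret group_action ?Z S ?\<phi>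
  proof (rule group_actionI)
    fix i j x assume "i \<in> carrier ?Z" "j \<in> carrier ?Z" and x: "x \<in> S"
    then have "nat ((i + j) mod int p) = (nat i + nat j) mod p"
      unfolding carrier by (simp add: nat_mod_distrib nat_add_distrib)
    then show "(f ^^ nat (i \<otimes>\<^bsub>?Z\<^esub> j)) x = (f ^^ nat i) ((f ^^ nat j) x)"
      using funpow_mod_eq[OF fp[OF x], of "nat i + nat j"] by (simp add: funpow_add)
  qed (simp_all add: pow_mem)
  have "{x \<in> S. \<forall>i\<in>carrier ?Z. ?\<phi> i x = x} = {x \<in> S. f x = x}"
  proof (intro Collect_cong conj_cong refl iffI ballI)
    fix x assume "x \<in> S" "\<forall>i\<in>carrier ?Z. ?\<phi> i x = x"
    then show "f x = x" using p_gt unfolding carrier by (auto dest: bspec[of _ _ 1])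
  next
    fix x i assume "x \<in> S" "f x = x"
    moreover from this(2) have "(f ^^ n) x = x" for n by (induction n) auto
    ultimately show "?\<phi> i x = x" by simp
  qed
  moreover have "order ?Z = p ^ 1" by (simp add: order_def carrier)
  ultimately show ?thesis using p_group_card_nonfixed[OF p _ fin] by metis
qed

lemma (in group) conj_p_subgroup_subset_sylow:
  fixes p :: nat
  assumes fin: "finite (carrier G)" and p: "prime p"
    and H: "subgroup H G" "\<not> p dvd card (rcosets H)"
    and A: "subgroup A G" "card A = p ^ a"
  shows "\<exists>g\<in>carrier G. \<forall>f\<in>A. g \<otimes> f \<otimes> inv g \<in> H"
proof -
  let ?A = "G\<lparr>carrier := A\<rparr>"
  note A_carrier = subgroup.mem_carrier[OF A(1)] and H_sub = subgroup.subset[OF H(1)]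
  have coset_act: "H #> g #> inv f = H #> (g \<otimes> inv f)" if "g \<in> carrier G" "f \<in> A" for g f
    using coset_mult_assoc[OF H_sub that(1) inv_closed[OF A_carrier[OF that(2)]]] .
  have "group_action ?A (rcosets H) (\<lambda>f. restrict (\<lambda>C. C #> inv f) (rcosets H))"
  proof (rule group_actionI)
    show "group ?A" using subgroup_imp_group A(1) by blast
    show "C #> inv f \<in> rcosets H" if "f \<in> carrier ?A" "C \<in> rcosets H" for f C
      using that coset_act A_carrier by (auto simp: RCOSETS_def)
    show "C #> inv \<one>\<^bsub>?A\<^esub> = C" if "C \<in> rcosets H" for C
      using that by (auto simp: RCOSETS_def coset_mult_assoc H_sub)
    show "C #> inv (f \<otimes>\<^bsub>?A\<^esub> h) = C #> inv h #> inv f"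
      if "f \<in> carrier ?A" "h \<in> carrier ?A" "C \<in> rcosets H" for f h C
      using that A_carrier by (auto simp: RCOSETS_def coset_mult_assoc H_sub inv_mult_group m_assoc)
  qed
  moreover have "order ?A = p ^ a" using A(2) by (simp add: order_def)
  moreover have "finite (rcosets H)" using fin rcosets_part_G[OF H(1)] finite_UnionD by metis
  ultimately obtain C where C: "C \<in> rcosets H" "\<And>f. f \<in> carrier ?A \<Longrightarrow> C #> inv f = C"
    using p_group_fixed_point[where \<phi>="\<lambda>f C. C #> inv f", OF _ p _ _ H(2)] by blast
  from C(1) obtain g where g: "g \<in> carrier G" "C = H #> g" by (auto simp: RCOSETS_def)
  have "g \<otimes> f \<otimes> inv g \<in> H" if f: "f \<in> A" for f
  proof -
    have "inv f \<in> A" using f subgroup.m_inv_closed[OF A(1)] by blast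
    then have "H #> (g \<otimes> inv (inv f)) = H #> g" using C(2)[of "inv f"] g coset_act[of g "inv f"] by simp
    then have "g \<otimes> f \<in> H #> g"
      using rcos_self[OF _ H(1), of "g \<otimes> f"] f g(1) A_carrier by simp
    then obtain h where "h \<in> H" "g \<otimes> f = h \<otimes> g" unfolding r_coset_def by blast
    moreover from this have "h \<otimes> g \<otimes> inv g = h" using g(1) subsetD[OF H_sub] by (simp add: m_assoc)
    ultimately show ?thesis by simp
  qed
  with g(1) show ?thesis by blast
qed

lemma (in group) exists_sylow_subgroup:
  fixes p :: nat
  assumes fin: "finite (carrier G)" and p: "prime p"
  obtains H k where "subgroup H G" "card H = p ^ k" "\<not> p dvd card (rcosets H)"
proof -
  have "order G \<noteq> 0" using fin by (auto simp: order_def card_gt_0_iff)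
  then obtain m where m: "order G = p ^ multiplicity p (order G) * m" "\<not> p dvd m"
    using p by (elim multiplicity_decompose'[rotated 2]) (auto simp: prime_nat_iff)
  then obtain H where H: "subgroup H G" "card H = p ^ multiplicity p (order G)"
    using sylow_thm[OF p is_group _ fin] by blast
  have "card (rcosets H) * p ^ multiplicity p (order G) = m * p ^ multiplicity p (order G)"
    using lagrange[OF H(1)] m(1) H(2) by (simp add: mult.commute)
  then have "\<not> p dvd card (rcosets H)" using m(2) p by (auto simp: prime_gt_0_nat)
  with that H show thesis by blast
qed

lemma (in group) card_conjugate_subgroup:
  assumes g: "g \<in> carrier G" and H: "subgroup H G" shows "card (inv g <# H #> g) = card H"
proof -
  have "inv g <# H #> g = (\<lambda>h. inv g \<otimes> h \<otimes> g) ` H" unfolding l_coset_def r_coset_def by auto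
  moreover have "inj_on (\<lambda>h. inv g \<otimes> h \<otimes> g) H"
    using g subgroup.mem_carrier[OF H] by (intro inj_onI) simp
  ultimately show ?thesis by (simp add: card_image)
qed

lemma (in group) conj_p_subgroups_in_common_p_subgroup:
  fixes p :: nat
  assumes fin: "finite (carrier G)" and p: "prime p"
    and A: "subgroup A G" "card A = p ^ a" and B: "subgroup B G" "card B = p ^ b"
  shows "\<exists>g\<in>carrier G. \<exists>T k. subgroup T G \<and> card T = p ^ k \<and> A \<subseteq> T \<and> (\<forall>f\<in>B. g \<otimes> f \<otimes> inv g \<in> T)"
proof -
  obtain H k where H: "subgroup H G" "card H = p ^ k" and index: "\<not> p dvd card (rcosets H)"
    using exists_sylow_subgroup[OF fin p] .
  obtain g where g: "g \<in> carrier G" "\<And>f. f \<in> A \<Longrightarrow> g \<otimes> f \<otimes> inv g \<in> H"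
    using conj_p_subgroup_subset_sylow[OF fin p H(1) index A] by blast
  obtain h where h: "h \<in> carrier G" "\<And>f. f \<in> B \<Longrightarrow> h \<otimes> f \<otimes> inv h \<in> H"
    using conj_p_subgroup_subset_sylow[OF fin p H(1) index B] by blast
  let ?T = "inv g <# H #> g"
  have memT: "f \<in> ?T" if "f \<in> carrier G" "g \<otimes> f \<otimes> inv g \<in> H" for f
  proof -
    have "f = inv g \<otimes> (g \<otimes> f \<otimes> inv g) \<otimes> g"
      using that g(1) by (simp add: m_assoc) (simp flip: m_assoc)
    then show ?thesis using that unfolding l_coset_def r_coset_def by blast
  qed
  have "subgroup ?T G" by (rule subgroup_conjugation_is_surj1[OF g(1) H(1)])
  moreover have "card ?T = card H" by (rule card_conjugate_subgroup[OF g(1) H(1)])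
  moreover have "A \<subseteq> ?T" using memT g(2) subgroup.mem_carrier[OF A(1)] by blast
  moreover have "(inv g \<otimes> h) \<otimes> f \<otimes> inv (inv g \<otimes> h) \<in> ?T" if f: "f \<in> B" for f
  proof (rule memT)
    note f' = subgroup.mem_carrier[OF B(1) f]
    then show "inv g \<otimes> h \<otimes> f \<otimes> inv (inv g \<otimes> h) \<in> carrier G" using g(1) h(1) by simp
    have "g \<otimes> (inv g \<otimes> h \<otimes> f \<otimes> inv (inv g \<otimes> h)) \<otimes> inv g = h \<otimes> f \<otimes> inv h"
      using f' g(1) h(1) by (simp add: inv_mult_group m_assoc) (simp flip: m_assoc)
    then show "g \<otimes> (inv g \<otimes> h \<otimes> f \<otimes> inv (inv g \<otimes> h)) \<otimes> inv g \<in> H" using h(2)[OF f] by simp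
  qed
  ultimately show ?thesis using H(2) g(1) h(1) by (metis inv_closed m_closed)
qed

section \<open>Permutation groups\<close>

abbreviation finv :: "('a \<Rightarrow> 'b) \<Rightarrow> 'b \<Rightarrow> 'a" where
  "finv \<equiv> inv_into UNIV"

lemma finv_involution: "(\<And>x. f (f x) = x) \<Longrightarrow> finv f = f"
  by (rule inv_unique_comp) (simp_all add: fun_eq_iff)

definition perm_group :: "'a set \<Rightarrow> ('a \<Rightarrow> 'a) set \<Rightarrow> bool" where
  "perm_group S G \<longleftrightarrow> (\<forall>f\<in>G. f permutes S) \<and> id \<in> G \<and>
     (\<forall>f\<in>G. \<forall>g\<in>G. f \<circ> g \<in> G) \<and> (\<forall>f\<in>G. finv f \<in> G)"

lemma perm_groupI:
  assumes "\<And>f. f \<in> G \<Longrightarrow> f permutes S" "id \<in> G"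
    "\<And>f g. f \<in> G \<Longrightarrow> g \<in> G \<Longrightarrow> f \<circ> g \<in> G" "\<And>f. f \<in> G \<Longrightarrow> finv f \<in> G"
  shows "perm_group S G"
  using assms unfolding perm_group_def by blast

lemma perm_groupD:
  assumes "perm_group S G"
  shows "f \<in> G \<Longrightarrow> f permutes S" "id \<in> G" "f \<in> G \<Longrightarrow> g \<in> G \<Longrightarrow> f \<circ> g \<in> G" "f \<in> G \<Longrightarrow> finv f \<in> G"
  using assms unfolding perm_group_def by blast+

lemma perm_group_finite:
  assumes "perm_group S G" "finite S" shows "finite G"
  using perm_groupD(1)[OF assms(1)] by (intro finite_subset[OF _ finite_permutations[OF assms(2)]]) blast

lemma perm_group_inv_apply:
  assumes "perm_group S G" "f \<in> G"
  shows "finv f (f x) = x" "f (finv f x) = x"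
  using perm_groupD(1)[OF assms] permutes_inverses by metis+

lemma perm_group_inv_comp:
  assumes "perm_group S G" "f \<in> G"
  shows "finv f \<circ> f = id" "f \<circ> finv f = id"
  using perm_group_inv_apply[OF assms] by (simp_all add: fun_eq_iff)

lemma perm_group_mult_mem:
  assumes "perm_group S G" "f \<in> G" "g \<in> G" shows "(\<lambda>x. f (g x)) \<in> G"
  using perm_groupD(3)[OF assms] by (simp add: comp_def)

definition perm_monoid :: "('a \<Rightarrow> 'a) set \<Rightarrow> ('a \<Rightarrow> 'a) monoid" where
  "perm_monoid G = \<lparr>carrier = G, monoid.mult = (\<circ>), one = id\<rparr>"

lemma perm_monoid_simps [simp]:
  "carrier (perm_monoid G) = G" "f \<otimes>\<^bsub>perm_monoid G\<^esub> g = f \<circ> g" "\<one>\<^bsub>perm_monoid G\<^esub> = id"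
  by (simp_all add: perm_monoid_def)

lemma group_perm_monoid:
  assumes "perm_group S G" shows "group (perm_monoid G)"
proof (rule groupI)
  fix f assume "f \<in> carrier (perm_monoid G)"
  then show "\<exists>g\<in>carrier (perm_monoid G). g \<otimes>\<^bsub>perm_monoid G\<^esub> f = \<one>\<^bsub>perm_monoid G\<^esub>"
    using perm_group_inv_comp(1)[OF assms] perm_groupD(4)[OF assms] by auto
qed (use perm_groupD[OF assms] in \<open>auto simp: comp_assoc\<close>)

lemma inv_perm_monoid:
  assumes "perm_group S G" "f \<in> G" shows "inv\<^bsub>perm_monoid G\<^esub> f = finv f"
  using assms perm_groupD(4) perm_group_inv_comp
  by (intro group.inv_equality[OF group_perm_monoid]) auto

lemma subgroup_perm_monoid_iff:
  assumes "perm_group S G"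
  shows "subgroup H (perm_monoid G) \<longleftrightarrow> H \<subseteq> G \<and> perm_group S H"
proof
  assume H: "subgroup H (perm_monoid G)"
  then have sub: "H \<subseteq> G" using subgroup.subset by fastforce
  then have "perm_group S H"
    using subgroup.one_closed[OF H] subgroup.m_closed[OF H] subgroup.m_inv_closed[OF H] perm_groupD(1)[OF assms]
      inv_perm_monoid[OF assms] by (intro perm_groupI) (simp_all add: subset_iff)
  with sub show "H \<subseteq> G \<and> perm_group S H" ..
next
  assume H: "H \<subseteq> G \<and> perm_group S H"
  then show "subgroup H (perm_monoid G)"
    using perm_groupD[of S H] perm_groupD(2)[of S H] inv_perm_monoid[OF assms]
    by (intro subgroup.intro) (auto simp: subset_iff)
qed

lemma perm_group_card_dvd:
  assumes "perm_group S G" "perm_group S H" "H \<subseteq> G"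
  shows "card H dvd card G"
  using group.lagrange[OF group_perm_monoid[OF assms(1)], of H] assms
  by (metis dvd_triv_right order_def perm_monoid_simps(1) subgroup_perm_monoid_iff)

lemma perm_group_action:
  assumes G: "perm_group S G"
    and "\<And>f x. f \<in> G \<Longrightarrow> x \<in> E \<Longrightarrow> \<phi> f x \<in> E" "\<And>x. x \<in> E \<Longrightarrow> \<phi> id x = x"
    and "\<And>f g x. \<lbrakk>f \<in> G; g \<in> G; x \<in> E\<rbrakk> \<Longrightarrow> \<phi> (f \<circ> g) x = \<phi> f (\<phi> g x)"
  shows "group_action (perm_monoid G) E (\<lambda>f. restrict (\<phi> f) E)"
  using assms by (intro group_actionI group_perm_monoid[OF G]) simp_all

lemma card_perm_orbit_prime_power:
  fixes p :: nat
  assumes "group_action (perm_monoid G) E (\<lambda>f. restrict (\<phi> f) E)" "card G dvd p ^ k" "prime p" "x \<in> E"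
  shows "\<exists>j. card ((\<lambda>f. \<phi> f x) ` G) = p ^ j"
proof -
  have "orbit (perm_monoid G) (\<lambda>f. restrict (\<phi> f) E) x = (\<lambda>f. \<phi> f x) ` G"
    using assms(4) unfolding orbit_def by auto
  then show ?thesis
    using group_action.card_orbit_prime_power[OF assms(1,3) _ assms(4), of k] assms(2) by (simp add: order_def)
qed

definition conj_perm :: "('a \<Rightarrow> 'a) \<Rightarrow> ('a \<Rightarrow> 'a) \<Rightarrow> 'a \<Rightarrow> 'a" where
  "conj_perm g f = g \<circ> f \<circ> finv g"

lemma conj_perm_funpow:
  assumes "g permutes S" shows "(conj_perm g f ^^ n) x = g ((f ^^ n) (finv g x))"
  by (induction n) (simp_all add: conj_perm_def permutes_inverses[OF assms])

lemma perm_groups_conj_in_common_p_group: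
  fixes p :: nat
  assumes G: "perm_group S G" and fin: "finite S" and p: "prime p"
    and A: "perm_group S A" "A \<subseteq> G" "card A = p ^ a" and B: "perm_group S B" "B \<subseteq> G" "card B = p ^ b"
  obtains g T k where "g \<in> G" "perm_group S T" "T \<subseteq> G" "card T = p ^ k" "A \<subseteq> T" "conj_perm g ` B \<subseteq> T"
proof -
  have "\<exists>g\<in>G. \<exists>T k. (T \<subseteq> G \<and> perm_group S T) \<and> card T = p ^ k \<and> A \<subseteq> T \<and>
      (\<forall>f\<in>B. g \<circ> f \<circ> inv\<^bsub>perm_monoid G\<^esub> g \<in> T)"
    using group.conj_p_subgroups_in_common_p_subgroup[OF group_perm_monoid[OF G], of p A a B b] p A B
      perm_group_finite[OF G fin] unfolding subgroup_perm_monoid_iff[OF G] by simp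
  then show thesis using that inv_perm_monoid[OF G] by (fastforce simp: conj_perm_def)
qed

definition orb :: "('a \<Rightarrow> 'a) set \<Rightarrow> 'a \<Rightarrow> 'a set" where
  "orb G x = (\<lambda>f. f x) ` G"

lemma orbI: "f \<in> G \<Longrightarrow> f x \<in> orb G x"
  unfolding orb_def by (rule imageI)

lemma orb_self: "perm_group S G \<Longrightarrow> x \<in> orb G x"
  using orbI[of id G x] perm_groupD(2) by fastforce

lemma orb_eq:
  assumes G: "perm_group S G" and "y \<in> orb G x" shows "orb G y = orb G x"
proof -
  have sub: "orb G (f x) \<subseteq> orb G x" if f: "f \<in> G" for f x
    using perm_group_mult_mem[OF G _ f] unfolding orb_def by auto
  obtain f where f: "f \<in> G" "y = f x" using assms(2) unfolding orb_def by blast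
  then show ?thesis
    using sub[OF f(1), of x] sub[OF perm_groupD(4)[OF G f(1)], of y] perm_group_inv_apply[OF G f(1)] by simp
qed

lemma orb_subset: "perm_group S G \<Longrightarrow> x \<in> S \<Longrightarrow> orb G x \<subseteq> S"
  using perm_groupD(1)[of S G] by (auto simp: orb_def permutes_in_image)

lemma card_orb_prime_power:
  fixes p :: nat
  assumes "perm_group S G" "card G dvd p ^ k" "prime p"
  shows "\<exists>j. card (orb G x) = p ^ j"
  using card_perm_orbit_prime_power[OF perm_group_action[where E=UNIV and \<phi>="\<lambda>f. f"]] assms
  unfolding orb_def by simp

inductive_set comp_closure :: "('a \<Rightarrow> 'a) set \<Rightarrow> ('a \<Rightarrow> 'a) set" for B where
  id: "id \<in> comp_closure B"
| comp: "f \<in> B \<Longrightarrow> g \<in> comp_closure B \<Longrightarrow> f \<circ> g \<in> comp_closure B"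

lemma comp_closure_generator: "f \<in> B \<Longrightarrow> f \<in> comp_closure B"
  using comp_closure.comp[OF _ comp_closure.id] by fastforce

lemma comp_closure_comp:
  assumes "f \<in> comp_closure B" "g \<in> comp_closure B" shows "f \<circ> g \<in> comp_closure B"
  using assms by induction (simp_all add: comp_assoc comp_closure.comp)

lemma perm_group_comp_closure:
  assumes perm: "\<And>f. f \<in> B \<Longrightarrow> f permutes S" and inv: "\<And>f. f \<in> B \<Longrightarrow> finv f \<in> B"
  shows "perm_group S (comp_closure B)"
proof (rule perm_groupI)
  show permutes: "f permutes S" if "f \<in> comp_closure B" for f
    using that by induction (blast intro: permutes_compose perm permutes_id)+
  show "finv f \<in> comp_closure B" if "f \<in> comp_closure B" for f
    using that
  proof induction
    case (comp f g)
    have "finv (f \<circ> g) = finv g \<circ> finv f"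
      using comp(1,2) perm permutes permutes_bij by (metis o_inv_distrib)
    then show ?case
      using comp_closure_comp[OF comp(3) comp_closure_generator[OF inv[OF comp(1)]]] by (simp only:)
  qed (metis comp_closure.id inv_id)
qed (use comp_closure_comp comp_closure.id in auto)

lemma comp_closure_subset:
  assumes "B \<subseteq> G" "perm_group S G" shows "comp_closure B \<subseteq> G"
proof
  fix f assume "f \<in> comp_closure B"
  then show "f \<in> G" using assms perm_groupD[OF assms(2)] by induction auto
qed

section \<open>Elementary abelian 2-groups\<close>

class elementary_2_group = ab_group_add +
  assumes add_self [simp]: "x + x = 0"
begin

lemma add_self_left [simp]: "x + (x + y) = y"
  by (simp flip: add_assoc)

lemma add_eq_zero_iff: "x + y = 0 \<longleftrightarrow> x = y"
proof
  assume "x + y = 0"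
  then show "x = y" using add_self_left[of x y] by simp
qed simp

end

definition add_subgroup :: "'v::elementary_2_group set \<Rightarrow> bool" where
  "add_subgroup K \<longleftrightarrow> 0 \<in> K \<and> (\<forall>x\<in>K. \<forall>y\<in>K. x + y \<in> K)"

lemma add_subgroup_zero: "add_subgroup K \<Longrightarrow> 0 \<in> K"
  and add_subgroup_add: "add_subgroup K \<Longrightarrow> x \<in> K \<Longrightarrow> y \<in> K \<Longrightarrow> x + y \<in> K"
  unfolding add_subgroup_def by auto

lemma add_subgroup_UNIV: "add_subgroup UNIV"
  and add_subgroup_singleton_zero: "add_subgroup {0}"
  unfolding add_subgroup_def by auto

lemma add_mem_iff_left: "add_subgroup K \<Longrightarrow> x \<in> K \<Longrightarrow> x + y \<in> K \<longleftrightarrow> y \<in> K"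
  using add_subgroup_add[of K x "x + y"] add_subgroup_add[of K x y] by auto

lemma add_mem_iff_right: "add_subgroup K \<Longrightarrow> x \<in> K \<Longrightarrow> y + x \<in> K \<longleftrightarrow> y \<in> K"
  using add_mem_iff_left[of K x y] by (simp add: add.commute)

lemma add_mem_trans: "add_subgroup K \<Longrightarrow> x + y \<in> K \<Longrightarrow> y + z \<in> K \<Longrightarrow> x + z \<in> K"
  using add_subgroup_add[of K "x + y" "y + z"] by (simp add: add.assoc)

lemma card_translate: "card ((\<lambda>k. k + v) ` K) = card K" for v :: "'v::group_add"
  by (rule card_image) (auto intro: inj_onI)

definition adjoin :: "'v::elementary_2_group \<Rightarrow> 'v set \<Rightarrow> 'v set" where
  "adjoin v K = {x. x \<in> K \<or> x + v \<in> K}"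

lemma mem_adjoin: "x \<in> adjoin v K \<longleftrightarrow> x \<in> K \<or> x + v \<in> K"
  by (simp add: adjoin_def)

lemma subset_adjoin: "K \<subseteq> adjoin v K"
  by (auto simp: adjoin_def)

lemma self_mem_adjoin: "add_subgroup K \<Longrightarrow> v \<in> adjoin v K"
  by (simp add: adjoin_def add_subgroup_zero)

lemma adjoin_subset:
  assumes "add_subgroup W" "K \<subseteq> W" "v \<in> W" shows "adjoin v K \<subseteq> W"
  using add_mem_iff_right[OF assms(1,3)] assms(2) unfolding mem_adjoin subset_iff by metis

lemma add_subgroup_adjoin:
  assumes K: "add_subgroup K" shows "add_subgroup (adjoin v K)"
  unfolding add_subgroup_def
proof (intro conjI ballI)
  fix x y assume "x \<in> adjoin v K" "y \<in> adjoin v K"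
  moreover have "(x + v) + y = x + y + v" "x + (y + v) = x + y + v" "(x + v) + (y + v) = x + y"
    by (simp_all add: add_ac)
  ultimately show "x + y \<in> adjoin v K" using add_subgroup_add[OF K] unfolding mem_adjoin by metis
qed (simp add: mem_adjoin add_subgroup_zero[OF K])

lemma card_adjoin:
  fixes K :: "'v::{elementary_2_group,finite} set"
  assumes K: "add_subgroup K" and v: "v \<notin> K"
  shows "card (adjoin v K) = 2 * card K"
proof -
  have "x \<in> (\<lambda>k. k + v) ` K" if "x + v \<in> K" for x
    using image_eqI[OF _ that, of x "\<lambda>k. k + v"] by (simp add: add_ac)
  then have "adjoin v K = K \<union> (\<lambda>k. k + v) ` K"
    by (auto simp: mem_adjoin add_ac)
  moreover have "K \<inter> (\<lambda>k. k + v) ` K = {}" using v add_mem_iff_left[OF K] by auto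
  ultimately show ?thesis by (simp add: card_Un_disjoint card_translate)
qed

lemma card_add_subgroup_pos:
  fixes K :: "'v::{elementary_2_group,finite} set"
  shows "add_subgroup K \<Longrightarrow> card K > 0"
  using add_subgroup_zero by (auto simp: card_gt_0_iff)

lemma card_add_subgroup_power_2_mult:
  fixes K W :: "'v::{elementary_2_group,finite} set"
  assumes "add_subgroup K" "add_subgroup W" "K \<subseteq> W"
  shows "\<exists>i. card W = 2 ^ i * card K"
  using assms(1,3)
proof (induction "card W - card K" arbitrary: K rule: less_induct)
  case less
  show ?case
  proof (cases "K = W")
    case True
    then show ?thesis by (intro exI[of _ 0]) simp
  next
    case False
    then obtain v where v: "v \<in> W" "v \<notin> K" using less.prems by blast
    have sub: "adjoin v K \<subseteq> W" using adjoin_subset[OF assms(2) less.prems(2) v(1)] .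
    have "card K < card (adjoin v K)" "card (adjoin v K) \<le> card W"
      using card_adjoin[OF less.prems(1) v(2)] card_add_subgroup_pos[OF less.prems(1)]
        card_mono[OF finite sub] by simp_all
    then have "card W - card (adjoin v K) < card W - card K" by linarith
    then obtain i where "card W = 2 ^ i * card (adjoin v K)"
      using less.hyps[OF _ add_subgroup_adjoin[OF less.prems(1)] sub] by blast
    then show ?thesis using card_adjoin[OF less.prems(1) v(2)] by (intro exI[of _ "Suc i"]) simp
  qed
qed

lemma card_add_subgroup_power_2:
  fixes K :: "'v::{elementary_2_group,finite} set"
  assumes "add_subgroup K" shows "\<exists>i. card K = 2 ^ i"
  using card_add_subgroup_power_2_mult[OF add_subgroup_singleton_zero assms] add_subgroup_zero[OF assms] by simp

lemma card_psubset_add_subgroup_dvd: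
  fixes K W :: "'v::{elementary_2_group,finite} set"
  assumes "add_subgroup K" "add_subgroup W" "K \<subset> W"
  shows "2 * card K dvd card W"
proof -
  obtain i where i: "card W = 2 ^ i * card K"
    using card_add_subgroup_power_2_mult[OF assms(1,2)] assms(3) by blast
  moreover have "card K < card W" by (simp add: assms(3) psubset_card_mono)
  ultimately show ?thesis by (cases i) auto
qed

lemma card_psubset_add_subgroup_le:
  fixes K W :: "'v::{elementary_2_group,finite} set"
  assumes "add_subgroup K" "add_subgroup W" "K \<subset> W"
  shows "2 * card K \<le> card W"
  using dvd_imp_le[OF card_psubset_add_subgroup_dvd[OF assms]] card_add_subgroup_pos[OF assms(2)] .

lemma add_mem_of_index_2:
  fixes K W :: "'v::{elementary_2_group,finite} set"
  assumes K: "add_subgroup K" and W: "add_subgroup W" "K \<subseteq> W" "card W \<le> 2 * card K"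
    and u: "u \<in> W" "u \<notin> K" and v: "v \<in> W" "v \<notin> K"
  shows "u + v \<in> K"
proof -
  have "adjoin v K = W"
    using adjoin_subset[OF W(1,2) v(1)] W(3) card_adjoin[OF K v(2)] by (intro card_seteq) auto
  with u show ?thesis by (auto simp: mem_adjoin)
qed

definition hyperplane :: "'v::{elementary_2_group,finite} set \<Rightarrow> bool" where
  "hyperplane U \<longleftrightarrow> add_subgroup U \<and> 2 * card U = CARD('v)"

lemma hyperplane_add_subgroup: "hyperplane U \<Longrightarrow> add_subgroup U"
  by (simp add: hyperplane_def)

lemma hyperplane_add_mem_iff:
  assumes "hyperplane U" shows "u + v \<in> U \<longleftrightarrow> (u \<in> U \<longleftrightarrow> v \<in> U)"
proof -
  note U = hyperplane_add_subgroup[OF assms]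
  have "u + v \<in> U" if "u \<notin> U" "v \<notin> U"
    by (rule add_mem_of_index_2[OF U add_subgroup_UNIV]) (use that assms in \<open>auto simp: hyperplane_def\<close>)
  then show ?thesis using add_mem_iff_left[OF U] add_mem_iff_right[OF U] by blast
qed

lemma hyperplane_proper: "hyperplane U \<Longrightarrow> \<exists>v. v \<notin> U"
proof (rule ccontr)
  assume "hyperplane U" "\<nexists>v. v \<notin> U"
  then have "U = UNIV" "2 * card U = CARD('a)" by (auto simp: hyperplane_def)
  then show False by simp
qed

subsection \<open>Sign characters\<close>

definition sign_chars :: "('v::elementary_2_group \<Rightarrow> int) set" where
  "sign_chars = {\<chi>. (\<forall>v. \<chi> v = 1 \<or> \<chi> v = - 1) \<and> (\<forall>u v. \<chi> (u + v) = \<chi> u * \<chi> v)}"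

lemma sign_char_cases: "\<chi> \<in> sign_chars \<Longrightarrow> \<chi> v = 1 \<or> \<chi> v = - 1"
  and sign_char_add: "\<chi> \<in> sign_chars \<Longrightarrow> \<chi> (u + v) = \<chi> u * \<chi> v"
  unfolding sign_chars_def by auto

lemma sign_char_square: "\<chi> \<in> sign_chars \<Longrightarrow> \<chi> v * \<chi> v = 1"
  using sign_char_cases[of \<chi> v] by auto

lemma sign_char_zero: "\<chi> \<in> sign_chars \<Longrightarrow> \<chi> 0 = 1"
  using sign_char_square[of \<chi> 0] sign_char_add[of \<chi> 0 0] by simp

lemma sign_char_mult:
  assumes "\<chi> \<in> sign_chars" "\<psi> \<in> sign_chars" shows "(\<lambda>v. \<chi> v * \<psi> v) \<in> sign_chars"
  unfolding sign_chars_def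
proof (intro CollectI conjI allI)
  show "\<chi> v * \<psi> v = 1 \<or> \<chi> v * \<psi> v = - 1" for v
    using sign_char_cases[OF assms(1), of v] sign_char_cases[OF assms(2), of v] by auto
qed (simp add: sign_char_add assms ac_simps)

lemma finite_sign_chars: "finite (sign_chars :: ('v::{elementary_2_group,finite} \<Rightarrow> int) set)"
  by (rule finite_subset[OF _ finite_PiE[of UNIV "\<lambda>_. {1, - 1}"]]) (auto simp: sign_chars_def PiE_def)

lemma sign_char_of_hyperplane:
  assumes U: "\<And>u v. u + v \<in> U \<longleftrightarrow> (u \<in> U \<longleftrightarrow> v \<in> U)"
  shows "(\<lambda>v. if v \<in> U then 1 else - 1) \<in> sign_chars"
  unfolding sign_chars_def by (auto simp: U)

lemma sign_chars_separate:
  fixes v :: "'v::{elementary_2_group,finite}"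
  assumes v: "v \<noteq> 0" shows "\<exists>\<chi>\<in>sign_chars. \<chi> v = - 1"
proof -
  let ?avoids = "\<lambda>M. add_subgroup M \<and> v \<notin> M"
  have "?avoids {0}" using v add_subgroup_singleton_zero by blast
  then obtain M where M: "?avoids M" "\<And>K. ?avoids K \<Longrightarrow> card K \<le> card M"
    using ex_has_greatest_nat[of ?avoids "{0}" card "Suc CARD('v)"] card_mono[OF finite subset_UNIV]
    by (auto simp: less_Suc_eq_le)
  have "u + v \<in> M" if u: "u \<notin> M" for u
  proof (rule ccontr)
    assume "u + v \<notin> M"
    then have "?avoids (adjoin u M)" using M(1) add_subgroup_adjoin by (auto simp: mem_adjoin add.commute)
    then show False using M card_adjoin[of M u] u card_add_subgroup_pos[of M] by fastforce
  qed
  then have "(u + v) + (w + v) \<in> M" if "u \<notin> M" "w \<notin> M" for u w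
    using that M(1) add_subgroup_add by blast
  moreover have "(u + v) + (w + v) = u + w" for u w by (simp add: add_ac)
  ultimately have "u + w \<in> M" if "u \<notin> M" "w \<notin> M" for u w using that by metis
  then have "(\<lambda>w. if w \<in> M then 1 else - 1 :: int) \<in> sign_chars"
    using M(1) add_mem_iff_left[of M] add_mem_iff_right[of M] by (intro sign_char_of_hyperplane) blast
  then show ?thesis using M(1) by (intro bexI) auto
qed

lemma sum_sign_chars:
  fixes v :: "'v::{elementary_2_group,finite}"
  assumes v: "v \<noteq> 0" shows "(\<Sum>\<chi>\<in>sign_chars. \<chi> v) = 0"
proof -
  obtain \<psi> where \<psi>: "\<psi> \<in> sign_chars" "\<psi> v = - 1" using sign_chars_separate[OF v] by blast
  have "bij_betw (\<lambda>\<chi> v. \<psi> v * \<chi> v) sign_chars sign_chars"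
    by (rule bij_betwI[where g="\<lambda>\<chi> v. \<psi> v * \<chi> v"])
      (use sign_char_mult[OF \<psi>(1)] in \<open>auto simp: mult.assoc[symmetric] sign_char_square[OF \<psi>(1)]\<close>)
  from sum.reindex_bij_betw[OF this, of "\<lambda>\<chi>. \<chi> v"]
  show ?thesis using \<psi>(2) by (simp add: sum_negf)
qed

lemma sum_sign_char_values:
  fixes \<chi> :: "'v::{elementary_2_group,finite} \<Rightarrow> int"
  assumes \<chi>: "\<chi> \<in> sign_chars" "\<chi> w \<noteq> 1" shows "(\<Sum>v\<in>UNIV. \<chi> v) = 0"
proof -
  have "bij_betw (\<lambda>v. v + w) UNIV UNIV"
    by (rule bij_betwI[where g="\<lambda>v. v + w"]) (simp_all add: add.assoc)
  from sum.reindex_bij_betw[OF this, of \<chi>] show ?thesis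
    using sign_char_cases[OF \<chi>(1), of w] \<chi>(2) by (simp add: sign_char_add[OF \<chi>(1)] sum_negf)
qed

lemma card_sign_chars: "card (sign_chars :: ('v::{elementary_2_group,finite} \<Rightarrow> int) set) = CARD('v)"
proof -
  have "(\<Sum>v\<in>UNIV. \<chi> v) = (if \<chi> = (\<lambda>_. 1) then int CARD('v) else 0)"
    if "\<chi> \<in> sign_chars" for \<chi> :: "'v \<Rightarrow> int"
    using sum_sign_char_values[OF that] by (auto simp: fun_eq_iff)
  moreover have "(\<lambda>_ :: 'v. 1) \<in> sign_chars" unfolding sign_chars_def by simp
  ultimately have "(\<Sum>\<chi>\<in>sign_chars. \<Sum>v::'v\<in>UNIV. \<chi> v) = int CARD('v)"
    by (simp add: finite_sign_chars)
  moreover have "(\<Sum>\<chi>\<in>sign_chars. \<chi> v) = (if v = 0 then int (card (sign_chars :: ('v \<Rightarrow> int) set)) else 0)"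
    for v :: 'v using sum_sign_chars[of v] by (simp add: sign_char_zero)
  then have "(\<Sum>v::'v\<in>UNIV. \<Sum>\<chi>\<in>sign_chars. \<chi> v) = int (card (sign_chars :: ('v \<Rightarrow> int) set))" by simp
  ultimately show ?thesis using sum.swap[of "\<lambda>v \<chi>. \<chi> v" "sign_chars :: ('v \<Rightarrow> int) set" UNIV] by simp
qed

lemma fourier_inversion:
  fixes S :: "'v::{elementary_2_group,finite} \<Rightarrow> int"
  shows "(\<Sum>\<chi>\<in>sign_chars. \<chi> m * (\<Sum>l\<in>UNIV. S l * \<chi> l)) = int CARD('v) * S m"
proof -
  have "(\<Sum>\<chi>\<in>sign_chars. \<chi> m * (\<Sum>l\<in>UNIV. S l * \<chi> l)) = (\<Sum>\<chi>\<in>sign_chars. \<Sum>l\<in>UNIV. S l * \<chi> (m + l))"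
    by (rule sum.cong[OF refl]) (simp add: sign_char_add sum_distrib_left mult.left_commute)
  also have "\<dots> = (\<Sum>l\<in>UNIV. S l * (\<Sum>\<chi>\<in>sign_chars. \<chi> (m + l)))"
    by (subst sum.swap) (simp add: sum_distrib_left)
  also have "\<dots> = (\<Sum>l\<in>UNIV. if l = m then S l * int CARD('v) else 0)"
  proof (rule sum.cong[OF refl])
    show "S l * (\<Sum>\<chi>\<in>sign_chars. \<chi> (m + l)) = (if l = m then S l * int CARD('v) else 0)" for l
      using sum_sign_chars[of "m + l"] add_eq_zero_iff[of m l] by (auto simp: sign_char_zero card_sign_chars)
  qed
  finally show ?thesis by simp
qed

section \<open>Pairs of regular elementary abelian 2-groups\<close>

text \<open>\<open>Q\<close> is a 2-group of permutations of \<open>'v\<close>, generated by the translations and by a second regular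
  elementary abelian group; \<open>\<sigma> v\<close> is the element of the latter that takes 0 to \<open>v\<close>.\<close>

locale regular_pair =
  fixes Q :: "('v::{elementary_2_group,finite} \<Rightarrow> 'v) set" and \<sigma> :: "'v \<Rightarrow> 'v \<Rightarrow> 'v"
  assumes perm_group_Q: "perm_group UNIV Q"
    and card_Q: "\<exists>k. card Q = 2 ^ k"
    and translation_mem: "(\<lambda>x. x + v) \<in> Q"
    and \<sigma>_mem: "\<sigma> v \<in> Q"
    and \<sigma>_zero [simp]: "\<sigma> v 0 = v"
    and \<sigma>_comm: "\<sigma> u (\<sigma> v x) = \<sigma> v (\<sigma> u x)"
    and \<sigma>_invol [simp]: "\<sigma> v (\<sigma> v x) = x"
    and generated: "\<And>P q. \<lbrakk>q \<in> Q; P id; \<And>v r. P r \<Longrightarrow> P (\<lambda>x. r x + v); \<And>v r. P r \<Longrightarrow> P (\<lambda>x. \<sigma> v (r x))\<rbrakk> \<Longrightarrow> P q"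
begin

lemma \<sigma>_swap: "\<sigma> v x = \<sigma> x v"
  using \<sigma>_comm[of v x 0] by simp

lemma \<sigma>_self [simp]: "\<sigma> v v = 0"
  using \<sigma>_invol[of v 0] by simp

lemma \<sigma>_\<sigma>: "\<sigma> (\<sigma> u v) x = \<sigma> u (\<sigma> v x)"
  by (metis \<sigma>_comm \<sigma>_swap)

lemma Q_id: "id \<in> Q"
  using perm_groupD(2)[OF perm_group_Q] .

lemma Q_inv:
  assumes "q \<in> Q" shows "finv q \<in> Q" "finv q (q x) = x" "q (finv q x) = x"
  using perm_groupD(4)[OF perm_group_Q assms] perm_group_inv_apply[OF perm_group_Q assms] by auto

lemma Q_eq_iff: "q \<in> Q \<Longrightarrow> q x = q y \<longleftrightarrow> x = y"
  using Q_inv(2) by metis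

lemma Q_comp: "q \<in> Q \<Longrightarrow> r \<in> Q \<Longrightarrow> (\<lambda>x. q (r x)) \<in> Q"
  using perm_group_mult_mem[OF perm_group_Q] .

lemma Q_add: "q \<in> Q \<Longrightarrow> (\<lambda>x. q x + v) \<in> Q"
  using Q_comp[OF translation_mem, of q v] .

lemma Q_recentre: "q \<in> Q \<Longrightarrow> (\<lambda>u. q (u + x) + q x) \<in> Q"
  using Q_add[OF Q_comp[OF _ translation_mem], of q x "q x"] .

subsection \<open>Blocks\<close>

definition block :: "'v set \<Rightarrow> bool" where
  "block K \<longleftrightarrow> add_subgroup K \<and> (\<forall>q\<in>Q. \<forall>x y. x + y \<in> K \<longrightarrow> q x + q y \<in> K)"

lemma blockI:
  assumes "add_subgroup K" "\<And>q x y. q \<in> Q \<Longrightarrow> x + y \<in> K \<Longrightarrow> q x + q y \<in> K" shows "block K"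
  using assms unfolding block_def by blast

lemma block_add_subgroup: "block K \<Longrightarrow> add_subgroup K"
  unfolding block_def by auto

lemma block_mem_iff: "block K \<Longrightarrow> q \<in> Q \<Longrightarrow> q x + q y \<in> K \<longleftrightarrow> x + y \<in> K"
  using Q_inv[of q] unfolding block_def by metis

lemma block_UNIV: "block UNIV"
  by (simp add: block_def add_subgroup_UNIV)

lemma block_singleton_zero: "block {0}"
  by (auto simp: block_def add_subgroup_singleton_zero add_eq_zero_iff)

lemma block_sum:
  assumes K: "block K" and L: "block L" shows "block {k + l | k l. k \<in> K \<and> l \<in> L}" (is "block ?S")
proof (rule blockI)
  note K' = block_add_subgroup[OF K] and L' = block_add_subgroup[OF L]
  have closed: "(k + l) + (k' + l') \<in> ?S" if "k \<in> K" "l \<in> L" "k' \<in> K" "l' \<in> L" for k l k' l'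
  proof -
    have "(k + l) + (k' + l') = (k + k') + (l + l')" by (simp only: add_ac)
    then show ?thesis using that K' L' add_subgroup_add by blast
  qed
  show "add_subgroup ?S"
    unfolding add_subgroup_def using add_subgroup_zero[OF K'] add_subgroup_zero[OF L'] closed
    by (auto intro: exI[of _ 0])
  fix q x y assume q: "q \<in> Q" and "x + y \<in> ?S"
  then obtain k l where kl: "k \<in> K" "l \<in> L" "x + y = k + l" by blast
  have "q x + q (x + l) \<in> L" using block_mem_iff[OF L q] kl(2) by simp
  moreover have "(x + l) + y = k" using kl(3) by (metis add.assoc add.commute add_self_left)
  then have "q (x + l) + q y \<in> K" using block_mem_iff[OF K q] kl(1) by simp
  moreover have "q x + q y = (q (x + l) + q y) + (q x + q (x + l))" by (simp add: add_ac)
  ultimately show "q x + q y \<in> ?S" by blast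
qed

lemma \<sigma>_mem_block_hyperplane_iff:
  assumes "block U" "hyperplane U" shows "\<sigma> w v \<in> U \<longleftrightarrow> (w \<in> U \<longleftrightarrow> v \<in> U)"
  using block_mem_iff[OF assms(1) \<sigma>_mem, of w v 0] hyperplane_add_mem_iff[OF assms(2), of "\<sigma> w v" w] by auto

definition suborbit :: "'v set \<Rightarrow> 'v \<Rightarrow> 'v set" where
  "suborbit K v = orb {q \<in> Q. q 0 \<in> K} v"

lemma perm_group_block_stabilizer:
  assumes K: "block K" shows "perm_group UNIV {q \<in> Q. q 0 \<in> K}"
proof (rule perm_groupI)
  note K' = block_add_subgroup[OF K]
  have zero_mem_iff: "q x \<in> K \<longleftrightarrow> x \<in> K" if "q \<in> Q" "q 0 \<in> K" for q x
    using block_mem_iff[OF K that(1), of x 0] add_mem_iff_right[OF K' that(2)] by simp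
  show "f \<circ> g \<in> {q \<in> Q. q 0 \<in> K}" if "f \<in> {q \<in> Q. q 0 \<in> K}" "g \<in> {q \<in> Q. q 0 \<in> K}" for f g
    using that zero_mem_iff perm_groupD(3)[OF perm_group_Q] by simp
  show "finv f \<in> {q \<in> Q. q 0 \<in> K}" if "f \<in> {q \<in> Q. q 0 \<in> K}" for f
    using that zero_mem_iff[of f "finv f 0"] Q_inv[of f] add_subgroup_zero[OF K'] by simp
qed (use perm_groupD[OF perm_group_Q] add_subgroup_zero[OF block_add_subgroup[OF K]] in auto)

lemma card_suborbit_power_2:
  assumes "block K" shows "\<exists>j. card (suborbit K v) = 2 ^ j"
proof -
  have "card {q \<in> Q. q 0 \<in> K} dvd card Q"
    using perm_group_card_dvd[OF perm_group_Q perm_group_block_stabilizer[OF assms]] by simp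
  then show ?thesis
    using card_Q card_orb_prime_power[OF perm_group_block_stabilizer[OF assms] _ two_is_prime_nat]
    unfolding suborbit_def by auto
qed

lemma suborbit_self: "block K \<Longrightarrow> v \<in> suborbit K v"
  unfolding suborbit_def by (rule orb_self[OF perm_group_block_stabilizer])

lemma suborbit_eq: "block K \<Longrightarrow> u \<in> suborbit K v \<Longrightarrow> suborbit K u = suborbit K v"
  unfolding suborbit_def by (rule orb_eq[OF perm_group_block_stabilizer])

lemma suborbitE:
  assumes "u \<in> suborbit K v" obtains q where "q \<in> Q" "q 0 \<in> K" "q v = u"
  using assms unfolding suborbit_def orb_def by blast

lemma Q_mem_suborbit:
  assumes "block K" "u \<in> suborbit K v" "q \<in> Q" "q 0 \<in> K" shows "q u \<in> suborbit K v"
  using orbI[of q "{q \<in> Q. q 0 \<in> K}" u] assms suborbit_eq unfolding suborbit_def by simp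

lemma suborbit_add:
  assumes "block K" "u \<in> suborbit K v" "k \<in> K" shows "u + k \<in> suborbit K v"
  using Q_mem_suborbit[OF assms(1,2) translation_mem, of k] assms(3) by simp

lemma suborbit_Q_diff:
  assumes K: "block K" and q: "q \<in> Q" and "y + x \<in> suborbit K v" shows "q y + q x \<in> suborbit K v"
proof -
  have "q ((y + x) + x) + q x \<in> suborbit K v"
    using Q_mem_suborbit[OF K assms(3) Q_recentre[OF q, of x]] add_subgroup_zero[OF block_add_subgroup[OF K]] by simp
  then show ?thesis by (simp add: add_ac)
qed

lemma suborbit_Q_diff_iff:
  assumes K: "block K" and q: "q \<in> Q" shows "q y + q x \<in> suborbit K v \<longleftrightarrow> y + x \<in> suborbit K v"
  using suborbit_Q_diff[OF K q, of y x v] suborbit_Q_diff[OF K Q_inv(1)[OF q], of "q y" "q x" v] Q_inv(2)[OF q] by auto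

lemma suborbit_mem_block_iff:
  assumes "block T" "K \<subseteq> T" "u \<in> suborbit K v" shows "u \<in> T \<longleftrightarrow> v \<in> T"
proof -
  obtain q where q: "q \<in> Q" "q 0 \<in> K" "q v = u" using suborbitE[OF assms(3)] .
  have "q v + q 0 \<in> T \<longleftrightarrow> v + 0 \<in> T" by (rule block_mem_iff[OF assms(1) q(1)])
  then show ?thesis
    using add_mem_iff_right[OF block_add_subgroup[OF assms(1)], of "q 0" "q v"] q assms(2) by auto
qed

subsection \<open>Translations that are central modulo a block\<close>

definition central :: "'v set \<Rightarrow> 'v set" where
  "central K = {v. \<forall>q\<in>Q. \<forall>x. q (x + v) + q x + v \<in> K}"

lemma centralD: "v \<in> central K \<Longrightarrow> q \<in> Q \<Longrightarrow> q (x + v) + q x + v \<in> K"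
  unfolding central_def by auto

lemma central_zeroD: "v \<in> central {0} \<Longrightarrow> q \<in> Q \<Longrightarrow> q (x + v) = q x + v"
  using centralD[of v "{0}" q x] add_eq_zero_iff[of "q (x + v)" "q x + v"] by (simp add: add.assoc)

lemma subset_central:
  assumes K: "block K" shows "K \<subseteq> central K"
proof
  fix v assume v: "v \<in> K"
  have "q (x + v) + q x \<in> K" if "q \<in> Q" for q x
    using block_mem_iff[OF K that, of "x + v" x] v by (simp add: add_ac)
  then show "v \<in> central K"
    unfolding central_def using v add_subgroup_add[OF block_add_subgroup[OF K]] by blast
qed

lemma block_central:
  assumes K: "block K" shows "block (central K)"
proof (rule blockI)
  note K' = block_add_subgroup[OF K]
  show sub: "add_subgroup (central K)" unfolding add_subgroup_def
  proof (intro conjI ballI)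
    show "0 \<in> central K" using subset_central[OF K] add_subgroup_zero[OF K'] by blast
    fix u v assume u: "u \<in> central K" and v: "v \<in> central K"
    show "u + v \<in> central K" unfolding central_def
    proof (intro CollectI ballI allI)
      fix q x assume q: "q \<in> Q"
      have "(q ((x + u) + v) + q (x + u) + v) + (q (x + u) + q x + u) \<in> K"
        using centralD[OF v q] centralD[OF u q] add_subgroup_add[OF K'] by blast
      then show "q (x + (u + v)) + q x + (u + v) \<in> K" by (simp add: add_ac)
    qed
  qed
  fix q x y assume q: "q \<in> Q" and xy: "x + y \<in> central K"
  have "q (y + (x + y)) + q y + (x + y) \<in> K" using centralD[OF xy q] .
  then have "(q x + q y) + (x + y) \<in> central K" using subset_central[OF K] by (auto simp: add_ac)
  then show "q x + q y \<in> central K" using add_mem_iff_right[OF sub xy] by blast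
qed

lemma suborbit_diff_mem:
  assumes "v \<in> central M" "add_subgroup M" "K \<subseteq> M" "u \<in> suborbit K v" shows "u + v \<in> M"
proof -
  obtain q where q: "q \<in> Q" "q 0 \<in> K" "q v = u" using suborbitE[OF assms(4)] .
  have "q 0 + (u + v) \<in> M" using centralD[OF assms(1) q(1), of 0] q(3) by (simp add: add_ac)
  then show ?thesis using add_mem_iff_left[OF assms(2)] q(2) assms(3) by blast
qed

lemma central_iff_suborbit:
  assumes K: "block K" shows "v \<in> central K \<longleftrightarrow> (\<forall>u\<in>suborbit K v. u + v \<in> K)"
proof
  assume "v \<in> central K"
  then show "\<forall>u\<in>suborbit K v. u + v \<in> K"
    using suborbit_diff_mem[OF _ block_add_subgroup[OF K] order_refl] by blast
next
  assume near: "\<forall>u\<in>suborbit K v. u + v \<in> K"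
  show "v \<in> central K" unfolding central_def
  proof (intro CollectI ballI allI)
    fix q x assume q: "q \<in> Q"
    have "q (v + x) + q x \<in> suborbit K v"
      using suborbit_Q_diff[OF K q, of "v + x" x v] suborbit_self[OF K] by (simp add: add_ac)
    then have "q (v + x) + q x + v \<in> K" using near by blast
    then show "q (x + v) + q x + v \<in> K" by (simp only: add.commute[of x v])
  qed
qed

lemma two_card_block_dvd_card_suborbit:
  assumes K: "block K" and v: "v \<notin> central K" shows "2 * card K dvd card (suborbit K v)"
proof -
  obtain u where u: "u \<in> suborbit K v" "u + v \<notin> K" using v central_iff_suborbit[OF K] by blast
  have "(\<lambda>k. k + v) ` K \<subseteq> suborbit K v"
    using suborbit_add[OF K suborbit_self[OF K]] by (auto simp: add.commute)
  moreover have "u \<notin> (\<lambda>k. k + v) ` K" using u(2) by (auto simp: add_ac)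
  ultimately have "(\<lambda>k. k + v) ` K \<subset> suborbit K v" using u(1) by blast
  then have less: "card K < card (suborbit K v)"
    using card_translate by (metis finite psubset_card_mono)
  obtain i j where "card K = 2 ^ i" "card (suborbit K v) = 2 ^ j"
    using card_add_subgroup_power_2[OF block_add_subgroup[OF K]] card_suborbit_power_2[OF K] by metis
  moreover from this less have "2 ^ Suc i dvd (2::nat) ^ j" by (intro le_imp_power_dvd) simp
  ultimately show ?thesis by simp
qed

lemma central_meets_larger_block:
  assumes K: "block K" and T: "block T" "K \<subset> T" shows "\<exists>v\<in>T. v \<notin> K \<and> v \<in> central K"
proof (rule ccontr)
  assume no: "\<not> ?thesis"
  let ?C = "suborbit K ` (T - K)"
  note K' = block_add_subgroup[OF K] and T' = block_add_subgroup[OF T(1)]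
  have "\<Union> ?C = T - K"
    using suborbit_self[OF K] suborbit_mem_block_iff[OF K order_refl] suborbit_mem_block_iff[OF T(1)] T(2) by blast
  moreover have "2 * card K dvd card (\<Union> ?C)"
  proof (rule dvd_partition)
    show "\<forall>c\<in>?C. 2 * card K dvd card c" using two_card_block_dvd_card_suborbit[OF K] no by blast
    show "\<forall>c1\<in>?C. \<forall>c2\<in>?C. c1 \<noteq> c2 \<longrightarrow> c1 \<inter> c2 = {}" using suborbit_eq[OF K] by blast
  qed simp
  ultimately have dvd: "2 * card K dvd card (T - K)" by simp
  have "2 * card K dvd card K + card (T - K)"
    using card_psubset_add_subgroup_dvd[OF K' T' T(2)] T(2) by (simp add: card_Diff_subset card_mono psubset_imp_subset)
  then have "2 * card K dvd card K" using dvd_add_left_iff[OF dvd] by blast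
  then show False using card_add_subgroup_pos[OF K'] by (auto dest: dvd_imp_le)
qed

lemma psubset_central: "block K \<Longrightarrow> K \<noteq> UNIV \<Longrightarrow> K \<subset> central K"
  using central_meets_larger_block[OF _ block_UNIV] subset_central by blast

lemma block_adjoin:
  assumes K: "block K" and z: "z \<in> central K" shows "block (adjoin z K)"
proof (rule blockI)
  note K' = block_add_subgroup[OF K]
  show "add_subgroup (adjoin z K)" by (rule add_subgroup_adjoin[OF K'])
  fix q x y assume q: "q \<in> Q" and "x + y \<in> adjoin z K"
  then consider (mem) "x + y \<in> K" | (shifted) "x + (y + z) \<in> K" by (auto simp: mem_adjoin add.assoc)
  then show "q x + q y \<in> adjoin z K"
  proof cases
    case mem
    then show ?thesis using block_mem_iff[OF K q] by (simp add: mem_adjoin)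
  next
    case shifted
    then have "(q x + q (y + z)) + (q (y + z) + q y + z) \<in> K"
      using block_mem_iff[OF K q] centralD[OF z q] add_subgroup_add[OF K'] by blast
    then show ?thesis by (simp add: mem_adjoin add_ac)
  qed
qed

lemma exists_block_hyperplane:
  assumes "block B" "B \<noteq> UNIV" obtains U where "block U" "hyperplane U" "B \<subseteq> U"
  using assms
proof (induction "CARD('v) - card B" arbitrary: B thesis rule: less_induct)
  case less
  note B = block_add_subgroup[OF less.prems(2)]
  obtain v where v: "v \<in> central B" "v \<notin> B" using psubset_central[OF less.prems(2,3)] by blast
  note block = block_adjoin[OF less.prems(2) v(1)] and card = card_adjoin[OF B v(2)]
  show ?case
  proof (cases "adjoin v B = UNIV")
    case True
    then have "hyperplane B" using B card by (simp add: hyperplane_def)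
    then show ?thesis using less.prems by blast
  next
    case False
    then have "card (adjoin v B) < CARD('v)" by (metis finite psubset_card_mono top.not_eq_extremum)
    then have "CARD('v) - card (adjoin v B) < CARD('v) - card B"
      using card card_add_subgroup_pos[OF B] by linarith
    then obtain U where "block U" "hyperplane U" "adjoin v B \<subseteq> U"
      using less.hyps[OF _ _ block False] by blast
    then show ?thesis using less.prems(1) subset_adjoin by blast
  qed
qed

lemma central_of_\<sigma>:
  assumes K: "block K" and near: "\<And>x. \<sigma> v x + x + v \<in> K" shows "v \<in> central K"
proof -
  note K' = block_add_subgroup[OF K]
  have "\<forall>x. q (x + v) + q x + v \<in> K" if "q \<in> Q" for q
  proof (rule generated[OF that, where P="\<lambda>r. \<forall>x. r (x + v) + r x + v \<in> K"])
    fix w r assume r: "\<forall>x. r (x + v) + r x + v \<in> K"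
    show "\<forall>x. (r (x + v) + w) + (r x + w) + v \<in> K" using r by (simp add: add_ac)
    show "\<forall>x. \<sigma> w (r (x + v)) + \<sigma> w (r x) + v \<in> K"
    proof
      fix x
      have "r (x + v) + \<sigma> v (r x) \<in> K"
        using add_subgroup_add[OF K' r[rule_format, of x] near[of "r x"]] by (simp add: add_ac)
      then have "\<sigma> w (r (x + v)) + \<sigma> w (\<sigma> v (r x)) \<in> K" using block_mem_iff[OF K \<sigma>_mem] by blast
      moreover have "\<sigma> w (\<sigma> v (r x)) + (\<sigma> w (r x) + v) \<in> K"
        using near[of "\<sigma> w (r x)"] by (simp add: \<sigma>_comm[of w v] add_ac)
      ultimately show "\<sigma> w (r (x + v)) + \<sigma> w (r x) + v \<in> K"
        using add_mem_trans[OF K'] by (fastforce simp: add.assoc)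
    qed
  qed (use add_subgroup_zero[OF K'] in \<open>simp add: add_ac\<close>)
  then show ?thesis unfolding central_def by blast
qed

lemma suborbit_add_central:
  assumes K: "block K" and z: "z \<in> central K" and u: "u \<in> suborbit K v" shows "u + z \<in> suborbit K (v + z)"
proof -
  obtain q where q: "q \<in> Q" "q 0 \<in> K" "q v = u" using suborbitE[OF u] .
  have "q (v + z) \<in> suborbit K (v + z)" using Q_mem_suborbit[OF K suborbit_self[OF K] q(1,2)] .
  from suborbit_add[OF K this centralD[OF z q(1), of v]] show ?thesis using q(3) by (simp add: add_ac)
qed

definition suborbit_periods :: "'v set \<Rightarrow> 'v \<Rightarrow> 'v set" where
  "suborbit_periods K v = {z \<in> central K. v + z \<in> suborbit K v}"

lemma mem_suborbit_periods:
  assumes K: "block K" and z: "z \<in> central K" and u: "u \<in> suborbit K v" "u + z \<in> suborbit K v"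
  shows "z \<in> suborbit_periods K v"
proof -
  have "u + z \<in> suborbit K (v + z)" using suborbit_add_central[OF K z u(1)] .
  then have "suborbit K (v + z) = suborbit K v" using suborbit_eq[OF K] u(2) by metis
  then show ?thesis using suborbit_self[OF K, of "v + z"] z unfolding suborbit_periods_def by auto
qed

lemma subset_suborbit_periods: "block K \<Longrightarrow> K \<subseteq> suborbit_periods K v"
  using suborbit_add[OF _ suborbit_self] subset_central unfolding suborbit_periods_def by blast

lemma add_subgroup_suborbit_periods:
  assumes K: "block K" shows "add_subgroup (suborbit_periods K v)"
  unfolding add_subgroup_def
proof (intro conjI ballI)
  show "0 \<in> suborbit_periods K v"
    using subset_suborbit_periods[OF K] add_subgroup_zero[OF block_add_subgroup[OF K]] by blast
  fix x y assume "x \<in> suborbit_periods K v" "y \<in> suborbit_periods K v"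
  then have xy: "v + x \<in> suborbit K v" "v + y \<in> suborbit K v" "x \<in> central K" "y \<in> central K"
    unfolding suborbit_periods_def by auto
  have "(v + x) + (x + y) = v + y" by (simp add: add_ac)
  moreover have "x + y \<in> central K"
    using xy(3,4) add_subgroup_add[OF block_add_subgroup[OF block_central[OF K]]] by blast
  ultimately show "x + y \<in> suborbit_periods K v"
    using mem_suborbit_periods[OF K _ xy(1)] xy(2) by metis
qed

subsection \<open>The defect of the second group\<close>

definition defect :: "'v \<Rightarrow> 'v \<Rightarrow> 'v" where
  "defect e x = \<sigma> e x + x + e"

lemma \<sigma>_eq_defect: "\<sigma> e x = x + e + defect e x"
  unfolding defect_def by (simp add: add_ac)

lemma defect_zero [simp]: "defect e 0 = 0"
  unfolding defect_def by simp

lemma defect_mem: "e \<in> central K \<Longrightarrow> defect e x \<in> K"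
  using centralD[OF _ \<sigma>_mem, of e K x 0] unfolding defect_def by (simp add: \<sigma>_swap[of e x])

lemma exists_defect_not_mem: "block K \<Longrightarrow> e \<notin> central K \<Longrightarrow> \<exists>x. defect e x \<notin> K"
  using central_of_\<sigma> unfolding defect_def by blast

lemma defect_add_central: "z \<in> central K \<Longrightarrow> defect e (x + z) + defect e x \<in> K"
  using centralD[OF _ \<sigma>_mem, of z K e x] unfolding defect_def by (simp add: add_ac)

lemma defect_add_self:
  assumes K: "block K" and e: "e \<in> central (central K)" shows "defect e (x + e) + defect e x \<in> K"
proof -
  have "\<sigma> e (\<sigma> e x) = x" by simp
  then have "x + (defect e x + defect e (x + e + defect e x)) = x"
    unfolding \<sigma>_eq_defect[of e] by (simp add: add_ac)
  then have "defect e (x + e + defect e x) = defect e x"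
    by (simp add: add_eq_zero_iff)
  then show ?thesis using defect_add_central[OF defect_mem[OF e], of e "x + e" x] by (simp add: add_ac)
qed

lemma defect_add_mem_suborbit:
  assumes K: "block K" shows "v + (defect e (x + v) + defect e x) \<in> suborbit K v"
proof -
  have "\<sigma> e (v + x) + \<sigma> e x \<in> suborbit K v"
    using suborbit_Q_diff[OF K \<sigma>_mem, of "v + x" x v] suborbit_self[OF K] by (simp add: add_ac)
  then show ?thesis unfolding defect_def by (simp add: add_ac)
qed

definition defect_periods :: "'v \<Rightarrow> 'v set \<Rightarrow> 'v set" where
  "defect_periods e K = {y. \<forall>x. defect e (x + y) + defect e x \<in> K}"

lemma defect_periodsD: "y \<in> defect_periods e K \<Longrightarrow> defect e (x + y) + defect e x \<in> K"
  unfolding defect_periods_def by blast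

lemma add_subgroup_defect_periods:
  assumes K: "add_subgroup K" shows "add_subgroup (defect_periods e K)"
  unfolding add_subgroup_def
proof (intro conjI ballI)
  fix a b assume ab: "a \<in> defect_periods e K" "b \<in> defect_periods e K"
  have "defect e (x + (a + b)) + defect e x \<in> K" for x
    using add_mem_trans[OF K defect_periodsD[OF ab(2), of "x + a"] defect_periodsD[OF ab(1)]] by (simp add: add.assoc)
  then show "a + b \<in> defect_periods e K" unfolding defect_periods_def by blast
qed (simp add: defect_periods_def add_subgroup_zero[OF K])

lemma central_subset_defect_periods: "central K \<subseteq> defect_periods e K"
  unfolding defect_periods_def using defect_add_central by blast

lemma self_mem_defect_periods: "block K \<Longrightarrow> e \<in> central (central K) \<Longrightarrow> e \<in> defect_periods e K"
  unfolding defect_periods_def using defect_add_self by blast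

lemma defect_periods_neq_UNIV:
  assumes "block K" "e \<notin> central K" shows "defect_periods e K \<noteq> UNIV"
proof
  assume "defect_periods e K = UNIV"
  then have "defect e (0 + x) + defect e 0 \<in> K" for x by (intro defect_periodsD) simp
  then show False using exists_defect_not_mem[OF assms] by simp
qed

lemma \<sigma>_eq_add_on_defect_periods:
  assumes "u \<in> defect_periods e {0}" shows "\<sigma> e u = u + e"
  using defect_periodsD[OF assms, of 0] by (simp add: \<sigma>_eq_defect)

lemma central_not_hyperplane:
  assumes K: "block K" shows "\<not> hyperplane (central K)"
proof
  assume H: "hyperplane (central K)"
  note K' = block_add_subgroup[OF K]
  obtain w where w: "w \<notin> central K" using hyperplane_proper[OF H] by blast
  have "q (x + w) + q x + w \<in> central K" if "q \<in> Q" for q x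
    using hyperplane_add_mem_iff[OF H] block_mem_iff[OF block_central[OF K] that, of "x + w" x] w
    by (simp add: add_ac)
  then have ww: "w \<in> central (central K)" unfolding central_def[of "central K"] by blast
  have "defect w x \<in> K" for x
  proof (cases "x \<in> central K")
    case True
    then show ?thesis using defect_add_central[of x K w 0] by simp
  next
    case False
    then have "x + w \<in> central K" using hyperplane_add_mem_iff[OF H] w by blast
    from defect_add_central[OF this, of w w] have "defect w x + defect w w \<in> K" by (simp add: add_ac)
    moreover have "defect w w \<in> K" using defect_add_self[OF K ww, of 0] by simp
    ultimately show ?thesis using add_mem_iff_right[OF K'] by blast
  qed
  then show False using exists_defect_not_mem[OF K w] by blast
qed

lemma card_central_le:
  assumes K: "block K" and "central K \<noteq> UNIV" shows "4 * card (central K) \<le> CARD('v)"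
proof -
  note C = block_add_subgroup[OF block_central[OF K]]
  obtain i where i: "CARD('v) = 2 ^ i * card (central K)"
    using card_add_subgroup_power_2_mult[OF C add_subgroup_UNIV] by blast
  have "i \<noteq> 0"
  proof
    assume "i = 0"
    then show False using i assms(2) card_subset_eq[of UNIV "central K"] by simp
  qed
  moreover have "i \<noteq> 1" using central_not_hyperplane[OF K] C i by (auto simp: hyperplane_def)
  ultimately have "2 \<le> i" by simp
  then have "(2::nat) ^ 2 \<le> 2 ^ i" by (intro power_increasing) simp_all
  then show ?thesis using i by simp
qed

end

subsection \<open>The dichotomy for a block hyperplane\<close>

context regular_pair
begin

definition rotatable_mod :: "'v set \<Rightarrow> 'v set \<Rightarrow> bool" where
  "rotatable_mod K U \<longleftrightarrow> (\<exists>e w. e \<notin> U \<and> w \<notin> U \<and>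
     (\<forall>x\<in>U. \<forall>y. y \<notin> U \<longrightarrow> (\<exists>q\<in>Q. q x + x \<in> K \<and> q y + (\<sigma> w y + e) \<in> K)))"

definition translators :: "'v set \<Rightarrow> 'v set" where
  "translators Y = {y \<in> Y. \<forall>x\<in>Y. \<sigma> y x = x + y}"

definition translation_hyperplane :: "'v set \<Rightarrow> bool" where
  "translation_hyperplane Y \<longleftrightarrow> block Y \<and> hyperplane Y \<and> Y \<subseteq> translators Y"

lemma add_subgroup_translators:
  assumes Y: "add_subgroup Y" shows "add_subgroup (translators Y)"
  unfolding add_subgroup_def
proof (intro conjI ballI)
  show "0 \<in> translators Y"
    using add_subgroup_zero[OF Y] by (simp add: translators_def \<sigma>_swap[of 0])
  fix y y' assume "y \<in> translators Y" "y' \<in> translators Y"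
  then have y: "y \<in> Y" "y' \<in> Y" "\<And>x. x \<in> Y \<Longrightarrow> \<sigma> y x = x + y" "\<And>x. x \<in> Y \<Longrightarrow> \<sigma> y' x = x + y'"
    unfolding translators_def by auto
  have "\<sigma> (y + y') x = x + (y + y')" if "x \<in> Y" for x
    using \<sigma>_\<sigma>[of y y' x] y that add_subgroup_add[OF Y] by (simp add: add_ac)
  then show "y + y' \<in> translators Y" using y add_subgroup_add[OF Y] unfolding translators_def by blast
qed

lemma central_zero_mem_translators: "z \<in> central {0} \<Longrightarrow> z \<in> Y \<Longrightarrow> z \<in> translators Y"
  using central_zeroD[OF _ \<sigma>_mem, of z _ 0] by (simp add: translators_def \<sigma>_swap[of z])

lemma rotatable_mod_central:
  assumes K: "block K" and v: "v \<in> central K" "v \<notin> U" shows "rotatable_mod K U"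
  unfolding rotatable_mod_def
proof (intro exI[of _ v] conjI ballI allI impI bexI[of _ id])
  fix x y
  show "id x + x \<in> K" using add_subgroup_zero[OF block_add_subgroup[OF K]] by simp
  show "id y + (\<sigma> v y + v) \<in> K" using defect_mem[OF v(1), of y] unfolding defect_def by (simp add: add_ac)
qed (use v Q_id in auto)

lemma correct_rotation:
  assumes K: "block K" and z: "z \<in> central K" "x + f + z \<in> suborbit K (x + f)"
    and r: "r \<in> Q" "r x + x \<in> K" "r y + f + z \<in> K"
  shows "\<exists>s\<in>Q. s x + x \<in> K \<and> s y + f \<in> K"
proof -
  note K' = block_add_subgroup[OF K]
  obtain s where s: "s \<in> Q" "s 0 \<in> K" "s (x + f) = x + f + z" using suborbitE[OF z(2)] .
  let ?s = "\<lambda>u. s (r u + x) + x"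
  have "?s \<in> Q" using Q_add[OF Q_comp[OF s(1) Q_add[OF r(1), of x]], of x] .
  moreover have "s (r x + x) \<in> K"
    using block_mem_iff[OF K s(1), of "r x + x" 0] r(2) add_mem_iff_right[OF K' s(2)] by simp
  moreover have "s (r y + x) + s ((x + f) + z) \<in> K"
    using block_mem_iff[OF K s(1), of "r y + x" "(x + f) + z"] r(3) by (simp add: add_ac)
  then have "s (r y + x) + (x + f) \<in> K"
  proof (rule add_mem_trans[OF K'])
    show "s ((x + f) + z) + (x + f) \<in> K"
      using centralD[OF z(1) s(1), of "x + f"] unfolding s(3) by (simp add: add_ac)
  qed
  ultimately show ?thesis by (intro bexI[of _ ?s]) (simp_all add: add_ac)
qed

lemma rotatable_mod_adjoin:
  assumes U: "block U" "hyperplane U" and K: "block K" and z: "z \<in> central K"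
    and periods: "\<And>v. v \<notin> U \<Longrightarrow> v + z \<in> suborbit K v"
    and rot: "rotatable_mod (adjoin z K) U"
  shows "rotatable_mod K U"
proof -
  obtain e w where ew: "e \<notin> U" "w \<notin> U"
    and rot: "\<And>x y. x \<in> U \<Longrightarrow> y \<notin> U \<Longrightarrow>
      \<exists>q\<in>Q. q x + x \<in> adjoin z K \<and> q y + (\<sigma> w y + e) \<in> adjoin z K"
    using rot unfolding rotatable_mod_def by blast
  have "\<exists>q\<in>Q. q x + x \<in> K \<and> q y + (\<sigma> w y + e) \<in> K" if x: "x \<in> U" and y: "y \<notin> U" for x y
  proof -
    define f where "f = \<sigma> w y + e"
    obtain q where q: "q \<in> Q" "q x + x \<in> adjoin z K" "q y + f \<in> adjoin z K"
      using rot[OF x y] unfolding f_def by blast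
    obtain r where r: "r \<in> Q" "r x + x \<in> K" "r y + f \<in> adjoin z K"
    proof (cases "q x + x \<in> K")
      case True
      then show ?thesis using that q by blast
    next
      case False
      then have "(q x + z) + x \<in> K" "(q y + z) + f \<in> adjoin z K"
        using q(2,3) by (auto simp: mem_adjoin add_ac)
      then show ?thesis using that Q_add[OF q(1), of z] by blast
    qed
    have "x + f \<notin> U"
      unfolding f_def using ew x y by (simp add: hyperplane_add_mem_iff[OF U(2)] \<sigma>_mem_block_hyperplane_iff[OF U])
    then show ?thesis
      using correct_rotation[OF K z periods r(1,2), of f y] r unfolding f_def mem_adjoin by blast
  qed
  then show ?thesis unfolding rotatable_mod_def using ew by blast
qed

lemma block_suborbit_symmetries:
  assumes K: "block K" shows "block {t. \<forall>u. u \<in> suborbit K v \<longleftrightarrow> u + t \<in> suborbit K v}" (is "block ?T")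
proof (rule blockI)
  have mem: "a + b \<in> ?T \<longleftrightarrow> (\<forall>y. y + a \<in> suborbit K v \<longleftrightarrow> y + b \<in> suborbit K v)" for a b
  proof
    assume "a + b \<in> ?T"
    then have "y + a \<in> suborbit K v \<longleftrightarrow> (y + a) + (a + b) \<in> suborbit K v" for y by blast
    then show "\<forall>y. y + a \<in> suborbit K v \<longleftrightarrow> y + b \<in> suborbit K v" by (simp add: add_ac)
  next
    assume shift: "\<forall>y. y + a \<in> suborbit K v \<longleftrightarrow> y + b \<in> suborbit K v"
    have "u \<in> suborbit K v \<longleftrightarrow> u + (a + b) \<in> suborbit K v" for u
      using shift[rule_format, of "u + a"] by (simp add: add_ac)
    then show "a + b \<in> ?T" by blast
  qed
  show "add_subgroup ?T" unfolding add_subgroup_def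
  proof (intro conjI ballI)
    show "a + b \<in> ?T" if "a \<in> ?T" "b \<in> ?T" for a b
      using that unfolding mem by blast
  qed simp
  fix q a b assume q: "q \<in> Q" and ab: "a + b \<in> ?T"
  have "y + q a \<in> suborbit K v \<longleftrightarrow> y + q b \<in> suborbit K v" for y
    using suborbit_Q_diff_iff[OF K q, of "finv q y"] Q_inv(3)[OF q] ab unfolding mem by metis
  then show "q a + q b \<in> ?T" unfolding mem by blast
qed

subsubsection \<open>A suborbit without central periods\<close>

context
  fixes U K :: "'v set" and v :: 'v
  assumes U: "block U" "hyperplane U" and K: "block K" and central_U: "central K \<subseteq> U"
    and v: "v \<notin> U" and aperiodic: "suborbit_periods K v \<subseteq> K"
begin

lemma no_central_shift: "u \<in> suborbit K v \<Longrightarrow> u + z \<in> suborbit K v \<Longrightarrow> z \<in> central K \<Longrightarrow> z \<in> K"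
  using mem_suborbit_periods[OF K] aperiodic by blast

lemma suborbit_disjoint_U: "u \<in> suborbit K v \<Longrightarrow> u \<notin> U"
  using suborbit_mem_block_iff[OF U(1) _] subset_central[OF K] central_U v by blast

lemma suborbit_symmetry_mem:
  assumes t: "\<And>u. u \<in> suborbit K v \<longleftrightarrow> u + t \<in> suborbit K v" shows "t \<in> K"
proof -
  define T where "T = {t. \<forall>u. u \<in> suborbit K v \<longleftrightarrow> u + t \<in> suborbit K v}"
  have T: "block T" unfolding T_def by (rule block_suborbit_symmetries[OF K])
  have "u \<in> suborbit K v \<longleftrightarrow> u + k \<in> suborbit K v" if k: "k \<in> K" for u k
    using suborbit_add[OF K _ k, of u v] suborbit_add[OF K _ k, of "u + k" v] by (auto simp: add_ac)
  then have "K \<subseteq> T" unfolding T_def by blast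
  have "T = K"
  proof (rule ccontr)
    assume "T \<noteq> K"
    with \<open>K \<subseteq> T\<close> have "K \<subset> T" by blast
    then obtain s where s: "s \<in> T" "s \<notin> K" "s \<in> central K"
      using central_meets_larger_block[OF K T] by blast
    then show False
      using no_central_shift[OF suborbit_self[OF K]] suborbit_self[OF K, of v] unfolding T_def by blast
  qed
  then show ?thesis using t unfolding T_def by blast
qed

lemma suborbit_eq_coset_subset:
  assumes W: "add_subgroup W" and eq: "suborbit K v = (\<lambda>k. k + v) ` W" shows "W \<subseteq> K"
proof
  have mem: "y \<in> suborbit K v \<longleftrightarrow> y + v \<in> W" for y
    unfolding eq using image_eqI[of y "\<lambda>k. k + v" "y + v" W] by (auto simp: add_ac)
  fix t assume t: "t \<in> W"
  have "y + t + v \<in> W \<longleftrightarrow> y + v \<in> W" for y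
    using add_mem_iff_left[OF W t, of "y + v"] by (simp add: add_ac)
  then show "t \<in> K" by (intro suborbit_symmetry_mem) (simp add: mem)
qed

lemma four_card_le_card_suborbit: "4 * card K \<le> card (suborbit K v)"
proof -
  note K' = block_add_subgroup[OF K]
  have v_central: "v \<notin> central K" using v central_U by blast
  then obtain u where u: "u \<in> suborbit K v" "u + v \<notin> K" using central_iff_suborbit[OF K] by blast
  have "card (suborbit K v) \<noteq> 2 * card K"
  proof
    assume card: "card (suborbit K v) = 2 * card K"
    have "k + v \<in> suborbit K v" if "k \<in> adjoin (u + v) K" for k
      using that suborbit_add[OF K suborbit_self[OF K, of v], of k] suborbit_add[OF K u(1), of "k + (u + v)"]
      by (auto simp: mem_adjoin add_ac)
    then have "(\<lambda>k. k + v) ` adjoin (u + v) K \<subseteq> suborbit K v" by blast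
    moreover have "card ((\<lambda>k. k + v) ` adjoin (u + v) K) = card (suborbit K v)"
      using card card_translate card_adjoin[OF K' u(2)] by metis
    ultimately have "suborbit K v = (\<lambda>k. k + v) ` adjoin (u + v) K"
      by (intro card_subset_eq[symmetric]) auto
    from suborbit_eq_coset_subset[OF add_subgroup_adjoin[OF K'] this]
    show False using self_mem_adjoin[OF K'] u(2) by blast
  qed
  moreover obtain m where "card (suborbit K v) = 2 * card K * m"
    using two_card_block_dvd_card_suborbit[OF K v_central] by (rule dvdE)
  moreover have "card (suborbit K v) > 0" using suborbit_self[OF K, of v] by (auto simp: card_gt_0_iff)
  ultimately have "card (suborbit K v) = 2 * card K * m" "m \<ge> 2" by (cases m; auto; cases "m = 1"; auto)+
  then show ?thesis using mult_le_mono2[of 2 m "2 * card K"] by simp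
qed

context
  fixes e :: 'v
  assumes e: "e \<in> central (central K)"
begin

lemma suborbit_subset_defect_periods: "suborbit K v \<subseteq> defect_periods e K"
proof
  fix u assume u: "u \<in> suborbit K v"
  have "defect e (x + u) + defect e x \<in> K" for x
  proof (rule no_central_shift[OF u])
    show "u + (defect e (x + u) + defect e x) \<in> suborbit K v"
      using defect_add_mem_suborbit[OF K, of u e x] suborbit_eq[OF K u] by simp
    show "defect e (x + u) + defect e x \<in> central K"
      using defect_mem[OF e] add_subgroup_add[OF block_add_subgroup[OF block_central[OF K]]] by blast
  qed
  then show "u \<in> defect_periods e K" unfolding defect_periods_def by blast
qed

lemma card_suborbit_less: "card (suborbit K v) < card (defect_periods e K \<inter> U)"
proof (rule ccontr)
  let ?Y0 = "defect_periods e K \<inter> U"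
  note K' = block_add_subgroup[OF K] and Y = add_subgroup_defect_periods[OF block_add_subgroup[OF K], of e]
  have Y0: "add_subgroup ?Y0"
    using Y hyperplane_add_subgroup[OF U(2)] unfolding add_subgroup_def by blast
  have sub: "suborbit K v \<subseteq> (\<lambda>y. y + v) ` ?Y0"
  proof
    fix u assume u: "u \<in> suborbit K v"
    then have "u + v \<in> ?Y0"
      using suborbit_subset_defect_periods suborbit_self[OF K, of v] add_subgroup_add[OF Y]
        hyperplane_add_mem_iff[OF U(2)] suborbit_disjoint_U v by blast
    moreover have "u = (u + v) + v" by (simp add: add_ac)
    ultimately show "u \<in> (\<lambda>y. y + v) ` ?Y0" by blast
  qed
  assume "\<not> card (suborbit K v) < card ?Y0"
  then have eq: "suborbit K v = (\<lambda>y. y + v) ` ?Y0" using sub by (intro card_seteq) (auto simp: card_translate)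
  have "card ?Y0 \<le> card K" using suborbit_eq_coset_subset[OF Y0 eq] by (simp add: card_mono)
  then show False
    using four_card_le_card_suborbit card_add_subgroup_pos[OF K'] unfolding eq card_translate by linarith
qed

lemma aperiodic_suborbit_cards:
  assumes "e \<notin> central K" "CARD('v) = 32"
  shows "K = {0}" "card (suborbit K v) = 4" "hyperplane (defect_periods e K)" "card (defect_periods e K - U) = 8"
proof -
  let ?Y = "defect_periods e K"
  note K' = block_add_subgroup[OF K] and Y = add_subgroup_defect_periods[OF block_add_subgroup[OF K], of e]
  have Y0: "add_subgroup (?Y \<inter> U)"
    using Y hyperplane_add_subgroup[OF U(2)] unfolding add_subgroup_def by blast
  have "?Y \<subset> UNIV" using defect_periods_neq_UNIV[OF K assms(1)] by blast
  from card_psubset_add_subgroup_le[OF Y add_subgroup_UNIV this] have card_Y: "card ?Y \<le> 16"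
    using assms(2) by simp
  have "?Y \<inter> U \<subset> ?Y" using v suborbit_self[OF K] suborbit_subset_defect_periods by blast
  from card_psubset_add_subgroup_le[OF Y0 Y this] have card_Y0: "2 * card (?Y \<inter> U) \<le> card ?Y" .
  obtain i j where ij: "card (suborbit K v) = 2 ^ i" "card (?Y \<inter> U) = 2 ^ j"
    using card_suborbit_power_2[OF K] card_add_subgroup_power_2[OF Y0] by metis
  have card_K: "card K = 1"
    using card_Y card_Y0 card_suborbit_less four_card_le_card_suborbit card_add_subgroup_pos[OF K'] by linarith
  then show "K = {0}" using add_subgroup_zero[OF K'] by (metis card_1_singletonE singletonD)
  have "(2::nat) ^ 2 \<le> 2 ^ i" "(2::nat) ^ i < 2 ^ j" "(2::nat) ^ j \<le> 2 ^ 3"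
    using card_Y card_Y0 card_suborbit_less four_card_le_card_suborbit card_K ij by simp_all
  then have "2 \<le> i" "i < j" "j \<le> 3" by (simp_all only: power_increasing_iff power_strict_increasing_iff one_less_numeral_iff semiring_norm)
  then have "i = 2" "j = 3" by linarith+
  then show "card (suborbit K v) = 4" using ij by simp
  have "card ?Y = 16" "card (?Y \<inter> U) = 8" using \<open>j = 3\<close> ij card_Y card_Y0 by simp_all
  then show "hyperplane ?Y" "card (?Y - U) = 8"
    using Y assms(2) by (simp_all add: hyperplane_def card_Diff_subset_Int)
qed

end

end

text \<open>The extremal configuration: \<open>quartet\<close> consists of 4 of the 8 points of \<open>periods\<close> outside \<open>U\<close>,
  and it is a Sidon set, so that the stabilizer of 0 in \<open>Q\<close> acts additively on it.\<close>

context
  fixes U :: "'v set" and v e z :: 'v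
  assumes U: "block U" "hyperplane U" and central_U: "central {0} \<subseteq> U"
    and v: "v \<notin> U" and aperiodic: "suborbit_periods {0} v \<subseteq> {0}"
    and e: "e \<in> central (central {0})" "e \<notin> central {0}" and z: "z \<in> central {0}" "z \<noteq> 0"
    and card_quartet: "card (suborbit {0} v) = 4"
    and Y: "hyperplane (defect_periods e {0})" "card (defect_periods e {0} - U) = 8"
begin

abbreviation (input) "quartet \<equiv> suborbit {0} v"
abbreviation (input) "periods \<equiv> defect_periods e {0}"

lemmas periods_add = add_subgroup_add[OF hyperplane_add_subgroup[OF Y(1)]]
lemmas aperiodic_zero = U block_singleton_zero central_U v aperiodic
lemmas quartet_not_U = suborbit_disjoint_U[OF aperiodic_zero]
lemmas quartet_subset_periods = suborbit_subset_defect_periods[OF aperiodic_zero e(1)]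
lemmas v_mem_quartet = suborbit_self[OF block_singleton_zero, of v]

lemma z_mem: "z \<in> periods" "z \<in> U"
  using z(1) central_subset_defect_periods central_U by auto

lemma quartet_central_shift: "u \<in> quartet \<Longrightarrow> s \<in> central {0} \<Longrightarrow> s \<noteq> 0 \<Longrightarrow> u + s \<notin> quartet"
  using no_central_shift[OF aperiodic_zero] by blast

lemma periods_minus_U_cases:
  assumes "u \<in> periods" "u \<notin> U" shows "u \<in> quartet \<or> u + z \<in> quartet"
proof -
  let ?Xz = "(\<lambda>u. u + z) ` quartet"
  have "quartet \<inter> ?Xz = {}" using quartet_central_shift z by auto
  then have "card (quartet \<union> ?Xz) = 8" by (simp add: card_Un_disjoint card_translate card_quartet)
  moreover have "quartet \<union> ?Xz \<subseteq> periods - U"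
    using quartet_subset_periods quartet_not_U z_mem periods_add hyperplane_add_mem_iff[OF U(2)] by auto
  ultimately have "quartet \<union> ?Xz = periods - U" using Y(2) by (intro card_subset_eq) auto
  then have "u \<in> quartet \<union> ?Xz" using assms by blast
  then show ?thesis by (auto simp: add_ac)
qed

lemma periods_inter_U_cases:
  assumes "u \<in> periods" "u \<in> U" "a \<in> quartet" shows "u + a \<in> quartet \<or> u + a + z \<in> quartet"
  using assms quartet_subset_periods quartet_not_U periods_add hyperplane_add_mem_iff[OF U(2)] by (intro periods_minus_U_cases) auto

lemma periods_cases:
  assumes "u \<in> periods"
  obtains a where "a \<in> quartet" "u = a \<or> u = a + z \<or> u = a + v \<or> u = a + v + z"
proof (cases "u \<in> U")
  case True
  from periods_inter_U_cases[OF assms this v_mem_quartet] show thesis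
    using that[of "u + v"] that[of "u + v + z"] by (auto simp: add_ac)
next
  case False
  from periods_minus_U_cases[OF assms this] show thesis
    using that[of u] that[of "u + z"] by (auto simp: add_ac)
qed

lemma periods_induct [consumes 1, case_names suborbit central add]:
  assumes "u \<in> periods" "\<And>a. a \<in> quartet \<Longrightarrow> P a" "P z" "\<And>s t. P s \<Longrightarrow> P t \<Longrightarrow> P (s + t)" shows "P u"
  using assms(2-4) v_mem_quartet periods_cases[OF assms(1)] by metis

lemma quartet_sidon:
  assumes X: "a \<in> quartet" "b \<in> quartet" "c \<in> quartet" "d \<in> quartet" and sum: "a + b = c + d" and "a \<noteq> b"
  shows "c = a \<or> c = b"
proof (rule ccontr)
  assume c: "\<not> ?thesis"
  have d: "d = a + b + c" using sum by (simp add: add_ac)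
  have "d \<noteq> a" "d \<noteq> b" "d \<noteq> c"
    using c sum \<open>a \<noteq> b\<close> by (auto simp: add.commute add_eq_zero_iff)
  then have "card {a, b, c, d} = 4" using c \<open>a \<noteq> b\<close> by auto
  then have quartet_eq: "quartet = {a, b, c, d}" using X card_quartet by (intro card_subset_eq[symmetric]) auto
  have shift: "u + (a + b) \<in> quartet" if "u \<in> quartet" for u using that unfolding quartet_eq d by (auto simp: add_ac)
  from shift shift[of "u + (a + b)" for u] have "u \<in> quartet \<longleftrightarrow> u + (a + b) \<in> quartet" for u
    by (auto simp: add_ac)
  then have "a + b \<in> {0}" by (rule suborbit_symmetry_mem[OF aperiodic_zero])
  then show False using \<open>a \<noteq> b\<close> by (simp add: add_eq_zero_iff)
qed

lemma Q_mem_quartet: "q \<in> Q \<Longrightarrow> q 0 = 0 \<Longrightarrow> u \<in> quartet \<Longrightarrow> q u \<in> quartet"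
  using Q_mem_suborbit[OF block_singleton_zero] by simp

lemma Q_add_on_quartet:
  assumes q: "q \<in> Q" "q 0 = 0" and ab: "a \<in> quartet" "b \<in> quartet" shows "q (a + b) = q a + q b"
proof (cases "a = b")
  case True
  then show ?thesis using q(2) by simp
next
  case False
  define c where "c = q (a + b) + q a"
  define d where "d = q (a + b) + q b"
  have "(a + b) + a \<in> quartet" "(a + b) + b \<in> quartet" using ab by (simp_all add: add_ac)
  then have "c \<in> quartet" "d \<in> quartet" unfolding c_def d_def using suborbit_Q_diff[OF block_singleton_zero q(1)] by blast+
  moreover have "q a + q b = c + d" unfolding c_def d_def by (simp add: add_ac)
  ultimately consider (fixes_a) "c = q a" | (swaps) "c = q b"
    using quartet_sidon Q_mem_quartet[OF q] ab False Q_eq_iff[OF q(1)] by metis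
  then show ?thesis
  proof cases
    case fixes_a
    then have "q (a + b) = q 0" unfolding c_def q(2) by simp
    then show ?thesis using False by (simp add: Q_eq_iff[OF q(1)] add_eq_zero_iff)
  next
    case swaps
    have "q (a + b) = c + q a" unfolding c_def by (simp add: add_ac)
    then show ?thesis using swaps by (simp add: add.commute)
  qed
qed

lemma Q_fixes_periods:
  assumes q: "q \<in> Q" "q 0 = 0" and X: "\<And>a. a \<in> quartet \<Longrightarrow> q a = a" and u: "u \<in> periods" shows "q u = u"
proof -
  have "q (a + v) = a + v" if "a \<in> quartet" for a using Q_add_on_quartet[OF q that v_mem_quartet] X that v_mem_quartet by simp
  then show ?thesis using periods_cases[OF u] X central_zeroD[OF z(1) q(1)] by metis
qed

lemmas translators_add = add_subgroup_add[OF add_subgroup_translators[OF hyperplane_add_subgroup[OF Y(1)]]]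

lemma z_mem_translators: "z \<in> translators periods"
  by (rule central_zero_mem_translators[OF z(1) z_mem(1)])

lemma e_mem_translators: "e \<in> translators periods"
  using self_mem_defect_periods[OF block_singleton_zero e(1)] \<sigma>_eq_add_on_defect_periods unfolding translators_def by blast

lemma translators_pair:
  assumes ab: "a \<in> quartet" "b \<in> quartet" and M: "a + b \<in> translators periods" shows "\<sigma> a b + a = b"
proof -
  let ?\<pi> = "\<lambda>u. \<sigma> a u + a"
  have "?\<pi> (a + b) = a + b"
    using M ab(1) quartet_subset_periods unfolding translators_def \<sigma>_swap[of a "a + b"] by (auto simp: add_ac)
  moreover have "?\<pi> (a + b) = ?\<pi> a + ?\<pi> b" by (rule Q_add_on_quartet[OF Q_add[OF \<sigma>_mem] _ ab]) simp
  ultimately have "a + b = a + (\<sigma> a b + a)" by simp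
  then show ?thesis by (simp only: add_left_cancel)
qed

lemma quartet_mem_translators:
  assumes quartet_eq: "quartet = {a, a', b, b'}" and a: "a + a' \<in> translators periods" and b: "b + b' \<in> translators periods"
  shows "a \<in> translators periods"
proof -
  have X: "a \<in> quartet" "a' \<in> quartet" "b \<in> quartet" "b' \<in> quartet" using quartet_eq by auto
  have "a \<noteq> b" "a \<noteq> b'" "a \<noteq> a'" "a' \<noteq> b" "a' \<noteq> b'" "b \<noteq> b'"
    using card_quartet unfolding quartet_eq by (auto simp: card_insert_if split: if_splits)
  note distinct = this this[symmetric]
  let ?\<pi> = "\<lambda>x u. \<sigma> x u + x"
  have \<pi>: "?\<pi> x \<in> Q" "?\<pi> x 0 = 0" for x by (simp_all add: Q_add \<sigma>_mem)
  have \<pi>_mem: "?\<pi> x u \<in> quartet" if "u \<in> quartet" for x u by (rule Q_mem_quartet[OF \<pi> that])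
  have fix_a: "?\<pi> a a = a" "?\<pi> a a' = a'" and fix_b: "?\<pi> b b = b" "?\<pi> b b' = b'"
    using translators_pair X a b by simp_all
  have "?\<pi> a b \<in> {b, b'}" "?\<pi> b a \<in> {a, a'}"
    using \<pi>_mem[OF X(3), of a] \<pi>_mem[OF X(1), of b] Q_eq_iff[OF \<pi>(1)] fix_a fix_b distinct
    unfolding quartet_eq by (metis empty_iff insert_iff)+
  moreover from this have "?\<pi> a b \<noteq> a" using distinct by (metis empty_iff insert_iff)
  moreover have sum: "?\<pi> a b + a = ?\<pi> b a + b" by (simp add: \<sigma>_swap[of b a] add_ac)
  ultimately have "?\<pi> b a = ?\<pi> a b \<or> ?\<pi> b a = a" "?\<pi> a b \<in> {b, b'}" "?\<pi> b a \<in> {a, a'}"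
    using quartet_sidon[OF \<pi>_mem[OF X(3), of a] X(1) \<pi>_mem[OF X(1), of b] X(3)] by blast+
  then have "?\<pi> b a = a" using distinct by auto
  with sum have ab: "?\<pi> a b = b" by (metis add.commute add_left_cancel)
  moreover have "?\<pi> a b' = b'"
    using \<pi>_mem[OF X(4), of a] Q_eq_iff[OF \<pi>(1)] fix_a ab distinct unfolding quartet_eq by (metis empty_iff insert_iff)
  ultimately have "?\<pi> a x = x" if "x \<in> quartet" for x using that fix_a unfolding quartet_eq by auto
  then have "?\<pi> a u = u" if "u \<in> periods" for u using Q_fixes_periods[OF \<pi> _ that] by blast
  then have "\<sigma> a u = u + a" if "u \<in> periods" for u using that by (metis add.assoc add_self add.right_neutral)
  then show ?thesis using X(1) quartet_subset_periods unfolding translators_def by blast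
qed

lemma e_mem_U: "e \<in> U"
proof (rule ccontr)
  assume "e \<notin> U"
  have "e \<in> periods" using e_mem_translators unfolding translators_def by blast
  from periods_minus_U_cases[OF this \<open>e \<notin> U\<close>] obtain p where p: "p \<in> quartet" "p + e \<in> central {0}"
    using z(1) add_subgroup_zero[OF block_add_subgroup[OF block_central[OF block_singleton_zero]]]
    by (fastforce simp: add_ac)
  have "\<not> quartet \<subseteq> {p}" using card_quartet card_mono[of "{p}" quartet] by auto
  then obtain u where u: "u \<in> quartet" "u \<noteq> p" by blast
  have "u + (p + e) \<in> suborbit {0} e"
    using suborbit_add_central[OF block_singleton_zero p(2), of u p] u suborbit_eq[OF block_singleton_zero p(1)] by simp
  then obtain q where q: "q \<in> Q" "q 0 = 0" "q e = u + (p + e)" by (auto elim: suborbitE)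
  have "u + p \<in> central {0}" using centralD[OF e(1) q(1), of 0] q by (simp add: add_ac)
  moreover have "p + (u + p) \<in> quartet" using u by (simp add: add_ac)
  ultimately show False using quartet_central_shift[OF p(1)] u(2) by (auto simp: add_eq_zero_iff)
qed

lemma exists_noncentral_translator:
  obtains f where "f \<in> translators periods" "f \<notin> central {0}" "v + f \<in> quartet"
proof -
  have "e + z \<notin> central {0}"
    using e(2) z(1) add_mem_iff_right[OF block_add_subgroup[OF block_central[OF block_singleton_zero]]] by blast
  moreover have "e \<in> periods" using e_mem_translators unfolding translators_def by blast
  then have "v + e \<in> quartet \<or> v + (e + z) \<in> quartet"
    using periods_inter_U_cases[OF _ e_mem_U v_mem_quartet] by (simp add: add_ac)
  ultimately show thesis
    using that e(2) e_mem_translators translators_add z_mem_translators by blast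
qed

lemma quartet_subset_translators: "quartet \<subseteq> translators periods"
proof -
  obtain f where f: "f \<in> translators periods" "f \<notin> central {0}" "v + f \<in> quartet"
    by (rule exists_noncentral_translator)
  have "0 \<in> central {0}" using subset_central[OF block_singleton_zero] by blast
  then have "f \<noteq> 0" "f \<noteq> z" using f(2) z(1) by auto
  define a where "a = v + f"
  have a: "a \<in> quartet" "a \<noteq> v" "v + a = f" using f \<open>f \<noteq> 0\<close> unfolding a_def by simp_all
  have "\<not> quartet \<subseteq> {v, a}" using card_quartet card_mono[of "{v, a}" quartet] a(2) by (auto simp: card_insert_if)
  then obtain b where b: "b \<in> quartet" "b \<noteq> v" "b \<noteq> a" by blast
  define b' where "b' = f + b + z"
  have f_Y: "f \<in> periods" "f \<in> U"
    using f(1) a quartet_not_U v hyperplane_add_mem_iff[OF U(2), of v a] unfolding translators_def by auto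
  have "f + b \<notin> quartet"
  proof
    assume "f + b \<in> quartet"
    moreover have "v + a = b + (f + b)" using a(3) by (simp add: add_ac)
    ultimately show False using quartet_sidon[OF v_mem_quartet a(1) b(1)] a(2) b by blast
  qed
  then have b': "b' \<in> quartet" using periods_inter_U_cases[OF f_Y b(1)] unfolding b'_def by blast
  have bb': "b + b' = f + z" unfolding b'_def by (simp add: add_ac)
  have "b + z = b' + f" unfolding b'_def by (simp add: add_ac)
  then have "b' + f \<notin> quartet" using quartet_central_shift[OF b(1) z] by simp
  moreover have "v + f \<in> quartet" "a + f \<in> quartet" using f(3) v_mem_quartet unfolding a_def by (simp_all add: add_ac)
  ultimately have "b' \<noteq> v" "b' \<noteq> a" by auto
  moreover have "b' \<noteq> b" using bb' \<open>f \<noteq> z\<close> by (auto simp: add_eq_zero_iff)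
  ultimately have "card {v, a, b, b'} = 4" using a(2) b by auto
  then have quartet_eq: "quartet = {v, a, b, b'}" using v_mem_quartet a(1) b(1) b' card_quartet by (intro card_subset_eq[symmetric]) auto
  then have "quartet = {a, v, b, b'}" "quartet = {b, b', v, a}" "quartet = {b', b, v, a}" by auto
  moreover have "v + a \<in> translators periods" "a + v \<in> translators periods" "b + b' \<in> translators periods" "b' + b \<in> translators periods"
    using a(3) bb' f(1) translators_add z_mem_translators by (simp_all add: add.commute)
  ultimately have "v \<in> translators periods" "a \<in> translators periods" "b \<in> translators periods" "b' \<in> translators periods"
    using quartet_mem_translators quartet_eq by blast+
  then show ?thesis unfolding quartet_eq by blast
qed

lemma translation_hyperplane_defect_periods: "translation_hyperplane periods"
proof -
  have "periods \<subseteq> translators periods"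
  proof
    fix u assume "u \<in> periods"
    then show "u \<in> translators periods"
      by (induction rule: periods_induct) (use quartet_subset_translators z_mem_translators translators_add in auto)
  qed
  moreover have "block periods"
  proof (rule blockI)
    fix q s t assume q: "q \<in> Q" and "s + t \<in> periods"
    have "\<forall>w. q (w + u) + q w \<in> periods" if "u \<in> periods" for u
      using that
    proof (induction rule: periods_induct)
      case (suborbit a)
      then show ?case
        using suborbit_Q_diff[OF block_singleton_zero q, of "w + a" w v for w] quartet_subset_periods by (auto simp: add_ac)
    next
      case central
      show ?case using central_zeroD[OF z(1) q] z_mem(1) by (simp add: add_ac)
    next
      case (add s t)
      then show ?case using add_mem_trans[OF hyperplane_add_subgroup[OF Y(1)]] by (metis add.assoc)
    qed
    from this[OF \<open>s + t \<in> periods\<close>, rule_format, of t] show "q s + q t \<in> periods" by (simp add: add_ac)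
  qed (rule hyperplane_add_subgroup[OF Y(1)])
  ultimately show ?thesis unfolding translation_hyperplane_def using Y(1) by blast
qed

end

lemma translation_hyperplane_of_aperiodic_suborbit:
  assumes U: "block U" "hyperplane U" and K: "block K" and central_U: "central K \<subseteq> U"
    and v: "v \<notin> U" and aperiodic: "suborbit_periods K v \<subseteq> K" and card: "CARD('v) = 32"
  shows "\<exists>Y. translation_hyperplane Y"
proof -
  have proper: "central K \<noteq> UNIV" "K \<noteq> UNIV" using central_U v subset_central[OF K] by auto
  then obtain e where e: "e \<in> central (central K)" "e \<notin> central K"
    using psubset_central[OF block_central[OF K]] by blast
  note cards = aperiodic_suborbit_cards[OF U K central_U v aperiodic e card]
  obtain z where z: "z \<in> central {0}" "z \<noteq> 0" using psubset_central[OF K proper(2)] unfolding cards(1) by blast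
  show ?thesis
    using translation_hyperplane_defect_periods[OF U _ v _ _ _ z] central_U aperiodic e cards unfolding cards(1) by blast
qed

subsubsection \<open>Suborbits with central periods\<close>

lemma suborbit_periods_subset_central: "suborbit_periods K v \<subseteq> central K"
  unfolding suborbit_periods_def by blast

lemma suborbit_periods_shift:
  assumes K: "block K" and "v + c \<in> central K" "z \<in> suborbit_periods K c" shows "z \<in> suborbit_periods K v"
proof -
  have z: "z \<in> central K" "c + z \<in> suborbit K c" using assms(3) unfolding suborbit_periods_def by auto
  have "(c + z) + (v + c) \<in> suborbit K (c + (v + c))" using suborbit_add_central[OF K assms(2) z(2)] .
  then show ?thesis using z(1) unfolding suborbit_periods_def by (simp add: add_ac)
qed

lemma suborbit_periods_transfer:
  assumes K: "block K" and c: "c \<in> suborbit K v" and z: "z \<in> suborbit_periods K (c + v)"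
    and index: "\<And>t. t \<in> suborbit K v \<Longrightarrow> t + v \<in> central K \<or> t + c \<in> central K"
  shows "z \<in> suborbit_periods K v"
proof -
  note central = block_add_subgroup[OF block_central[OF K]] and periods = add_subgroup_suborbit_periods[OF K, of v]
  have z_central: "z \<in> central K" using z suborbit_periods_subset_central by blast
  obtain r where r: "r \<in> Q" "r 0 \<in> K" "r (c + v) = (c + v) + z"
    using z unfolding suborbit_periods_def by (auto elim: suborbitE)
  have rc: "r c \<in> suborbit K v" by (rule Q_mem_suborbit[OF K c r(1,2)])
  have "c + (c + v) \<in> suborbit K v" using suborbit_self[OF K, of v] by simp
  from suborbit_Q_diff[OF K r(1) this] have rc': "r c + ((c + v) + z) \<in> suborbit K v" unfolding r(3) .
  obtain d where "d \<in> suborbit_periods K v" "d + z \<in> suborbit_periods K v"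
  proof (cases "r c + v \<in> central K")
    case True
    then have "r c + v + z \<in> central K" using z_central add_subgroup_add[OF central] by blast
    then show thesis
      using that[of "r c + v"] mem_suborbit_periods[OF K True suborbit_self[OF K]] rc
        mem_suborbit_periods[OF K _ c] rc' by (simp add: add_ac)
  next
    case False
    then have "r c + c \<in> central K" using index[OF rc] by blast
    moreover from this have "r c + c + z \<in> central K" using z_central add_subgroup_add[OF central] by blast
    ultimately show thesis
      using that[of "r c + c"] mem_suborbit_periods[OF K _ c] rc
        mem_suborbit_periods[OF K _ suborbit_self[OF K]] rc' by (simp add: add_ac)
  qed
  then show ?thesis using add_mem_iff_left[OF periods] by blast
qed

lemma defect_diff_mem_suborbit_periods:
  assumes K: "block K" and top: "central (central K) = UNIV"
  shows "defect a (x + b) + defect a x \<in> suborbit_periods K b" (is "?d a b \<in> _")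
    and "defect a (x + b) + defect a x \<in> suborbit_periods K a"
proof -
  note K' = block_add_subgroup[OF K] and central = block_add_subgroup[OF block_central[OF K]]
  have defect: "defect a y \<in> central K" for a y by (rule defect_mem) (simp add: top)
  have right: "defect a (x + b) + defect a x \<in> suborbit_periods K b" for a b x
    using defect_add_mem_suborbit[OF K, of b a x] add_subgroup_add[OF central defect defect]
    unfolding suborbit_periods_def by blast
  then show "?d a b \<in> suborbit_periods K b" .
  have "\<sigma> a ((x + b) + defect b x) = \<sigma> b ((x + a) + defect a x)"
    using \<sigma>_comm[of a b x] unfolding \<sigma>_eq_defect[of b x] \<sigma>_eq_defect[of a x] .
  then have "(\<sigma> a (x + b) + defect b x) + (\<sigma> b (x + a) + defect a x) \<in> K"
    using add_subgroup_add[OF K' centralD[OF defect[of b x] \<sigma>_mem[of a], of "x + b"] centralD[OF defect[of a x] \<sigma>_mem[of b], of "x + a"]]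
    by (simp add: add_ac)
  then have "?d a b + ?d b a \<in> K"
    unfolding \<sigma>_eq_defect[of a "x + b"] \<sigma>_eq_defect[of b "x + a"] by (simp add: add_ac)
  then have "?d a b + ?d b a \<in> suborbit_periods K a" using subset_suborbit_periods[OF K] by blast
  then show "?d a b \<in> suborbit_periods K a"
    using add_mem_iff_right[OF add_subgroup_suborbit_periods[OF K] right[where a=b and b=a]] by blast
qed

context
  fixes U K :: "'v set"
  assumes U: "block U" "hyperplane U" and K: "block K" and central_U: "central K \<subseteq> U"
    and periodic: "\<And>v. v \<notin> U \<Longrightarrow> \<not> suborbit_periods K v \<subseteq> K"
    and no_common: "\<And>z. z \<in> central K \<Longrightarrow> z \<notin> K \<Longrightarrow> \<exists>v. v \<notin> U \<and> z \<notin> suborbit_periods K v"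
    and card_V: "CARD('v) = 32"
begin

lemmas add_subgroup_K = block_add_subgroup[OF K]
lemmas add_subgroup_central = block_add_subgroup[OF block_central[OF K]]

lemma central_proper: "central K \<noteq> UNIV"
  using hyperplane_proper[OF U(2)] central_U by blast

lemma psubset_central_K: "K \<subset> central K"
  using subset_central[OF K] hyperplane_proper[OF U(2)] periodic suborbit_periods_subset_central by blast

lemma four_card_le_card_central: "4 * card K \<le> card (central K)"
proof -
  obtain z where z: "z \<in> central K" "z \<notin> K" using psubset_central_K by blast
  obtain v where v: "v \<notin> U" "z \<notin> suborbit_periods K v" using no_common[OF z] by blast
  obtain y where y: "y \<in> suborbit_periods K v" "y \<notin> K" using periodic[OF v(1)] by blast
  have "suborbit_periods K v \<subset> central K" using suborbit_periods_subset_central v(2) z(1) by blast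
  moreover have "K \<subset> suborbit_periods K v" using subset_suborbit_periods[OF K] y by blast
  ultimately show ?thesis
    using card_psubset_add_subgroup_le[OF add_subgroup_K add_subgroup_suborbit_periods[OF K]]
      card_psubset_add_subgroup_le[OF add_subgroup_suborbit_periods[OF K] add_subgroup_central] by fastforce
qed

lemma card_central_le_8: "card (central K) \<le> 8"
  using card_central_le[OF K central_proper] card_V by simp

lemma singleton_zero_if_card_central_le_4:
  assumes "card (central K) \<le> 4" shows "K = {0}" "card (central K) = 4"
proof -
  have "card K = 1" using assms four_card_le_card_central card_add_subgroup_pos[OF add_subgroup_K] by linarith
  then show "K = {0}" using add_subgroup_zero[OF add_subgroup_K] by (metis card_1_singletonE singletonD)
  show "card (central K) = 4" using assms four_card_le_card_central \<open>card K = 1\<close> by simp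
qed

lemma card_central_central_if_proper:
  assumes "central (central K) \<noteq> UNIV"
  shows "K = {0}" "card (central (central K)) = 2 * card (central K)" "card (central (central K)) = 8"
proof -
  note Z2 = block_central[OF block_central[OF K]]
  have "card (central (central K)) \<le> 8" using card_central_le[OF block_central[OF K] assms] card_V by simp
  moreover have "2 * card (central K) \<le> card (central (central K))"
    by (rule card_psubset_add_subgroup_le[OF add_subgroup_central block_add_subgroup[OF Z2] psubset_central[OF block_central[OF K] central_proper]])
  ultimately show "K = {0}" "card (central (central K)) = 2 * card (central K)" "card (central (central K)) = 8"
    using singleton_zero_if_card_central_le_4 by simp_all
qed

lemma central_central_central_UNIV:
  assumes proper: "central (central K) \<noteq> UNIV" shows "central (central (central K)) = UNIV"
proof (rule ccontr)
  note Z2 = block_central[OF block_central[OF K]]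
  assume "\<not> ?thesis"
  then have "card (central (central (central K))) \<le> 8" using card_central_le[OF Z2] card_V by simp
  moreover have "2 * card (central (central K)) \<le> card (central (central (central K)))"
    by (rule card_psubset_add_subgroup_le[OF block_add_subgroup[OF Z2] block_add_subgroup[OF block_central[OF Z2]] psubset_central[OF Z2 proper]])
  ultimately show False using card_central_central_if_proper(3)[OF proper] by linarith
qed

lemma central_central_UNIV: "central (central K) = UNIV"
proof (rule ccontr)
  let ?Z2 = "central (central K)"
  assume proper: "?Z2 \<noteq> UNIV"
  note Z2' = block_add_subgroup[OF block_central[OF block_central[OF K]]]
  have sub: "central K \<subset> ?Z2" by (rule psubset_central[OF block_central[OF K] central_proper])
  have index: "s + t \<in> central K" if "s \<in> ?Z2" "s \<notin> central K" "t \<in> ?Z2" "t \<notin> central K" for s t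
    by (rule add_mem_of_index_2[OF add_subgroup_central Z2' _ _ that]) (use sub card_central_central_if_proper(2)[OF proper] in auto)
  obtain s where s: "s \<in> ?Z2" "s \<notin> central K" using sub by blast
  obtain u where u: "u \<in> suborbit K s" "u + s \<notin> K" using s(2) central_iff_suborbit[OF K] by blast
  define z where "z = u + s"
  have z: "z \<in> central K" "z \<notin> K"
    using suborbit_diff_mem[OF s(1) add_subgroup_central subset_central[OF K] u(1)] u(2) unfolding z_def by auto
  have z_s: "z \<in> suborbit_periods K s"
    by (rule mem_suborbit_periods[OF K z(1) suborbit_self[OF K]]) (use u(1) in \<open>simp add: z_def add_ac\<close>)
  obtain v where v: "v \<notin> U" "z \<notin> suborbit_periods K v" using no_common[OF z] by blast
  have "v \<notin> ?Z2"
    using index[OF _ _ s, of v] suborbit_periods_shift[OF K _ z_s] v central_U by blast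
  then obtain q x where q: "q \<in> Q" "q (x + v) + q x + v \<notin> central K" unfolding central_def[of "central K"] by blast
  define c where "c = q (x + v) + q x"
  have c: "c \<in> suborbit K v" unfolding c_def
    using suborbit_Q_diff[OF K q(1), of "x + v" x v] suborbit_self[OF K] by (simp add: add_ac)
  have diff: "t + v \<in> ?Z2" if "t \<in> suborbit K v" for t
    by (rule suborbit_diff_mem[OF _ Z2' _ that]) (use central_central_central_UNIV[OF proper] subset_central[OF K] sub in auto)
  have cv: "c + v \<in> ?Z2" "c + v \<notin> central K" using diff[OF c] q(2) unfolding c_def by auto
  have "z \<in> suborbit_periods K v"
  proof (rule suborbit_periods_transfer[OF K c])
    show "z \<in> suborbit_periods K (c + v)" by (rule suborbit_periods_shift[OF K index[OF cv s] z_s])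
    fix t assume t: "t \<in> suborbit K v"
    have "(t + v) + (c + v) = t + c" by (simp add: add_ac)
    then show "t + v \<in> central K \<or> t + c \<in> central K" using index[OF diff[OF t] _ cv] by metis
  qed
  then show False using v(2) by blast
qed

lemma card_central_neq_8: "card (central K) \<noteq> 8"
proof
  assume card: "card (central K) = 8"
  obtain v where v: "v \<notin> U" using hyperplane_proper[OF U(2)] by blast
  have "\<not> U \<subseteq> central K"
    using card U(2) card_V card_mono[of "central K" U] by (auto simp: hyperplane_def)
  then obtain t where t: "t \<in> U" "t \<notin> central K" by blast
  have vt: "v + t \<notin> U" using v t by (simp add: hyperplane_add_mem_iff[OF U(2)])
  have v_central: "v \<notin> central K" using v central_U by blast
  have P: "add_subgroup (defect_periods v K)" by (rule add_subgroup_defect_periods[OF add_subgroup_K])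
  have "v + t \<notin> defect_periods v K"
  proof
    assume "v + t \<in> defect_periods v K"
    moreover have "adjoin v (central K) \<subseteq> defect_periods v K"
      using adjoin_subset[OF P central_subset_defect_periods] self_mem_defect_periods[OF K] central_central_UNIV by blast
    moreover have "v + t \<notin> adjoin v (central K)"
      using vt t central_U by (auto simp: mem_adjoin add_ac)
    ultimately have "2 * card (adjoin v (central K)) \<le> card (defect_periods v K)"
      by (intro card_psubset_add_subgroup_le[OF add_subgroup_adjoin[OF add_subgroup_central] P]) auto
    then have "CARD('v) \<le> card (defect_periods v K)"
      using card card_V card_adjoin[OF add_subgroup_central v_central] by simp
    then have "defect_periods v K = UNIV" by (intro card_seteq) auto
    then show False using defect_periods_neq_UNIV[OF K v_central] by blast
  qed
  then obtain x where x: "defect v (x + (v + t)) + defect v x \<notin> K" unfolding defect_periods_def by blast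
  define b where "b = defect v (x + (v + t)) + defect v x"
  have b: "b \<in> suborbit_periods K v" "b \<in> suborbit_periods K (v + t)" "b \<notin> K"
    unfolding b_def using defect_diff_mem_suborbit_periods[OF K central_central_UNIV] x by auto
  then obtain y where y: "y \<notin> U" "b \<notin> suborbit_periods K y"
    using no_common[of b] suborbit_periods_subset_central by blast
  have "y + v \<in> central K \<or> y + (v + t) \<in> central K"
  proof (rule ccontr)
    assume far: "\<not> ?thesis"
    have "(y + v) + t \<in> central K"
      by (rule add_mem_of_index_2[OF add_subgroup_central hyperplane_add_subgroup[OF U(2)] central_U])
        (use far t v y(1) card U(2) card_V in \<open>auto simp: hyperplane_add_mem_iff[OF U(2)] hyperplane_def\<close>)
    then show False using far by (simp add: add_ac)
  qed
  then show False using suborbit_periods_shift[OF K] b(1,2) y(2) by blast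
qed

lemma card_central_eq_4: "K = {0}" "card (central K) = 4"
proof -
  obtain i where i: "card (central K) = 2 ^ i" using card_add_subgroup_power_2[OF add_subgroup_central] by blast
  then have "i \<le> 3" using card_central_le_8 power_le_imp_le_exp[of "2::nat" i 3] by simp
  then have "card (central K) \<le> 4"
    using i card_central_neq_8 power_increasing[of i 2 "2::nat"] by (cases "i = 3") auto
  then show "K = {0}" "card (central K) = 4" using singleton_zero_if_card_central_le_4 by auto
qed

lemma exists_suborbits_without_common_period:
  "\<exists>v w. v \<notin> U \<and> w \<notin> U \<and> v + w \<notin> central K \<and> suborbit_periods K v \<inter> suborbit_periods K w \<subseteq> {0}"
proof -
  obtain z where z: "z \<in> central K" "z \<notin> K" using psubset_central_K by blast
  obtain v where v: "v \<notin> U" "z \<notin> suborbit_periods K v" using no_common[OF z] by blast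
  obtain t where t: "t \<in> suborbit_periods K v" "t \<notin> K" using periodic[OF v(1)] by blast
  have "suborbit_periods K v \<subset> central K" using suborbit_periods_subset_central z(1) v(2) by blast
  then have "card (suborbit_periods K v) \<le> 2"
    using card_psubset_add_subgroup_le[OF add_subgroup_suborbit_periods[OF K] add_subgroup_central] card_central_eq_4(2) by fastforce
  moreover have "{0, t} \<subseteq> suborbit_periods K v" "card {0, t} = 2"
    using t add_subgroup_zero[OF add_subgroup_suborbit_periods[OF K]] card_central_eq_4(1) by auto
  ultimately have periods: "{0, t} = suborbit_periods K v" by (intro card_seteq) auto
  obtain w where w: "w \<notin> U" "t \<notin> suborbit_periods K w"
    using no_common[of t] t suborbit_periods_subset_central by blast
  then have "v + w \<notin> central K" using suborbit_periods_shift[OF K _ t(1), of w] by (auto simp: add.commute)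
  then show ?thesis using v(1) w periods by blast
qed

lemma adjoin_two_subset_translators:
  assumes disjoint: "suborbit_periods K v \<inter> suborbit_periods K w \<subseteq> {0}"
  defines "Y \<equiv> adjoin w (adjoin v (central K))"
  shows "Y \<subseteq> translators Y"
proof -
  note top = central_central_UNIV and K0 = card_central_eq_4(1)
  have Y': "add_subgroup Y" unfolding Y_def by (intro add_subgroup_adjoin add_subgroup_central)
  have mem: "central K \<subseteq> Y" "v \<in> Y" "w \<in> Y"
    using add_subgroup_zero[OF add_subgroup_central] by (auto simp: Y_def mem_adjoin)
  have "y \<in> translators Y" if y: "y \<in> {v, w}" for y
  proof -
    have "defect y (x + y') + defect y x \<in> K" if y': "y' \<in> {v, w}" for x y'
    proof (cases "y' = y")
      case True
      then show ?thesis using defect_add_self[OF K] top by blast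
    next
      case False
      then show ?thesis
        using defect_diff_mem_suborbit_periods[OF K top, of y x y'] y y' disjoint K0 by auto
    qed
    then have "v \<in> defect_periods y K" "w \<in> defect_periods y K" unfolding defect_periods_def by blast+
    then have "Y \<subseteq> defect_periods y K"
      unfolding Y_def by (intro adjoin_subset add_subgroup_defect_periods add_subgroup_K central_subset_defect_periods)
    then show ?thesis
      using y mem(2,3) \<sigma>_eq_add_on_defect_periods K0 unfolding translators_def by blast
  qed
  moreover have "central K \<subseteq> translators Y" using mem(1) central_zero_mem_translators K0 by auto
  ultimately show ?thesis
    unfolding Y_def by (intro adjoin_subset add_subgroup_translators Y'[unfolded Y_def]) auto
qed

lemma translation_hyperplane_of_periodic_suborbits: "\<exists>Y. translation_hyperplane Y"
proof -
  obtain v w where vw: "v \<notin> U" "w \<notin> U" "v + w \<notin> central K"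
    and disjoint: "suborbit_periods K v \<inter> suborbit_periods K w \<subseteq> {0}"
    using exists_suborbits_without_common_period by blast
  define Y where "Y = adjoin w (adjoin v (central K))"
  have Y': "add_subgroup Y" unfolding Y_def by (intro add_subgroup_adjoin add_subgroup_central)
  have sub: "central K \<subseteq> Y" using add_subgroup_zero[OF add_subgroup_central] by (auto simp: Y_def mem_adjoin)
  have "v \<notin> central K" "w \<notin> adjoin v (central K)"
    using vw central_U by (auto simp: mem_adjoin add.commute)
  then have "card Y = 16"
    unfolding Y_def using card_central_eq_4(2) by (simp add: card_adjoin add_subgroup_central add_subgroup_adjoin)
  then have hyperplane: "hyperplane Y" using Y' card_V by (simp add: hyperplane_def)
  have "block Y"
  proof (rule blockI[OF Y'])
    fix q x y assume q: "q \<in> Q" and xy: "x + y \<in> Y"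
    have "q (y + (x + y)) + q y + (x + y) \<in> central K" by (rule centralD[OF _ q]) (simp add: central_central_UNIV)
    then have "(q x + q y) + (x + y) \<in> Y" using sub by (auto simp: add_ac)
    then show "q x + q y \<in> Y" using add_mem_iff_right[OF Y' xy] by blast
  qed
  moreover have "Y \<subseteq> translators Y"
    unfolding Y_def by (rule adjoin_two_subset_translators[OF disjoint])
  ultimately show ?thesis unfolding translation_hyperplane_def using hyperplane by blast
qed

end

lemma rotatable_mod_or_translation_hyperplane:
  assumes U: "block U" "hyperplane U" and card: "CARD('v) = 32" and "block K" "K \<subseteq> U"
  shows "rotatable_mod K U \<or> (\<exists>Y. translation_hyperplane Y)"
  using assms(4,5)
proof (induction "CARD('v) - card K" arbitrary: K rule: less_induct)
  case less
  note K = less.prems(1)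
  show ?case
  proof (cases "central K \<subseteq> U")
    case False
    then show ?thesis using rotatable_mod_central[OF K] by blast
  next
    case central_U: True
    consider (common_period) z where "z \<in> central K" "z \<notin> K" "\<And>v. v \<notin> U \<Longrightarrow> z \<in> suborbit_periods K v"
      | (aperiodic) v where "v \<notin> U" "suborbit_periods K v \<subseteq> K"
      | (periodic) "\<And>v. v \<notin> U \<Longrightarrow> \<not> suborbit_periods K v \<subseteq> K"
        "\<And>z. z \<in> central K \<Longrightarrow> z \<notin> K \<Longrightarrow> \<exists>v. v \<notin> U \<and> z \<notin> suborbit_periods K v"
      by blast
    then show ?thesis
    proof cases
      case (common_period z)
      have "card (adjoin z K) \<le> CARD('v)" by (simp add: card_mono)
      then have "CARD('v) - card (adjoin z K) < CARD('v) - card K"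
        using card_adjoin[OF block_add_subgroup[OF K] common_period(2)] card_add_subgroup_pos[OF block_add_subgroup[OF K]] by simp
      moreover have "adjoin z K \<subseteq> U"
        using adjoin_subset[OF hyperplane_add_subgroup[OF U(2)] less.prems(2)] common_period(1) central_U by blast
      ultimately have "rotatable_mod (adjoin z K) U \<or> (\<exists>Y. translation_hyperplane Y)"
        using less.hyps block_adjoin[OF K common_period(1)] by blast
      then show ?thesis
        using rotatable_mod_adjoin[OF U K common_period(1)] common_period(3) unfolding suborbit_periods_def by blast
    next
      case (aperiodic v)
      then show ?thesis using translation_hyperplane_of_aperiodic_suborbit[OF U K central_U _ _ card] by blast
    next
      case periodic
      then show ?thesis using translation_hyperplane_of_periodic_suborbits[OF U K central_U _ _ card] by blast
    qed
  qed
qed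

lemma rotatable_translation_hyperplane:
  assumes "translation_hyperplane Y" shows "rotatable_mod {0} Y"
proof -
  have Y: "block Y" "hyperplane Y" "Y \<subseteq> translators Y" using assms unfolding translation_hyperplane_def by auto
  obtain w where w: "w \<notin> Y" using hyperplane_proper[OF Y(2)] by blast
  have "\<exists>q\<in>Q. q x + x \<in> {0} \<and> q y + (\<sigma> w y + w) \<in> {0}" if xy: "x \<in> Y" "y \<notin> Y" for x y
  proof (rule bexI)
    let ?u = "\<sigma> w y"
    show "(\<lambda>x. \<sigma> ?u x + ?u) \<in> Q" by (rule Q_add[OF \<sigma>_mem])
    have "?u \<in> Y" using \<sigma>_mem_block_hyperplane_iff[OF Y(1,2)] xy(2) w by blast
    then have "\<sigma> ?u x = x + ?u" using Y(3) xy(1) unfolding translators_def by auto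
    moreover have "\<sigma> ?u y = w" by (simp add: \<sigma>_swap[of w y] \<sigma>_swap[of "\<sigma> y w"])
    ultimately show "\<sigma> ?u x + ?u + x \<in> {0} \<and> \<sigma> ?u y + ?u + (\<sigma> w y + w) \<in> {0}" by (simp add: add_ac)
  qed
  then show ?thesis unfolding rotatable_mod_def using w by blast
qed

lemma \<sigma>_eq_add_if_central_not_mem:
  assumes Y: "translation_hyperplane Y" and c: "c \<in> central {0}" "c \<notin> Y" shows "\<sigma> y x = x + y"
proof -
  have Y': "hyperplane Y" "Y \<subseteq> translators Y" using Y unfolding translation_hyperplane_def by auto
  have shift: "\<sigma> y (x + c) = \<sigma> y x + c" for x y using central_zeroD[OF c(1) \<sigma>_mem] .
  have inside: "\<sigma> y x = x + y" if "x \<in> Y" "y \<in> Y" for x y using that Y'(2) unfolding translators_def by blast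
  have left: "\<sigma> y x = x + y" if y: "y \<in> Y" for x y
  proof (cases "x \<in> Y")
    case False
    then have "x + c \<in> Y" using c(2) hyperplane_add_mem_iff[OF Y'(1)] by blast
    from inside[OF this y] show ?thesis unfolding shift by (metis add.assoc add.commute add_left_cancel)
  qed (rule inside[OF _ y])
  show ?thesis
  proof (cases "x \<in> Y")
    case True
    then show ?thesis using left[OF True, of y] by (simp add: \<sigma>_swap[of y] add.commute)
  next
    case False
    then have "x + c \<in> Y" using c(2) hyperplane_add_mem_iff[OF Y'(1)] by blast
    from left[OF this, of y] have "\<sigma> y (x + c) = y + (x + c)" by (simp add: \<sigma>_swap[of y])
    then show ?thesis unfolding shift by (metis add.assoc add.commute add_left_cancel)
  qed
qed

lemma rotatable_if_central_not_in_translation_hyperplane: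
  assumes Y: "translation_hyperplane Y" and c: "c \<in> central {0}" "c \<notin> Y" and "U \<noteq> UNIV"
  shows "rotatable_mod {0} U"
proof -
  obtain w where "w \<notin> U" using assms(4) by blast
  then show ?thesis
    unfolding rotatable_mod_def using \<sigma>_eq_add_if_central_not_mem[OF Y c] Q_id
    by (intro exI[of _ w]) (auto intro!: bexI[of _ id] simp: add_ac)
qed

text \<open>\<open>straighten w Y\<close> is an isomorphism from the second group to the group of translations.\<close>

definition straighten :: "'v \<Rightarrow> 'v set \<Rightarrow> 'v \<Rightarrow> 'v" where
  "straighten w Y v = (if v \<in> Y then v else \<sigma> w v + w)"

context
  fixes w :: 'v and Y :: "'v set"
  assumes Y: "translation_hyperplane Y" and w: "w \<notin> Y"
begin

lemma translation_hyperplaneD: "block Y" "hyperplane Y" "x \<in> Y \<Longrightarrow> y \<in> Y \<Longrightarrow> \<sigma> y x = x + y"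
  using Y unfolding translation_hyperplane_def translators_def by auto

lemma \<sigma>_w_mem_iff: "\<sigma> w v \<in> Y \<longleftrightarrow> v \<notin> Y"
  using \<sigma>_mem_block_hyperplane_iff[OF translation_hyperplaneD(1,2)] w by blast

lemma straighten_mem_iff: "straighten w Y v \<in> Y \<longleftrightarrow> v \<in> Y"
  unfolding straighten_def
  using \<sigma>_w_mem_iff hyperplane_add_mem_iff[OF translation_hyperplaneD(2)] w by simp

lemma inj_straighten: "inj (straighten w Y)"
proof (rule injI)
  fix u v assume eq: "straighten w Y u = straighten w Y v"
  then have "u \<in> Y \<longleftrightarrow> v \<in> Y" using straighten_mem_iff by metis
  then have "u = v \<or> \<sigma> w u = \<sigma> w v" using eq unfolding straighten_def by (auto split: if_splits)
  then show "u = v" using \<sigma>_invol by metis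
qed

lemma straighten_\<sigma>: "straighten w Y (\<sigma> c v) = straighten w Y v + straighten w Y c"
proof -
  note mem = \<sigma>_mem_block_hyperplane_iff[OF translation_hyperplaneD(1,2)]
  have inside: "straighten w Y (\<sigma> c v) = straighten w Y v + c" if c: "c \<in> Y" for c v
  proof (cases "v \<in> Y")
    case True
    then have "v + c \<in> Y" using add_subgroup_add[OF hyperplane_add_subgroup[OF translation_hyperplaneD(2)]] c by blast
    then show ?thesis unfolding straighten_def using translation_hyperplaneD(3)[OF True c] True by simp
  next
    case False
    then have "\<sigma> w (\<sigma> c v) = \<sigma> w v + c"
      using \<sigma>_comm[of w c v] translation_hyperplaneD(3)[OF _ c] \<sigma>_w_mem_iff by simp
    then show ?thesis unfolding straighten_def using False c mem by (simp add: add_ac)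
  qed
  have outside: "straighten w Y (\<sigma> w v) = straighten w Y v + w" for v
    unfolding straighten_def using \<sigma>_w_mem_iff by (simp add: add_ac)
  show ?thesis
  proof (cases "c \<in> Y")
    case True
    then show ?thesis using inside by (simp add: straighten_def)
  next
    case False
    then have "straighten w Y (\<sigma> (\<sigma> w (\<sigma> w c)) v) = straighten w Y v + \<sigma> w c + w"
      using inside[of "\<sigma> w c"] \<sigma>_w_mem_iff outside unfolding \<sigma>_\<sigma>[of w "\<sigma> w c"] by simp
    then show ?thesis using False by (simp add: straighten_def add_ac)
  qed
qed

lemma \<sigma>_\<sigma>_w: "\<sigma> (\<sigma> w v) v = w"
  by (simp add: \<sigma>_\<sigma>)

lemma straighten_agrees_with_Q:
  "\<exists>q\<in>Q. q u = straighten w Y u \<and> q v = straighten w Y v"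
proof -
  have mixed: "\<exists>q\<in>Q. q u = straighten w Y u \<and> q v = straighten w Y v" if uv: "u \<in> Y" "v \<notin> Y" for u v
  proof (rule bexI[OF _ Q_add[OF \<sigma>_mem, of "\<sigma> w v" "\<sigma> w v"]])
    have "\<sigma> (\<sigma> w v) u = u + \<sigma> w v" using translation_hyperplaneD(3)[OF uv(1)] uv(2) \<sigma>_w_mem_iff by blast
    then show "\<sigma> (\<sigma> w v) u + \<sigma> w v = straighten w Y u \<and> \<sigma> (\<sigma> w v) v + \<sigma> w v = straighten w Y v"
      using uv by (simp add: straighten_def \<sigma>_\<sigma>_w add_ac)
  qed
  show ?thesis
  proof (cases "u \<in> Y"; cases "v \<in> Y")
    assume "u \<in> Y" "v \<in> Y"
    then show ?thesis by (intro bexI[OF _ Q_id]) (simp add: straighten_def)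
  next
    assume "u \<notin> Y" "v \<notin> Y"
    then show ?thesis by (intro bexI[OF _ Q_add[OF \<sigma>_mem]]) (auto simp: straighten_def)
  qed (use mixed in blast)+
qed

end

end

section \<open>Regular representations in a 2-closed group\<close>

lemma funpow_funpow: "(f ^^ m) ((f ^^ n) x) = (f ^^ (m + n)) x"
  by (simp add: funpow_add)

lemma exists_inverse_mod_prime:
  fixes p k :: nat
  assumes "prime p" "\<not> p dvd k" obtains i where "(k * i) mod p = 1"
proof -
  have "coprime k p" using prime_imp_coprime[OF assms] by (simp only: coprime_commute)
  moreover have "k \<noteq> 0" using assms(2) by (rule contrapos_nn) simp
  ultimately obtain i y where "k * i = p * y + 1" using bezout_nat[of k p] by auto
  then have "(k * i) mod p = 1" using prime_gt_1_nat[OF assms(1)] mod_mult_self2[of 1 p y] by (simp add: add.commute)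
  then show thesis by (rule that)
qed

locale two_closed_group =
  fixes \<Omega> :: "'a set" and A :: "('a \<Rightarrow> 'a) set" and p :: nat
  assumes finite_\<Omega>: "finite \<Omega>" and perm_group_A: "perm_group \<Omega> A"
    and two_closed: "\<And>\<delta>. \<delta> permutes \<Omega> \<Longrightarrow>
      (\<And>x y. x \<in> \<Omega> \<Longrightarrow> y \<in> \<Omega> \<Longrightarrow> \<exists>a\<in>A. a x = \<delta> x \<and> a y = \<delta> y) \<Longrightarrow> \<delta> \<in> A"
    and prime_p: "prime p" and odd_p: "odd p"
begin

lemma p_pos: "p > 0" using prime_p prime_gt_0_nat by blast
lemma p_gt_1: "p > 1" using prime_p prime_gt_1_nat by blast

lemma not_p_dvd_power_2: "\<not> p dvd 2 ^ k"
proof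
  assume "p dvd 2 ^ k"
  then have "p dvd 2" using prime_p prime_dvd_power by blast
  then show False using odd_p primes_dvd_imp_eq[OF prime_p two_is_prime_nat] by simp
qed

lemma not_p_dvd_card_add_subgroup:
  fixes K :: "'v::{elementary_2_group,finite} set"
  shows "add_subgroup K \<Longrightarrow> \<not> p dvd card K"
  using card_add_subgroup_power_2 not_p_dvd_power_2 by metis

lemma A_permutes: "a \<in> A \<Longrightarrow> a permutes \<Omega>" using perm_groupD(1)[OF perm_group_A] .
lemma A_mem: "a \<in> A \<Longrightarrow> x \<in> \<Omega> \<Longrightarrow> a x \<in> \<Omega>" using permutes_in_image[OF A_permutes] by blast
lemma A_outside: "a \<in> A \<Longrightarrow> x \<notin> \<Omega> \<Longrightarrow> a x = x" using permutes_not_in[OF A_permutes] by blast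
lemma A_inj: "a \<in> A \<Longrightarrow> a x = a y \<Longrightarrow> x = y" using permutes_inj[OF A_permutes] injD by metis
lemma A_id: "(\<lambda>x. x) \<in> A" using perm_groupD(2)[OF perm_group_A] by (simp add: id_def)
lemma A_comp: "a \<in> A \<Longrightarrow> b \<in> A \<Longrightarrow> (\<lambda>x. a (b x)) \<in> A" using perm_group_mult_mem[OF perm_group_A] .

lemma A_inv: "a \<in> A \<Longrightarrow> finv a \<in> A" "a \<in> A \<Longrightarrow> finv a (a x) = x" "a \<in> A \<Longrightarrow> a (finv a x) = x"
  using perm_groupD(4)[OF perm_group_A] perm_group_inv_apply[OF perm_group_A] by blast+

lemma A_inv_mem: "a \<in> A \<Longrightarrow> x \<in> \<Omega> \<Longrightarrow> finv a x \<in> \<Omega>"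
  using A_mem[OF A_inv(1)] .

lemma A_pow: "a \<in> A \<Longrightarrow> a ^^ n \<in> A"
  using perm_groupD(2,3)[OF perm_group_A] by (induction n) simp_all

lemma A_conj: "g \<in> A \<Longrightarrow> a \<in> A \<Longrightarrow> conj_perm g a \<in> A"
  unfolding conj_perm_def using perm_groupD(3,4)[OF perm_group_A] by blast

lemma permutes_\<Omega>I:
  assumes "\<And>x. x \<in> \<Omega> \<Longrightarrow> \<delta> x \<in> \<Omega>" "inj_on \<delta> \<Omega>" "\<And>x. x \<notin> \<Omega> \<Longrightarrow> \<delta> x = x" shows "\<delta> permutes \<Omega>"
proof (rule bij_imp_permutes)
  have "\<delta> ` \<Omega> \<subseteq> \<Omega>" using assms(1) by blast
  then show "bij_betw \<delta> \<Omega> \<Omega>" unfolding bij_betw_def using assms(2) endo_inj_surj[OF finite_\<Omega>] by blast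
qed (rule assms(3))

text \<open>\<open>\<tau>\<close> and \<open>z\<close> generate a regular subgroup isomorphic to the product of \<open>'v\<close> and a cyclic group of order \<open>p\<close>;
  regularity is expressed by transitivity and the order of \<open>\<Omega>\<close>.\<close>

definition regular_rep :: "('v::{elementary_2_group,finite} \<Rightarrow> 'a \<Rightarrow> 'a) \<Rightarrow> ('a \<Rightarrow> 'a) \<Rightarrow> bool" where
  "regular_rep \<tau> z \<longleftrightarrow> (\<forall>v. \<tau> v \<in> A) \<and> z \<in> A \<and> (\<forall>u v x. \<tau> (u + v) x = \<tau> u (\<tau> v x)) \<and>
     (\<forall>v x. \<tau> v (z x) = z (\<tau> v x)) \<and> (\<forall>x. (z ^^ p) x = x) \<and>
     (\<forall>x\<in>\<Omega>. \<forall>y\<in>\<Omega>. \<exists>v t. y = (z ^^ t) (\<tau> v x)) \<and> card \<Omega> = CARD('v) * p"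

end

locale regular_rep = two_closed_group \<Omega> A p for \<Omega> :: "'a set" and A p +
  fixes \<tau> :: "'v::{elementary_2_group,finite} \<Rightarrow> 'a \<Rightarrow> 'a" and z :: "'a \<Rightarrow> 'a"
  assumes rep: "regular_rep \<tau> z"
begin

lemma \<tau>_mem_A: "\<tau> v \<in> A" and z_mem_A: "z \<in> A" and \<tau>_add: "\<tau> (u + v) x = \<tau> u (\<tau> v x)"
  and \<tau>_z: "\<tau> v (z x) = z (\<tau> v x)" and z_pow_p: "(z ^^ p) x = x" and card_\<Omega>: "card \<Omega> = CARD('v) * p"
  using rep unfolding regular_rep_def by auto

lemma transitive: assumes "x \<in> \<Omega>" "y \<in> \<Omega>" obtains v t where "y = (z ^^ t) (\<tau> v x)"
  using rep assms unfolding regular_rep_def by blast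

lemma z_pow_mem_A: "z ^^ t \<in> A" using A_pow[OF z_mem_A] .
lemma z_pow_mem: "x \<in> \<Omega> \<Longrightarrow> (z ^^ t) x \<in> \<Omega>" using A_mem[OF z_pow_mem_A] .
lemma z_mem: "x \<in> \<Omega> \<Longrightarrow> z x \<in> \<Omega>" using A_mem[OF z_mem_A] .
lemma \<tau>_mem: "x \<in> \<Omega> \<Longrightarrow> \<tau> v x \<in> \<Omega>" using A_mem[OF \<tau>_mem_A] .

lemma \<tau>_0: "\<tau> 0 x = x"
  using A_inj[OF \<tau>_mem_A, of 0 "\<tau> 0 x" x] \<tau>_add[of 0 0 x] by simp

lemma \<tau>_invol: "\<tau> v (\<tau> v x) = x"
  using \<tau>_add[of v v x] \<tau>_0 by simp

lemma \<tau>_comm: "\<tau> u (\<tau> v x) = \<tau> v (\<tau> u x)"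
  using \<tau>_add[of u v x] \<tau>_add[of v u x] by (simp add: add.commute)

lemma \<tau>_z_pow: "\<tau> v ((z ^^ t) x) = (z ^^ t) (\<tau> v x)"
  by (induction t) (simp_all add: \<tau>_z)

lemma z_pow_mod: "(z ^^ (t mod p)) x = (z ^^ t) x"
  using funpow_mod_eq[OF z_pow_p] .

lemma z_pow_cong: "s mod p = t mod p \<Longrightarrow> (z ^^ s) x = (z ^^ t) x"
  using z_pow_mod by metis

lemma
  assumes x: "x \<in> \<Omega>" and eq: "(z ^^ t) (\<tau> v x) = (z ^^ s) (\<tau> u x)"
  shows rep_inj_\<tau>: "v = u" and rep_inj_z: "t mod p = s mod p"
proof -
  let ?f = "\<lambda>(v, t). (z ^^ t) (\<tau> v x)"
  let ?D = "(UNIV :: 'v set) \<times> {..<p}"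
  have img: "?f ` ?D = \<Omega>"
  proof
    show "?f ` ?D \<subseteq> \<Omega>" using z_pow_mem \<tau>_mem x by auto
    show "\<Omega> \<subseteq> ?f ` ?D"
    proof
      fix y assume "y \<in> \<Omega>"
      then obtain v t where "y = (z ^^ t) (\<tau> v x)" using transitive[OF x] by blast
      then have "y = ?f (v, t mod p)" "(v, t mod p) \<in> ?D" using z_pow_mod p_pos by simp_all
      then show "y \<in> ?f ` ?D" by (rule image_eqI)
    qed
  qed
  have "card ?D = card (?f ` ?D)" unfolding img card_\<Omega> by (simp add: card_cartesian_product)
  then have inj: "inj_on ?f ?D" by (intro eq_card_imp_inj_on) auto
  have "?f (v, t mod p) = ?f (u, s mod p)" using eq z_pow_mod by simp
  then have "(v, t mod p) = (u, s mod p)" by (rule inj_onD[OF inj]) (use p_pos in auto)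
  then show "v = u" "t mod p = s mod p" by auto
qed

lemma \<tau>_eq_iff: "x \<in> \<Omega> \<Longrightarrow> \<tau> v x = \<tau> u x \<longleftrightarrow> v = u"
  using rep_inj_\<tau>[of x 0 v 0 u] by auto

lemma z_pow_eq_iff:
  assumes x: "x \<in> \<Omega>" shows "(z ^^ s) x = (z ^^ t) x \<longleftrightarrow> s mod p = t mod p"
  using rep_inj_z[OF x, of s 0 t 0] z_pow_cong[of s t x] unfolding \<tau>_0 by blast

lemma z_pow_fixes_iff: "x \<in> \<Omega> \<Longrightarrow> (z ^^ t) x = x \<longleftrightarrow> p dvd t"
  using z_pow_eq_iff[of x t 0] by (auto simp: dvd_eq_mod_eq_0)

lemma inj_\<tau>: "\<Omega> \<noteq> {} \<Longrightarrow> inj \<tau>"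
  using \<tau>_eq_iff by (metis ex_in_conv injI)

lemma perm_group_range_\<tau>: "perm_group \<Omega> (range \<tau>)"
proof (rule perm_groupI)
  show "f permutes \<Omega>" if "f \<in> range \<tau>" for f using that A_permutes[OF \<tau>_mem_A] by blast
  show "finv f \<in> range \<tau>" if "f \<in> range \<tau>" for f using that finv_involution[of "\<tau> v" for v, OF \<tau>_invol] by auto
  have "\<tau> u \<circ> \<tau> v = \<tau> (u + v)" for u v using \<tau>_add by (simp add: fun_eq_iff)
  then show "f \<circ> g \<in> range \<tau>" if "f \<in> range \<tau>" "g \<in> range \<tau>" for f g using that by auto
  have "id = \<tau> 0" using \<tau>_0 by (simp add: fun_eq_iff)
  then show "id \<in> range \<tau>" by blast
qed

lemma card_range_\<tau>: "\<Omega> \<noteq> {} \<Longrightarrow> \<exists>k. card (range \<tau>) = 2 ^ k"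
  using inj_\<tau> card_add_subgroup_power_2[OF add_subgroup_UNIV, where 'v='v] by (simp add: card_image)

lemma regular_rep_conj_into:
  assumes B: "two_closed_group \<Omega> B p" and g: "g permutes \<Omega>" and into: "\<And>a. a \<in> A \<Longrightarrow> conj_perm g a \<in> B"
  shows "two_closed_group.regular_rep \<Omega> B p (\<lambda>v. conj_perm g (\<tau> v)) (conj_perm g z)"
proof -
  interpret B: two_closed_group \<Omega> B p by (rule B)
  note inv = permutes_inverses[OF g]
  have inv_mem: "finv g x \<in> \<Omega>" if "x \<in> \<Omega>" for x using permutes_in_image[OF permutes_inv[OF g]] that by blast
  show ?thesis
    unfolding B.regular_rep_def
  proof (intro conjI allI ballI)
    fix x y assume "x \<in> \<Omega>" "y \<in> \<Omega>"
    then obtain v t where "finv g y = (z ^^ t) (\<tau> v (finv g x))" using transitive[OF inv_mem inv_mem] by blast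
    then have "y = g ((z ^^ t) (\<tau> v (finv g x)))" using inv(1)[of y] by simp
    then have "y = (conj_perm g z ^^ t) (conj_perm g (\<tau> v) x)"
      unfolding conj_perm_funpow[OF g] by (simp add: conj_perm_def inv)
    then show "\<exists>v t. y = (conj_perm g z ^^ t) (conj_perm g (\<tau> v) x)" by blast
  next
    show "(conj_perm g z ^^ p) x = x" for x unfolding conj_perm_funpow[OF g] z_pow_p inv ..
  qed (simp_all add: into \<tau>_mem_A z_mem_A card_\<Omega>, simp_all add: conj_perm_def inv \<tau>_add \<tau>_z)
qed

lemma regular_rep_conj: "g \<in> A \<Longrightarrow> regular_rep (\<lambda>v. conj_perm g (\<tau> v)) (conj_perm g z)"
  using regular_rep_conj_into[OF two_closed_group_axioms A_permutes A_conj] .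

subsection \<open>Coordinates with respect to a base point\<close>

definition vcoord :: "'a \<Rightarrow> 'a \<Rightarrow> 'v" where
  "vcoord b x = (THE v. \<exists>t. x = (z ^^ t) (\<tau> v b))"

definition zcoord :: "'a \<Rightarrow> 'a \<Rightarrow> nat" where
  "zcoord b x = (THE t. t < p \<and> (\<exists>v. x = (z ^^ t) (\<tau> v b)))"

lemma vcoord_z_pow_\<tau>: "b \<in> \<Omega> \<Longrightarrow> vcoord b ((z ^^ t) (\<tau> v b)) = v"
  unfolding vcoord_def using rep_inj_\<tau> by (intro the_equality) blast+

lemma zcoord_z_pow_\<tau>:
  assumes "b \<in> \<Omega>" shows "zcoord b ((z ^^ t) (\<tau> v b)) = t mod p"
  unfolding zcoord_def
proof (rule the_equality)
  show "t mod p < p \<and> (\<exists>u. (z ^^ t) (\<tau> v b) = (z ^^ (t mod p)) (\<tau> u b))"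
    using p_pos z_pow_mod by fastforce
  fix s assume "s < p \<and> (\<exists>u. (z ^^ t) (\<tau> v b) = (z ^^ s) (\<tau> u b))"
  then show "s = t mod p" using rep_inj_z[OF assms] by (metis mod_less)
qed

lemma coordinates:
  assumes "b \<in> \<Omega>" "x \<in> \<Omega>" shows "x = (z ^^ zcoord b x) (\<tau> (vcoord b x) b)"
proof -
  obtain v t where "x = (z ^^ t) (\<tau> v b)" using transitive[OF assms] .
  then show ?thesis using vcoord_z_pow_\<tau>[OF assms(1)] zcoord_z_pow_\<tau>[OF assms(1)] z_pow_mod by simp
qed

lemma zcoord_less: "b \<in> \<Omega> \<Longrightarrow> x \<in> \<Omega> \<Longrightarrow> zcoord b x < p"
  using coordinates zcoord_z_pow_\<tau> p_pos mod_less_divisor by metis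

lemma vcoord_\<tau>_base: "b \<in> \<Omega> \<Longrightarrow> vcoord b (\<tau> v b) = v"
  using vcoord_z_pow_\<tau>[of b 0] by simp

lemma vcoord_z_pow_\<tau>_add:
  assumes "b \<in> \<Omega>" "x \<in> \<Omega>" shows "vcoord b ((z ^^ t) (\<tau> v x)) = v + vcoord b x"
proof -
  have "(z ^^ t) (\<tau> v x) = (z ^^ (t + zcoord b x)) (\<tau> (v + vcoord b x) b)"
    using arg_cong[OF coordinates[OF assms], of "\<lambda>x. (z ^^ t) (\<tau> v x)"]
    by (simp add: \<tau>_z_pow funpow_funpow \<tau>_add)
  then show ?thesis using vcoord_z_pow_\<tau>[OF assms(1)] by simp
qed

lemma vcoord_z_pow: "b \<in> \<Omega> \<Longrightarrow> x \<in> \<Omega> \<Longrightarrow> vcoord b ((z ^^ t) x) = vcoord b x"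
  using vcoord_z_pow_\<tau>_add[of b x t 0] by (simp add: \<tau>_0)

lemma vcoord_\<tau>: "b \<in> \<Omega> \<Longrightarrow> x \<in> \<Omega> \<Longrightarrow> vcoord b (\<tau> v x) = v + vcoord b x"
  using vcoord_z_pow_\<tau>_add[of b x 0] by simp

lemma vcoord_eqD:
  assumes b: "b \<in> \<Omega>" and x: "x \<in> \<Omega>" and y: "y \<in> \<Omega>" and eq: "vcoord b x = vcoord b y"
  obtains s where "y = (z ^^ s) x"
proof -
  obtain v s where y_eq: "y = (z ^^ s) (\<tau> v x)" using transitive[OF x y] .
  then have "v + vcoord b x = vcoord b x" using vcoord_z_pow_\<tau>_add[OF b x] eq by metis
  then show thesis using that y_eq by (simp add: \<tau>_0)
qed

subsection \<open>Classes and adapted representations\<close>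

definition same_class :: "'v set \<Rightarrow> 'a \<Rightarrow> 'a \<Rightarrow> bool" where
  "same_class L x y \<longleftrightarrow> (\<exists>l\<in>L. \<exists>t. y = (z ^^ t) (\<tau> l x))"

lemma same_classI: "l \<in> L \<Longrightarrow> same_class L x ((z ^^ t) (\<tau> l x))"
  unfolding same_class_def by blast

lemma same_class_z_pow: "add_subgroup L \<Longrightarrow> same_class L x ((z ^^ t) x)"
  using same_classI[OF add_subgroup_zero] by (metis \<tau>_0)

lemma same_class_\<tau>: "same_class L x y \<Longrightarrow> same_class L (\<tau> v x) (\<tau> v y)"
  unfolding same_class_def using \<tau>_z_pow \<tau>_comm by metis

lemma same_class_mem: "x \<in> \<Omega> \<Longrightarrow> same_class L x y \<Longrightarrow> y \<in> \<Omega>"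
  unfolding same_class_def using z_pow_mem \<tau>_mem by blast

lemma same_class_iff_vcoord:
  assumes b: "b \<in> \<Omega>" and x: "x \<in> \<Omega>" and y: "y \<in> \<Omega>"
  shows "same_class L x y \<longleftrightarrow> vcoord b x + vcoord b y \<in> L"
proof
  assume "same_class L x y"
  then obtain l t where l: "l \<in> L" "y = (z ^^ t) (\<tau> l x)" unfolding same_class_def by blast
  then show "vcoord b x + vcoord b y \<in> L" using vcoord_z_pow_\<tau>_add[OF b x] by (simp add: add_ac)
next
  assume mem: "vcoord b x + vcoord b y \<in> L"
  have "vcoord b (\<tau> (vcoord b x + vcoord b y) x) = vcoord b y" using vcoord_\<tau>[OF b x] by (simp add: add_ac)
  from vcoord_eqD[OF b \<tau>_mem[OF x] y this] show "same_class L x y" using same_classI[OF mem] by metis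
qed

lemma same_class_UNIV: "x \<in> \<Omega> \<Longrightarrow> y \<in> \<Omega> \<Longrightarrow> same_class UNIV x y"
  unfolding same_class_def by (meson UNIV_I transitive)

lemma equivp_same_class:
  assumes L: "add_subgroup L" shows "equivp (same_class L)"
proof (rule equivpI)
  show "reflp (same_class L)" using same_class_z_pow[OF L, of _ 0] by (simp add: reflp_def)
  show "symp (same_class L)"
  proof (rule sympI)
    fix x y assume "same_class L x y"
    then obtain l t where l: "l \<in> L" "y = (z ^^ t) (\<tau> l x)" unfolding same_class_def by blast
    have "t \<le> p * t" using p_pos by simp
    then have "(z ^^ (p * t - t)) (\<tau> l y) = (z ^^ (p * t)) x"
      unfolding l(2) \<tau>_z_pow \<tau>_invol funpow_funpow by simp
    also have "\<dots> = x" using z_pow_cong[of "p * t" 0] by simp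
    finally show "same_class L y x" using same_classI[OF l(1)] by metis
  qed
  show "transp (same_class L)"
  proof (rule transpI)
    fix x y w assume "same_class L x y" "same_class L y w"
    then obtain l t m s where "l \<in> L" "y = (z ^^ t) (\<tau> l x)" "m \<in> L" "w = (z ^^ s) (\<tau> m y)"
      unfolding same_class_def by blast
    then have "m + l \<in> L" "w = (z ^^ (s + t)) (\<tau> (m + l) x)"
      using add_subgroup_add[OF L] by (simp_all add: \<tau>_z_pow funpow_funpow \<tau>_add)
    then show "same_class L x w" using same_classI by blast
  qed
qed

definition class_constant :: "'v set \<Rightarrow> ('a \<Rightarrow> nat) \<Rightarrow> bool" where
  "class_constant L a \<longleftrightarrow> (\<forall>x\<in>\<Omega>. \<forall>y. same_class L x y \<longrightarrow> a x = a y)"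

lemma class_constantD: "class_constant L a \<Longrightarrow> x \<in> \<Omega> \<Longrightarrow> same_class L x y \<Longrightarrow> a x = a y"
  unfolding class_constant_def by blast

definition fibre_rotation :: "('a \<Rightarrow> nat) \<Rightarrow> 'a \<Rightarrow> 'a" where
  "fibre_rotation a x = (if x \<in> \<Omega> then (z ^^ a x) x else x)"

definition independent_rotations :: "'v set \<Rightarrow> bool" where
  "independent_rotations L \<longleftrightarrow> (\<forall>a. class_constant L a \<longrightarrow> fibre_rotation a \<in> A)"

lemma independent_rotationsD: "independent_rotations L \<Longrightarrow> class_constant L a \<Longrightarrow> fibre_rotation a \<in> A"
  unfolding independent_rotations_def by blast

lemma independent_rotations_pair:
  assumes L: "add_subgroup L" "independent_rotations L" and far: "\<not> same_class L x y"
  obtains a where "a \<in> A" "\<And>u. u \<in> \<Omega> \<Longrightarrow> same_class L x u \<Longrightarrow> a u = (z ^^ m) u"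
    "\<And>u. u \<in> \<Omega> \<Longrightarrow> same_class L y u \<Longrightarrow> a u = (z ^^ n) u"
proof -
  let ?a = "\<lambda>u. if same_class L x u then m else n"
  note sym = equivp_symp[OF equivp_same_class[OF L(1)]] and trans = equivp_transp[OF equivp_same_class[OF L(1)]]
  have "class_constant L ?a" unfolding class_constant_def using trans sym by metis
  then have "fibre_rotation ?a \<in> A" by (rule independent_rotationsD[OF L(2)])
  moreover have "\<not> same_class L x u" if "same_class L y u" for u using far that trans sym by blast
  ultimately show thesis using that[of "fibre_rotation ?a"] by (simp add: fibre_rotation_def)
qed

lemma independent_rotations_UNIV: "independent_rotations UNIV"
  unfolding independent_rotations_def
proof (intro allI impI)
  fix a assume a: "class_constant UNIV a"
  have "fibre_rotation a \<in> A" if b: "b \<in> \<Omega>" for b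
  proof -
    have "a x = a b" if "x \<in> \<Omega>" for x using class_constantD[OF a that same_class_UNIV[OF that b]] .
    then have "fibre_rotation a = z ^^ a b"
      using A_outside[OF z_pow_mem_A] by (fastforce simp: fibre_rotation_def)
    then show ?thesis using z_pow_mem_A by simp
  qed
  moreover have "fibre_rotation a = (\<lambda>x. x)" if "\<Omega> = {}" unfolding fibre_rotation_def[abs_def] using that by simp
  ultimately show "fibre_rotation a \<in> A" using A_id by fastforce
qed

definition adapted :: "'v set \<Rightarrow> ('v \<Rightarrow> 'a \<Rightarrow> 'a) \<Rightarrow> ('a \<Rightarrow> 'a) \<Rightarrow> ('a \<Rightarrow> nat) \<Rightarrow> bool" where
  "adapted L \<sigma> z' \<kappa> \<longleftrightarrow> regular_rep \<sigma> z' \<and> class_constant L \<kappa> \<and> (\<forall>x\<in>\<Omega>. \<kappa> x < p \<and> z' x = (z ^^ \<kappa> x) x) \<and>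
     (\<forall>v. \<forall>x\<in>\<Omega>. \<forall>y. same_class L x y \<longrightarrow> same_class L (\<sigma> v x) (\<sigma> v y))"

definition common :: "('v \<Rightarrow> 'a \<Rightarrow> 'a) \<Rightarrow> 'v set" where
  "common \<sigma> = {v. \<tau> v \<in> range \<sigma>}"

definition conjugate_into :: "('v \<Rightarrow> 'a \<Rightarrow> 'a) \<Rightarrow> ('a \<Rightarrow> 'a) \<Rightarrow> bool" where
  "conjugate_into \<sigma> z' \<longleftrightarrow> (\<exists>\<delta>\<in>A. (\<forall>v. \<exists>u. \<forall>x\<in>\<Omega>. \<delta> (\<sigma> v x) = \<tau> u (\<delta> x)) \<and> (\<exists>k. \<forall>x\<in>\<Omega>. \<delta> (z' x) = (z ^^ k) (\<delta> x)))"

lemma conjugate_into_conj: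
  assumes g: "g \<in> A" and conj: "conjugate_into (\<lambda>v. conj_perm g (\<sigma> v)) (conj_perm g z')"
  shows "conjugate_into \<sigma> z'"
proof -
  obtain \<delta> k where \<delta>: "\<delta> \<in> A" "\<And>v. \<exists>u. \<forall>x\<in>\<Omega>. \<delta> (conj_perm g (\<sigma> v) x) = \<tau> u (\<delta> x)"
    "\<And>x. x \<in> \<Omega> \<Longrightarrow> \<delta> (conj_perm g z' x) = (z ^^ k) (\<delta> x)"
    using conj unfolding conjugate_into_def by blast
  have conj_g: "conj_perm g f (g x) = g (f x)" for f x by (simp add: conj_perm_def A_inv[OF g])
  have "\<exists>u. \<forall>x\<in>\<Omega>. \<delta> (g (\<sigma> v x)) = \<tau> u (\<delta> (g x))" for v
    using \<delta>(2)[of v] A_mem[OF g] conj_g by metis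
  moreover have "\<delta> (g (z' x)) = (z ^^ k) (\<delta> (g x))" if "x \<in> \<Omega>" for x
    using \<delta>(3)[OF A_mem[OF g that]] conj_g by metis
  ultimately show ?thesis
    unfolding conjugate_into_def by (intro bexI[OF _ A_comp[OF \<delta>(1) g]]) blast
qed

lemma adapted_UNIV:
  assumes adapted: "adapted L \<sigma> z' \<kappa>" and "\<And>x y. x \<in> \<Omega> \<Longrightarrow> y \<in> \<Omega> \<Longrightarrow> \<kappa> x = \<kappa> y"
  shows "adapted UNIV \<sigma> z' \<kappa>"
proof -
  interpret S: regular_rep \<Omega> A p \<sigma> z'
    using adapted by unfold_locales (simp add: adapted_def)
  show ?thesis
    using adapted assms(2) same_class_mem same_class_UNIV S.\<tau>_mem
    unfolding adapted_def class_constant_def by meson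
qed

end

section \<open>The group generated by two adapted representations\<close>

definition (in regular_rep) joint :: "('v \<Rightarrow> 'a \<Rightarrow> 'a) \<Rightarrow> ('a \<Rightarrow> 'a) set" where
  "joint \<sigma> = comp_closure (range \<tau> \<union> range \<sigma>)"

locale adapted_rep = regular_rep \<Omega> A p \<tau> z
  for \<Omega> :: "'a set" and A p and \<tau> :: "'v::{elementary_2_group,finite} \<Rightarrow> 'a \<Rightarrow> 'a" and z +
  fixes L :: "'v set" and \<sigma> :: "'v \<Rightarrow> 'a \<Rightarrow> 'a" and z' :: "'a \<Rightarrow> 'a" and \<kappa> :: "'a \<Rightarrow> nat"
  assumes adapted: "adapted L \<sigma> z' \<kappa>" and add_subgroup_L: "add_subgroup L"

sublocale adapted_rep \<subseteq> S: regular_rep \<Omega> A p \<sigma> z'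
  by unfold_locales (use adapted in \<open>simp add: adapted_def\<close>)

context adapted_rep
begin

lemma \<kappa>_less: "x \<in> \<Omega> \<Longrightarrow> \<kappa> x < p"
  and z'_eq: "x \<in> \<Omega> \<Longrightarrow> z' x = (z ^^ \<kappa> x) x"
  and \<kappa>_same_class: "x \<in> \<Omega> \<Longrightarrow> same_class L x y \<Longrightarrow> \<kappa> x = \<kappa> y"
  and \<sigma>_same_class: "x \<in> \<Omega> \<Longrightarrow> same_class L x y \<Longrightarrow> same_class L (\<sigma> v x) (\<sigma> v y)"
  using adapted unfolding adapted_def class_constant_def by blast+

lemma \<kappa>_z_pow: "x \<in> \<Omega> \<Longrightarrow> \<kappa> ((z ^^ t) x) = \<kappa> x"
  using \<kappa>_same_class[OF _ same_class_z_pow[OF add_subgroup_L]] by simp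

lemma z'_pow: "x \<in> \<Omega> \<Longrightarrow> (z' ^^ n) x = (z ^^ (n * \<kappa> x)) x"
proof (induction n)
  case (Suc n)
  then have "(z' ^^ Suc n) x = (z ^^ \<kappa> x) ((z ^^ (n * \<kappa> x)) x)"
    using z'_eq[OF z_pow_mem[OF Suc.prems]] \<kappa>_z_pow[OF Suc.prems] by simp
  then show ?case by (simp add: funpow_funpow)
qed simp

lemma not_p_dvd_\<kappa>: assumes x: "x \<in> \<Omega>" shows "\<not> p dvd \<kappa> x"
proof
  assume "p dvd \<kappa> x"
  then have "(z' ^^ 1) x = x" using z'_pow[OF x, of 1] z_pow_fixes_iff[OF x, of "\<kappa> x"] by simp
  then show False using S.z_pow_fixes_iff[OF x, of 1] p_gt_1 by auto
qed

lemma z_pow_eq_z'_pow: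
  assumes x: "x \<in> \<Omega>" obtains i where "\<And>y t. y \<in> \<Omega> \<Longrightarrow> \<kappa> y = \<kappa> x \<Longrightarrow> (z ^^ t) y = (z' ^^ (t * i)) y"
proof -
  obtain i where i: "(\<kappa> x * i) mod p = 1" using exists_inverse_mod_prime[OF prime_p not_p_dvd_\<kappa>[OF x]] .
  have "(z ^^ t) y = (z' ^^ (t * i)) y" if y: "y \<in> \<Omega>" "\<kappa> y = \<kappa> x" for y t
  proof -
    have "(t * i * \<kappa> y) mod p = (t * ((\<kappa> x * i) mod p)) mod p" by (simp add: y(2) mod_mult_right_eq ac_simps)
    then show ?thesis unfolding z'_pow[OF y(1)] i by (intro z_pow_cong) simp
  qed
  then show thesis by (rule that)
qed

lemma perm_group_joint: "perm_group \<Omega> (joint \<sigma>)"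
  unfolding joint_def
proof (rule perm_group_comp_closure)
  show "f permutes \<Omega>" "finv f \<in> range \<tau> \<union> range \<sigma>" if "f \<in> range \<tau> \<union> range \<sigma>" for f
    using that perm_groupD(1,4)[OF perm_group_range_\<tau>, of f] perm_groupD(1,4)[OF S.perm_group_range_\<tau>, of f] by auto
qed

lemma joint_subset_A: "joint \<sigma> \<subseteq> A"
  unfolding joint_def by (rule comp_closure_subset[OF _ perm_group_A]) (use \<tau>_mem_A S.\<tau>_mem_A in auto)

lemma \<tau>_mem_joint: "\<tau> v \<in> joint \<sigma>" and \<sigma>_mem_joint: "\<sigma> v \<in> joint \<sigma>"
  unfolding joint_def by (rule comp_closure_generator; blast)+

lemma joint_id: "(\<lambda>x. x) \<in> joint \<sigma>"
  using perm_groupD(2)[OF perm_group_joint] by (simp add: id_def)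

lemma joint_comp: "q \<in> joint \<sigma> \<Longrightarrow> r \<in> joint \<sigma> \<Longrightarrow> (\<lambda>x. q (r x)) \<in> joint \<sigma>"
  using perm_group_mult_mem[OF perm_group_joint] .

lemma joint_inv: "q \<in> joint \<sigma> \<Longrightarrow> finv q \<in> joint \<sigma>"
  using perm_groupD(4)[OF perm_group_joint] .

lemma joint_mem_A: "q \<in> joint \<sigma> \<Longrightarrow> q \<in> A"
  using joint_subset_A by blast

lemma joint_mem: "q \<in> joint \<sigma> \<Longrightarrow> x \<in> \<Omega> \<Longrightarrow> q x \<in> \<Omega>"
  using A_mem[OF joint_mem_A] .

lemma joint_induct [consumes 1, case_names id \<tau> \<sigma>]:
  assumes "q \<in> joint \<sigma>" and id: "P (\<lambda>x. x)"
    and \<tau>: "\<And>v q. q \<in> joint \<sigma> \<Longrightarrow> P q \<Longrightarrow> P (\<lambda>x. \<tau> v (q x))"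
    and \<sigma>: "\<And>v q. q \<in> joint \<sigma> \<Longrightarrow> P q \<Longrightarrow> P (\<lambda>x. \<sigma> v (q x))"
  shows "P q"
  using assms(1) unfolding joint_def
proof induction
  case id
  then show ?case using assms(2) by (simp add: id_def)
next
  case (comp f g)
  then have "g \<in> joint \<sigma>" by (simp add: joint_def)
  from comp(1) consider v where "f = \<tau> v" | v where "f = \<sigma> v" by blast
  then show ?case using \<tau>[OF \<open>g \<in> joint \<sigma>\<close> comp(3)] \<sigma>[OF \<open>g \<in> joint \<sigma>\<close> comp(3)] by cases (simp_all add: comp_def)
qed

lemma joint_same_class:
  assumes q: "q \<in> joint \<sigma>" and x: "x \<in> \<Omega>" and "same_class L x y" shows "same_class L (q x) (q y)"
  using q
proof (induction rule: joint_induct)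
  case (\<sigma> v q)
  then show ?case using \<sigma>_same_class[OF joint_mem[OF \<sigma>(1) x]] by blast
qed (use assms(3) same_class_\<tau> in blast)+

lemma joint_same_class_iff:
  assumes q: "q \<in> joint \<sigma>" and x: "x \<in> \<Omega>" shows "same_class L (q x) (q y) \<longleftrightarrow> same_class L x y"
  using joint_same_class[OF q x, of y] joint_same_class[OF joint_inv[OF q] joint_mem[OF q x], of "q y"]
    A_inv(2)[OF joint_mem_A[OF q]] by auto

lemma joint_multiplier:
  assumes q: "q \<in> joint \<sigma>" and x: "x \<in> \<Omega>"
  shows "\<exists>m. \<forall>y. same_class L x y \<longrightarrow> (\<forall>t. q ((z ^^ t) y) = (z ^^ (t * m)) (q y))"
  using q
proof (induction rule: joint_induct)
  case id
  show ?case by (rule exI[of _ 1]) simp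
next
  case (\<tau> v q)
  then obtain m where "\<And>y t. same_class L x y \<Longrightarrow> q ((z ^^ t) y) = (z ^^ (t * m)) (q y)" by blast
  then show ?case by (intro exI[of _ m]) (simp add: \<tau>_z_pow)
next
  case (\<sigma> v q)
  then obtain m where m: "\<And>y t. same_class L x y \<Longrightarrow> q ((z ^^ t) y) = (z ^^ (t * m)) (q y)" by blast
  note qx = joint_mem[OF \<sigma>(1) x]
  obtain i where i: "\<And>y t. y \<in> \<Omega> \<Longrightarrow> \<kappa> y = \<kappa> (q x) \<Longrightarrow> (z ^^ t) y = (z' ^^ (t * i)) y"
    using z_pow_eq_z'_pow[OF qx] by blast
  show ?case
  proof (intro exI[of _ "m * i * \<kappa> (\<sigma> v (q x))"] allI impI)
    fix y t assume "same_class L x y"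
    then have c: "same_class L (q x) (q y)" by (rule joint_same_class[OF \<sigma>(1) x])
    note qy = same_class_mem[OF qx c]
    have "\<sigma> v (q ((z ^^ t) y)) = \<sigma> v ((z' ^^ (t * m * i)) (q y))"
      using m[OF \<open>same_class L x y\<close>] i[OF qy] \<kappa>_same_class[OF qx c] by simp
    also have "\<dots> = (z ^^ (t * m * i * \<kappa> (\<sigma> v (q y)))) (\<sigma> v (q y))"
      unfolding S.\<tau>_z_pow by (rule z'_pow[OF S.\<tau>_mem[OF qy]])
    also have "\<kappa> (\<sigma> v (q y)) = \<kappa> (\<sigma> v (q x))"
      using \<kappa>_same_class[OF S.\<tau>_mem[OF qx] \<sigma>_same_class[OF qx c]] by simp
    finally show "\<sigma> v (q ((z ^^ t) y)) = (z ^^ (t * (m * i * \<kappa> (\<sigma> v (q x))))) (\<sigma> v (q y))"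
      by (simp only: ac_simps)
  qed
qed

lemma joint_z_pow:
  assumes "q \<in> joint \<sigma>" "x \<in> \<Omega>" obtains s where "q ((z ^^ t) x) = (z ^^ s) (q x)"
  using joint_multiplier[OF assms] same_class_z_pow[OF add_subgroup_L, of x 0] by auto

lemma common_central:
  assumes v: "v \<in> common \<sigma>" and q: "q \<in> joint \<sigma>" shows "q (\<tau> v x) = \<tau> v (q x)"
  using q
proof (induction rule: joint_induct)
  case (\<sigma> u q)
  obtain w where "\<tau> v = \<sigma> w" using v unfolding common_def by blast
  then show ?case using \<sigma>(2) S.\<tau>_comm[of u w] by simp
qed (simp_all add: \<tau>_comm)

lemma \<kappa>_common: assumes v: "v \<in> common \<sigma>" and x: "x \<in> \<Omega>" shows "\<kappa> (\<tau> v x) = \<kappa> x"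
proof -
  obtain w where w: "\<tau> v = \<sigma> w" using v unfolding common_def by blast
  note vx = \<tau>_mem[OF x, of v]
  have "(z ^^ \<kappa> (\<tau> v x)) (\<tau> v x) = \<tau> v (z' x)" using z'_eq[OF vx] S.\<tau>_z[of w x] by (simp add: w)
  also have "\<dots> = (z ^^ \<kappa> x) (\<tau> v x)" by (simp add: z'_eq[OF x] \<tau>_z_pow)
  finally show ?thesis using z_pow_eq_iff[OF vx] \<kappa>_less[OF x] \<kappa>_less[OF vx] by simp
qed

lemma conjugate_into_if_common_UNIV:
  assumes "common \<sigma> = UNIV" shows "conjugate_into \<sigma> z'"
proof (cases "\<Omega> = {}")
  case True
  then show ?thesis unfolding conjugate_into_def using A_id by blast
next
  case False
  then obtain b where b: "b \<in> \<Omega>" by blast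
  have "card (range \<tau>) = card (range \<sigma>)" using inj_\<tau>[OF False] S.inj_\<tau>[OF False] by (simp add: card_image)
  moreover have "range \<tau> \<subseteq> range \<sigma>" using assms unfolding common_def by blast
  ultimately have "range \<tau> = range \<sigma>" by (simp add: card_subset_eq)
  then have "\<exists>u. \<forall>x\<in>\<Omega>. \<sigma> v x = \<tau> u x" for v by (metis rangeE rangeI)
  moreover have "\<kappa> x = \<kappa> b" if x: "x \<in> \<Omega>" for x
  proof -
    have "\<kappa> x = \<kappa> (\<tau> (vcoord b x) b)" using coordinates[OF b x] \<kappa>_z_pow[OF \<tau>_mem[OF b]] by metis
    then show ?thesis using \<kappa>_common[OF _ b] assms by simp
  qed
  then have "\<forall>x\<in>\<Omega>. z' x = (z ^^ \<kappa> b) x" using z'_eq by simp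
  ultimately show ?thesis unfolding conjugate_into_def by (intro bexI[OF _ A_id]) blast
qed

lemma common_subset_conj:
  assumes g: "g \<in> A" and comm: "\<And>v x. v \<in> common \<sigma> \<Longrightarrow> g (\<tau> v x) = \<tau> v (g x)"
  shows "common \<sigma> \<subseteq> common (\<lambda>v. conj_perm g (\<sigma> v))"
proof
  fix v assume v: "v \<in> common \<sigma>"
  then obtain u where "\<tau> v = \<sigma> u" unfolding common_def by blast
  then have "\<tau> v = conj_perm g (\<sigma> u)" using comm[OF v] by (simp add: conj_perm_def fun_eq_iff A_inv(3)[OF g])
  then show "v \<in> common (\<lambda>v. conj_perm g (\<sigma> v))" unfolding common_def by blast
qed

lemma adapted_conjI:
  assumes g: "g \<in> A" and same_class_iff: "\<And>x y. x \<in> \<Omega> \<Longrightarrow> same_class L (g x) (g y) \<longleftrightarrow> same_class L x y"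
    and \<mu>: "class_constant L \<mu>" "\<And>x. x \<in> \<Omega> \<Longrightarrow> \<mu> x < p" "\<And>x. x \<in> \<Omega> \<Longrightarrow> g (z' x) = (z ^^ \<mu> (g x)) (g x)"
  shows "adapted L (\<lambda>v. conj_perm g (\<sigma> v)) (conj_perm g z') \<mu>"
  unfolding adapted_def
proof (intro conjI ballI allI impI)
  show "class_constant L \<mu>" by (rule \<mu>)
  show "regular_rep (\<lambda>v. conj_perm g (\<sigma> v)) (conj_perm g z')" by (rule S.regular_rep_conj[OF g])
  fix x assume x: "x \<in> \<Omega>"
  note y = A_inv_mem[OF g x]
  show "\<mu> x < p" by (rule \<mu>(2)[OF x])
  show "conj_perm g z' x = (z ^^ \<mu> x) x" using \<mu>(3)[OF y] by (simp add: conj_perm_def A_inv(3)[OF g])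
  fix v x' assume "same_class L x x'"
  then have "same_class L (finv g x) (finv g x')"
    using same_class_iff[OF y, of "finv g x'"] by (simp add: A_inv(3)[OF g])
  then have "same_class L (\<sigma> v (finv g x)) (\<sigma> v (finv g x'))" by (rule \<sigma>_same_class[OF y])
  then show "same_class L (conj_perm g (\<sigma> v) x) (conj_perm g (\<sigma> v) x')"
    using same_class_iff[OF S.\<tau>_mem[OF y]] by (simp add: conj_perm_def)
qed

lemma adapted_conj_joint:
  assumes g: "g \<in> joint \<sigma>"
  obtains \<mu> where "adapted L (\<lambda>v. conj_perm g (\<sigma> v)) (conj_perm g z') \<mu>"
proof -
  note gA = joint_mem_A[OF g]
  have "\<exists>s<p. \<forall>y. same_class L x y \<longrightarrow> g (z' y) = (z ^^ s) (g y)" if x: "x \<in> \<Omega>" for x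
  proof -
    obtain m where m: "\<And>y t. same_class L x y \<Longrightarrow> g ((z ^^ t) y) = (z ^^ (t * m)) (g y)"
      using joint_multiplier[OF g x] by blast
    have "g (z' y) = (z ^^ ((\<kappa> x * m) mod p)) (g y)" if "same_class L x y" for y
      using z'_eq[OF same_class_mem[OF x that]] \<kappa>_same_class[OF x that] m[OF that] by (simp add: z_pow_mod)
    then show ?thesis using p_pos mod_less_divisor by blast
  qed
  then obtain \<mu> where \<mu>: "\<And>x. x \<in> \<Omega> \<Longrightarrow> \<mu> x < p"
    "\<And>x y. x \<in> \<Omega> \<Longrightarrow> same_class L x y \<Longrightarrow> g (z' y) = (z ^^ \<mu> x) (g y)" by metis
  have self: "same_class L x x" for x using same_class_z_pow[OF add_subgroup_L, of x 0] by simp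
  have const: "\<mu> x = \<mu> y" if x: "x \<in> \<Omega>" and c: "same_class L x y" for x y
  proof -
    note y = same_class_mem[OF x c]
    have "(z ^^ \<mu> x) (g y) = (z ^^ \<mu> y) (g y)" using \<mu>(2)[OF x c] \<mu>(2)[OF y self] by simp
    then show ?thesis using z_pow_eq_iff[OF joint_mem[OF g y]] \<mu>(1)[OF x] \<mu>(1)[OF y] by simp
  qed
  have "adapted L (\<lambda>v. conj_perm g (\<sigma> v)) (conj_perm g z') (\<lambda>x. \<mu> (finv g x))"
  proof (rule adapted_conjI[OF gA joint_same_class_iff[OF g]])
    show "class_constant L (\<lambda>x. \<mu> (finv g x))"
      unfolding class_constant_def
      using const A_inv_mem[OF gA] joint_same_class[OF joint_inv[OF g]] by blast
    show "g (z' x) = (z ^^ \<mu> (finv g (g x))) (g x)" if "x \<in> \<Omega>" for x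
      using \<mu>(2)[OF that self] A_inv(2)[OF gA] by simp
  qed (use \<mu>(1) A_inv_mem[OF gA] in auto)
  then show thesis by (rule that)
qed

lemma conj_joint_power_2:
  assumes "\<Omega> \<noteq> {}"
  obtains g k \<mu> where "g \<in> joint \<sigma>" "adapted L (\<lambda>v. conj_perm g (\<sigma> v)) (conj_perm g z') \<mu>"
    "card (joint (\<lambda>v. conj_perm g (\<sigma> v))) = 2 ^ k"
proof -
  obtain i j where card: "card (range \<tau>) = 2 ^ i" "card (range \<sigma>) = 2 ^ j"
    using card_range_\<tau>[OF assms] S.card_range_\<tau>[OF assms] by blast
  have sub: "range \<tau> \<subseteq> joint \<sigma>" "range \<sigma> \<subseteq> joint \<sigma>" using \<tau>_mem_joint \<sigma>_mem_joint by auto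
  obtain g T k where g: "g \<in> joint \<sigma>" and T: "perm_group \<Omega> T" "card T = 2 ^ k" "range \<tau> \<subseteq> T"
      "conj_perm g ` range \<sigma> \<subseteq> T"
    using perm_groups_conj_in_common_p_group[OF perm_group_joint finite_\<Omega> two_is_prime_nat
        perm_group_range_\<tau> sub(1) card(1) S.perm_group_range_\<tau> sub(2) card(2)] .
  obtain \<mu> where \<mu>: "adapted L (\<lambda>v. conj_perm g (\<sigma> v)) (conj_perm g z') \<mu>" using adapted_conj_joint[OF g] .
  interpret C: adapted_rep \<Omega> A p \<tau> z L "\<lambda>v. conj_perm g (\<sigma> v)" "conj_perm g z'" \<mu>
    by unfold_locales (rule \<mu> add_subgroup_L)+
  have "joint (\<lambda>v. conj_perm g (\<sigma> v)) \<subseteq> T"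
    unfolding joint_def using T(3,4) by (intro comp_closure_subset[OF _ T(1)]) auto
  from perm_group_card_dvd[OF T(1) C.perm_group_joint this]
  show thesis using that[OF g \<mu>] divides_primepow_nat[OF two_is_prime_nat] T(2) by auto
qed

text \<open>Since \<open>p\<close> is odd, \<open>\<Omega>\<close> cannot be partitioned into orbits of length divisible by \<open>2 * CARD('v)\<close>.\<close>

lemma exists_base_point:
  assumes "\<Omega> \<noteq> {}" and k: "card (joint \<sigma>) = 2 ^ k"
  obtains b where "b \<in> \<Omega>" "orb (joint \<sigma>) b = range (\<lambda>v. \<tau> v b)"
proof (rule ccontr)
  assume "\<not> thesis"
  then have proper: "x \<in> \<Omega> \<Longrightarrow> range (\<lambda>v. \<tau> v x) \<subset> orb (joint \<sigma>) x" for x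
    using that[of x] orbI[OF \<tau>_mem_joint, of _ x] by blast
  note orb = orb_subset[OF perm_group_joint] orb_self[OF perm_group_joint] orb_eq[OF perm_group_joint]
  obtain i where i: "CARD('v) = 2 ^ i" using card_add_subgroup_power_2[OF add_subgroup_UNIV] by blast
  have "2 * CARD('v) dvd card (orb (joint \<sigma>) x)" if x: "x \<in> \<Omega>" for x
  proof -
    obtain j where j: "card (orb (joint \<sigma>) x) = 2 ^ j"
      using card_orb_prime_power[OF perm_group_joint _ two_is_prime_nat, of k x] k by auto
    have "card (range (\<lambda>v. \<tau> v x)) < card (orb (joint \<sigma>) x)"
      using psubset_card_mono[OF finite_subset[OF orb(1)[OF x] finite_\<Omega>] proper[OF x]] .
    moreover have "card (range (\<lambda>v. \<tau> v x)) = CARD('v)"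
      using \<tau>_eq_iff[OF x] by (intro card_image injI) simp
    ultimately have "(2::nat) ^ Suc i dvd 2 ^ j" by (intro le_imp_power_dvd) (simp add: i j)
    then show ?thesis unfolding i j by simp
  qed
  then have "2 * CARD('v) dvd card (\<Union> (orb (joint \<sigma>) ` \<Omega>))"
    using orb(3) by (intro dvd_partition finite_UN_I finite_\<Omega> finite_subset[OF orb(1) finite_\<Omega>]) blast+
  moreover have "\<Union> (orb (joint \<sigma>) ` \<Omega>) = \<Omega>" using orb(1,2) by blast
  ultimately show False using card_\<Omega> odd_p by simp
qed

definition improvable :: bool where
  "improvable \<longleftrightarrow> (\<exists>g\<in>A. \<exists>\<mu>. adapted L (\<lambda>v. conj_perm g (\<sigma> v)) (conj_perm g z') \<mu> \<and>
     common \<sigma> \<subset> common (\<lambda>v. conj_perm g (\<sigma> v)))"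

end

section \<open>Reduction to a pair of regular 2-groups\<close>

text \<open>Since the orbit of \<open>b\<close> under the joint group consists of the points \<open>\<tau> v b\<close>, the joint group acts on
  \<open>'v\<close>.\<close>

locale based_pair = adapted_rep \<Omega> A p \<tau> z L \<sigma> z' \<kappa>
  for \<Omega> :: "'a set" and A p and \<tau> :: "'v::{elementary_2_group,finite} \<Rightarrow> 'a \<Rightarrow> 'a" and z L \<sigma> z' \<kappa> +
  fixes b :: 'a
  assumes independent: "independent_rotations L" and b: "b \<in> \<Omega>"
    and orb_b: "orb (joint \<sigma>) b = range (\<lambda>v. \<tau> v b)" and card_joint: "\<exists>k. card (joint \<sigma>) = 2 ^ k"
begin

lemma \<tau>_b_mem: "\<tau> v b \<in> \<Omega>"
  using \<tau>_mem[OF b] .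

lemma \<tau>_b_eq_iff: "\<tau> u b = \<tau> v b \<longleftrightarrow> u = v"
  using \<tau>_eq_iff[OF b] .

definition induced :: "('a \<Rightarrow> 'a) \<Rightarrow> 'v \<Rightarrow> 'v" where
  "induced q v = vcoord b (q (\<tau> v b))"

lemma induced_eqI: "q (\<tau> v b) = \<tau> u b \<Longrightarrow> induced q v = u"
  by (simp add: induced_def vcoord_\<tau>_base[OF b])

lemma joint_apply_\<tau>: assumes q: "q \<in> joint \<sigma>" shows "q (\<tau> v b) = \<tau> (induced q v) b"
proof -
  have "q (\<tau> v b) \<in> range (\<lambda>v. \<tau> v b)" using orbI[OF joint_comp[OF q \<tau>_mem_joint[of v]], of b] orb_b by blast
  then obtain u where "q (\<tau> v b) = \<tau> u b" by blast
  then show ?thesis using induced_eqI by metis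
qed

lemma vcoord_joint:
  assumes q: "q \<in> joint \<sigma>" and x: "x \<in> \<Omega>" shows "vcoord b (q x) = induced q (vcoord b x)"
proof -
  obtain s where "q ((z ^^ zcoord b x) (\<tau> (vcoord b x) b)) = (z ^^ s) (q (\<tau> (vcoord b x) b))"
    using joint_z_pow[OF q \<tau>_b_mem] by blast
  then have "q x = (z ^^ s) (\<tau> (induced q (vcoord b x)) b)"
    using coordinates[OF b x] joint_apply_\<tau>[OF q] by simp
  then show ?thesis using vcoord_z_pow_\<tau>[OF b] by simp
qed

lemma induced_comp:
  assumes "q \<in> joint \<sigma>" "r \<in> joint \<sigma>" shows "induced (\<lambda>x. q (r x)) v = induced q (induced r v)"
  by (rule induced_eqI) (simp add: joint_apply_\<tau>[OF assms(2)] joint_apply_\<tau>[OF assms(1)])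

lemma induced_id: "induced (\<lambda>x. x) v = v"
  by (rule induced_eqI) simp

lemma induced_\<tau>: "induced (\<tau> u) v = v + u"
  by (rule induced_eqI) (simp add: add.commute flip: \<tau>_add)

lemma induced_inv:
  assumes q: "q \<in> joint \<sigma>"
  shows "induced (finv q) (induced q v) = v" "induced q (induced (finv q) v) = v"
  using induced_comp[OF joint_inv[OF q] q, of v] induced_comp[OF q joint_inv[OF q], of v] induced_id
  by (simp_all add: perm_group_inv_apply[OF perm_group_joint q])

lemma perm_group_induced: "perm_group UNIV (induced ` joint \<sigma>)"
proof (rule perm_groupI)
  fix f assume "f \<in> induced ` joint \<sigma>"
  then obtain q where q: "q \<in> joint \<sigma>" "f = induced q" by blast
  have inv: "f \<circ> induced (finv q) = id" "induced (finv q) \<circ> f = id"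
    using induced_inv[OF q(1)] by (simp_all add: q(2) fun_eq_iff)
  show "f permutes UNIV" using bij_imp_permutes[OF o_bij[OF inv(2,1)]] by simp
  show "finv f \<in> induced ` joint \<sigma>" using inv_unique_comp[OF inv] joint_inv[OF q(1)] by blast
  fix g assume "g \<in> induced ` joint \<sigma>"
  then obtain r where r: "r \<in> joint \<sigma>" "g = induced r" by blast
  have "f \<circ> g = induced (\<lambda>x. q (r x))" using induced_comp[OF q(1) r(1)] q(2) r(2) by (simp add: fun_eq_iff)
  then show "f \<circ> g \<in> induced ` joint \<sigma>" using joint_comp[OF q(1) r(1)] by blast
next
  have "id = induced (\<lambda>x. x)" using induced_id by (simp add: fun_eq_iff)
  then show "id \<in> induced ` joint \<sigma>" using joint_id by blast
qed

lemma card_induced: "\<exists>k. card (induced ` joint \<sigma>) = 2 ^ k"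
proof -
  have "group_action (perm_monoid (joint \<sigma>)) UNIV (\<lambda>q. restrict (\<lambda>f v. induced q (f v)) UNIV)"
    by (rule perm_group_action[OF perm_group_joint])
      (use induced_id induced_comp in \<open>simp_all add: comp_def id_def\<close>)
  moreover obtain k where "card (joint \<sigma>) = 2 ^ k" using card_joint by blast
  ultimately show ?thesis using card_perm_orbit_prime_power[OF _ _ two_is_prime_nat, of "joint \<sigma>" UNIV _ k id] by (simp add: id_def)
qed

definition index :: "'v \<Rightarrow> 'v" where
  "index v = S.vcoord b (\<tau> v b)"

lemma index_vcoord: "index (vcoord b (\<sigma> u b)) = u"
proof -
  have "\<sigma> u b = \<tau> (vcoord b (\<sigma> u b)) b"
    using joint_apply_\<tau>[OF \<sigma>_mem_joint, of u 0] vcoord_joint[OF \<sigma>_mem_joint b, of u] \<tau>_0 vcoord_\<tau>_base[OF b, of 0] by simp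
  then show ?thesis unfolding index_def using S.vcoord_\<tau>_base[OF b, of u] by simp
qed

lemma \<sigma>_index_b: "\<sigma> (index v) b = \<tau> v b"
proof -
  have "inj (\<lambda>u. vcoord b (\<sigma> u b))" by (rule inj_on_inverseI[of _ index]) (rule index_vcoord)
  then have "surj (\<lambda>u. vcoord b (\<sigma> u b))" by (rule finite_UNIV_inj_surj[OF finite])
  then obtain u where u: "vcoord b (\<sigma> u b) = v" unfolding surj_def by metis
  have "\<sigma> u b = \<tau> v b"
    using joint_apply_\<tau>[OF \<sigma>_mem_joint, of u 0] u by (simp add: induced_def \<tau>_0)
  then show ?thesis using index_vcoord u by metis
qed

lemma \<sigma>_eq_\<sigma>_index: obtains v where "\<sigma> u = \<sigma> (index v)"
  using index_vcoord by metis

definition \<rho> :: "'v \<Rightarrow> 'v \<Rightarrow> 'v" where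
  "\<rho> v = induced (\<sigma> (index v))"

lemma \<sigma>_index_\<tau>: "\<sigma> (index c) (\<tau> v b) = \<tau> (\<rho> c v) b"
  unfolding \<rho>_def using joint_apply_\<tau>[OF \<sigma>_mem_joint] .

lemma regular_pair_induced: "regular_pair (induced ` joint \<sigma>) \<rho>"
proof
  show "perm_group UNIV (induced ` joint \<sigma>)" by (rule perm_group_induced)
  show "\<exists>k. card (induced ` joint \<sigma>) = 2 ^ k" by (rule card_induced)
  show "(\<lambda>x. x + v) \<in> induced ` joint \<sigma>" for v
  proof -
    have "(\<lambda>x. x + v) = induced (\<tau> v)" using induced_\<tau> by (simp add: fun_eq_iff)
    then show ?thesis using \<tau>_mem_joint by blast
  qed
  show "\<rho> v \<in> induced ` joint \<sigma>" for v unfolding \<rho>_def using \<sigma>_mem_joint by blast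
  show "\<rho> v 0 = v" for v unfolding \<rho>_def by (rule induced_eqI) (simp add: \<tau>_0 \<sigma>_index_b)
  have "\<tau> (\<rho> u (\<rho> v x)) b = \<tau> (\<rho> v (\<rho> u x)) b" for u v x
    unfolding \<sigma>_index_\<tau>[symmetric] by (rule S.\<tau>_comm)
  then show "\<rho> u (\<rho> v x) = \<rho> v (\<rho> u x)" for u v x using \<tau>_b_eq_iff by blast
  have "\<tau> (\<rho> v (\<rho> v x)) b = \<tau> x b" for v x unfolding \<sigma>_index_\<tau>[symmetric] by (rule S.\<tau>_invol)
  then show "\<rho> v (\<rho> v x) = x" for v x using \<tau>_b_eq_iff by blast
  fix P q assume "q \<in> induced ` joint \<sigma>" and id: "P id"
    and add: "\<And>v r. P r \<Longrightarrow> P (\<lambda>x. r x + v)" and \<rho>: "\<And>v r. P r \<Longrightarrow> P (\<lambda>x. \<rho> v (r x))"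
  then obtain r where r: "r \<in> joint \<sigma>" "q = induced r" by blast
  have "P (induced r)" using r(1)
  proof (induction rule: joint_induct)
    case id
    have "induced (\<lambda>x. x) = id" using induced_id by (simp add: fun_eq_iff)
    then show ?case using \<open>P id\<close> by metis
  next
    case (\<tau> v q)
    have "induced (\<lambda>x. \<tau> v (q x)) = (\<lambda>x. induced q x + v)"
      using induced_comp[OF \<tau>_mem_joint \<tau>(1)] induced_\<tau> by (simp add: fun_eq_iff)
    then show ?case using add[OF \<tau>(2)] by simp
  next
    case (\<sigma> v q)
    obtain y where y: "\<sigma> v = \<sigma> (index y)" using \<sigma>_eq_\<sigma>_index .
    have "induced (\<lambda>x. \<sigma> v (q x)) = (\<lambda>x. \<rho> y (induced q x))"
      unfolding y \<rho>_def using induced_comp[OF \<sigma>_mem_joint \<sigma>(1)] by (simp add: fun_eq_iff)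
    then show ?case using \<rho>[OF \<sigma>(2)] by simp
  qed
  then show "P q" using r(2) by simp
qed

end

sublocale based_pair \<subseteq> P: regular_pair "induced ` joint \<sigma>" \<rho>
  by (rule regular_pair_induced)

context based_pair
begin

lemma vcoord_\<sigma>_index: "x \<in> \<Omega> \<Longrightarrow> vcoord b (\<sigma> (index v) x) = \<rho> v (vcoord b x)"
  unfolding \<rho>_def using vcoord_joint[OF \<sigma>_mem_joint] .

lemma block_L: "P.block L"
proof (rule P.blockI[OF add_subgroup_L])
  fix q x y assume "q \<in> induced ` joint \<sigma>" and "x + y \<in> L"
  then obtain r where r: "r \<in> joint \<sigma>" "q = induced r" by blast
  note iff = same_class_iff_vcoord[OF b \<tau>_b_mem \<tau>_b_mem, unfolded vcoord_\<tau>_base[OF b]]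
  have "same_class L (r (\<tau> x b)) (r (\<tau> y b))"
    using joint_same_class[OF r(1) \<tau>_b_mem] iff \<open>x + y \<in> L\<close> by blast
  then show "q x + q y \<in> L" unfolding joint_apply_\<tau>[OF r(1)] r(2) using iff by simp
qed

lemma common_subset_central: "common \<sigma> \<subseteq> P.central {0}"
proof
  fix v assume v: "v \<in> common \<sigma>"
  have "induced q (x + v) = induced q x + v" if q: "q \<in> joint \<sigma>" for q x
  proof (rule induced_eqI)
    have "q (\<tau> (x + v) b) = q (\<tau> v (\<tau> x b))" using \<tau>_add[of v x b] by (simp add: add.commute)
    also have "\<dots> = \<tau> (induced q x + v) b"
      using common_central[OF v q] joint_apply_\<tau>[OF q] \<tau>_add[of v "induced q x" b] by (simp add: add.commute)
    finally show "q (\<tau> (x + v) b) = \<tau> (induced q x + v) b" .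
  qed
  then show "v \<in> P.central {0}" unfolding P.central_def by (auto simp: add_ac)
qed

lemma block_common: "P.block (common \<sigma>)"
proof (rule P.blockI)
  show "add_subgroup (common \<sigma>)" unfolding add_subgroup_def
  proof (intro conjI ballI)
    have "\<tau> 0 = \<sigma> 0" using \<tau>_0 S.\<tau>_0 by (simp add: fun_eq_iff)
    then show "0 \<in> common \<sigma>" unfolding common_def by blast
    fix u v assume "u \<in> common \<sigma>" "v \<in> common \<sigma>"
    then obtain u' v' where "\<tau> u = \<sigma> u'" "\<tau> v = \<sigma> v'" unfolding common_def by blast
    then have "\<tau> (u + v) = \<sigma> (u' + v')" using \<tau>_add S.\<tau>_add by (simp add: fun_eq_iff)
    then show "u + v \<in> common \<sigma>" unfolding common_def by blast
  qed
  fix q x y assume q: "q \<in> induced ` joint \<sigma>" and xy: "x + y \<in> common \<sigma>"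
  have "q (x + (x + y)) = q x + (x + y)" using P.central_zeroD[OF subsetD[OF common_subset_central xy] q] .
  then show "q x + q y \<in> common \<sigma>" using xy by simp
qed

lemma rotate_pair:
  assumes x: "x \<in> \<Omega>" "x' \<in> \<Omega>" "vcoord b x = vcoord b x'" and y: "y \<in> \<Omega>" "y' \<in> \<Omega>" "vcoord b y = vcoord b y'"
    and far: "vcoord b x + vcoord b y \<notin> L"
  obtains a where "a \<in> A" "a x = x'" "a y = y'"
proof -
  obtain s where s: "x' = (z ^^ s) x" using vcoord_eqD[OF b x] .
  obtain t where t: "y' = (z ^^ t) y" using vcoord_eqD[OF b y] .
  have "\<not> same_class L x y" using far same_class_iff_vcoord[OF b x(1) y(1)] by blast
  then obtain a where "a \<in> A" "\<And>u. u \<in> \<Omega> \<Longrightarrow> same_class L x u \<Longrightarrow> a u = (z ^^ s) u"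
      "\<And>u. u \<in> \<Omega> \<Longrightarrow> same_class L y u \<Longrightarrow> a u = (z ^^ t) u"
    using independent_rotations_pair[OF add_subgroup_L independent] by blast
  then show thesis
    using that s t x(1) y(1) equivp_reflp[OF equivp_same_class[OF add_subgroup_L]] by metis
qed

lemma joint_z_pow_if_UNIV:
  assumes L: "L = UNIV" and q: "q \<in> joint \<sigma>" and x: "x \<in> \<Omega>"
  shows "q ((z ^^ t) x) = (z ^^ t) (q x)"
  using q
proof (induction rule: joint_induct)
  case (\<sigma> v q)
  note qx = joint_mem[OF \<sigma>(1) x]
  have \<kappa>: "\<kappa> y = \<kappa> (q x)" if "y \<in> \<Omega>" for y
    using \<kappa>_same_class[OF that, of "q x"] same_class_UNIV[OF that qx] L by simp
  obtain i where i: "\<And>y t. y \<in> \<Omega> \<Longrightarrow> \<kappa> y = \<kappa> (q x) \<Longrightarrow> (z ^^ t) y = (z' ^^ (t * i)) y"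
    using z_pow_eq_z'_pow[OF qx] by blast
  show ?case using \<sigma>(2) i[OF qx] i[OF S.\<tau>_mem[OF qx] \<kappa>[OF S.\<tau>_mem[OF qx]]] S.\<tau>_z_pow by simp
qed (simp_all add: \<tau>_z_pow)

lemma joint_apply_eq_if_UNIV:
  assumes "L = UNIV" "q \<in> joint \<sigma>" "r \<in> joint \<sigma>" "x \<in> \<Omega>" "induced q (vcoord b x) = induced r (vcoord b x)"
  shows "q x = r x"
  using coordinates[OF b assms(4)] joint_z_pow_if_UNIV[OF assms(1,2) \<tau>_b_mem]
    joint_z_pow_if_UNIV[OF assms(1,3) \<tau>_b_mem] joint_apply_\<tau>[OF assms(2)] joint_apply_\<tau>[OF assms(3)] assms(5) by metis

subsection \<open>Twisting one half of the points\<close>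

definition off :: "'v set \<Rightarrow> 'a \<Rightarrow> bool" where
  "off U x \<longleftrightarrow> x \<in> \<Omega> \<and> vcoord b x \<notin> U"

definition twist_half :: "'v set \<Rightarrow> 'v \<Rightarrow> 'v \<Rightarrow> 'a \<Rightarrow> 'a" where
  "twist_half U e w x = (if off U x then \<tau> e (\<sigma> (index w) x) else x)"

context
  fixes U e w
  assumes U: "P.block U" "hyperplane U" and L_U: "L \<subseteq> U \<or> L = UNIV" and e: "e \<notin> U" and w: "w \<notin> U"
begin

lemma off_\<tau>_iff: "x \<in> \<Omega> \<Longrightarrow> off U (\<tau> v x) \<longleftrightarrow> (off U x \<longleftrightarrow> v \<in> U)"
  unfolding off_def using vcoord_\<tau>[OF b] hyperplane_add_mem_iff[OF U(2)] \<tau>_mem by auto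

lemma off_\<sigma>_index_iff: "x \<in> \<Omega> \<Longrightarrow> off U (\<sigma> (index v) x) \<longleftrightarrow> (off U x \<longleftrightarrow> v \<in> U)"
  unfolding off_def using vcoord_\<sigma>_index P.\<sigma>_mem_block_hyperplane_iff[OF U] S.\<tau>_mem by auto

lemma off_same_class: "L \<subseteq> U \<Longrightarrow> x \<in> \<Omega> \<Longrightarrow> same_class L x y \<Longrightarrow> off U x \<longleftrightarrow> off U y"
  unfolding off_def
  using same_class_iff_vcoord[OF b, of x y L] same_class_mem[of x L y]
    hyperplane_add_mem_iff[OF U(2), of "vcoord b x" "vcoord b y"] by blast

lemma twist_mem_joint: "(\<lambda>x. \<tau> e (\<sigma> (index w) x)) \<in> joint \<sigma>"
  using joint_comp[OF \<tau>_mem_joint \<sigma>_mem_joint] .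

lemma off_twist_half: "off U (twist_half U e w x) \<longleftrightarrow> off U x"
proof (cases "off U x")
  case True
  then have "x \<in> \<Omega>" by (simp add: off_def)
  then show ?thesis
    using True e w by (simp add: twist_half_def off_\<tau>_iff[OF S.\<tau>_mem] off_\<sigma>_index_iff)
qed (simp add: twist_half_def)

lemma twist_half_mem: "x \<in> \<Omega> \<Longrightarrow> twist_half U e w x \<in> \<Omega>"
  unfolding twist_half_def using joint_mem[OF twist_mem_joint] by simp

lemma twist_half_permutes: "twist_half U e w permutes \<Omega>"
proof (rule permutes_\<Omega>I)
  show "inj_on (twist_half U e w) \<Omega>"
  proof (rule inj_onI)
    fix x y assume eq: "twist_half U e w x = twist_half U e w y"
    then have "off U x \<longleftrightarrow> off U y" using off_twist_half by metis
    then show "x = y"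
      using eq A_inj[OF joint_mem_A[OF twist_mem_joint], of x y] unfolding twist_half_def by (simp split: if_splits)
  qed
qed (auto simp: twist_half_mem, simp add: twist_half_def off_def)

lemma twist_half_\<tau>:
  assumes v: "v \<in> common \<sigma>" "v \<in> U" shows "twist_half U e w (\<tau> v x) = \<tau> v (twist_half U e w x)"
proof (cases "x \<in> \<Omega>")
  case True
  then show ?thesis
    using off_\<tau>_iff[OF True] v(2) common_central[OF v(1) twist_mem_joint] by (simp add: twist_half_def)
next
  case False
  then show ?thesis using A_outside[OF \<tau>_mem_A] by (simp add: twist_half_def off_def)
qed

lemma twist_half_\<sigma>_index: "twist_half U e w (\<sigma> (index w) x) = \<tau> e (twist_half U e w x)"
proof (cases "x \<in> \<Omega>")
  case True
  then show ?thesis using w by (simp add: twist_half_def off_\<sigma>_index_iff S.\<tau>_invol \<tau>_invol)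
next
  case False
  then show ?thesis
    using A_outside[OF \<tau>_mem_A] A_outside[OF S.\<tau>_mem_A] by (simp add: twist_half_def off_def)
qed

context
  assumes cross: "\<And>x y. x \<in> U \<Longrightarrow> y \<notin> U \<Longrightarrow> \<exists>q\<in>induced ` joint \<sigma>. q x = x \<and> q y = \<rho> w y + e"
begin

lemma twist_half_agrees_across:
  assumes x: "x \<in> \<Omega>" "\<not> off U x" and y: "off U y"
  shows "\<exists>a\<in>A. a x = x \<and> a y = \<tau> e (\<sigma> (index w) y)"
proof -
  let ?f = "\<lambda>x. \<tau> e (\<sigma> (index w) x)"
  have xU: "vcoord b x \<in> U" and y': "y \<in> \<Omega>" "vcoord b y \<notin> U" using x y by (auto simp: off_def)
  from cross[OF xU y'(2)] obtain q where q: "q \<in> joint \<sigma>" "induced q (vcoord b x) = vcoord b x"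
      "induced q (vcoord b y) = \<rho> w (vcoord b y) + e" by blast
  have vcoord_f: "vcoord b (?f y) = \<rho> w (vcoord b y) + e"
    using vcoord_\<tau>[OF b S.\<tau>_mem[OF y'(1)]] vcoord_\<sigma>_index[OF y'(1)] by (simp add: add.commute)
  note qA = joint_mem_A[OF q(1)]
  have vcoord_q: "vcoord b (q x) = vcoord b x" "vcoord b (q y) = vcoord b (?f y)"
    using vcoord_joint[OF q(1)] vcoord_f x y' q(2,3) by simp_all
  from L_U show ?thesis
  proof
    assume "L \<subseteq> U"
    moreover have "vcoord b (?f y) \<notin> U" using off_twist_half[of y] y by (simp add: twist_half_def off_def)
    ultimately have "vcoord b (q x) + vcoord b (q y) \<notin> L"
      using vcoord_q xU hyperplane_add_mem_iff[OF U(2)] by auto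
    from rotate_pair[OF A_mem[OF qA x(1)] x(1) vcoord_q(1) A_mem[OF qA y'(1)] joint_mem[OF twist_mem_joint y'(1)]
        vcoord_q(2) this]
    obtain d where d: "d \<in> A" "d (q x) = x" "d (q y) = ?f y" .
    show ?thesis using A_comp[OF d(1) qA] d(2,3) by (intro bexI[of _ "\<lambda>x. d (q x)"]) auto
  next
    assume L: "L = UNIV"
    have "induced ?f (vcoord b y) = induced q (vcoord b y)"
      using vcoord_joint[OF twist_mem_joint y'(1)] vcoord_f q(3) by simp
    then have "q x = x" "q y = ?f y"
      using joint_apply_eq_if_UNIV[OF L q(1) joint_id x(1)] induced_id q(2)
        joint_apply_eq_if_UNIV[OF L q(1) twist_mem_joint y'(1)] by simp_all
    then show ?thesis using qA by blast
  qed
qed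

lemma twist_half_mem_A: "twist_half U e w \<in> A"
proof (rule two_closed[OF twist_half_permutes])
  fix x y assume x: "x \<in> \<Omega>" and y: "y \<in> \<Omega>"
  show "\<exists>a\<in>A. a x = twist_half U e w x \<and> a y = twist_half U e w y"
  proof (cases "off U x \<longleftrightarrow> off U y")
    case True
    then show ?thesis
      using A_id joint_mem_A[OF twist_mem_joint] unfolding twist_half_def by (cases "off U x") auto
  next
    case False
    then show ?thesis using twist_half_agrees_across[OF x, of y] twist_half_agrees_across[OF y, of x] unfolding twist_half_def by auto
  qed
qed

end

lemma same_class_twist_half_iff:
  assumes x: "x \<in> \<Omega>" shows "same_class L (twist_half U e w x) (twist_half U e w y) \<longleftrightarrow> same_class L x y"
  using L_U
proof
  assume L: "L \<subseteq> U"
  show ?thesis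
  proof (cases "off U x \<longleftrightarrow> off U y")
    case True
    then show ?thesis unfolding twist_half_def using joint_same_class_iff[OF twist_mem_joint x] by simp
  next
    case False
    then show ?thesis
      using off_same_class[OF L x, of y] off_same_class[OF L twist_half_mem[OF x], of "twist_half U e w y"] off_twist_half by blast
  qed
next
  assume L: "L = UNIV"
  show ?thesis
    using same_class_UNIV[OF x] same_class_UNIV[OF twist_half_mem[OF x]] same_class_mem[OF x]
      same_class_mem[OF twist_half_mem[OF x]] permutes_in_image[OF twist_half_permutes] L by blast
qed

lemma adapted_conj_twist_half:
  assumes "twist_half U e w \<in> A"
  shows "adapted L (\<lambda>v. conj_perm (twist_half U e w) (\<sigma> v)) (conj_perm (twist_half U e w) z') (\<lambda>x. if off U x then \<kappa> (\<tau> e x) else \<kappa> x)"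
proof (rule adapted_conjI[OF assms same_class_twist_half_iff])
  show "class_constant L (\<lambda>x. if off U x then \<kappa> (\<tau> e x) else \<kappa> x)"
    unfolding class_constant_def
  proof (intro ballI allI impI)
    fix x y assume x: "x \<in> \<Omega>" and c: "same_class L x y"
    have eq: "\<kappa> x = \<kappa> y" "\<kappa> (\<tau> e x) = \<kappa> (\<tau> e y)"
      using \<kappa>_same_class[OF x c] \<kappa>_same_class[OF \<tau>_mem[OF x] same_class_\<tau>[OF c]] .
    from L_U have "(off U x \<longleftrightarrow> off U y) \<or> \<kappa> (\<tau> e x) = \<kappa> x"
      using off_same_class[OF _ x c] \<kappa>_same_class[OF x, of "\<tau> e x"] same_class_UNIV[OF x \<tau>_mem[OF x]] by auto
    then show "(if off U x then \<kappa> (\<tau> e x) else \<kappa> x) = (if off U y then \<kappa> (\<tau> e y) else \<kappa> y)"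
      using eq by auto
  qed
  show "(if off U x then \<kappa> (\<tau> e x) else \<kappa> x) < p" if "x \<in> \<Omega>" for x
    using \<kappa>_less that \<tau>_mem by simp
  fix x assume x: "x \<in> \<Omega>"
  have off_z': "off U (z' x) \<longleftrightarrow> off U x"
    unfolding off_def z'_eq[OF x] using vcoord_z_pow[OF b x] z_pow_mem[OF x] x by simp
  show "twist_half U e w (z' x) = (z ^^ (if off U (twist_half U e w x) then \<kappa> (\<tau> e (twist_half U e w x)) else \<kappa> (twist_half U e w x))) (twist_half U e w x)"
  proof (cases "off U x")
    case True
    have "twist_half U e w (z' x) = \<tau> e (z' (\<sigma> (index w) x))" using True off_z' by (simp add: twist_half_def S.\<tau>_z)
    then have "twist_half U e w (z' x) = (z ^^ \<kappa> (\<sigma> (index w) x)) (twist_half U e w x)"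
      using True by (simp add: twist_half_def z'_eq[OF S.\<tau>_mem[OF x]] \<tau>_z_pow)
    moreover have "\<tau> e (twist_half U e w x) = \<sigma> (index w) x" using True by (simp add: twist_half_def \<tau>_invol)
    ultimately show ?thesis using True by (simp add: off_twist_half)
  next
    case False
    then show ?thesis using off_z' z'_eq[OF x] by (simp add: twist_half_def)
  qed
qed

end

lemma improvable_if_rotatable:
  assumes U: "P.block U" "hyperplane U" and common: "common \<sigma> \<subseteq> U" and L: "L \<subseteq> U \<or> L = UNIV"
    and rot: "P.rotatable_mod {0} U"
  shows improvable
proof -
  obtain e w where e: "e \<notin> U" and w: "w \<notin> U" and
    cross: "\<And>x y. x \<in> U \<Longrightarrow> y \<notin> U \<Longrightarrow> \<exists>q\<in>induced ` joint \<sigma>. q x + x \<in> {0} \<and> q y + (\<rho> w y + e) \<in> {0}"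
    using rot unfolding P.rotatable_mod_def by blast
  let ?\<delta> = "twist_half U e w"
  have \<delta>: "?\<delta> \<in> A"
    by (rule twist_half_mem_A[OF U L e w]) (use cross in \<open>simp add: add_eq_zero_iff\<close>)
  have "common \<sigma> \<subseteq> common (\<lambda>v. conj_perm ?\<delta> (\<sigma> v))"
    by (rule common_subset_conj[OF \<delta>]) (use twist_half_\<tau>[OF U L e w] common in blast)
  moreover have "\<tau> e = conj_perm ?\<delta> (\<sigma> (index w))"
    using twist_half_\<sigma>_index[OF U L e w] by (simp add: conj_perm_def fun_eq_iff A_inv(3)[OF \<delta>])
  then have "e \<in> common (\<lambda>v. conj_perm ?\<delta> (\<sigma> v))" unfolding common_def by blast
  ultimately have "common \<sigma> \<subset> common (\<lambda>v. conj_perm ?\<delta> (\<sigma> v))" using e common by blast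
  then show ?thesis unfolding improvable_def using \<delta> adapted_conj_twist_half[OF U L e w \<delta>] by blast
qed

subsection \<open>Straightening the second representation\<close>

lemma z'_pow_\<tau>_b:
  assumes "u \<in> L" shows "(z' ^^ s) (\<tau> u b) = \<tau> u ((z' ^^ s) b)"
proof -
  have "\<kappa> (\<tau> u b) = \<kappa> b" using \<kappa>_same_class[OF b same_classI[OF assms, of b 0]] by simp
  then show ?thesis by (simp add: z'_pow \<tau>_b_mem b \<tau>_z_pow)
qed

lemma vcoord_z'_pow: "x \<in> \<Omega> \<Longrightarrow> vcoord b ((z' ^^ s) x) = vcoord b x"
  by (simp add: z'_pow vcoord_z_pow[OF b])

lemma z'_coordinates:
  assumes x: "x \<in> \<Omega>" shows "x = (z' ^^ S.zcoord b x) (\<tau> (vcoord b x) b)"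
proof -
  obtain v where "\<sigma> (S.vcoord b x) b = \<tau> v b" using \<sigma>_eq_\<sigma>_index[of "S.vcoord b x"] \<sigma>_index_b by metis
  then have "x = (z' ^^ S.zcoord b x) (\<tau> v b)" using S.coordinates[OF b x] by simp
  moreover from this have "vcoord b x = v" using vcoord_z'_pow[OF \<tau>_b_mem] vcoord_\<tau>_base[OF b] by metis
  ultimately show ?thesis by simp
qed

lemma zcoord_z'_pow: "S.zcoord b ((z' ^^ s) (\<tau> v b)) = s mod p"
  using S.zcoord_z_pow_\<tau>[OF b, of s "index v"] by (simp add: \<sigma>_index_b)

definition shear :: "'v \<Rightarrow> 'a \<Rightarrow> 'a" where
  "shear c x = \<tau> c (\<sigma> (index c) x)"

lemma shear_mem_A: "shear c \<in> A"
  unfolding shear_def[abs_def] using A_comp[OF \<tau>_mem_A S.\<tau>_mem_A] .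

lemma shear_eq:
  assumes "\<rho> c v \<in> L" shows "shear c ((z' ^^ s) (\<tau> v b)) = \<tau> (c + \<rho> c v) ((z' ^^ s) b)"
  by (simp add: shear_def S.\<tau>_z_pow \<sigma>_index_\<tau> z'_pow_\<tau>_b[OF assms] \<tau>_add)

definition align :: "'v set \<Rightarrow> 'v \<Rightarrow> 'a \<Rightarrow> 'a" where
  "align Y w x = (if x \<in> \<Omega> then \<tau> (P.straighten w Y (vcoord b x)) ((z' ^^ S.zcoord b x) b) else x)"

lemma align_eq: "align Y w ((z' ^^ s) (\<tau> v b)) = \<tau> (P.straighten w Y v) ((z' ^^ s) b)"
  unfolding align_def
  by (simp add: S.z_pow_mem[OF \<tau>_b_mem] zcoord_z'_pow S.z_pow_mod vcoord_z'_pow[OF \<tau>_b_mem] vcoord_\<tau>_base[OF b])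

context
  fixes Y w
  assumes Y: "P.translation_hyperplane Y" and w: "w \<in> L" "w \<notin> Y"
begin

lemma align_mem: "x \<in> \<Omega> \<Longrightarrow> align Y w x \<in> \<Omega>"
  unfolding align_def using \<tau>_mem[OF S.z_pow_mem[OF b]] by simp

lemma vcoord_align: "x \<in> \<Omega> \<Longrightarrow> vcoord b (align Y w x) = P.straighten w Y (vcoord b x)"
  unfolding align_def using vcoord_\<tau>[OF b S.z_pow_mem[OF b]] vcoord_z'_pow[OF b] vcoord_\<tau>_base[OF b, of 0]
  by (simp add: \<tau>_0)

lemma align_permutes: "align Y w permutes \<Omega>"
proof (rule permutes_\<Omega>I[OF align_mem])
  show "inj_on (align Y w) \<Omega>"
  proof (rule inj_onI)
    fix x y assume x: "x \<in> \<Omega>" and y: "y \<in> \<Omega>" and eq: "align Y w x = align Y w y"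
    have v: "vcoord b x = vcoord b y"
      using vcoord_align[OF x] vcoord_align[OF y] eq injD[OF P.inj_straighten[OF Y w(2)]] by simp
    then have "(z' ^^ S.zcoord b x) b = (z' ^^ S.zcoord b y) b"
      using eq x y A_inj[OF \<tau>_mem_A] unfolding align_def by metis
    then have "S.zcoord b x mod p = S.zcoord b y mod p" using S.z_pow_eq_iff[OF b] by blast
    then show "x = y" using z'_coordinates[OF x] z'_coordinates[OF y] v S.z_pow_cong by metis
  qed
  show "x \<notin> \<Omega> \<Longrightarrow> align Y w x = x" for x by (simp add: align_def)
qed

lemma shear_eq_align_inside:
  assumes c: "c \<in> Y" and x: "x \<in> \<Omega>" "vcoord b x \<in> Y" "vcoord b x + c \<in> L" shows "shear c x = align Y w x"
proof -
  have "\<rho> c (vcoord b x) = vcoord b x + c" using P.translation_hyperplaneD(3)[OF Y w(2) x(2) c] .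
  then have "shear c ((z' ^^ S.zcoord b x) (\<tau> (vcoord b x) b)) = \<tau> (vcoord b x) ((z' ^^ S.zcoord b x) b)"
    using shear_eq[of c "vcoord b x"] x(3) by (simp add: add_ac)
  then show ?thesis using x(1,2) z'_coordinates[OF x(1)] by (simp add: align_def P.straighten_def)
qed

lemma shear_eq_align_outside:
  assumes x: "x \<in> \<Omega>" "vcoord b x \<notin> Y" shows "shear (\<rho> w (vcoord b x)) x = align Y w x"
proof -
  have "\<rho> (\<rho> w (vcoord b x)) (vcoord b x) = w" using P.\<sigma>_\<sigma>_w[OF Y w(2)] .
  then have "shear (\<rho> w (vcoord b x)) ((z' ^^ S.zcoord b x) (\<tau> (vcoord b x) b))
      = \<tau> (P.straighten w Y (vcoord b x)) ((z' ^^ S.zcoord b x) b)"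
    using shear_eq[of "\<rho> w (vcoord b x)" "vcoord b x"] w(1) x(2) by (simp add: P.straighten_def)
  then show ?thesis using x(1) z'_coordinates[OF x(1)] by (simp add: align_def)
qed

lemma \<rho>_w_diff_mem: "\<rho> w v + v \<in> L"
  using P.block_mem_iff[OF block_L P.\<sigma>_mem, of v w 0] w(1) add_mem_iff_left[OF add_subgroup_L w(1)]
  by (simp add: P.\<sigma>_swap[of v])

lemma align_agrees_near_across:
  assumes x: "x \<in> \<Omega>" "vcoord b x \<in> Y" and y: "y \<in> \<Omega>" "vcoord b y \<notin> Y" and near: "vcoord b x + vcoord b y \<in> L"
  shows "\<exists>a\<in>A. a x = align Y w x \<and> a y = align Y w y"
proof -
  have "vcoord b x + \<rho> w (vcoord b y) \<in> L"
    by (rule add_mem_trans[OF add_subgroup_L near]) (use \<rho>_w_diff_mem in \<open>simp add: add.commute\<close>)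
  then show ?thesis
    using shear_eq_align_inside[OF _ x] shear_eq_align_outside[OF y] P.\<sigma>_w_mem_iff[OF Y w(2)] y(2) shear_mem_A by blast
qed

lemma conj_shear_eq_align_outside:
  assumes c: "c \<in> Y" and x: "x \<in> \<Omega>" "vcoord b x \<notin> Y" "\<rho> w (vcoord b x) + c \<in> L"
  shows "\<tau> w (shear c (\<sigma> (index w) x)) = align Y w x"
proof -
  let ?u = "\<sigma> (index w) x"
  note \<rho>_w_mem_iff = P.\<sigma>_w_mem_iff[OF Y w(2)]
  have u: "?u \<in> \<Omega>" "vcoord b ?u = \<rho> w (vcoord b x)" using S.\<tau>_mem vcoord_\<sigma>_index x(1) by auto
  then have "shear c ?u = align Y w ?u"
    using shear_eq_align_inside[OF c, of ?u] \<rho>_w_mem_iff x(2,3) by simp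
  moreover have "?u = (z' ^^ S.zcoord b x) (\<tau> (\<rho> w (vcoord b x)) b)"
    using arg_cong[OF z'_coordinates[OF x(1)], of "\<sigma> (index w)"] by (simp add: S.\<tau>_z_pow \<sigma>_index_\<tau>)
  ultimately show ?thesis
    using x \<rho>_w_mem_iff by (simp add: align_eq) (simp add: align_def P.straighten_def add.commute flip: \<tau>_add)
qed

lemma align_agrees_near:
  assumes x: "x \<in> \<Omega>" and y: "y \<in> \<Omega>" and near: "vcoord b x + vcoord b y \<in> L"
  shows "\<exists>a\<in>A. a x = align Y w x \<and> a y = align Y w y"
proof -
  consider (inside) "vcoord b x \<in> Y" "vcoord b y \<in> Y" | (leaving) "vcoord b x \<in> Y" "vcoord b y \<notin> Y"
    | (entering) "vcoord b x \<notin> Y" "vcoord b y \<in> Y" | (outside) "vcoord b x \<notin> Y" "vcoord b y \<notin> Y" by blast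
  then show ?thesis
  proof cases
    case inside
    then have "shear (vcoord b x) x = align Y w x" "shear (vcoord b x) y = align Y w y"
      using shear_eq_align_inside x y near add_subgroup_zero[OF add_subgroup_L] by (simp_all add: add.commute)
    then show ?thesis using shear_mem_A by blast
  next
    case leaving
    then show ?thesis using align_agrees_near_across x y near by blast
  next
    case entering
    then show ?thesis using align_agrees_near_across[OF y _ x] near by (auto simp: add.commute)
  next
    case outside
    let ?c = "\<rho> w (vcoord b x)"
    have c: "?c \<in> Y" using P.\<sigma>_w_mem_iff[OF Y w(2)] outside(1) by blast
    have "\<rho> w (vcoord b y) + ?c \<in> L"
      using P.block_mem_iff[OF block_L P.\<sigma>_mem] near by (simp add: add.commute)
    moreover have "?c + ?c \<in> L" using add_subgroup_zero[OF add_subgroup_L] by simp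
    ultimately show ?thesis
      using conj_shear_eq_align_outside[OF c x outside(1)] conj_shear_eq_align_outside[OF c y outside(2)]
        A_comp[OF \<tau>_mem_A A_comp[OF shear_mem_A S.\<tau>_mem_A]]
      by (intro bexI[of _ "\<lambda>u. \<tau> w (shear ?c (\<sigma> (index w) u))"] conjI) blast+
  qed
qed

lemma align_mem_A: "align Y w \<in> A"
proof (rule two_closed[OF align_permutes])
  fix x y assume x: "x \<in> \<Omega>" and y: "y \<in> \<Omega>"
  show "\<exists>a\<in>A. a x = align Y w x \<and> a y = align Y w y"
  proof (cases "vcoord b x + vcoord b y \<in> L")
    case True
    then show ?thesis by (rule align_agrees_near[OF x y])
  next
    case False
    obtain q where q: "q \<in> joint \<sigma>" "induced q (vcoord b x) = P.straighten w Y (vcoord b x)" "induced q (vcoord b y) = P.straighten w Y (vcoord b y)"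
      using P.straighten_agrees_with_Q[OF Y w(2), of "vcoord b x" "vcoord b y"] by blast
    note qA = joint_mem_A[OF q(1)]
    have v: "vcoord b (q x) = vcoord b (align Y w x)" "vcoord b (q y) = vcoord b (align Y w y)"
      using vcoord_joint[OF q(1)] vcoord_align x y q(2,3) by simp_all
    have "vcoord b (q x) + vcoord b (q y) \<notin> L"
      using vcoord_joint[OF q(1)] P.block_mem_iff[OF block_L imageI[OF q(1)]] x y False by simp
    from rotate_pair[OF A_mem[OF qA x] align_mem[OF x] v(1) A_mem[OF qA y] align_mem[OF y] v(2) this]
    obtain d where d: "d \<in> A" "d (q x) = align Y w x" "d (q y) = align Y w y" .
    then show ?thesis using A_comp[OF d(1) qA] by (intro bexI[of _ "\<lambda>x. d (q x)"]) auto
  qed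
qed

lemma conjugate_into_if_translation_hyperplane: "conjugate_into \<sigma> z'"
  unfolding conjugate_into_def
proof (intro bexI[OF _ align_mem_A] conjI allI exI ballI)
  fix v x assume x: "x \<in> \<Omega>"
  define s where "s = S.zcoord b x"
  have x_eq: "x = (z' ^^ s) (\<tau> (vcoord b x) b)" unfolding s_def by (rule z'_coordinates[OF x])
  define y where "y = vcoord b (\<sigma> v b)"
  have "\<sigma> v x = (z' ^^ s) (\<tau> (\<rho> y (vcoord b x)) b)"
    using arg_cong[OF x_eq, of "\<sigma> (index y)"] by (simp add: S.\<tau>_z_pow \<sigma>_index_\<tau>) (simp add: y_def index_vcoord)
  moreover have "align Y w x = \<tau> (P.straighten w Y (vcoord b x)) ((z' ^^ s) b)" unfolding align_def s_def using x by simp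
  ultimately show "align Y w (\<sigma> v x) = \<tau> (P.straighten w Y (vcoord b (\<sigma> v b))) (align Y w x)"
    by (simp add: align_eq P.straighten_\<sigma>[OF Y w(2)] add.commute flip: y_def \<tau>_add)
  have "z' x = (z' ^^ Suc s) (\<tau> (vcoord b x) b)" using arg_cong[OF x_eq, of z'] by simp
  then have "align Y w (z' x) = \<tau> (P.straighten w Y (vcoord b x)) (z' ((z' ^^ s) b))" using align_eq[of Y w "Suc s"] by simp
  also have "z' ((z' ^^ s) b) = (z ^^ \<kappa> b) ((z' ^^ s) b)"
    using z'_eq[OF S.z_pow_mem[OF b]] \<kappa>_z_pow[OF b] z'_pow[OF b] by simp
  finally show "align Y w (z' x) = (z ^^ \<kappa> b) (align Y w x)" unfolding align_def s_def using x by (simp add: \<tau>_z_pow)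
qed

end

subsection \<open>The reduction step\<close>

lemma hyperplane_containing_common:
  assumes L: "L = UNIV \<or> (\<exists>x\<in>\<Omega>. \<exists>y\<in>\<Omega>. \<kappa> x \<noteq> \<kappa> y)" and "common \<sigma> \<noteq> UNIV"
  obtains U where "P.block U" "hyperplane U" "common \<sigma> \<subseteq> U" "L \<subseteq> U \<or> L = UNIV"
proof (cases "L = UNIV")
  case True
  then show ?thesis using P.exists_block_hyperplane[OF block_common assms(2)] that by blast
next
  case False
  then obtain x y where x: "x \<in> \<Omega>" and y: "y \<in> \<Omega>" and \<kappa>: "\<kappa> x \<noteq> \<kappa> y" using L by blast
  let ?S = "{l + c | l c. l \<in> L \<and> c \<in> common \<sigma>}"
  have "?S \<noteq> UNIV"
  proof
    assume "?S = UNIV"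
    then obtain l c where lc: "vcoord b x + vcoord b y = l + c" "l \<in> L" "c \<in> common \<sigma>" by blast
    have "vcoord b (\<tau> c x) + vcoord b y = l"
      using vcoord_\<tau>[OF b x, of c] arg_cong[OF lc(1), of "(+) c"] by (simp add: add_ac)
    then have "same_class L (\<tau> c x) y" using same_class_iff_vcoord[OF b \<tau>_mem[OF x] y] lc(2) by simp
    then show False using \<kappa>_same_class[OF \<tau>_mem[OF x]] \<kappa>_common[OF lc(3) x] \<kappa> by simp
  qed
  then obtain U where U: "P.block U" "hyperplane U" "?S \<subseteq> U"
    using P.exists_block_hyperplane[OF P.block_sum[OF block_L block_common]] by blast
  have "L \<subseteq> ?S" "common \<sigma> \<subseteq> ?S"
    using add_subgroup_zero[OF add_subgroup_L] add_subgroup_zero[OF P.block_add_subgroup[OF block_common]] by force+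
  then show ?thesis using that[OF U(1,2)] U(3) by blast
qed

lemma conjugate_into_or_improvable:
  assumes "L = UNIV \<or> (\<exists>x\<in>\<Omega>. \<exists>y\<in>\<Omega>. \<kappa> x \<noteq> \<kappa> y)" "common \<sigma> \<noteq> UNIV" and card: "CARD('v) = 32"
  shows "conjugate_into \<sigma> z' \<or> improvable"
proof -
  obtain U where U: "P.block U" "hyperplane U" "common \<sigma> \<subseteq> U" "L \<subseteq> U \<or> L = UNIV"
    using hyperplane_containing_common[OF assms(1,2)] .
  consider (rotatable) "P.rotatable_mod {0} U" | (translating) Y where "P.translation_hyperplane Y"
    using P.rotatable_mod_or_translation_hyperplane[OF U(1,2) card P.block_singleton_zero]
      add_subgroup_zero[OF hyperplane_add_subgroup[OF U(2)]] by blast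
  then show ?thesis
  proof cases
    case rotatable
    then show ?thesis using improvable_if_rotatable[OF U] by blast
  next
    case (translating Y)
    have Y': "P.block Y" "hyperplane Y" using translating unfolding P.translation_hyperplane_def by auto
    consider (class_crosses) w where "w \<in> L" "w \<notin> Y"
      | (contained) "L \<subseteq> Y" "common \<sigma> \<subseteq> Y" | (common_crosses) c where "c \<in> common \<sigma>" "c \<notin> Y" by blast
    then show ?thesis
    proof cases
      case class_crosses
      then show ?thesis using conjugate_into_if_translation_hyperplane[OF translating] by blast
    next
      case contained
      then show ?thesis using improvable_if_rotatable[OF Y'] P.rotatable_translation_hyperplane[OF translating] by blast
    next
      case (common_crosses c)
      then have "P.rotatable_mod {0} U"
        using P.rotatable_if_central_not_in_translation_hyperplane[OF translating] common_subset_central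
          hyperplane_proper[OF U(2)] by blast
      then show ?thesis using improvable_if_rotatable[OF U] by blast
    qed
  qed
qed

end

context regular_rep
begin

lemma adapted_maximal_class:
  assumes "adapted L \<sigma> z' \<kappa>" "add_subgroup L" "independent_rotations L"
  obtains M where "adapted M \<sigma> z' \<kappa>" "add_subgroup M" "independent_rotations M"
    "M = UNIV \<or> (\<exists>x\<in>\<Omega>. \<exists>y\<in>\<Omega>. \<kappa> x \<noteq> \<kappa> y)"
  using assms that adapted_UNIV[OF assms(1)] add_subgroup_UNIV independent_rotations_UNIV by blast

lemma adapted_reduction_step:
  assumes ne: "\<Omega> \<noteq> {}" and L: "adapted L \<sigma> z' \<kappa>" "add_subgroup L" "independent_rotations L" and card: "CARD('v) = 32"
    and not_conj: "\<not> conjugate_into \<sigma> z'"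
  obtains g \<sigma>' M \<mu> z'' where "g \<in> A" "\<sigma>' = (\<lambda>v. conj_perm g (\<sigma> v))" "z'' = conj_perm g z'"
    "adapted M \<sigma>' z'' \<mu>" "add_subgroup M" "independent_rotations M"
    "\<exists>h\<in>A. \<exists>\<nu>. adapted M (\<lambda>v. conj_perm h (\<sigma>' v)) (conj_perm h z'') \<nu> \<and> common \<sigma> \<subset> common (\<lambda>v. conj_perm h (\<sigma>' v))"
proof -
  interpret N: adapted_rep \<Omega> A p \<tau> z L \<sigma> z' \<kappa> by unfold_locales (rule L)+
  obtain g k \<mu> where g: "g \<in> joint \<sigma>" and \<mu>: "adapted L (\<lambda>v. conj_perm g (\<sigma> v)) (conj_perm g z') \<mu>"
    and k: "card (joint (\<lambda>v. conj_perm g (\<sigma> v))) = 2 ^ k" using N.conj_joint_power_2[OF ne] .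
  define \<sigma>' z'' where defs: "\<sigma>' = (\<lambda>v. conj_perm g (\<sigma> v))" "z'' = conj_perm g z'"
  note gA = N.joint_mem_A[OF g]
  obtain M where M: "adapted M \<sigma>' z'' \<mu>" "add_subgroup M" "independent_rotations M"
      "M = UNIV \<or> (\<exists>x\<in>\<Omega>. \<exists>y\<in>\<Omega>. \<mu> x \<noteq> \<mu> y)"
    using adapted_maximal_class[OF \<mu> L(2,3)] unfolding defs .
  interpret M: adapted_rep \<Omega> A p \<tau> z M \<sigma>' z'' \<mu> by unfold_locales (rule M)+
  obtain b where b: "b \<in> \<Omega>" "orb (joint \<sigma>') b = range (\<lambda>v. \<tau> v b)"
    using M.exists_base_point[OF ne] k unfolding defs by blast
  interpret B: based_pair \<Omega> A p \<tau> z M \<sigma>' z'' \<mu> b by unfold_locales (use M(3) b k defs in auto)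
  have "\<not> conjugate_into \<sigma>' z''"
    unfolding defs using conjugate_into_conj[OF gA] not_conj by blast
  then have "M.improvable"
    using M.conjugate_into_if_common_UNIV B.conjugate_into_or_improvable[OF M(4) _ card] by blast
  moreover have "common \<sigma> \<subseteq> common \<sigma>'"
    unfolding defs by (rule N.common_subset_conj[OF gA]) (use N.common_central[OF _ g] in blast)
  ultimately have "\<exists>h\<in>A. \<exists>\<nu>. adapted M (\<lambda>v. conj_perm h (\<sigma>' v)) (conj_perm h z'') \<nu> \<and> common \<sigma> \<subset> common (\<lambda>v. conj_perm h (\<sigma>' v))"
    unfolding M.improvable_def by (meson subset_psubset_trans)
  from that[OF gA defs M(1-3) this] show thesis .
qed

theorem conjugate_into_if_adapted:
  assumes "adapted L \<sigma> z' \<kappa>" "add_subgroup L" "independent_rotations L" and card: "CARD('v) = 32"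
  shows "conjugate_into \<sigma> z'"
  using assms(1-3)
proof (induction "CARD('v) - card (common \<sigma>)" arbitrary: L \<sigma> z' \<kappa> rule: less_induct)
  case less
  show ?case
  proof (rule ccontr)
    assume not_conj: "\<not> ?case"
    then have "\<Omega> \<noteq> {}" unfolding conjugate_into_def using A_id by blast
    from adapted_reduction_step[OF this less.prems card not_conj] obtain g \<sigma>' M z'' h \<nu> where
      g: "g \<in> A" "\<sigma>' = (\<lambda>v. conj_perm g (\<sigma> v))" "z'' = conj_perm g z'" and M: "add_subgroup M" "independent_rotations M"
      and h: "h \<in> A" "adapted M (\<lambda>v. conj_perm h (\<sigma>' v)) (conj_perm h z'') \<nu>" "common \<sigma> \<subset> common (\<lambda>v. conj_perm h (\<sigma>' v))"
      by metis
    have "card (common \<sigma>) < card (common (\<lambda>v. conj_perm h (\<sigma>' v)))" by (rule psubset_card_mono[OF finite h(3)])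
    then have "CARD('v) - card (common (\<lambda>v. conj_perm h (\<sigma>' v))) < CARD('v) - card (common \<sigma>)"
      using card_mono[OF finite subset_UNIV, of "common (\<lambda>v. conj_perm h (\<sigma>' v))"] by linarith
    from conjugate_into_conj[OF h(1) less.hyps[OF this h(2) M]] have "conjugate_into \<sigma>' z''" .
    then show False using conjugate_into_conj[OF g(1)] not_conj unfolding g(2,3) by blast
  qed
qed

end

section \<open>Counting walks of prime length\<close>

context regular_rep
begin

definition shift :: "'v \<times> nat \<Rightarrow> 'a \<Rightarrow> 'a" where
  "shift c x = (z ^^ snd c) (\<tau> (fst c) x)"

lemma shift_mem_A: "shift c \<in> A"
  unfolding shift_def[abs_def] using A_comp[OF z_pow_mem_A \<tau>_mem_A] .

lemma shift_mem: "x \<in> \<Omega> \<Longrightarrow> shift c x \<in> \<Omega>"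
  using A_mem[OF shift_mem_A] .

lemma shift_comm: "shift c (shift d x) = shift d (shift c x)"
  by (simp add: shift_def \<tau>_z_pow funpow_funpow add.commute \<tau>_comm)

lemma exists_shift:
  assumes "x \<in> \<Omega>" "y \<in> \<Omega>" obtains v t where "t < p" "y = shift (v, t) x"
proof -
  obtain v t where "y = (z ^^ t) (\<tau> v x)" using transitive[OF assms] .
  then have "y = shift (v, t mod p) x" by (simp add: shift_def z_pow_mod)
  then show thesis using that p_pos mod_less_divisor by blast
qed

lemma shift_eqD:
  assumes "x \<in> \<Omega>" "shift c x = shift d x" "snd c < p" "snd d < p" shows "c = d"
  using rep_inj_\<tau>[OF assms(1)] rep_inj_z[OF assms(1)] assms(2-4) unfolding shift_def by (metis mod_less prod_eqI)

lemma foldr_shift_mem: "x \<in> \<Omega> \<Longrightarrow> foldr shift cs x \<in> \<Omega>"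
  by (induction cs) (simp_all add: shift_mem)

lemma foldr_shift_rotate1: "foldr shift (rotate1 cs) x = foldr shift cs x"
proof (cases cs)
  case (Cons c cs')
  have "foldr shift cs' (shift c x) = shift c (foldr shift cs' x)"
    by (induction cs') (simp_all add: shift_comm)
  then show ?thesis using Cons by simp
qed simp

lemma foldr_shift_replicate: "foldr shift (replicate p c) x = \<tau> (fst c) x"
proof -
  have "foldr shift (replicate n c) x = (z ^^ (n * snd c)) ((\<tau> (fst c) ^^ n) x)" for n
    by (induction n) (simp_all add: shift_def \<tau>_z_pow funpow_funpow)
  moreover have "(\<tau> v ^^ n) x = (if even n then x else \<tau> v x)" for v n
    by (induction n) (simp_all add: \<tau>_invol)
  ultimately show ?thesis using odd_p z_pow_mod[of "p * snd c"] by simp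
qed

text \<open>The orbital digraph of \<open>(b, x0)\<close> is invariant under \<open>A\<close>; \<open>steps b x0\<close> is its connection set as a Cayley
  digraph of the regular subgroup.\<close>

definition orbital :: "'a \<Rightarrow> 'a \<Rightarrow> 'a \<Rightarrow> 'a \<Rightarrow> bool" where
  "orbital b x0 y w \<longleftrightarrow> (\<exists>a\<in>A. a b = y \<and> a x0 = w)"

definition steps :: "'a \<Rightarrow> 'a \<Rightarrow> ('v \<times> nat) set" where
  "steps b x0 = {c. snd c < p \<and> orbital b x0 b (shift c b)}"

definition walks :: "'a \<Rightarrow> 'a \<Rightarrow> nat \<Rightarrow> 'a \<Rightarrow> ('v \<times> nat) list set" where
  "walks b x0 k w = {cs. length cs = k \<and> set cs \<subseteq> steps b x0 \<and> foldr shift cs b = w}"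

lemma finite_walks: "finite (walks b x0 k w)"
proof -
  have "steps b x0 \<subseteq> UNIV \<times> {..<p}" by (auto simp: steps_def)
  then have "finite (steps b x0)" by (rule finite_subset) simp
  from finite_lists_length_eq[OF this, of k] show ?thesis by (rule rev_finite_subset) (auto simp: walks_def)
qed

lemma orbital_A_iff: assumes a: "a \<in> A" shows "orbital b x0 (a y) (a w) \<longleftrightarrow> orbital b x0 y w"
proof -
  have "orbital b x0 (c y) (c w)" if "orbital b x0 y w" "c \<in> A" for c y w
    using that A_comp[OF that(2)] unfolding orbital_def by force
  then show ?thesis using a A_inv[OF a] by metis
qed

lemma orbital_iff_step:
  assumes b: "b \<in> \<Omega>" and x0: "x0 \<in> \<Omega>" and y: "y \<in> \<Omega>"
  shows "orbital b x0 y w \<longleftrightarrow> (\<exists>c\<in>steps b x0. w = shift c y)"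
proof -
  obtain u r where yb: "y = shift (u, r) b" using exists_shift[OF b y] by blast
  have step_iff: "orbital b x0 y (shift c y) \<longleftrightarrow> orbital b x0 b (shift c b)" for c
    using orbital_A_iff[OF shift_mem_A, of b x0 "(u, r)" b "shift c b"] by (simp add: yb shift_comm[of c])
  show ?thesis
  proof
    assume orb: "orbital b x0 y w"
    then have "w \<in> \<Omega>" using A_mem x0 unfolding orbital_def by blast
    then obtain v t where "t < p" "w = shift (v, t) y" using exists_shift[OF y] by blast
    then show "\<exists>c\<in>steps b x0. w = shift c y" using orb step_iff unfolding steps_def by force
  qed (use step_iff in \<open>auto simp: steps_def\<close>)
qed

lemma card_walks_Suc:
  assumes b: "b \<in> \<Omega>" and x0: "x0 \<in> \<Omega>"
  shows "card (walks b x0 (Suc k) w) = (\<Sum>y\<in>{y \<in> \<Omega>. orbital b x0 y w}. card (walks b x0 k y))"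
proof -
  let ?Y = "{y \<in> \<Omega>. orbital b x0 y w}"
  let ?f = "\<lambda>cs. (foldr shift (tl cs) b, tl cs)"
  have "bij_betw ?f (walks b x0 (Suc k) w) (SIGMA y:?Y. walks b x0 k y)"
    unfolding bij_betw_def
  proof
    show "inj_on ?f (walks b x0 (Suc k) w)"
    proof (rule inj_onI)
      fix cs ds assume cs: "cs \<in> walks b x0 (Suc k) w" and ds: "ds \<in> walks b x0 (Suc k) w" and eq: "?f cs = ?f ds"
      have "cs \<noteq> []" "ds \<noteq> []" "tl cs = tl ds" using cs ds eq by (auto simp: walks_def)
      then obtain c d es where cd: "cs = c # es" "ds = d # es" by (metis list.collapse)
      then have "shift c (foldr shift es b) = shift d (foldr shift es b)" "snd c < p" "snd d < p"
        using cs ds by (auto simp: walks_def steps_def)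
      then show "cs = ds" using shift_eqD[OF foldr_shift_mem[OF b]] cd by simp
    qed
    show "?f ` walks b x0 (Suc k) w = (SIGMA y:?Y. walks b x0 k y)"
    proof (intro equalityI subsetI)
      fix e assume "e \<in> ?f ` walks b x0 (Suc k) w"
      then obtain c cs where "c # cs \<in> walks b x0 (Suc k) w" "e = (foldr shift cs b, cs)"
        unfolding walks_def by (auto simp: length_Suc_conv)
      then show "e \<in> (SIGMA y:?Y. walks b x0 k y)"
        using foldr_shift_mem[OF b, of cs] orbital_iff_step[OF b x0 foldr_shift_mem[OF b, of cs]] unfolding walks_def by auto
    next
      fix e assume "e \<in> (SIGMA y:?Y. walks b x0 k y)"
      then obtain y cs where e: "e = (y, cs)" "y \<in> \<Omega>" "orbital b x0 y w" "cs \<in> walks b x0 k y" by auto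
      then obtain c where "c \<in> steps b x0" "w = shift c y" using orbital_iff_step[OF b x0] by blast
      then have "c # cs \<in> walks b x0 (Suc k) w" "e = ?f (c # cs)" using e by (auto simp: walks_def)
      then show "e \<in> ?f ` walks b x0 (Suc k) w" by (rule rev_image_eqI)
    qed
  qed
  then have "card (walks b x0 (Suc k) w) = card (SIGMA y:?Y. walks b x0 k y)" by (rule bij_betw_same_card)
  then show ?thesis using finite_\<Omega> finite_walks by simp
qed

lemma card_walks_stabilizer:
  assumes b: "b \<in> \<Omega>" and x0: "x0 \<in> \<Omega>" and a: "a \<in> A" "a b = b"
  shows "card (walks b x0 k (a w)) = card (walks b x0 k w)"
proof (induction k arbitrary: w)
  case 0
  have "b = a w \<longleftrightarrow> b = w" using A_inj[OF a(1), of w b] a(2) by auto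
  then have "walks b x0 0 (a w) = walks b x0 0 w" by (auto simp: walks_def)
  then show ?case by (rule arg_cong)
next
  case (Suc k)
  have "bij_betw a {y \<in> \<Omega>. orbital b x0 y w} {y \<in> \<Omega>. orbital b x0 y (a w)}"
    using A_mem[OF a(1)] A_inv_mem[OF a(1)] A_inv(2,3)[OF a(1)] orbital_A_iff[OF a(1)]
      orbital_A_iff[OF a(1), of b x0 "finv a y" w for y]
    by (intro bij_betwI[of _ _ _ "finv a"]) auto
  from sum.reindex_bij_betw[OF this, of "\<lambda>y. card (walks b x0 k y)"]
  show ?case by (simp add: card_walks_Suc[OF b x0] Suc)
qed

text \<open>Cyclic rotation of the steps permutes the walks of length \<open>p\<close>, and its fixed points are the walks with
  constant step.\<close>

lemma p_dvd_card_walks_iff: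
  "p dvd card (walks b x0 p w) \<longleftrightarrow> p dvd card {c \<in> steps b x0. \<tau> (fst c) b = w}" (is "_ \<longleftrightarrow> _ dvd card ?C")
proof -
  let ?W = "walks b x0 p w"
  let ?F = "{cs \<in> ?W. rotate1 cs = cs}"
  have rot: "p dvd card (?W - ?F)"
  proof (rule card_cyclic_nonfixed[OF finite_walks prime_p])
    fix cs assume cs: "cs \<in> ?W"
    then show "rotate1 cs \<in> ?W" by (simp add: walks_def foldr_shift_rotate1)
    show "(rotate1 ^^ p) cs = cs" using cs rotate_id[of p cs] by (auto simp: walks_def simp flip: rotate_def)
  qed
  have F: "?F = replicate p ` ?C"
  proof (intro equalityI subsetI)
    fix cs assume "cs \<in> ?F"
    then have cs: "length cs = p" "set cs \<subseteq> steps b x0" "foldr shift cs b = w" "rotate1 cs = cs"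
      by (auto simp: walks_def)
    then have "card (set cs) = 1" using rotate1_fixpoint_card[of cs] p_pos by auto
    then obtain c where c: "cs = replicate p c" using cs(1) by (auto simp: card_set_1_iff_replicate)
    then have "c \<in> ?C" using cs(2,3) p_pos foldr_shift_replicate[of c b] by auto
    then show "cs \<in> replicate p ` ?C" using c by blast
  next
    fix cs assume "cs \<in> replicate p ` ?C"
    moreover have "rotate1 (replicate p c) = replicate p c" for c :: "'v \<times> nat"
      by (cases p) (simp_all add: replicate_append_same)
    ultimately show "cs \<in> ?F" using foldr_shift_replicate by (auto simp: walks_def)
  qed
  have "card ?F = card ?C" unfolding F using p_pos by (intro card_image inj_onI) (simp add: replicate_eq_replicate)
  moreover have F_subset: "?F \<subseteq> ?W" by blast
  then have "card ?W = card (?W - ?F) + card ?F"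
    using card_Diff_subset[OF finite_subset[OF F_subset finite_walks] F_subset] card_mono[OF finite_walks F_subset] by simp
  ultimately show ?thesis using rot by (simp add: dvd_add_right_iff)
qed

lemma stabilizer_transitive_on_z_orbit:
  assumes b: "b \<in> \<Omega>" and a: "a \<in> A" "a b = b" and out: "\<And>u. a (\<tau> v b) \<noteq> \<tau> u b"
  obtains f where "f \<in> A" "f b = b" "f (shift (v, s) b) = shift (v, t) b"
proof -
  let ?x0 = "shift (v, s) b"
  let ?C = "{c \<in> steps b ?x0. \<tau> (fst c) b = \<tau> v b}"
  note x0 = shift_mem[OF b, of "(v, s)"]
  have "{c \<in> steps b ?x0. \<tau> (fst c) b = a (\<tau> v b)} = {}" using out by (metis (mono_tags, lifting) Collect_empty_eq)
  then have "p dvd card (walks b ?x0 p (a (\<tau> v b)))" by (simp only: p_dvd_card_walks_iff card.empty dvd_0_right)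
  then have p_dvd: "p dvd card ?C" unfolding card_walks_stabilizer[OF b x0 a] p_dvd_card_walks_iff .
  have fst: "c \<in> ?C \<Longrightarrow> fst c = v" for c using \<tau>_eq_iff[OF b] by simp
  have "inj_on snd ?C"
  proof (rule inj_onI)
    fix c d assume "c \<in> ?C" "d \<in> ?C" "snd c = snd d"
    then show "c = d" using fst[of c] fst[of d] by (simp only: prod_eq_iff)
  qed
  then have card_snd: "card (snd ` ?C) = card ?C" by (rule card_image)
  have sub: "snd ` ?C \<subseteq> {..<p}" by (auto simp: steps_def)
  have "orbital b ?x0 b (shift (v, s mod p) b)"
    unfolding orbital_def using A_id by (intro bexI[of _ "\<lambda>x. x"]) (simp_all add: shift_def z_pow_mod)
  then have "(v, s mod p) \<in> ?C" using p_pos by (simp add: steps_def)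
  then have "0 < card (snd ` ?C)" using finite_subset[OF sub] by (auto simp: card_gt_0_iff)
  then have "p \<le> card (snd ` ?C)" using p_dvd unfolding card_snd by (rule dvd_imp_le[rotated])
  then have "snd ` ?C = {..<p}" using card_seteq[OF _ sub] by simp
  then have "t mod p \<in> snd ` ?C" using p_pos by simp
  then obtain c where "c \<in> ?C" "snd c = t mod p" by auto
  then have "orbital b ?x0 b (shift (v, t mod p) b)" using fst[of c] unfolding steps_def by (cases c) auto
  then have "orbital b ?x0 b (shift (v, t) b)" by (simp add: shift_def z_pow_mod)
  then show thesis using that unfolding orbital_def by blast
qed

subsection \<open>Rigid translations\<close>

definition rigid :: "'v set" where
  "rigid = {v. \<forall>x\<in>\<Omega>. \<forall>a\<in>A. a x = x \<longrightarrow> (\<exists>u. a (\<tau> v x) = \<tau> u x)}"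

lemma rigidD: "v \<in> rigid \<Longrightarrow> x \<in> \<Omega> \<Longrightarrow> a \<in> A \<Longrightarrow> a x = x \<Longrightarrow> \<exists>u. a (\<tau> v x) = \<tau> u x"
  unfolding rigid_def by blast

lemma shift_\<tau>: "shift c (\<tau> v x) = \<tau> v (shift c x)"
  by (simp add: shift_def \<tau>_z_pow \<tau>_comm)

lemma rigidI:
  assumes x: "x \<in> \<Omega>" and stab: "\<And>a. a \<in> A \<Longrightarrow> a x = x \<Longrightarrow> \<exists>u. a (\<tau> v x) = \<tau> u x"
  shows "v \<in> rigid"
  unfolding rigid_def
proof (intro CollectI ballI impI)
  fix y a assume y: "y \<in> \<Omega>" and a: "a \<in> A" "a y = y"
  obtain u t where y_eq: "y = shift (u, t) x" using exists_shift[OF x y] by blast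
  let ?g = "shift (u, t)"
  note g = shift_mem_A[of "(u, t)"]
  have "(\<lambda>w. finv ?g (a (?g w))) \<in> A" using A_comp[OF A_inv(1)[OF g] A_comp[OF a(1) g]] .
  from stab[OF this] obtain w where "finv ?g (a (?g (\<tau> v x))) = \<tau> w x"
    using a(2) A_inv(2)[OF g] unfolding y_eq by auto
  from arg_cong[OF this, of ?g] have "a (?g (\<tau> v x)) = ?g (\<tau> w x)" by (simp add: A_inv(3)[OF g])
  then show "\<exists>u. a (\<tau> v y) = \<tau> u y" unfolding y_eq shift_\<tau> by blast
qed

lemma rigid_A:
  assumes a: "a \<in> A" and l: "l \<in> rigid" and x: "x \<in> \<Omega>"
  shows "\<exists>m\<in>rigid. a (\<tau> l x) = \<tau> m (a x)"
proof -
  obtain u t where ax: "a x = shift (u, t) x" using exists_shift[OF x A_mem[OF a x]] by blast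
  let ?g = "shift (u, t)"
  note g = shift_mem_A[of "(u, t)"]
  let ?a = "\<lambda>w. finv ?g (a w)"
  have a': "?a \<in> A" "?a x = x" using A_comp[OF A_inv(1)[OF g] a] A_inv(2)[OF g] ax by auto
  obtain m where m: "?a (\<tau> l x) = \<tau> m x" using rigidD[OF l x a'] by blast
  have "m \<in> rigid"
  proof (rule rigidI[OF x])
    fix c assume c: "c \<in> A" "c x = x"
    then have "c (?a x) = x" using a'(2) by simp
    from rigidD[OF l x A_comp[OF c(1) a'(1)] this] show "\<exists>u. c (\<tau> m x) = \<tau> u x" unfolding m .
  qed
  moreover have "a (\<tau> l x) = \<tau> m (a x)" using arg_cong[OF m, of ?g] by (simp add: A_inv(3)[OF g] ax shift_\<tau>)
  ultimately show ?thesis by blast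
qed

lemma add_subgroup_rigid: "add_subgroup rigid"
  unfolding add_subgroup_def
proof (intro conjI ballI)
  show "0 \<in> rigid" unfolding rigid_def by (auto simp: \<tau>_0 intro: exI[of _ 0])
  fix u v assume u: "u \<in> rigid" and v: "v \<in> rigid"
  show "u + v \<in> rigid" unfolding rigid_def
  proof (intro CollectI ballI impI)
    fix x a assume x: "x \<in> \<Omega>" and a: "a \<in> A" "a x = x"
    obtain m n where "a (\<tau> v x) = \<tau> m x" "a (\<tau> u (\<tau> v x)) = \<tau> n (a (\<tau> v x))"
      using rigid_A[OF a(1) v x] rigid_A[OF a(1) u \<tau>_mem[OF x]] a(2) by metis
    then show "\<exists>w. a (\<tau> (u + v) x) = \<tau> w x" by (metis \<tau>_add)
  qed
qed

lemma stabilizer_z_pow_if_not_same_class: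
  assumes x: "x \<in> \<Omega>" and y: "y \<in> \<Omega>" and far: "\<not> same_class rigid x y"
  obtains f where "f \<in> A" "f x = x" "f y = (z ^^ t) y"
proof -
  obtain v s where y_eq: "y = shift (v, s) x" using exists_shift[OF x y] by blast
  then have "v \<notin> rigid" using far same_classI unfolding shift_def by auto
  then obtain a where "a \<in> A" "a x = x" "\<And>u. a (\<tau> v x) \<noteq> \<tau> u x" using rigidI[OF x] by blast
  then obtain f where "f \<in> A" "f x = x" "f (shift (v, s) x) = shift (v, t + s) x"
    using stabilizer_transitive_on_z_orbit[OF x] by blast
  then show thesis using that unfolding y_eq by (simp add: shift_def funpow_funpow)
qed

subsection \<open>Independent rotations of the rigid classes\<close>

lemma fibre_rotation_mem: "x \<in> \<Omega> \<Longrightarrow> fibre_rotation a x \<in> \<Omega>"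
  unfolding fibre_rotation_def using z_pow_mem by simp

lemma class_constant_fibre_rotation:
  assumes "add_subgroup L" "class_constant L a" "x \<in> \<Omega>" shows "a (fibre_rotation c x) = a x"
  using class_constantD[OF assms(2,3) same_class_z_pow[OF assms(1)]] assms(3) by (simp add: fibre_rotation_def)

lemma fibre_rotation_permutes:
  assumes L: "add_subgroup L" and a: "class_constant L a" shows "fibre_rotation a permutes \<Omega>"
proof (rule permutes_\<Omega>I[OF fibre_rotation_mem])
  show "inj_on (fibre_rotation a) \<Omega>"
  proof (rule inj_onI)
    fix x y assume x: "x \<in> \<Omega>" and y: "y \<in> \<Omega>" and eq: "fibre_rotation a x = fibre_rotation a y"
    have "a x = a y" using class_constant_fibre_rotation[OF L a x, of a] class_constant_fibre_rotation[OF L a y, of a] eq by simp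
    then show "x = y" using eq x y A_inj[OF z_pow_mem_A] by (simp add: fibre_rotation_def)
  qed
qed (simp_all add: fibre_rotation_def)

lemma independent_rotations_rigid: "independent_rotations rigid"
  unfolding independent_rotations_def
proof (intro allI impI)
  fix a assume a: "class_constant rigid a"
  show "fibre_rotation a \<in> A"
  proof (rule two_closed[OF fibre_rotation_permutes[OF add_subgroup_rigid a]])
    fix x y assume x: "x \<in> \<Omega>" and y: "y \<in> \<Omega>"
    show "\<exists>f\<in>A. f x = fibre_rotation a x \<and> f y = fibre_rotation a y"
    proof (cases "same_class rigid x y")
      case True
      then show ?thesis using class_constantD[OF a x] x y z_pow_mem_A by (auto simp: fibre_rotation_def)
    next
      case False
      obtain f where f: "f \<in> A" "f x = x" "f y = (z ^^ (a y + (p - 1) * a x)) y"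
        using stabilizer_z_pow_if_not_same_class[OF x y False] .
      have "a x + (a y + (p - 1) * a x) = a y + p * a x" using p_pos by (cases p) simp_all
      then have "(z ^^ a x) (f y) = (z ^^ a y) y" unfolding f(3) funpow_funpow by (intro z_pow_cong) (simp only: mod_mult_self2)
      then show ?thesis using f(2) x y A_comp[OF z_pow_mem_A f(1)] by (intro bexI[of _ "\<lambda>u. (z ^^ a x) (f u)"]) (simp_all add: fibre_rotation_def)
    qed
  qed
qed

definition linked :: "'a \<Rightarrow> 'a \<Rightarrow> bool" where
  "linked x y \<longleftrightarrow> (\<exists>l\<in>rigid. y = \<tau> l x)"

lemma linkedI: "l \<in> rigid \<Longrightarrow> linked x (\<tau> l x)"
  unfolding linked_def by blast

lemma equivp_linked: "equivp linked"
proof (rule equivpI)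
  show "reflp linked" using linkedI[OF add_subgroup_zero[OF add_subgroup_rigid]] by (simp add: reflp_def \<tau>_0)
  show "symp linked" unfolding linked_def symp_def by (metis \<tau>_invol)
  show "transp linked"
    unfolding linked_def transp_def using add_subgroup_add[OF add_subgroup_rigid] by (metis \<tau>_add)
qed

lemmas linked_refl = equivp_reflp[OF equivp_linked]
  and linked_sym = equivp_symp[OF equivp_linked]
  and linked_trans = equivp_transp[OF equivp_linked]

lemma linked_mem: "x \<in> \<Omega> \<Longrightarrow> linked x y \<Longrightarrow> y \<in> \<Omega>"
  unfolding linked_def using \<tau>_mem by blast

lemma linked_A: "a \<in> A \<Longrightarrow> x \<in> \<Omega> \<Longrightarrow> linked x y \<Longrightarrow> linked (a x) (a y)"
  unfolding linked_def using rigid_A by blast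

lemma linked_A_iff: assumes a: "a \<in> A" and x: "x \<in> \<Omega>" shows "linked (a x) (a y) \<longleftrightarrow> linked x y"
  using linked_A[OF a x, of y] linked_A[OF A_inv(1)[OF a] A_mem[OF a x], of "a y"] A_inv(2)[OF a] by auto

lemma linked_same_class: "linked x y \<Longrightarrow> same_class rigid x y"
  unfolding linked_def using same_classI[of _ rigid x 0] by auto

lemma same_class_rigidE:
  assumes "same_class rigid x y" obtains t where "t < p" "linked ((z ^^ t) x) y"
proof -
  obtain l t where "l \<in> rigid" "y = (z ^^ t) (\<tau> l x)" using assms unfolding same_class_def by blast
  then have "linked ((z ^^ (t mod p)) x) y" using linkedI[of l "(z ^^ t) x"] by (simp add: z_pow_mod \<tau>_z_pow)
  then show thesis using that p_pos mod_less_divisor by blast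
qed

lemma linked_z_pow_iff:
  assumes x: "x \<in> \<Omega>" shows "linked ((z ^^ s) x) ((z ^^ t) x) \<longleftrightarrow> s mod p = t mod p"
proof
  assume "linked ((z ^^ s) x) ((z ^^ t) x)"
  then obtain l where "(z ^^ t) (\<tau> 0 x) = (z ^^ s) (\<tau> l x)" unfolding linked_def by (auto simp: \<tau>_z_pow \<tau>_0)
  from rep_inj_z[OF x this] show "s mod p = t mod p" by simp
next
  assume "s mod p = t mod p"
  then show "linked ((z ^^ s) x) ((z ^^ t) x)" using z_pow_cong linked_refl by metis
qed

end

section \<open>Correlations modulo a prime\<close>

definition forward_difference :: "(nat \<Rightarrow> int) \<Rightarrow> nat \<Rightarrow> int" where
  "forward_difference f t = f (Suc t) - f t"

lemma forward_difference_funpow: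
  "(forward_difference ^^ k) f t = (\<Sum>i\<le>k. (- 1) ^ (k + i) * int (k choose i) * f (t + i))"
proof (induction k arbitrary: t)
  case (Suc k)
  let ?g = "\<lambda>i. (- 1) ^ (k + i) * int (k choose i) * f (Suc t + i)"
  let ?h = "\<lambda>i. (- 1) ^ (Suc k + i) * int (k choose i) * f (t + i)"
  have "(forward_difference ^^ Suc k) f t = (\<Sum>i\<le>k. ?g i) - (\<Sum>i\<le>k. (- 1) ^ (k + i) * int (k choose i) * f (t + i))"
    by (simp add: forward_difference_def Suc)
  also have "\<dots> = (\<Sum>i\<le>k. ?g i) + (\<Sum>i\<le>k. ?h i)" by (simp add: sum_negf)
  also have "(\<Sum>i\<le>k. ?h i) = (\<Sum>i\<le>Suc k. ?h i)" by simp
  also have "\<dots> = ?h 0 + (\<Sum>i\<le>k. ?h (Suc i))" by (rule sum.atMost_Suc_shift)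
  also have "(\<Sum>i\<le>k. ?g i) + (?h 0 + (\<Sum>i\<le>k. ?h (Suc i))) = ?h 0 + (\<Sum>i\<le>k. ?g i + ?h (Suc i))"
    by (simp add: sum.distrib)
  also have "\<dots> = (- 1) ^ (Suc k + 0) * int (Suc k choose 0) * f (t + 0) +
      (\<Sum>i\<le>k. (- 1) ^ (Suc k + Suc i) * int (Suc k choose Suc i) * f (t + Suc i))"
    by (simp add: algebra_simps)
  also have "\<dots> = (\<Sum>i\<le>Suc k. (- 1) ^ (Suc k + i) * int (Suc k choose i) * f (t + i))"
    by (rule sum.atMost_Suc_shift[symmetric])
  finally show ?case .
qed simp

lemma prime_dvd_forward_difference_funpow:
  fixes p :: nat
  assumes p: "prime p" "odd p" and per: "\<And>t. f (t + p) = f t"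
  shows "int p dvd (forward_difference ^^ p) f t"
proof -
  let ?g = "\<lambda>i. (- 1) ^ (p + i) * int (p choose i) * f (t + i)"
  have p0: "p > 0" using p prime_gt_0_nat by blast
  then have "{..p} = insert 0 (insert p {1..<p})" by auto
  then have "sum ?g {..p} = (?g 0 + ?g p) + sum ?g {1..<p}" using p0 by simp
  moreover have "?g 0 + ?g p = 0" using per[of t] p(2) by simp
  moreover have "int p dvd sum ?g {1..<p}"
  proof (rule dvd_sum)
    fix i assume "i \<in> {1..<p}"
    then have "p dvd (p choose i)" using p by (intro dvd_choose_prime) auto
    then show "int p dvd ?g i" by (intro dvd_mult2 dvd_mult) simp
  qed
  ultimately show ?thesis unfolding forward_difference_funpow by (simp only: add_0)
qed

text \<open>The forward difference preserves these sequences, and its \<open>p\<close>-th power is 0 modulo \<open>p\<close>.\<close>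

definition uncorrelated :: "nat \<Rightarrow> (nat \<Rightarrow> int) \<Rightarrow> (nat \<Rightarrow> int) set" where
  "uncorrelated p n = {d. (\<forall>t. d (t + p) = d t) \<and> (\<forall>t. (\<Sum>s<p. d s * n (t + s)) = 0)}"

lemma uncorrelated_forward_difference:
  assumes p: "p > 0" and n: "\<And>t. n (t + p) = n t" and d: "d \<in> uncorrelated p n"
  shows "forward_difference d \<in> uncorrelated p n"
proof -
  have per: "d (t + p) = d t" and zero: "(\<Sum>s<p. d s * n (t + s)) = 0" for t
    using d unfolding uncorrelated_def by blast+
  have "(\<Sum>s<p. d (Suc s) * n (t + s)) = 0" for t
  proof -
    let ?h = "\<lambda>s. d s * n (t + (p - 1) + s)"
    have "n (t + s) = n (t + (p - 1) + Suc s)" for s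
      using n[of "t + s"] p by (simp add: add.assoc add.left_commute add.commute)
    then have "(\<Sum>s<p. d (Suc s) * n (t + s)) = (\<Sum>s<p. ?h (Suc s))" by simp
    moreover have "?h 0 + (\<Sum>s<p. ?h (Suc s)) = (\<Sum>s<p. ?h s) + ?h p"
      using sum.lessThan_Suc_shift[of ?h p] sum.lessThan_Suc[of ?h p] by simp
    moreover have "?h p = ?h 0" using per[of 0] n[of "t + (p - 1)"] by simp
    ultimately show ?thesis using zero[of "t + (p - 1)"] by simp
  qed
  then have "(\<Sum>s<p. forward_difference d s * n (t + s)) = 0" for t
    using zero[of t] by (simp add: forward_difference_def left_diff_distrib sum_subtractf)
  moreover have "forward_difference d (t + p) = forward_difference d t" for t
    using per[of t] per[of "Suc t"] by (simp add: forward_difference_def)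
  ultimately show ?thesis unfolding uncorrelated_def by blast
qed

lemma prime_dvd_uncorrelated:
  fixes p :: nat
  assumes p: "prime p" "odd p" and n: "\<And>t. n (t + p) = n t" "\<not> int p dvd (\<Sum>s<p. n s)"
    and d: "d \<in> uncorrelated p n"
  shows "int p dvd d s"
proof (rule ccontr)
  assume s: "\<not> int p dvd d s"
  define P where "P k \<longleftrightarrow> (\<forall>t. int p dvd (forward_difference ^^ k) d t)" for k
  have "P p" using prime_dvd_forward_difference_funpow[OF p, of d] d unfolding P_def uncorrelated_def by blast
  moreover have "\<not> P 0" using s unfolding P_def by auto
  ultimately obtain m where m: "P (Suc m)" "\<not> P m" by (metis not0_implies_Suc LeastI not_less_Least lessI)
  define e where "e = (forward_difference ^^ m) d"
  have e: "e \<in> uncorrelated p n"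
    unfolding e_def using p(1) n(1) d
    by (induction m) (simp_all add: uncorrelated_forward_difference prime_gt_0_nat)
  have step: "int p dvd e (Suc t) - e t" for t using m(1) unfolding P_def e_def by (simp add: forward_difference_def)
  have const: "int p dvd e t - e 0" for t
  proof (induction t)
    case (Suc t)
    from dvd_add[OF step[of t] Suc] show ?case by simp
  qed simp
  have "(\<Sum>s<p. e s * n (0 + s)) = 0" using e unfolding uncorrelated_def by blast
  moreover have "(\<Sum>s<p. (e s - e 0) * n s) = (\<Sum>s<p. e s * n s) - e 0 * (\<Sum>s<p. n s)"
    by (simp add: left_diff_distrib sum_subtractf sum_distrib_left)
  moreover have "int p dvd (\<Sum>s<p. (e s - e 0) * n s)" by (rule dvd_sum) (use const in auto)
  ultimately have "int p dvd e 0 * (\<Sum>s<p. n s)" by simp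
  then have "int p dvd e 0" using n(2) p by (simp add: prime_dvd_mult_iff)
  then have "int p dvd e t" for t using dvd_add[OF const[of t]] by force
  then show False using m(2) unfolding P_def e_def by blast
qed

text \<open>In other words, \<open>n\<close> is a unit in the localisation at \<open>p\<close> of the group ring of a cyclic group of order \<open>p\<close>.\<close>

lemma uncorrelated_eq_0:
  fixes p :: nat
  assumes p: "prime p" "odd p" and n: "\<And>t. n (t + p) = n t" "\<not> int p dvd (\<Sum>s<p. n s)"
    and d: "d \<in> uncorrelated p n"
  shows "d s = 0"
proof (rule ccontr)
  assume nonzero: "d s \<noteq> 0"
  have p1: "p > 1" using p prime_gt_1_nat by blast
  have "d \<in> uncorrelated p n \<Longrightarrow> int p ^ k dvd d s" for k d
  proof (induction k arbitrary: d)
    case (Suc k)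
    define e where "e s = d s div int p" for s
    have d_eq: "d s = int p * e s" for s unfolding e_def using prime_dvd_uncorrelated[OF p n Suc.prems, of s] by simp
    have "int p * (\<Sum>s<p. e s * n (t + s)) = 0" for t
      using Suc.prems unfolding uncorrelated_def by (simp add: sum_distrib_left d_eq mult.assoc)
    then have "e \<in> uncorrelated p n" using Suc.prems p1 unfolding uncorrelated_def by (auto simp: e_def)
    from Suc.IH[OF this] show ?case unfolding d_eq by simp
  qed simp
  from dvd_imp_le_int[OF nonzero this[OF d, of "nat \<bar>d s\<bar>"]] have "int p ^ nat \<bar>d s\<bar> \<le> \<bar>d s\<bar>" by simp
  moreover have "nat \<bar>d s\<bar> < p ^ nat \<bar>d s\<bar>" using p1 by (intro power_gt_expt) simp
  then have "\<bar>d s\<bar> < int (p ^ nat \<bar>d s\<bar>)" by linarith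
  ultimately show False by simp
qed

lemma signs_constant_if_prime_dvd_sum:
  fixes g :: "nat \<Rightarrow> int" and p :: nat
  assumes p: "prime p" "odd p" and g: "\<And>t. g t = 1 \<or> g t = - 1" and dvd: "int p dvd (\<Sum>t<p. g t)"
    and "s < p" "t < p"
  shows "g s = g t"
proof -
  define P where "P = {t \<in> {..<p}. g t = 1}"
  have P: "finite P" "P \<subseteq> {..<p}" unfolding P_def by auto
  have "(\<Sum>t<p. g t) = (\<Sum>t<p. 2 * (if t \<in> P then 1 else 0) - 1)"
    using g unfolding P_def by (intro sum.cong) auto
  also have "\<dots> = 2 * int (card P) - int p"
    using P by (simp add: sum_subtractf sum.If_cases Int_absorb1 flip: sum_distrib_left)
  finally have "int p dvd 2 * int (card P) - int p" using dvd by simp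
  from dvd_add[OF this dvd_refl] have "int p dvd int (2 * card P)" by simp
  then have "p dvd 2 * card P" by (simp only: of_nat_dvd_iff)
  then have "p dvd card P" using p prime_dvd_mult_iff[OF p(1)] primes_dvd_imp_eq[OF p(1) two_is_prime_nat] by auto
  then consider (negative) "card P = 0" | (positive) "card P \<ge> p" using dvd_imp_le by blast
  then show ?thesis
  proof cases
    case negative
    then have "g t = - 1" if "t < p" for t using P that g[of t] unfolding P_def by auto
    then show ?thesis using assms by simp
  next
    case positive
    then have "P = {..<p}" using card_seteq[OF _ P(2)] by simp
    then have "g t = 1" if "t < p" for t using that unfolding P_def by blast
    then show ?thesis using assms by simp
  qed
qed

section \<open>Characters and orbits within a class\<close>

context regular_rep
begin

lemma vcoord_shift: "b \<in> \<Omega> \<Longrightarrow> x \<in> \<Omega> \<Longrightarrow> vcoord b (shift c x) = fst c + vcoord b x"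
  by (simp add: shift_def vcoord_z_pow_\<tau>_add)

lemma vcoord_shift_base: "b \<in> \<Omega> \<Longrightarrow> vcoord b (shift c b) = fst c"
  by (simp add: shift_def vcoord_z_pow_\<tau>)

lemma zcoord_shift_base: "b \<in> \<Omega> \<Longrightarrow> zcoord b (shift c b) = snd c mod p"
  by (simp add: shift_def zcoord_z_pow_\<tau>)

lemma shift_coordinates: "b \<in> \<Omega> \<Longrightarrow> x \<in> \<Omega> \<Longrightarrow> shift (vcoord b x, zcoord b x) b = x"
  using coordinates by (simp add: shift_def)

lemma shift_shift: "shift c (shift d x) = shift (fst c + fst d, snd c + snd d) x"
  by (simp add: shift_def \<tau>_z_pow funpow_funpow \<tau>_add)

lemma shift_add_p: "shift (l, t + p) x = shift (l, t) x"
  unfolding shift_def by (simp add: z_pow_cong[of "t + p" t])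

abbreviation same_rigid_class :: "'a \<Rightarrow> 'a \<Rightarrow> bool" where
  "same_rigid_class \<equiv> same_class rigid"

lemmas same_rigid_class_refl = equivp_reflp[OF equivp_same_class[OF add_subgroup_rigid]]
  and same_rigid_class_sym = equivp_symp[OF equivp_same_class[OF add_subgroup_rigid]]
  and same_rigid_class_trans = equivp_transp[OF equivp_same_class[OF add_subgroup_rigid]]

lemma same_rigid_class_z_pow: "same_rigid_class x ((z ^^ t) x)"
  using same_class_z_pow[OF add_subgroup_rigid] .

lemma same_rigid_class_iff:
  assumes "b \<in> \<Omega>" "x \<in> \<Omega>" shows "same_rigid_class b x \<longleftrightarrow> vcoord b x \<in> rigid"
  using same_class_iff_vcoord[OF assms(1,1,2)] vcoord_\<tau>_base[OF assms(1), of 0] by (simp add: \<tau>_0)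

lemma sum_same_rigid_class:
  fixes g :: "'a \<Rightarrow> int"
  assumes b: "b \<in> \<Omega>"
  shows "(\<Sum>u | same_rigid_class b u. g u) = (\<Sum>l\<in>rigid. \<Sum>t<p. g (shift (l, t) b))"
proof -
  have mem: "u \<in> \<Omega>" if "same_rigid_class b u" for u using same_class_mem[OF b that] .
  have "bij_betw (\<lambda>c. shift c b) (rigid \<times> {..<p}) {u. same_rigid_class b u}"
  proof (rule bij_betwI[where g = "\<lambda>u. (vcoord b u, zcoord b u)"])
    show "(\<lambda>c. shift c b) \<in> rigid \<times> {..<p} \<rightarrow> {u. same_rigid_class b u}"
      using same_rigid_class_iff[OF b shift_mem[OF b]] vcoord_shift_base[OF b] by auto
    show "(\<lambda>u. (vcoord b u, zcoord b u)) \<in> {u. same_rigid_class b u} \<rightarrow> rigid \<times> {..<p}"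
      using same_rigid_class_iff[OF b] mem zcoord_less[OF b] by auto
    show "(vcoord b (shift c b), zcoord b (shift c b)) = c" if "c \<in> rigid \<times> {..<p}" for c
      using that vcoord_shift_base[OF b] zcoord_shift_base[OF b] by (cases c) simp
    show "shift (vcoord b u, zcoord b u) b = u" if "u \<in> {u. same_rigid_class b u}" for u
      using that shift_coordinates[OF b mem] by simp
  qed
  from sum.reindex_bij_betw[OF this, of g] show ?thesis by (simp add: sum.cartesian_product split_beta)
qed

definition class_preserving :: "('a \<Rightarrow> 'a) set" where
  "class_preserving = {a \<in> A. \<forall>x\<in>\<Omega>. same_rigid_class x (a x)}"

lemma class_preserving_mem_A: "f \<in> class_preserving \<Longrightarrow> f \<in> A"
  and class_preserving_same_class: "f \<in> class_preserving \<Longrightarrow> x \<in> \<Omega> \<Longrightarrow> same_rigid_class x (f x)"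
  unfolding class_preserving_def by auto

lemma perm_group_class_preserving: "perm_group \<Omega> class_preserving"
proof (rule perm_groupI)
  show "f permutes \<Omega>" if "f \<in> class_preserving" for f using A_permutes[OF class_preserving_mem_A[OF that]] .
  show "id \<in> class_preserving"
    unfolding class_preserving_def using perm_groupD(2)[OF perm_group_A] same_rigid_class_refl by simp
  show "f \<circ> g \<in> class_preserving" if f: "f \<in> class_preserving" and g: "g \<in> class_preserving" for f g
  proof -
    have "same_rigid_class x (f (g x))" if "x \<in> \<Omega>" for x
      using same_rigid_class_trans[OF class_preserving_same_class[OF g that]]
        class_preserving_same_class[OF f A_mem[OF class_preserving_mem_A[OF g] that]] by blast
    then show ?thesis
      using perm_groupD(3)[OF perm_group_A class_preserving_mem_A[OF f] class_preserving_mem_A[OF g]]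
      unfolding class_preserving_def by simp
  qed
  show "finv f \<in> class_preserving" if "f \<in> class_preserving" for f
  proof -
    note f = class_preserving_mem_A[OF that]
    have "same_rigid_class x (finv f x)" if "x \<in> \<Omega>" for x
      using class_preserving_same_class[OF \<open>f \<in> class_preserving\<close> A_inv_mem[OF f that]] A_inv(3)[OF f]
        same_rigid_class_sym by metis
    then show ?thesis unfolding class_preserving_def using A_inv(1)[OF f] by blast
  qed
qed

lemma class_preserving_comp:
  "f \<in> class_preserving \<Longrightarrow> g \<in> class_preserving \<Longrightarrow> (\<lambda>x. f (g x)) \<in> class_preserving"
  using perm_group_mult_mem[OF perm_group_class_preserving] .

lemma class_preserving_inv: "f \<in> class_preserving \<Longrightarrow> finv f \<in> class_preserving"
  using perm_groupD(4)[OF perm_group_class_preserving] .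

lemma class_preserving_id: "(\<lambda>x. x) \<in> class_preserving"
  using perm_groupD(2)[OF perm_group_class_preserving] by (simp add: id_def)

lemma class_preserving_mem: "f \<in> class_preserving \<Longrightarrow> x \<in> \<Omega> \<Longrightarrow> f x \<in> \<Omega>"
  using A_mem[OF class_preserving_mem_A] .

lemma shift_class_preserving: "l \<in> rigid \<Longrightarrow> shift (l, t) \<in> class_preserving"
  unfolding class_preserving_def using shift_mem_A same_classI by (simp add: shift_def)

lemma z_class_preserving: "z \<in> class_preserving"
  unfolding class_preserving_def using z_mem_A same_rigid_class_z_pow[of _ 1] by simp

definition class_stabilizer :: "'a \<Rightarrow> ('a \<Rightarrow> 'a) set" where
  "class_stabilizer b = {f \<in> class_preserving. f b = b}"

lemma perm_group_class_stabilizer: "perm_group \<Omega> (class_stabilizer b)"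
  unfolding class_stabilizer_def
proof (rule perm_groupI)
  show "finv f \<in> {f \<in> class_preserving. f b = b}" if "f \<in> {f \<in> class_preserving. f b = b}" for f
    using that class_preserving_inv[of f] perm_group_inv_apply(1)[OF perm_group_class_preserving, of f b] by simp
qed (use perm_groupD[OF perm_group_class_preserving] in auto)

definition z_invariant :: "'a \<Rightarrow> ('v \<Rightarrow> int) \<Rightarrow> bool" where
  "z_invariant b \<chi> \<longleftrightarrow>
     (\<forall>f\<in>class_preserving. \<forall>u. same_rigid_class b u \<longrightarrow> \<chi> (vcoord b (f (z u))) = \<chi> (vcoord b (f u)))"

definition char_correlation :: "'a \<Rightarrow> ('v \<Rightarrow> int) \<Rightarrow> ('v \<Rightarrow> int) \<Rightarrow> ('a \<Rightarrow> 'a) \<Rightarrow> nat \<Rightarrow> int" where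
  "char_correlation b \<chi> \<psi> f t = (\<Sum>l\<in>rigid. \<chi> l * \<psi> (vcoord b (f (shift (l, t) b))))"

context
  fixes b assumes b: "b \<in> \<Omega>"
begin

lemma sum_not_divisible_on_z_orbit:
  assumes \<chi>: "\<chi> \<in> sign_chars" and "\<not> z_invariant b \<chi>"
  obtains f l where "f \<in> class_preserving" "l \<in> rigid" "\<not> int p dvd (\<Sum>t<p. \<chi> (vcoord b (f (shift (l, t) b))))"
proof -
  obtain f u where f: "f \<in> class_preserving" "same_rigid_class b u" "\<chi> (vcoord b (f (z u))) \<noteq> \<chi> (vcoord b (f u))"
    using assms(2) unfolding z_invariant_def by blast
  define l where "l = vcoord b u"
  define g where "g t = \<chi> (vcoord b (f (shift (l, t) b)))" for t
  note u = same_class_mem[OF b f(2)]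
  have g_mod: "g (t mod p) = g t" for t unfolding g_def by (simp add: shift_def z_pow_mod)
  have "z u = shift (l, Suc (zcoord b u)) b"
    using arg_cong[OF shift_coordinates[OF b u], of z] unfolding l_def by (simp add: shift_def)
  then have "g (zcoord b u) \<noteq> g (Suc (zcoord b u))"
    unfolding g_def using f(3) shift_coordinates[OF b u] unfolding l_def by simp
  then have "\<not> int p dvd (\<Sum>t<p. g t)"
    using signs_constant_if_prime_dvd_sum[OF prime_p odd_p, of g "zcoord b u mod p" "Suc (zcoord b u) mod p"]
      sign_char_cases[OF \<chi>] p_pos g_mod unfolding g_def by auto
  moreover have "l \<in> rigid" unfolding l_def using same_rigid_class_iff[OF b u] f(2) by blast
  ultimately show thesis using that f(1) unfolding g_def by blast
qed

lemma exists_correlated_char: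
  assumes \<chi>: "\<chi> \<in> sign_chars" and "\<not> z_invariant b \<chi>"
  obtains f \<psi> where "f \<in> class_preserving" "\<psi> \<in> sign_chars"
    "\<not> int p dvd (\<Sum>u | same_rigid_class b u. \<chi> (vcoord b (f u)) * \<psi> (vcoord b u))"
proof -
  obtain f l where f: "f \<in> class_preserving" "l \<in> rigid" "\<not> int p dvd (\<Sum>t<p. \<chi> (vcoord b (f (shift (l, t) b))))"
    using sum_not_divisible_on_z_orbit[OF assms] .
  define S where "S m = (if m \<in> rigid then \<Sum>t<p. \<chi> (vcoord b (f (shift (m, t) b))) else 0)" for m
  have "\<exists>\<psi>\<in>sign_chars. \<not> int p dvd (\<Sum>m\<in>UNIV. S m * \<psi> m)"
  proof (rule ccontr)
    assume "\<not> ?thesis"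
    then have "int p dvd (\<Sum>\<psi>\<in>sign_chars. \<psi> l * (\<Sum>m\<in>UNIV. S m * \<psi> m))" by (intro dvd_sum; intro dvd_mult) blast
    then have "int p dvd int CARD('v) * S l" unfolding fourier_inversion .
    moreover have "\<not> int p dvd int CARD('v)"
      using not_p_dvd_card_add_subgroup[OF add_subgroup_UNIV, where 'v = 'v] by simp
    ultimately show False using f(2,3) prime_p by (simp add: S_def prime_dvd_mult_iff)
  qed
  then obtain \<psi> where \<psi>: "\<psi> \<in> sign_chars" "\<not> int p dvd (\<Sum>m\<in>UNIV. S m * \<psi> m)" by blast
  have "(\<Sum>m\<in>UNIV. S m * \<psi> m) = (\<Sum>m\<in>rigid. S m * \<psi> m)"
    by (rule sum.mono_neutral_right) (auto simp: S_def)
  also have "\<dots> = (\<Sum>u | same_rigid_class b u. \<chi> (vcoord b (f u)) * \<psi> (vcoord b u))"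
    unfolding sum_same_rigid_class[OF b]
    by (rule sum.cong[OF refl]) (simp add: S_def sum_distrib_right vcoord_shift_base[OF b])
  finally show thesis using that f(1) \<psi> by metis
qed

lemma sum_char_correlation:
  assumes f: "f \<in> class_preserving"
  shows "(\<Sum>t<p. char_correlation b \<chi> \<psi> (finv f) t)
    = (\<Sum>u | same_rigid_class b u. \<chi> (vcoord b (f u)) * \<psi> (vcoord b u))"
proof -
  let ?C = "{u. same_rigid_class b u}"
  note fA = class_preserving_mem_A[OF f]
  have "same_rigid_class b (g u)" if "g \<in> class_preserving" "same_rigid_class b u" for g u
    using that same_rigid_class_trans class_preserving_same_class same_class_mem[OF b] by blast
  then have "bij_betw (finv f) ?C ?C"
    using f class_preserving_inv[OF f] by (intro bij_betwI[where g = f]) (auto simp: A_inv[OF fA])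
  from sum.reindex_bij_betw[OF this, of "\<lambda>u. \<chi> (vcoord b (f u)) * \<psi> (vcoord b u)"]
  have "(\<Sum>u\<in>?C. \<chi> (vcoord b (f u)) * \<psi> (vcoord b u)) = (\<Sum>u\<in>?C. \<chi> (vcoord b u) * \<psi> (vcoord b (finv f u)))"
    by (simp add: A_inv[OF fA])
  also have "\<dots> = (\<Sum>l\<in>rigid. \<Sum>t<p. \<chi> l * \<psi> (vcoord b (finv f (shift (l, t) b))))"
    unfolding sum_same_rigid_class[OF b] by (simp add: vcoord_shift_base[OF b])
  also have "\<dots> = (\<Sum>t<p. char_correlation b \<chi> \<psi> (finv f) t)" unfolding char_correlation_def by (rule sum.swap)
  finally show ?thesis by simp
qed

lemma char_correlation_shift:
  assumes \<chi>: "\<chi> \<in> sign_chars" and x: "same_rigid_class b x"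
  shows "\<chi> (vcoord b x) * char_correlation b \<chi> \<psi> f (t + zcoord b x)
    = (\<Sum>l\<in>rigid. \<chi> l * \<psi> (vcoord b (f (shift (l, t) x))))"
proof -
  note xO = same_class_mem[OF b x]
  define v where "v = vcoord b x"
  have v: "v \<in> rigid" unfolding v_def using same_rigid_class_iff[OF b xO] x by blast
  have x_eq: "shift (l + v, t + zcoord b x) b = shift (l, t) x" for l
    using shift_shift[of "(l, t)" "(v, zcoord b x)" b] shift_coordinates[OF b xO] by (simp add: v_def)
  have "bij_betw (\<lambda>l. l + v) rigid rigid"
    using add_subgroup_add[OF add_subgroup_rigid _ v] by (intro bij_betwI[where g = "\<lambda>l. l + v"]) (auto simp: add.assoc)
  from sum.reindex_bij_betw[OF this, of "\<lambda>l. \<chi> l * \<psi> (vcoord b (f (shift (l, t + zcoord b x) b)))"]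
  have "char_correlation b \<chi> \<psi> f (t + zcoord b x) = (\<Sum>l\<in>rigid. \<chi> v * (\<chi> l * \<psi> (vcoord b (f (shift (l, t) x)))))"
    unfolding char_correlation_def x_eq by (simp add: sign_char_add[OF \<chi>] ac_simps)
  then show ?thesis
    unfolding v_def by (simp add: sum_distrib_left sign_char_square[OF \<chi>] flip: mult.assoc)
qed

text \<open>For a sign character \<open>\<psi>\<close> the sum over an orbit of the stabilizer of \<open>b\<close> is an eigenvalue of the orbital.\<close>

lemma sum_orb_class_stabilizer:
  assumes g: "g \<in> class_preserving" and \<psi>: "\<psi> \<in> sign_chars" and y: "y \<in> \<Omega>"
  shows "(\<Sum>x\<in>orb (class_stabilizer b) y. \<psi> (vcoord b (g x)))
    = (\<Sum>x\<in>orb (class_stabilizer b) y. \<psi> (vcoord b x)) * \<psi> (vcoord b (g b))"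
proof -
  let ?X = "orb (class_stabilizer b) y"
  note stab = perm_group_class_stabilizer[of b]
  note gb = class_preserving_mem[OF g b]
  define h where "h = shift (vcoord b (g b), zcoord b (g b))"
  have h: "h \<in> class_preserving" "h b = g b"
    unfolding h_def using shift_class_preserving same_rigid_class_iff[OF b gb] class_preserving_same_class[OF g b]
      shift_coordinates[OF b gb] by auto
  note hA = class_preserving_mem_A[OF h(1)]
  define f where "f x = finv h (g x)" for x
  have f: "f \<in> class_stabilizer b"
    unfolding class_stabilizer_def f_def
    using class_preserving_comp[OF class_preserving_inv[OF h(1)] g] A_inv(2)[OF hA, of b] h(2) by simp
  have "f ` ?X = ?X"
  proof
    have "orb (class_stabilizer b) (f x) = orb (class_stabilizer b) x" for x using orb_eq[OF stab orbI[OF f]] .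
    then show "f ` ?X \<subseteq> ?X" using orb_self[OF stab] orb_eq[OF stab] by blast
    then show "?X \<subseteq> f ` ?X"
      using endo_inj_surj[OF finite_subset[OF orb_subset[OF stab y] finite_\<Omega>]]
        inj_on_subset[OF permutes_inj[OF perm_groupD(1)[OF stab f]]] by blast
  qed
  then have bij: "bij_betw f ?X ?X"
    using inj_on_subset[OF permutes_inj[OF perm_groupD(1)[OF stab f]]] unfolding bij_betw_def by blast
  have "\<psi> (vcoord b (g x)) = \<psi> (vcoord b (g b)) * \<psi> (vcoord b (f x))" if x: "x \<in> ?X" for x
  proof -
    have "f x \<in> \<Omega>" using x orb_subset[OF stab y] permutes_in_image[OF perm_groupD(1)[OF stab f]] by blast
    moreover have "g x = h (f x)" unfolding f_def A_inv(3)[OF hA] ..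
    ultimately show ?thesis unfolding h_def by (simp add: vcoord_shift[OF b] sign_char_add[OF \<psi>])
  qed
  then have "(\<Sum>x\<in>?X. \<psi> (vcoord b (g x))) = \<psi> (vcoord b (g b)) * (\<Sum>x\<in>?X. \<psi> (vcoord b (f x)))"
    by (simp add: sum_distrib_left)
  then show ?thesis using sum.reindex_bij_betw[OF bij, of "\<lambda>x. \<psi> (vcoord b x)"] by (simp add: mult.commute)
qed

definition layer_sum :: "'a set \<Rightarrow> ('v \<Rightarrow> int) \<Rightarrow> nat \<Rightarrow> int" where
  "layer_sum X \<chi> s = (\<Sum>l\<in>UNIV. (if shift (l, s) b \<in> X then 1 else 0) * \<chi> l)"

lemma sum_layer_sum:
  fixes n :: "nat \<Rightarrow> int"
  assumes X: "X \<subseteq> \<Omega>"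
  shows "(\<Sum>s<p. layer_sum X \<chi> s * n s) = (\<Sum>x\<in>X. \<chi> (vcoord b x) * n (zcoord b x))"
proof -
  have "(\<Sum>x\<in>X. \<chi> (vcoord b x) * n (zcoord b x)) = (\<Sum>(s, l)\<in>{(s, l). s < p \<and> shift (l, s) b \<in> X}. \<chi> l * n s)"
  proof (rule sum.reindex_bij_witness[where i = "\<lambda>(s, l). shift (l, s) b" and j = "\<lambda>x. (zcoord b x, vcoord b x)"])
    fix x assume x: "x \<in> X"
    then have "x \<in> \<Omega>" using X by blast
    then show "(case (zcoord b x, vcoord b x) of (s, l) \<Rightarrow> shift (l, s) b) = x"
      "(zcoord b x, vcoord b x) \<in> {(s, l). s < p \<and> shift (l, s) b \<in> X}"
      using shift_coordinates[OF b] zcoord_less[OF b] x by simp_all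
  qed (auto simp: vcoord_shift_base[OF b] zcoord_shift_base[OF b])
  also have "\<dots> = (\<Sum>(s, l)\<in>{..<p} \<times> UNIV. (if shift (l, s) b \<in> X then 1 else 0) * \<chi> l * n s)"
    by (rule sum.mono_neutral_cong_left) (auto split: if_splits)
  also have "\<dots> = (\<Sum>s<p. layer_sum X \<chi> s * n s)"
    by (simp add: layer_sum_def sum_distrib_right sum.cartesian_product)
  finally show ?thesis by simp
qed

lemma layer_sum_correlation:
  assumes \<chi>: "\<chi> \<in> sign_chars" and \<psi>: "\<psi> \<in> sign_chars" and f: "f \<in> class_preserving" and y: "same_rigid_class b y"
  defines "X \<equiv> orb (class_stabilizer b) y"
  shows "(\<Sum>s<p. layer_sum X \<chi> s * char_correlation b \<chi> \<psi> f (t + s))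
    = (\<Sum>x\<in>X. \<psi> (vcoord b x)) * char_correlation b \<chi> \<psi> f t"
proof -
  note yO = same_class_mem[OF b y]
  have X: "X \<subseteq> \<Omega>" unfolding X_def by (rule orb_subset[OF perm_group_class_stabilizer yO])
  have in_class: "same_rigid_class b x" if x: "x \<in> X" for x
  proof -
    obtain h where "h \<in> class_preserving" "x = h y" using x unfolding X_def orb_def class_stabilizer_def by blast
    then show ?thesis using class_preserving_same_class[OF _ yO] same_rigid_class_trans[OF y] by simp
  qed
  have "(\<Sum>s<p. layer_sum X \<chi> s * char_correlation b \<chi> \<psi> f (t + s))
      = (\<Sum>x\<in>X. \<chi> (vcoord b x) * char_correlation b \<chi> \<psi> f (t + zcoord b x))" by (rule sum_layer_sum[OF X])
  also have "\<dots> = (\<Sum>x\<in>X. \<Sum>l\<in>rigid. \<chi> l * \<psi> (vcoord b (f (shift (l, t) x))))"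
    by (rule sum.cong[OF refl]) (rule char_correlation_shift[OF \<chi> in_class])
  also have "\<dots> = (\<Sum>l\<in>rigid. \<chi> l * (\<Sum>x\<in>X. \<psi> (vcoord b (f (shift (l, t) x)))))"
    unfolding sum_distrib_left by (rule sum.swap)
  also have "\<dots> = (\<Sum>l\<in>rigid. \<chi> l * ((\<Sum>x\<in>X. \<psi> (vcoord b x)) * \<psi> (vcoord b (f (shift (l, t) b)))))"
    unfolding X_def
    by (rule sum.cong[OF refl]) (simp only: sum_orb_class_stabilizer[OF class_preserving_comp[OF f shift_class_preserving] \<psi> yO])
  also have "\<dots> = (\<Sum>x\<in>X. \<psi> (vcoord b x)) * char_correlation b \<chi> \<psi> f t"
    by (simp add: char_correlation_def sum_distrib_left mult.left_commute)
  finally show ?thesis .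
qed

lemma layer_sum_eq_0_if_not_linked:
  assumes y: "same_rigid_class b y" "\<not> linked b y" and s: "s mod p = 0"
  shows "layer_sum (orb (class_stabilizer b) y) \<chi> s = 0"
proof -
  have "shift (l, s) b \<notin> orb (class_stabilizer b) y" for l
  proof
    assume "shift (l, s) b \<in> orb (class_stabilizer b) y"
    then obtain h where h: "h \<in> class_preserving" "h b = b" "h y = \<tau> l b"
      using z_pow_mod[of s] s unfolding orb_def class_stabilizer_def shift_def by auto
    have "same_rigid_class b (\<tau> l b)"
      using h(3) class_preserving_same_class[OF h(1) same_class_mem[OF b y(1)]] same_rigid_class_trans[OF y(1)] by metis
    then have "l \<in> rigid" using same_rigid_class_iff[OF b \<tau>_mem[OF b]] by (simp add: vcoord_\<tau>_base[OF b])
    then have "linked (h b) (h y)" using h(2,3) linkedI by simp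
    then show False using y(2) linked_A_iff[OF class_preserving_mem_A[OF h(1)] b] by blast
  qed
  then show ?thesis unfolding layer_sum_def by simp
qed

lemma layer_sum_eq_0:
  assumes \<chi>: "\<chi> \<in> sign_chars" "\<not> z_invariant b \<chi>" and y: "same_rigid_class b y" "\<not> linked b y"
  shows "layer_sum (orb (class_stabilizer b) y) \<chi> s = 0"
proof -
  let ?X = "orb (class_stabilizer b) y"
  obtain f \<psi> where f: "f \<in> class_preserving" and \<psi>: "\<psi> \<in> sign_chars"
    and ndvd: "\<not> int p dvd (\<Sum>u | same_rigid_class b u. \<chi> (vcoord b (f u)) * \<psi> (vcoord b u))"
    using exists_correlated_char[OF \<chi>] .
  let ?n = "char_correlation b \<chi> \<psi> (finv f)"
  define eig where "eig = (\<Sum>x\<in>?X. \<psi> (vcoord b x))"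
  note periodic = shift_add_p[of _ _ b]
  define d where "d s = layer_sum ?X \<chi> s - (if s mod p = 0 then eig else 0)" for s
  have "d \<in> uncorrelated p ?n"
    unfolding uncorrelated_def
  proof (intro CollectI conjI allI)
    show "d (t + p) = d t" for t unfolding d_def layer_sum_def periodic by simp
    fix t
    have "(\<Sum>s<p. (if s mod p = 0 then eig else 0) * ?n (t + s)) = (\<Sum>s<p. if s = 0 then eig * ?n t else 0)"
      by (rule sum.cong[OF refl]) auto
    then show "(\<Sum>s<p. d s * ?n (t + s)) = 0"
      using layer_sum_correlation[OF \<chi>(1) \<psi> class_preserving_inv[OF f] y(1), of t] p_pos
      unfolding d_def eig_def by (simp add: left_diff_distrib sum_subtractf)
  qed
  moreover have "?n (t + p) = ?n t" for t unfolding char_correlation_def periodic ..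
  ultimately have zero: "d s = 0" for s
    using uncorrelated_eq_0[OF prime_p odd_p, of ?n] ndvd unfolding sum_char_correlation[OF f, symmetric] by blast
  have "eig = 0" using zero[of 0] layer_sum_eq_0_if_not_linked[OF y, of 0] by (simp add: d_def)
  then show ?thesis using zero[of s] by (simp add: d_def)
qed

definition near :: "'a \<Rightarrow> 'a \<Rightarrow> bool" where
  "near u y \<longleftrightarrow> (\<forall>\<chi>\<in>sign_chars. z_invariant b \<chi> \<longrightarrow>
     (\<forall>f\<in>class_preserving. \<chi> (vcoord b (f u)) = \<chi> (vcoord b (f y))))"

lemma nearD:
  "near u y \<Longrightarrow> \<chi> \<in> sign_chars \<Longrightarrow> z_invariant b \<chi> \<Longrightarrow> f \<in> class_preserving \<Longrightarrow> \<chi> (vcoord b (f u)) = \<chi> (vcoord b (f y))"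
  unfolding near_def by blast

lemma near_refl: "near u u" and near_sym: "near u y \<Longrightarrow> near y u" and near_trans: "near u y \<Longrightarrow> near y x \<Longrightarrow> near u x"
  unfolding near_def by auto

lemma near_class_preserving:
  assumes "near u y" "g \<in> class_preserving" shows "near (g u) (g y)"
  unfolding near_def
proof (intro ballI impI)
  fix \<chi> f assume "\<chi> \<in> sign_chars" "z_invariant b \<chi>" "f \<in> class_preserving"
  then show "\<chi> (vcoord b (f (g u))) = \<chi> (vcoord b (f (g y)))"
    using nearD[OF assms(1) _ _ class_preserving_comp[OF _ assms(2)]] by blast
qed

lemma near_funpow: assumes "near u (g u)" "g \<in> class_preserving" shows "near u ((g ^^ i) u)"
proof (induction i)
  case (Suc i)
  from near_class_preserving[OF Suc assms(2)] show ?case using near_trans[OF assms(1)] by simp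
qed (simp add: near_refl)

lemma near_z_pow: assumes "same_rigid_class b u" shows "near u ((z ^^ t) u)"
proof (rule near_funpow[OF _ z_class_preserving])
  show "near u (z u)" using assms unfolding near_def z_invariant_def by simp
qed

lemma near_linked_in_orbit:
  assumes y: "same_rigid_class b y" "\<not> linked b y" and y': "linked y y'" "near y y'"
  obtains f where "f \<in> class_preserving" "f b = b" "f y = y'"
proof -
  let ?X = "orb (class_stabilizer b) y"
  note yO = same_class_mem[OF b y(1)]
  obtain m where m: "y' = \<tau> m y" using y'(1) unfolding linked_def by blast
  define s where "s = zcoord b y"
  define l where "l = vcoord b y"
  have y_eq: "y = shift (l, s) b" unfolding l_def s_def using shift_coordinates[OF b yO] by simp
  have y'_eq: "y' = shift (m + l, s) b" unfolding m y_eq by (simp add: shift_def \<tau>_z_pow \<tau>_add)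
  define S where "S l = (if shift (l, s) b \<in> ?X then 1 else 0 :: int)" for l
  have "int CARD('v) * S (m + l) = (\<Sum>\<chi>\<in>sign_chars. \<chi> (m + l) * (\<Sum>l\<in>UNIV. S l * \<chi> l))"
    by (rule fourier_inversion[symmetric])
  also have "\<dots> = (\<Sum>\<chi>\<in>sign_chars. \<chi> l * (\<Sum>l\<in>UNIV. S l * \<chi> l))"
  proof (rule sum.cong[OF refl])
    fix \<chi> :: "'v \<Rightarrow> int" assume \<chi>: "\<chi> \<in> sign_chars"
    show "\<chi> (m + l) * (\<Sum>l\<in>UNIV. S l * \<chi> l) = \<chi> l * (\<Sum>l\<in>UNIV. S l * \<chi> l)"
    proof (cases "z_invariant b \<chi>")
      case True
      then have "\<chi> (vcoord b y) = \<chi> (vcoord b y')" using nearD[OF y'(2) \<chi> _ class_preserving_id] by blast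
      then show ?thesis unfolding m vcoord_\<tau>[OF b yO] l_def by simp
    next
      case False
      then show ?thesis using layer_sum_eq_0[OF \<chi> False y, of s] unfolding layer_sum_def S_def by simp
    qed
  qed
  also have "\<dots> = int CARD('v) * S l" by (rule fourier_inversion)
  finally have "S (m + l) = S l" by simp
  moreover have "S l = 1" unfolding S_def using orb_self[OF perm_group_class_stabilizer] y_eq by simp
  ultimately have "y' \<in> ?X" unfolding S_def y'_eq by (simp split: if_splits)
  then show thesis using that unfolding orb_def class_stabilizer_def by blast
qed

end

end

section \<open>Aligning two regular representations\<close>

context regular_rep
begin

definition linked_class :: "'a \<Rightarrow> 'a set" where
  "linked_class x = {y. linked x y}"

lemma linked_class_eq_iff: "linked_class x = linked_class y \<longleftrightarrow> linked x y"
  unfolding linked_class_def using linked_refl linked_sym linked_trans by blast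

lemma image_linked_class: assumes a: "a \<in> A" and x: "x \<in> \<Omega>" shows "a ` linked_class x = linked_class (a x)"
proof
  show "a ` linked_class x \<subseteq> linked_class (a x)" unfolding linked_class_def using linked_A[OF a x] by blast
  show "linked_class (a x) \<subseteq> a ` linked_class x"
  proof
    fix y assume "y \<in> linked_class (a x)"
    then have "linked (finv a (a x)) (finv a y)"
      unfolding linked_class_def using linked_A[OF A_inv(1)[OF a] A_mem[OF a x]] by blast
    then have "finv a y \<in> linked_class x" by (simp add: linked_class_def A_inv(2)[OF a])
    then show "y \<in> a ` linked_class x" using A_inv(3)[OF a, of y] by (metis imageI)
  qed
qed

lemma card_linked_class: "x \<in> \<Omega> \<Longrightarrow> card (linked_class x) = card rigid"
proof -
  assume x: "x \<in> \<Omega>"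
  have "linked_class x = (\<lambda>l. \<tau> l x) ` rigid" unfolding linked_class_def linked_def by blast
  then show ?thesis using \<tau>_eq_iff[OF x] by (simp add: card_image inj_on_def)
qed

lemma card_linked_class_orbit:
  assumes G: "perm_group \<Omega> G" "G \<subseteq> A" "card G dvd p ^ k" and x: "x \<in> \<Omega>"
  shows "\<exists>i. card ((\<lambda>g. linked_class (g x)) ` G) = p ^ i"
proof -
  have "group_action (perm_monoid G) (linked_class ` \<Omega>) (\<lambda>g. restrict ((`) g) (linked_class ` \<Omega>))"
    by (rule perm_group_action[OF G(1)]) (use G(2) image_linked_class A_mem in \<open>auto simp: image_comp\<close>)
  from card_perm_orbit_prime_power[OF this G(3) prime_p imageI[OF x]]
  show ?thesis using image_linked_class[OF subsetD[OF G(2)] x] by (metis (mono_tags, lifting) image_cong)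
qed

lemma linked_class_z_pow:
  assumes x: "x \<in> \<Omega>"
  shows "linked_class ` Collect (same_rigid_class x) = (\<lambda>t. linked_class ((z ^^ t) x)) ` {..<p}"
proof -
  have "linked_class y \<in> (\<lambda>t. linked_class ((z ^^ t) x)) ` {..<p}" if y: "same_rigid_class x y" for y
  proof -
    obtain t where "t < p" "linked ((z ^^ t) x) y" using same_class_rigidE[OF y] .
    then show ?thesis by (intro image_eqI[of _ _ t]) (simp_all add: linked_class_eq_iff linked_sym)
  qed
  then show ?thesis using same_rigid_class_z_pow by fast
qed

lemma card_linked_classes:
  assumes x: "x \<in> \<Omega>" shows "card (linked_class ` Collect (same_rigid_class x)) = p"
proof -
  have "inj_on (\<lambda>t. linked_class ((z ^^ t) x)) {..<p}"
    by (rule inj_onI) (simp add: linked_class_eq_iff linked_z_pow_iff[OF x])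
  then show ?thesis unfolding linked_class_z_pow[OF x] by (simp add: card_image)
qed

lemma same_rigid_class_if_linked_class_mem:
  assumes "linked_class y \<in> linked_class ` Collect (same_rigid_class x)" shows "same_rigid_class x y"
  using assms linked_class_eq_iff linked_same_class same_rigid_class_trans by blast

lemma fixed_point_on_linked_class:
  assumes a: "a \<in> A" and x: "x \<in> \<Omega>" "linked x (a x)" and order: "\<And>y. (a ^^ p) y = y"
  obtains y where "linked x y" "a y = y"
proof -
  have mem: "y \<in> \<Omega>" if "y \<in> linked_class x" for y using that linked_mem[OF x(1)] unfolding linked_class_def by blast
  have "p dvd card (linked_class x - {y \<in> linked_class x. a y = y})"
  proof (rule card_cyclic_nonfixed[OF _ prime_p _ order])
    show "finite (linked_class x)" using finite_subset[OF _ finite_\<Omega>] mem by blast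
    show "a y \<in> linked_class x" if "y \<in> linked_class x" for y
      using that image_linked_class[OF a x(1)] x(2) unfolding linked_class_eq_iff[symmetric] by blast
  qed
  moreover have "\<not> p dvd card (linked_class x)"
    unfolding card_linked_class[OF x(1)] by (rule not_p_dvd_card_add_subgroup[OF add_subgroup_rigid])
  ultimately have "{y \<in> linked_class x. a y = y} \<noteq> {}" by (metis Diff_empty)
  then show thesis using that unfolding linked_class_def by blast
qed

definition class_rotations :: "('a \<Rightarrow> 'a) set" where
  "class_rotations = {fibre_rotation a | a. class_constant rigid a}"

lemma class_rotations_subset_A: "class_rotations \<subseteq> A"
  unfolding class_rotations_def using independent_rotationsD[OF independent_rotations_rigid] by blast

lemma fibre_rotation_comp:
  assumes "class_constant rigid a"
  shows "fibre_rotation a \<circ> fibre_rotation c = fibre_rotation (\<lambda>x. a x + c x)"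
proof
  fix x show "(fibre_rotation a \<circ> fibre_rotation c) x = fibre_rotation (\<lambda>x. a x + c x) x"
  proof (cases "x \<in> \<Omega>")
    case True
    have "fibre_rotation a (fibre_rotation c x) = (z ^^ a (fibre_rotation c x)) (fibre_rotation c x)"
      using fibre_rotation_mem[OF True] by (simp add: fibre_rotation_def)
    also have "\<dots> = (z ^^ a x) ((z ^^ c x) x)"
      using class_constant_fibre_rotation[OF add_subgroup_rigid assms True] True by (simp add: fibre_rotation_def)
    finally show ?thesis using True by (simp add: fibre_rotation_def funpow_funpow)
  qed (simp add: fibre_rotation_def)
qed

lemma fibre_rotation_eq_id: "(\<And>x. x \<in> \<Omega> \<Longrightarrow> p dvd a x) \<Longrightarrow> fibre_rotation a = id"
  by (auto simp: fibre_rotation_def fun_eq_iff z_pow_fixes_iff)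

lemma perm_group_class_rotations: "perm_group \<Omega> class_rotations"
proof (rule perm_groupI)
  fix f assume f: "f \<in> class_rotations"
  show "f permutes \<Omega>" using f class_rotations_subset_A A_permutes by blast
  obtain a where a: "f = fibre_rotation a" "class_constant rigid a" using f unfolding class_rotations_def by blast
  define c where "c x = (p - 1) * a x" for x
  have c: "class_constant rigid c" using a(2) unfolding class_constant_def c_def by metis
  have "a x + c x = p * a x" "c x + a x = p * a x" for x unfolding c_def using p_pos by (cases p; simp)+
  then have "f \<circ> fibre_rotation c = id" "fibre_rotation c \<circ> f = id"
    unfolding a(1) fibre_rotation_comp[OF a(2)] fibre_rotation_comp[OF c] by (simp_all add: fibre_rotation_eq_id)
  then have "finv f = fibre_rotation c" by (rule inv_unique_comp)
  then show "finv f \<in> class_rotations" unfolding class_rotations_def using c by blast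
  fix g assume "g \<in> class_rotations"
  then obtain d where d: "g = fibre_rotation d" "class_constant rigid d" unfolding class_rotations_def by blast
  have "class_constant rigid (\<lambda>x. a x + d x)" using a(2) d(2) unfolding class_constant_def by metis
  then show "f \<circ> g \<in> class_rotations" unfolding a(1) d(1) fibre_rotation_comp[OF a(2)] class_rotations_def by blast
next
  have "id = fibre_rotation (\<lambda>_. 0)" by (rule fibre_rotation_eq_id[symmetric]) simp
  moreover have "class_constant rigid (\<lambda>_. 0)" unfolding class_constant_def by simp
  ultimately show "id \<in> class_rotations" unfolding class_rotations_def by blast
qed

definition rotate_classes :: "('a set \<Rightarrow> nat) \<Rightarrow> 'a \<Rightarrow> 'a" where
  "rotate_classes a = fibre_rotation (\<lambda>x. a (Collect (same_rigid_class x)))"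

lemma rotate_classes_mem: "rotate_classes a \<in> class_rotations"
proof -
  have "Collect (same_rigid_class x) = Collect (same_rigid_class y)" if "same_rigid_class x y" for x y
    using that same_rigid_class_sym same_rigid_class_trans by blast
  then have "class_constant rigid (\<lambda>x. a (Collect (same_rigid_class x)))" unfolding class_constant_def by metis
  then show ?thesis unfolding rotate_classes_def class_rotations_def by blast
qed

lemma inj_on_rotate_classes:
  "inj_on rotate_classes ((\<lambda>x. Collect (same_rigid_class x)) ` \<Omega> \<rightarrow>\<^sub>E {..<p})"
proof (rule inj_onI)
  let ?c = "\<lambda>x. Collect (same_rigid_class x)"
  fix a c assume a: "a \<in> ?c ` \<Omega> \<rightarrow>\<^sub>E {..<p}" and c: "c \<in> ?c ` \<Omega> \<rightarrow>\<^sub>E {..<p}" and eq: "rotate_classes a = rotate_classes c"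
  have "a (?c x) = c (?c x)" if x: "x \<in> \<Omega>" for x
  proof -
    have "(z ^^ a (?c x)) x = (z ^^ c (?c x)) x"
      using fun_cong[OF eq, of x] x by (simp add: rotate_classes_def fibre_rotation_def)
    moreover have "a (?c x) < p" "c (?c x) < p" using a c x by auto
    ultimately show ?thesis using z_pow_eq_iff[OF x] by simp
  qed
  then show "a = c" by (intro PiE_ext[OF a c]) blast
qed

lemma class_rotation_in_rotate_classes:
  assumes "f \<in> class_rotations"
  shows "f \<in> rotate_classes ` ((\<lambda>x. Collect (same_rigid_class x)) ` \<Omega> \<rightarrow>\<^sub>E {..<p})"
proof -
  let ?c = "\<lambda>x. Collect (same_rigid_class x)"
  obtain a where a: "f = fibre_rotation a" "class_constant rigid a" using assms unfolding class_rotations_def by blast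
  let ?a = "\<lambda>B\<in>?c ` \<Omega>. a (SOME y. y \<in> B) mod p"
  have "f x = rotate_classes ?a x" for x
  proof (cases "x \<in> \<Omega>")
    case True
    have "same_rigid_class x (SOME y. y \<in> ?c x)" using someI[of "same_rigid_class x" x] same_rigid_class_refl by simp
    then have "a (SOME y. y \<in> ?c x) = a x" using class_constantD[OF a(2) True] by metis
    then show ?thesis using True z_pow_mod[of "a x"] by (simp add: a(1) rotate_classes_def fibre_rotation_def)
  qed (simp add: a(1) rotate_classes_def fibre_rotation_def)
  then have "f = rotate_classes ?a" by (rule ext)
  moreover have "?a \<in> ?c ` \<Omega> \<rightarrow>\<^sub>E {..<p}" using p_pos by auto
  ultimately show ?thesis by (rule image_eqI)
qed

lemma card_class_rotations: "\<exists>k. card class_rotations = p ^ k"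
proof -
  let ?P = "(\<lambda>x. Collect (same_rigid_class x)) ` \<Omega> \<rightarrow>\<^sub>E {..<p}"
  have "class_rotations = rotate_classes ` ?P"
    using rotate_classes_mem class_rotation_in_rotate_classes by auto
  then have "card class_rotations = card ?P" by (simp only: card_image[OF inj_on_rotate_classes])
  then have "card class_rotations = p ^ card ((\<lambda>x. Collect (same_rigid_class x)) ` \<Omega>)"
    using finite_\<Omega> by (simp add: card_PiE)
  then show ?thesis by blast
qed

definition class_rotation :: "'a \<Rightarrow> nat \<Rightarrow> 'a \<Rightarrow> 'a" where
  "class_rotation x n = fibre_rotation (\<lambda>y. if same_rigid_class x y then n else 0)"

lemma class_rotation_mem: "class_rotation x n \<in> class_rotations"
proof -
  have "class_constant rigid (\<lambda>y. if same_rigid_class x y then n else 0)"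
    unfolding class_constant_def using same_rigid_class_sym same_rigid_class_trans by metis
  then show ?thesis unfolding class_rotation_def class_rotations_def by blast
qed

lemma class_rotation_inside: "y \<in> \<Omega> \<Longrightarrow> same_rigid_class x y \<Longrightarrow> class_rotation x n y = (z ^^ n) y"
  and class_rotation_outside: "\<not> same_rigid_class x y \<Longrightarrow> class_rotation x n y = y"
  by (simp_all add: class_rotation_def fibre_rotation_def)

end

locale conjugated_rep = regular_rep \<Omega> A p \<tau> z
  for \<Omega> :: "'a set" and A p and \<tau> :: "'v::{elementary_2_group,finite} \<Rightarrow> 'a \<Rightarrow> 'a" and z +
  fixes g :: "'a \<Rightarrow> 'a"
  assumes g_mem_A: "g \<in> A"

sublocale conjugated_rep \<subseteq> K: regular_rep \<Omega> A p "\<lambda>v. conj_perm g (\<tau> v)" "conj_perm g z"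
  by unfold_locales (rule regular_rep_conj[OF g_mem_A])

context conjugated_rep
begin

lemma rigid_subset_conj: "rigid \<subseteq> K.rigid"
proof
  fix v assume v: "v \<in> rigid"
  note inv = A_inv[OF g_mem_A]
  show "v \<in> K.rigid" unfolding K.rigid_def
  proof (intro CollectI ballI impI)
    fix x a assume x: "x \<in> \<Omega>" and a: "a \<in> A" "a x = x"
    let ?a = "\<lambda>u. finv g (a (g u))"
    have "?a \<in> A" "?a (finv g x) = finv g x" using A_comp[OF inv(1) A_comp[OF a(1) g_mem_A]] a(2) by (simp_all add: inv)
    from rigidD[OF v A_inv_mem[OF g_mem_A x] this] obtain u where "?a (\<tau> v (finv g x)) = \<tau> u (finv g x)" by blast
    from arg_cong[OF this, of g] have "a (conj_perm g (\<tau> v) x) = conj_perm g (\<tau> u) x"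
      by (simp add: conj_perm_def inv)
    then show "\<exists>u. a (conj_perm g (\<tau> v) x) = conj_perm g (\<tau> u) x" by blast
  qed
qed

lemma same_rigid_class_conj:
  assumes "same_rigid_class x y" shows "K.same_rigid_class (g x) (g y)"
proof -
  obtain l t where l: "l \<in> rigid" "y = (z ^^ t) (\<tau> l x)" using assms unfolding same_class_def by blast
  then have "g y = (conj_perm g z ^^ t) (conj_perm g (\<tau> l) (g x))"
    by (simp add: conj_perm_funpow[OF A_permutes[OF g_mem_A]]) (simp add: conj_perm_def A_inv(2)[OF g_mem_A])
  then show ?thesis using K.same_classI rigid_subset_conj l(1) by auto
qed

lemma class_rotations_conj: "K.class_rotations \<subseteq> conj_perm g ` class_rotations"
proof
  fix f assume "f \<in> K.class_rotations"
  then obtain a where a: "f = K.fibre_rotation a" "K.class_constant K.rigid a" unfolding K.class_rotations_def by blast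
  have "class_constant rigid (\<lambda>x. a (g x))"
    unfolding class_constant_def using K.class_constantD[OF a(2) A_mem[OF g_mem_A] same_rigid_class_conj] by blast
  moreover have "f x = conj_perm g (fibre_rotation (\<lambda>x. a (g x))) x" for x
  proof (cases "x \<in> \<Omega>")
    case True
    then show ?thesis
      using A_inv_mem[OF g_mem_A True]
      by (simp add: a(1) K.fibre_rotation_def fibre_rotation_def conj_perm_funpow[OF A_permutes[OF g_mem_A]])
        (simp add: conj_perm_def fibre_rotation_def A_inv(3)[OF g_mem_A])
  next
    case False
    then show ?thesis
      using A_outside[OF A_inv(1)[OF g_mem_A] False] A_outside[OF g_mem_A False]
      by (simp add: a(1) K.fibre_rotation_def) (simp add: fibre_rotation_def conj_perm_def)
  qed
  ultimately show "f \<in> conj_perm g ` class_rotations" unfolding class_rotations_def by blast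
qed

end

locale two_reps = regular_rep \<Omega> A p \<tau> z + S: regular_rep \<Omega> A p \<sigma> z'
  for \<Omega> :: "'a set" and A p and \<tau> :: "'v::{elementary_2_group,finite} \<Rightarrow> 'a \<Rightarrow> 'a" and z
    and \<sigma> :: "'v \<Rightarrow> 'a \<Rightarrow> 'a" and z'
begin

lemma p_dvd_double_iff: "p dvd 2 * t \<longleftrightarrow> p dvd t"
  using prime_dvd_mult_iff[OF prime_p, of 2 t] primes_dvd_imp_eq[OF prime_p two_is_prime_nat] odd_p by auto

lemma S_shift_shift: "S.shift (u, t) (S.shift (u, t) x) = (z' ^^ (2 * t)) x"
  unfolding S.shift_shift by (simp add: S.shift_def S.\<tau>_0 mult_2)

lemma linked_imp_\<sigma>:
  assumes x: "x \<in> \<Omega>" and xy: "linked x y" obtains u where "y = \<sigma> u x"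
proof -
  obtain u t where ut: "t < p" "y = S.shift (u, t) x" using S.exists_shift[OF x linked_mem[OF x xy]] .
  have "linked y (S.shift (u, t) y)" using linked_A[OF S.shift_mem_A x xy, of "(u, t)"] unfolding ut(2) .
  then have "linked x ((z' ^^ (2 * t)) x)" using linked_trans[OF xy] unfolding ut(2) S_shift_shift by blast
  moreover have "((z' ^^ (2 * t)) ^^ p) w = w" for w
    unfolding funpow_mult using S.z_pow_cong[of "2 * t * p" 0] by simp
  ultimately obtain w where w: "linked x w" "(z' ^^ (2 * t)) w = w"
    using fixed_point_on_linked_class[OF S.z_pow_mem_A x] by blast
  then have "p dvd t" using S.z_pow_fixes_iff[OF linked_mem[OF x w(1)]] p_dvd_double_iff by blast
  then have "t = 0" using ut(1) by (auto dest: dvd_imp_le)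
  then show thesis using that ut(2) by (simp add: S.shift_def)
qed

lemma linked_imp_S_linked:
  assumes x: "x \<in> \<Omega>" and xy: "linked x y" shows "S.linked x y"
proof -
  obtain u where u: "y = \<sigma> u x" using linked_imp_\<sigma>[OF x xy] .
  have "u \<in> S.rigid"
  proof (rule S.rigidI[OF x])
    fix a assume a: "a \<in> A" "a x = x"
    have "linked x (a y)" using linked_A[OF a(1) x xy] a(2) by simp
    then show "\<exists>w. a (\<sigma> u x) = \<sigma> w x" using linked_imp_\<sigma>[OF x] u by metis
  qed
  then show ?thesis unfolding u by (rule S.linkedI)
qed

lemma linked_iff_S_linked: assumes "x \<in> \<Omega>" shows "linked x y \<longleftrightarrow> S.linked x y"
proof -
  interpret T: two_reps \<Omega> A p \<sigma> z' \<tau> z by unfold_locales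
  show ?thesis using linked_imp_S_linked[OF assms] T.linked_imp_S_linked[OF assms] by blast
qed

lemma S_linked_class: "x \<in> \<Omega> \<Longrightarrow> S.linked_class x = linked_class x"
  unfolding S.linked_class_def linked_class_def using linked_iff_S_linked by blast

lemma linked_classes_S:
  assumes x: "x \<in> \<Omega>" shows "S.linked_class ` Collect (S.same_rigid_class x) = linked_class ` Collect (S.same_rigid_class x)"
  using S_linked_class S.same_class_mem[OF x] by (intro image_cong) auto

end

lemma prime_power_eq_if_less_double:
  fixes p :: nat
  assumes "p \<le> p ^ i" "p ^ i < 2 * p" "p > 1" shows "p ^ i = p"
proof -
  have "i \<noteq> 0" using assms(1,3) by (cases i) auto
  moreover have "i < 2"
  proof (rule ccontr)
    assume "\<not> i < 2"
    then have "p ^ 2 \<le> p ^ i" using assms(3) by (intro power_increasing) auto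
    moreover have "2 * p \<le> p * p" using assms(3) by simp
    ultimately show False using assms(2) by (simp add: power2_eq_square)
  qed
  ultimately have "i = 1" by linarith
  then show ?thesis by simp
qed

lemma eq_if_card_Un_eq:
  assumes "finite A" "finite B" "card (A \<union> B) = card A" "card (A \<union> B) = card B" shows "A = B"
proof -
  have "A = A \<union> B" by (rule card_subset_eq) (use assms in auto)
  moreover have "B = A \<union> B" by (rule card_subset_eq) (use assms in auto)
  ultimately show ?thesis by simp
qed

locale common_sylow = two_reps \<Omega> A p \<tau> z \<sigma> z'
  for \<Omega> :: "'a set" and A p and \<tau> :: "'v::{elementary_2_group,finite} \<Rightarrow> 'a \<Rightarrow> 'a" and z
    and \<sigma> :: "'v \<Rightarrow> 'a \<Rightarrow> 'a" and z' +
  fixes T :: "('a \<Rightarrow> 'a) set" and k :: nat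
  assumes perm_group_T: "perm_group \<Omega> T" and T_subset_A: "T \<subseteq> A" and card_T: "card T = p ^ k"
    and class_rotations_subset: "class_rotations \<subseteq> T" "S.class_rotations \<subseteq> T"
begin

abbreviation C :: "'a \<Rightarrow> 'a \<Rightarrow> bool" where "C \<equiv> same_rigid_class"
abbreviation C' :: "'a \<Rightarrow> 'a \<Rightarrow> bool" where "C' \<equiv> S.same_rigid_class"

lemmas C_refl = same_rigid_class_refl and C_sym = same_rigid_class_sym and C_trans = same_rigid_class_trans
  and C_z_pow = same_rigid_class_z_pow

lemma T_mem_A: "f \<in> T \<Longrightarrow> f \<in> A" using T_subset_A by blast

lemma T_subgroup:
  assumes "P id" "\<And>f g. \<lbrakk>f \<in> T; g \<in> T; P f; P g\<rbrakk> \<Longrightarrow> P (f \<circ> g)" "\<And>f. \<lbrakk>f \<in> T; P f\<rbrakk> \<Longrightarrow> P (finv f)"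
  shows "perm_group \<Omega> {f \<in> T. P f}" "{f \<in> T. P f} \<subseteq> A" "card {f \<in> T. P f} dvd p ^ k"
proof -
  show "perm_group \<Omega> {f \<in> T. P f}" by (rule perm_groupI) (use perm_groupD[OF perm_group_T] assms in auto)
  from perm_group_card_dvd[OF perm_group_T this] show "card {f \<in> T. P f} dvd p ^ k" unfolding card_T by blast
qed (use T_subset_A in blast)

definition supported :: "'a set \<Rightarrow> ('a \<Rightarrow> 'a) \<Rightarrow> bool" where
  "supported X f \<longleftrightarrow> (\<forall>y. y \<notin> X \<longrightarrow> f y = y)"

lemma supported_id: "supported X id" and supported_comp: "supported X f \<Longrightarrow> supported X g \<Longrightarrow> supported X (f \<circ> g)"
  by (auto simp: supported_def)

lemma supported_inv: "f \<in> T \<Longrightarrow> supported X f \<Longrightarrow> supported X (finv f)"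
  unfolding supported_def using A_inv(2)[OF T_mem_A] by metis

lemma supported_mem: "f \<in> T \<Longrightarrow> supported X f \<Longrightarrow> x \<in> X \<Longrightarrow> f x \<in> X"
  unfolding supported_def using A_inj[OF T_mem_A] by metis

text \<open>A \<open>p\<close>-group contains the rotations of both classes of \<open>x\<close> and moves \<open>x\<close> within their union, which meets
  fewer than \<open>2 p\<close> linked classes.\<close>

lemma linked_classes_eq:
  assumes x: "x \<in> \<Omega>" shows "linked_class ` Collect (C x) = linked_class ` Collect (C' x)"
proof -
  let ?X = "Collect (C x)" and ?X' = "Collect (C' x)"
  let ?P = "linked_class ` ?X" and ?P' = "linked_class ` ?X'"
  have card: "card ?P = p" "card ?P' = p"
    using card_linked_classes[OF x] S.card_linked_classes[OF x] linked_classes_S[OF x] by simp_all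
  have fin: "finite ?P" "finite ?P'" by (rule card_ge_0_finite, simp only: card p_pos)+
  let ?G = "{f \<in> T. supported (?X \<union> ?X') f}"
  note G = T_subgroup[of "supported (?X \<union> ?X')", OF supported_id supported_comp supported_inv]
  let ?O = "(\<lambda>g. linked_class (g x)) ` ?G"
  obtain i where i: "card ?O = p ^ i" using card_linked_class_orbit[OF G x] by blast
  have "?O \<subseteq> ?P \<union> ?P'"
    using supported_mem[of _ "?X \<union> ?X'" x] C_refl[of x] by blast
  moreover have "?P \<subseteq> ?O"
  proof -
    have "class_rotation x t \<in> ?G" for t
      using class_rotation_mem class_rotations_subset class_rotation_outside by (auto simp: supported_def)
    moreover have "class_rotation x t x = (z ^^ t) x" for t by (rule class_rotation_inside[OF x C_refl])
    ultimately show ?thesis unfolding linked_class_z_pow[OF x] by (metis (no_types, lifting) image_eqI image_subsetI)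
  qed
  moreover have "?P' \<subseteq> ?O"
  proof -
    have "S.class_rotation x t \<in> ?G" for t
      using S.class_rotation_mem class_rotations_subset S.class_rotation_outside by (auto simp: supported_def)
    moreover have "S.class_rotation x t x = (z' ^^ t) x" for t by (rule S.class_rotation_inside[OF x S.same_rigid_class_refl])
    ultimately show ?thesis
      unfolding linked_classes_S[OF x, symmetric] S.linked_class_z_pow[OF x]
      using S_linked_class[OF S.z_pow_mem[OF x]] by (metis (no_types, lifting) image_eqI image_subsetI)
  qed
  ultimately have O_eq: "?O = ?P \<union> ?P'" by blast
  have "linked_class x \<in> ?P \<inter> ?P'" using C_refl S.same_rigid_class_refl by blast
  then have "card (?P \<inter> ?P') > 0" using fin by (auto simp: card_gt_0_iff)
  then have "card (?P \<union> ?P') < 2 * p" using card_Un_Int[OF fin] card by linarith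
  moreover have "p \<le> card (?P \<union> ?P')" using card_mono[of "?P \<union> ?P'" ?P] fin card(1) by simp
  ultimately have "card (?P \<union> ?P') = p"
    using prime_power_eq_if_less_double[of p i] i p_gt_1 unfolding O_eq by simp
  then show ?thesis using eq_if_card_Un_eq[OF fin] card by (simp only:)
qed

lemma same_rigid_class_S_iff:
  assumes x: "x \<in> \<Omega>" shows "C x y \<longleftrightarrow> C' x y"
proof
  assume xy: "C x y"
  then have "linked_class y \<in> linked_class ` Collect (C' x)" using linked_classes_eq[OF x] by blast
  then have "S.linked_class y \<in> S.linked_class ` Collect (C' x)"
    unfolding S_linked_class[OF same_class_mem[OF x xy]] linked_classes_S[OF x] .
  then show "C' x y" by (rule S.same_rigid_class_if_linked_class_mem)
next
  assume "C' x y"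
  then have "linked_class y \<in> linked_class ` Collect (C x)" using linked_classes_eq[OF x] by blast
  then show "C x y" by (rule same_rigid_class_if_linked_class_mem)
qed

lemma C_z'_pow: "x \<in> \<Omega> \<Longrightarrow> C x ((z' ^^ n) x)"
  using same_rigid_class_S_iff S.same_rigid_class_z_pow by blast

lemma linked_if_supported:
  assumes x: "x \<in> \<Omega>" and g: "g \<in> T" "supported (Collect (C x)) g" "linked x (g x)" and y: "C x y"
  shows "linked y (g y)"
proof (cases "linked x y")
  case True
  then show ?thesis using g(3) linked_A[OF T_mem_A[OF g(1)] x True] linked_sym linked_trans by blast
next
  case False
  let ?P = "\<lambda>f. supported (Collect (C x)) f \<and> linked x (f x)"
  have inv: "linked x (finv f x)" if "f \<in> T" "linked x (f x)" for f
    using linked_A[OF A_inv(1)[OF T_mem_A[OF that(1)]] x that(2)] linked_sym unfolding A_inv(2)[OF T_mem_A[OF that(1)]] by blast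
  have comp: "linked x ((f \<circ> h) x)" if "f \<in> T" "linked x (f x)" "linked x (h x)" for f h
    using linked_trans[OF that(2) linked_A[OF T_mem_A[OF that(1)] x that(3)]] by simp
  have G: "perm_group \<Omega> {f \<in> T. ?P f}" "{f \<in> T. ?P f} \<subseteq> A" "card {f \<in> T. ?P f} dvd p ^ k"
    by (rule T_subgroup; use supported_id supported_comp supported_inv linked_refl comp inv in auto)+
  let ?O = "(\<lambda>g. linked_class (g y)) ` {f \<in> T. ?P f}"
  obtain i where i: "card ?O = p ^ i" using card_linked_class_orbit[OF G same_class_mem[OF x y]] by blast
  have "?O \<subseteq> linked_class ` Collect (C x) - {linked_class x}"
  proof
    fix B assume "B \<in> ?O"
    then obtain f where f: "f \<in> T" "?P f" "B = linked_class (f y)" by blast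
    have "\<not> linked x (f y)"
      using False f(2) linked_A_iff[OF T_mem_A[OF f(1)] x] linked_sym linked_trans by blast
    then show "B \<in> linked_class ` Collect (C x) - {linked_class x}"
      using supported_mem[OF f(1), of "Collect (C x)" y] f(2,3) y linked_class_eq_iff by blast
  qed
  moreover have "card (linked_class ` Collect (C x) - {linked_class x}) = p - 1"
    using card_linked_classes[OF x] C_refl by (subst card_Diff_singleton) auto
  moreover have "finite (linked_class ` Collect (C x))" by (rule card_ge_0_finite, simp only: card_linked_classes[OF x] p_pos)
  ultimately have "card ?O \<le> p - 1" using card_mono[OF finite_Diff, of "linked_class ` Collect (C x)" ?O "{linked_class x}"] by simp
  then have "p ^ i < p" using i p_pos by simp
  then have "card ?O = 1" using i p_gt_1 by (cases i) auto
  then obtain B where B: "?O = {B}" by (rule card_1_singletonE)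
  have "linked_class (id y) \<in> ?O" using perm_groupD(2)[OF G(1)] by blast
  moreover have "linked_class (g y) \<in> ?O" using g by blast
  ultimately have "linked_class y = linked_class (g y)" unfolding B by simp
  then show ?thesis unfolding linked_class_eq_iff .
qed

lemma exists_multiplier:
  assumes x: "x \<in> \<Omega>" shows "\<exists>m. m < p \<and> (\<forall>y. C x y \<longrightarrow> linked ((z ^^ m) y) (z' y))"
proof -
  obtain m where m: "m < p" "linked ((z ^^ m) x) (z' x)" using same_class_rigidE[of x "z' x"] C_z'_pow[OF x, of 1] by auto
  let ?g = "class_rotation x (p * m - m) \<circ> S.class_rotation x 1"
  have cancel: "(z ^^ m) ((z ^^ (p * m - m)) y) = y" "(z ^^ (p * m - m)) ((z ^^ m) y) = y" for y
    unfolding funpow_funpow using p_pos z_pow_cong[of "p * m" 0 y] by simp_all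
  have "?g \<in> T" using perm_groupD(3)[OF perm_group_T] class_rotation_mem S.class_rotation_mem class_rotations_subset by blast
  moreover have "supported (Collect (C x)) ?g"
    using class_rotation_outside S.class_rotation_outside same_rigid_class_S_iff[OF x] by (simp add: supported_def)
  moreover have g_eq: "?g y = (z ^^ (p * m - m)) (z' y)" if y: "C x y" for y
  proof -
    note yO = same_class_mem[OF x y]
    have "S.class_rotation x 1 y = z' y" using S.class_rotation_inside[OF yO] y same_rigid_class_S_iff[OF x] by simp
    then show ?thesis
      using class_rotation_inside[OF S.z_mem[OF yO]] C_trans[OF y] C_z'_pow[OF yO, of 1] by simp
  qed
  moreover have "linked x (?g x)"
    unfolding g_eq[OF C_refl] using linked_A[OF z_pow_mem_A z_pow_mem[OF x] m(2), of "p * m - m"] unfolding cancel(2) .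
  ultimately have g: "linked y ((z ^^ (p * m - m)) (z' y))" if y: "C x y" for y
    using linked_if_supported[OF x, of ?g y] y unfolding g_eq[OF y] by blast
  have "linked ((z ^^ m) y) (z' y)" if y: "C x y" for y
    using linked_A[OF z_pow_mem_A same_class_mem[OF x y] g[OF y], of m] unfolding cancel(1) .
  then show ?thesis using m(1) by blast
qed

subsection \<open>Points in one class are near their images under \<open>z'\<close>\<close>

lemma S_class_preserving: "S.class_preserving = class_preserving"
  unfolding S.class_preserving_def class_preserving_def using same_rigid_class_S_iff by blast

lemma near_z'_if_near_shift:
  assumes b: "b \<in> \<Omega>" and l: "l \<in> S.rigid" and near: "near b u (S.shift (l, t) u)" and t: "\<not> p dvd t"
  shows "near b u (z' u)"
proof -
  obtain i where i: "(2 * t * i) mod p = 1"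
    using exists_inverse_mod_prime[OF prime_p, of "2 * t"] t p_dvd_double_iff by blast
  note shift = S.shift_class_preserving[OF l, of t, unfolded S_class_preserving]
  have "near b u (S.shift (l, t) (S.shift (l, t) u))"
    using near_trans[OF b near near_class_preserving[OF b near shift]] .
  then have "near b u ((z' ^^ (2 * t)) u)" unfolding S_shift_shift .
  moreover have "z' ^^ n \<in> class_preserving" for n
    using S.z_class_preserving perm_groupD(2,3)[OF perm_group_class_preserving] unfolding S_class_preserving
    by (induction n) simp_all
  ultimately have "near b u (((z' ^^ (2 * t)) ^^ i) u)" using near_funpow[OF b] by blast
  moreover have "((z' ^^ (2 * t)) ^^ i) u = z' u"
    unfolding funpow_mult using S.z_pow_cong[of "2 * t * i" 1 u] i p_gt_1 by simp
  ultimately show ?thesis by simp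
qed

lemma add_subgroup_near:
  assumes b: "b \<in> \<Omega>" shows "add_subgroup {l \<in> S.rigid. near b u (\<sigma> l u)}"
  unfolding add_subgroup_def
proof (intro conjI ballI)
  let ?K = "{l \<in> S.rigid. near b u (\<sigma> l u)}"
  show "0 \<in> ?K" using add_subgroup_zero[OF S.add_subgroup_rigid] near_refl[OF b] by (simp add: S.\<tau>_0)
  fix l m assume l: "l \<in> ?K" and m: "m \<in> ?K"
  have "near b (\<sigma> l u) (\<sigma> l (\<sigma> m u))"
    using near_class_preserving[OF b _ S.shift_class_preserving[of l 0, unfolded S_class_preserving], of u "\<sigma> m u"] l m
    by (simp add: S.shift_def)
  then show "l + m \<in> ?K"
    using l m near_trans[OF b, of u "\<sigma> l u" "\<sigma> l (\<sigma> m u)"] add_subgroup_add[OF S.add_subgroup_rigid]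
    by (simp add: S.\<tau>_add)
qed

lemma near_z':
  assumes b: "b \<in> \<Omega>" and u: "C b u" shows "near b u (z' u)"
proof (rule ccontr)
  assume far: "\<not> near b u (z' u)"
  note uO = same_class_mem[OF b u]
  define B where "B = {y. C u y \<and> near b u y}"
  define K where "K = {l \<in> S.rigid. near b u (\<sigma> l u)}"
  have B_mem: "y \<in> \<Omega>" if "y \<in> B" for y using that same_class_mem[OF uO] unfolding B_def by blast
  have "B = (\<lambda>l. \<sigma> l u) ` K"
  proof (intro equalityI subsetI)
    fix y assume "y \<in> B"
    then obtain l t where l: "l \<in> S.rigid" "y = S.shift (l, t) u" and near: "near b u y"
      unfolding B_def same_rigid_class_S_iff[OF uO] S.same_class_def S.shift_def by auto
    have "p dvd t" using near_z'_if_near_shift[OF b l(1)] near far unfolding l(2) by blast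
    then have "y = \<sigma> l u" using l(2) S.z_pow_fixes_iff[OF S.\<tau>_mem[OF uO]] by (simp add: S.shift_def)
    then show "y \<in> (\<lambda>l. \<sigma> l u) ` K" unfolding K_def using l(1) near by blast
  next
    fix y assume "y \<in> (\<lambda>l. \<sigma> l u) ` K"
    then show "y \<in> B"
      unfolding B_def K_def using S.linked_same_class[OF S.linkedI] same_rigid_class_S_iff[OF uO] by blast
  qed
  then have "card B = card K" using S.\<tau>_eq_iff[OF uO] by (simp add: card_image inj_on_def)
  moreover have "add_subgroup K" unfolding K_def by (rule add_subgroup_near[OF b])
  moreover have "p dvd card B"
  proof -
    have "p dvd card (B - {y \<in> B. z y = y})"
    proof (rule card_cyclic_nonfixed[OF _ prime_p _ z_pow_p])
      show "finite B" using finite_subset[OF _ finite_\<Omega>] B_mem by blast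
      show "z y \<in> B" if "y \<in> B" for y
        using that C_trans[OF u] C_trans[of u y "z y"] C_z_pow[of y 1] near_z_pow[OF b, of y 1] near_trans[OF b] unfolding B_def by auto
    qed
    moreover have "{y \<in> B. z y = y} = {}" using z_pow_fixes_iff[OF B_mem, of _ 1] p_gt_1 by auto
    ultimately show ?thesis by simp
  qed
  ultimately show False using not_p_dvd_card_add_subgroup by metis
qed

subsection \<open>The aligning permutation\<close>

definition multiplier :: "'a \<Rightarrow> nat" where
  "multiplier x = (SOME m. m < p \<and> (\<forall>y. C x y \<longrightarrow> linked ((z ^^ m) y) (z' y)))"

definition class_base :: "'a \<Rightarrow> 'a" where
  "class_base x = (SOME y. C x y)"

definition height :: "'a \<Rightarrow> nat" where
  "height x = (SOME t. linked ((z ^^ t) (class_base x)) x)"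

definition coheight :: "'a \<Rightarrow> nat" where
  "coheight x = (SOME n. linked ((z' ^^ n) x) (class_base x))"

text \<open>On every linked class the permutation descends by a power of \<open>z'\<close> to the class of the base point and climbs back by a
  power of \<open>z\<close>.\<close>

definition aligning :: "'a \<Rightarrow> 'a" where
  "aligning x = (if x \<in> \<Omega> then (z ^^ height x) ((z' ^^ coheight x) x) else x)"

lemma C_eq: "C x y \<Longrightarrow> C x = C y"
  by (rule ext) (use C_sym C_trans in blast)

lemma multiplier_eq: "C x y \<Longrightarrow> multiplier x = multiplier y" and class_base_eq: "C x y \<Longrightarrow> class_base x = class_base y"
  unfolding multiplier_def class_base_def using C_eq by metis+

lemma multiplier: "x \<in> \<Omega> \<Longrightarrow> multiplier x < p" "x \<in> \<Omega> \<Longrightarrow> linked ((z ^^ multiplier x) x) (z' x)"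
  unfolding multiplier_def using someI_ex[OF exists_multiplier] C_refl by blast+

lemma C_class_base: "C x (class_base x)"
  unfolding class_base_def using C_refl by (rule someI)

lemma class_base_mem: "x \<in> \<Omega> \<Longrightarrow> class_base x \<in> \<Omega>"
  using same_class_mem C_class_base by blast

lemma linked_height: "linked ((z ^^ height x) (class_base x)) x"
  unfolding height_def using same_class_rigidE[OF C_sym[OF C_class_base]] by (metis someI_ex)

lemma linked_coheight:
  assumes x: "x \<in> \<Omega>" shows "linked ((z' ^^ coheight x) x) (class_base x)"
proof -
  obtain n where "S.linked ((z' ^^ n) x) (class_base x)"
    using S.same_class_rigidE C_class_base same_rigid_class_S_iff[OF x] by metis
  then have "\<exists>n. linked ((z' ^^ n) x) (class_base x)" using linked_iff_S_linked[OF S.z_pow_mem[OF x]] by blast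
  then show ?thesis unfolding coheight_def by (rule someI_ex)
qed

lemma class_base_linked: "linked x y \<Longrightarrow> class_base x = class_base y"
  using class_base_eq linked_same_class by blast

lemma height_linked: "linked x y \<Longrightarrow> height x = height y"
proof -
  assume xy: "linked x y"
  have "linked u x \<longleftrightarrow> linked u y" for u using xy linked_sym linked_trans by blast
  then show ?thesis unfolding height_def class_base_linked[OF xy] by simp
qed

lemma coheight_linked: assumes x: "x \<in> \<Omega>" and xy: "linked x y" shows "coheight x = coheight y"
proof -
  have "linked ((z' ^^ n) x) u \<longleftrightarrow> linked ((z' ^^ n) y) u" for n u
    using linked_A[OF S.z_pow_mem_A x xy] linked_sym linked_trans by blast
  then show ?thesis unfolding coheight_def class_base_linked[OF xy] by simp
qed

lemma linked_z'_pow: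
  assumes x: "x \<in> \<Omega>" shows "linked ((z ^^ (n * multiplier x)) x) ((z' ^^ n) x)"
proof (induction n)
  case (Suc n)
  let ?y = "(z' ^^ n) x"
  have "multiplier ?y = multiplier x" using multiplier_eq[OF C_z'_pow[OF x]] by simp
  then have step: "linked ((z ^^ multiplier x) ?y) (z' ?y)" using multiplier(2)[OF S.z_pow_mem[OF x]] by metis
  have "linked ((z ^^ multiplier x) ((z ^^ (n * multiplier x)) x)) ((z ^^ multiplier x) ?y)"
    by (rule linked_A[OF z_pow_mem_A z_pow_mem[OF x] Suc])
  then have "linked ((z ^^ (Suc n * multiplier x)) x) ((z ^^ multiplier x) ?y)" by (simp add: funpow_funpow)
  from linked_trans[OF this step] show ?case by simp
qed (simp add: linked_refl)

lemma linked_move: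
  assumes x: "x \<in> \<Omega>" and y: "C x y" shows "linked y ((z ^^ height x) ((z' ^^ coheight x) y))"
proof -
  let ?h = "height x" and ?n = "coheight x" and ?m = "multiplier x"
  have move: "linked ((z ^^ (?h + ?n * ?m)) u) ((z ^^ ?h) ((z' ^^ ?n) u))" if "u \<in> \<Omega>" "multiplier u = ?m" for u
    using linked_A[OF z_pow_mem_A z_pow_mem[OF that(1)] linked_z'_pow[OF that(1)], of ?h ?n] that(2)
    by (simp add: funpow_funpow)
  have "linked ((z ^^ ?h) ((z' ^^ ?n) x)) x"
    using linked_trans[OF linked_A[OF z_pow_mem_A S.z_pow_mem[OF x] linked_coheight[OF x]] linked_height] .
  then have "linked ((z ^^ (?h + ?n * ?m)) x) ((z ^^ 0) x)" using linked_trans[OF move[OF x refl]] by simp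
  then have "(?h + ?n * ?m) mod p = 0 mod p" using linked_z_pow_iff[OF x] by blast
  then have "(z ^^ (?h + ?n * ?m)) y = y" using z_pow_cong[of _ 0 y] by simp
  then show ?thesis using move[OF same_class_mem[OF x y]] multiplier_eq[OF y] by simp
qed

lemma linked_aligning: "x \<in> \<Omega> \<Longrightarrow> linked x (aligning x)"
  unfolding aligning_def using linked_move[OF _ C_refl] by simp

lemma aligning_mem: "x \<in> \<Omega> \<Longrightarrow> aligning x \<in> \<Omega>"
  using linked_mem linked_aligning by blast

lemma C_aligning: "x \<in> \<Omega> \<Longrightarrow> C x (aligning x)"
  using linked_same_class linked_aligning by blast

lemma aligning_permutes: "aligning permutes \<Omega>"
proof (rule permutes_\<Omega>I[OF aligning_mem])
  show "inj_on aligning \<Omega>"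
  proof (rule inj_onI)
    fix x y assume x: "x \<in> \<Omega>" and y: "y \<in> \<Omega>" and eq: "aligning x = aligning y"
    have "linked x y" using linked_aligning[OF x] linked_aligning[OF y] eq linked_sym linked_trans by metis
    then have "(z ^^ height x) ((z' ^^ coheight x) x) = (z ^^ height x) ((z' ^^ coheight x) y)"
      using eq x y height_linked coheight_linked[OF x] by (simp add: aligning_def)
    then show "x = y" using A_inj[OF z_pow_mem_A] A_inj[OF S.z_pow_mem_A] by blast
  qed
  show "x \<notin> \<Omega> \<Longrightarrow> aligning x = x" for x by (simp add: aligning_def)
qed

lemma near_aligning:
  assumes b: "b \<in> \<Omega>" and y: "C b y" shows "near b y ((z ^^ t) ((z' ^^ n) y))"
proof -
  note yO = same_class_mem[OF b y]
  have "z' \<in> class_preserving" using S.z_class_preserving unfolding S_class_preserving .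
  then have "near b y ((z' ^^ n) y)" using near_funpow[OF b, of y z' n] near_z'[OF b y] by blast
  then show ?thesis using near_trans[OF b _ near_z_pow[OF b]] C_trans[OF y C_z'_pow[OF yO]] by blast
qed

lemma aligning_pair_same_class:
  assumes x: "x \<in> \<Omega>" and y: "C x y" shows "\<exists>a\<in>A. a x = aligning x \<and> a y = aligning y"
proof -
  note yO = same_class_mem[OF x y]
  define g where "g u = (z ^^ height x) ((z' ^^ coheight x) u)" for u
  have gA: "g \<in> A" unfolding g_def[abs_def] using A_comp[OF z_pow_mem_A S.z_pow_mem_A] .
  have gx: "g x = aligning x" unfolding g_def aligning_def using x by simp
  show ?thesis
  proof (cases "linked x y")
    case True
    then have "g y = aligning y" unfolding g_def aligning_def using yO height_linked coheight_linked[OF x] by simp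
    then show ?thesis using gx gA by blast
  next
    case False
    note b = aligning_mem[OF x]
    have Cy: "C (aligning x) y" using C_trans[OF C_sym[OF C_aligning[OF x]] y] .
    have gy: "linked y (g y)" unfolding g_def by (rule linked_move[OF x y])
    then have Cgy: "C (aligning x) (g y)" using C_trans[OF Cy] linked_same_class by blast
    have not_linked: "\<not> linked (aligning x) (g y)"
      using False linked_aligning[OF x] gy linked_sym linked_trans by metis
    have "near (aligning x) y (g y)" "near (aligning x) y (aligning y)" unfolding g_def aligning_def[of y] using near_aligning[OF b Cy] yO by auto
    then have near: "near (aligning x) (g y) (aligning y)" using near_sym[OF b] near_trans[OF b] by blast
    have "linked (g y) (aligning y)" using gy linked_aligning[OF yO] linked_sym linked_trans by blast
    then obtain f where f: "f \<in> class_preserving" "f (aligning x) = aligning x" "f (g y) = aligning y"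
      using near_linked_in_orbit[OF b Cgy not_linked _ near] by blast
    then show ?thesis using gx A_comp[OF class_preserving_mem_A[OF f(1)] gA] by (intro bexI[of _ "\<lambda>u. f (g u)"]) auto
  qed
qed

lemma aligning_pair_different_classes:
  assumes x: "x \<in> \<Omega>" and y: "y \<in> \<Omega>" and far: "\<not> C x y" shows "\<exists>a\<in>A. a x = aligning x \<and> a y = aligning y"
proof -
  have far': "\<not> C' x y" using far same_rigid_class_S_iff[OF x] by blast
  obtain d where d: "d \<in> A" "\<And>u. u \<in> \<Omega> \<Longrightarrow> C x u \<Longrightarrow> d u = (z ^^ height x) u"
      "\<And>u. u \<in> \<Omega> \<Longrightarrow> C y u \<Longrightarrow> d u = (z ^^ height y) u"
    using independent_rotations_pair[OF add_subgroup_rigid independent_rotations_rigid far] by blast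
  obtain e where e: "e \<in> A" "\<And>u. u \<in> \<Omega> \<Longrightarrow> C' x u \<Longrightarrow> e u = (z' ^^ coheight x) u"
      "\<And>u. u \<in> \<Omega> \<Longrightarrow> C' y u \<Longrightarrow> e u = (z' ^^ coheight y) u"
    using S.independent_rotations_pair[OF S.add_subgroup_rigid S.independent_rotations_rigid far'] by blast
  have "d (e x) = aligning x" "d (e y) = aligning y"
    unfolding aligning_def using x y e(2)[OF x S.same_rigid_class_refl] e(3)[OF y S.same_rigid_class_refl]
      d(2)[OF S.z_pow_mem[OF x] C_z'_pow[OF x]] d(3)[OF S.z_pow_mem[OF y] C_z'_pow[OF y]] by simp_all
  then show ?thesis using A_comp[OF d(1) e(1)] by (intro bexI[of _ "\<lambda>u. d (e u)"]) auto
qed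

lemma aligning_mem_A: "aligning \<in> A"
  by (rule two_closed[OF aligning_permutes]) (use aligning_pair_same_class aligning_pair_different_classes in blast)

lemma aligning_z':
  assumes x: "x \<in> \<Omega>" shows "aligning (z' x) = (z ^^ multiplier x) (aligning x)"
proof -
  let ?y = "z' x" and ?m = "multiplier x"
  have y: "?y \<in> \<Omega>" by (rule S.z_mem[OF x])
  have base: "class_base ?y = class_base x" using class_base_eq[OF C_z'_pow[OF x, of 1]] by simp
  have "linked ((z ^^ height ?y) (class_base x)) ((z ^^ ?m) x)"
    using linked_trans[OF linked_height linked_sym[OF multiplier(2)[OF x]]] unfolding base .
  moreover have "linked ((z ^^ ?m) ((z ^^ height x) (class_base x))) ((z ^^ ?m) x)"
    by (rule linked_A[OF z_pow_mem_A z_pow_mem[OF class_base_mem[OF x]] linked_height])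
  ultimately have "linked ((z ^^ height ?y) (class_base x)) ((z ^^ (?m + height x)) (class_base x))"
    using linked_sym linked_trans unfolding funpow_funpow by blast
  then have height: "height ?y mod p = (?m + height x) mod p" using linked_z_pow_iff[OF class_base_mem[OF x]] by blast
  have "linked ((z' ^^ Suc (coheight ?y)) x) ((z' ^^ coheight x) x)"
    using linked_trans[OF linked_coheight[OF y] linked_sym[OF linked_coheight[OF x, folded base]]] by (simp add: funpow_swap1)
  then have "Suc (coheight ?y) mod p = coheight x mod p"
    using linked_iff_S_linked[OF S.z_pow_mem[OF x]] S.linked_z_pow_iff[OF x] by blast
  then have "(z' ^^ Suc (coheight ?y)) x = (z' ^^ coheight x) x" by (rule S.z_pow_cong)
  then show ?thesis
    using x y z_pow_cong[OF height] by (simp add: aligning_def funpow_swap1 funpow_funpow)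
qed

lemma adapted_conj_aligning: "adapted rigid (\<lambda>v. conj_perm aligning (\<sigma> v)) (conj_perm aligning z') multiplier"
  unfolding adapted_def class_constant_def
proof (intro conjI ballI allI impI)
  show "regular_rep (\<lambda>v. conj_perm aligning (\<sigma> v)) (conj_perm aligning z')" by (rule S.regular_rep_conj[OF aligning_mem_A])
  show "multiplier x = multiplier y" if "C x y" for x y using multiplier_eq[OF that] .
  fix x assume x: "x \<in> \<Omega>"
  note inv_mem = A_inv_mem[OF aligning_mem_A]
  have C_inv: "C (finv aligning y) y" if "y \<in> \<Omega>" for y using C_aligning[OF inv_mem[OF that]] by (simp add: A_inv(3)[OF aligning_mem_A])
  show "multiplier x < p" by (rule multiplier(1)[OF x])
  show "conj_perm aligning z' x = (z ^^ multiplier x) x"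
    using aligning_z'[OF inv_mem[OF x]] multiplier_eq[OF C_inv[OF x]] by (simp add: conj_perm_def A_inv(3)[OF aligning_mem_A])
  fix v y assume xy: "C x y"
  note y = same_class_mem[OF x xy]
  have "C (finv aligning x) (finv aligning y)" using C_trans[OF C_trans[OF C_inv[OF x] xy] C_sym[OF C_inv[OF y]]] .
  then have "C (\<sigma> v (finv aligning x)) (\<sigma> v (finv aligning y))"
    using same_rigid_class_S_iff S.same_class_\<tau> inv_mem[OF x] S.\<tau>_mem by blast
  then show "C (conj_perm aligning (\<sigma> v) x) (conj_perm aligning (\<sigma> v) y)"
    unfolding conj_perm_def comp_apply using C_aligning[OF S.\<tau>_mem[OF inv_mem]] x y C_sym C_trans by blast
qed

lemma conjugate_into_if_common_sylow: "CARD('v) = 32 \<Longrightarrow> conjugate_into \<sigma> z'"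
  using conjugate_into_conj[OF aligning_mem_A] conjugate_into_if_adapted[OF adapted_conj_aligning add_subgroup_rigid
      independent_rotations_rigid] by blast

end

theorem (in two_reps) regular_reps_conjugate:
  assumes "CARD('v) = 32" shows "conjugate_into \<sigma> z'"
proof -
  obtain i j where card: "card class_rotations = p ^ i" "card S.class_rotations = p ^ j"
    using card_class_rotations S.card_class_rotations by blast
  obtain g T k where g: "g \<in> A" and T: "perm_group \<Omega> T" "T \<subseteq> A" "card T = p ^ k" "class_rotations \<subseteq> T"
      "conj_perm g ` S.class_rotations \<subseteq> T"
    using perm_groups_conj_in_common_p_group[OF perm_group_A finite_\<Omega> prime_p
        perm_group_class_rotations class_rotations_subset_A card(1)
        S.perm_group_class_rotations S.class_rotations_subset_A card(2)] .
  interpret G: conjugated_rep \<Omega> A p \<sigma> z' g by unfold_locales (rule g)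
  interpret T: common_sylow \<Omega> A p \<tau> z "\<lambda>v. conj_perm g (\<sigma> v)" "conj_perm g z'" T k
    by unfold_locales (use T G.class_rotations_conj in auto)
  show ?thesis using conjugate_into_conj[OF g T.conjugate_into_if_common_sylow[OF assms]] .
qed

section \<open>Cayley digraphs\<close>

lemma cayley_arc_iff: "(g, h) \<in> parcs (cayley_digraph G S) \<longleftrightarrow> g \<in> carrier G \<and> (\<exists>s\<in>S. h = s \<otimes>\<^bsub>G\<^esub> g)"
  unfolding cayley_digraph_def by auto

definition cayley_map :: "('a, 'b) monoid_scheme \<Rightarrow> 'a set \<Rightarrow> 'a set \<Rightarrow> ('a \<Rightarrow> 'a) \<Rightarrow> bool" where
  "cayley_map G S T \<phi> \<longleftrightarrow> bij_betw \<phi> (carrier G) (carrier G) \<and>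
    (\<forall>g\<in>carrier G. \<forall>h\<in>carrier G. (g, h) \<in> parcs (cayley_digraph G S) \<longleftrightarrow> (\<phi> g, \<phi> h) \<in> parcs (cayley_digraph G T))"

lemma cayley_map_bij: "cayley_map G S T \<phi> \<Longrightarrow> bij_betw \<phi> (carrier G) (carrier G)"
  and cayley_map_arc_iff: "\<lbrakk>cayley_map G S T \<phi>; g \<in> carrier G; h \<in> carrier G\<rbrakk> \<Longrightarrow>
    (\<phi> g, \<phi> h) \<in> parcs (cayley_digraph G T) \<longleftrightarrow> (g, h) \<in> parcs (cayley_digraph G S)"
  unfolding cayley_map_def by auto

lemma cayley_map_mem: "cayley_map G S T \<phi> \<Longrightarrow> g \<in> carrier G \<Longrightarrow> \<phi> g \<in> carrier G"
  using bij_betw_apply[OF cayley_map_bij] .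

lemma cayley_map_comp:
  assumes \<phi>: "cayley_map G S T \<phi>" and \<psi>: "cayley_map G T U \<psi>" shows "cayley_map G S U (\<psi> \<circ> \<phi>)"
  unfolding cayley_map_def
proof (intro conjI ballI)
  show "bij_betw (\<psi> \<circ> \<phi>) (carrier G) (carrier G)" by (rule bij_betw_trans[OF cayley_map_bij[OF \<phi>] cayley_map_bij[OF \<psi>]])
qed (simp add: cayley_map_arc_iff[OF \<phi>] cayley_map_arc_iff[OF \<psi>] cayley_map_mem[OF \<phi>])

lemma cayley_map_cong:
  assumes "\<And>g. g \<in> carrier G \<Longrightarrow> \<phi> g = \<psi> g" and \<psi>: "cayley_map G S T \<psi>" shows "cayley_map G S T \<phi>"
  unfolding cayley_map_def
  using bij_betw_cong[of "carrier G" \<phi> \<psi>] cayley_map_bij[OF \<psi>] cayley_map_arc_iff[OF \<psi>] assms(1) by simp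

lemma cayley_map_inv:
  assumes perm: "\<phi> permutes carrier G" and \<phi>: "cayley_map G S T \<phi>" shows "cayley_map G T S (finv \<phi>)"
  unfolding cayley_map_def
proof (intro conjI ballI)
  show "bij_betw (finv \<phi>) (carrier G) (carrier G)" by (rule permutes_imp_bij[OF permutes_inv[OF perm]])
  fix g h assume "g \<in> carrier G" "h \<in> carrier G"
  then have "finv \<phi> g \<in> carrier G" "finv \<phi> h \<in> carrier G" using permutes_in_image[OF permutes_inv[OF perm]] by blast+
  from cayley_map_arc_iff[OF \<phi> this]
  show "(g, h) \<in> parcs (cayley_digraph G T) \<longleftrightarrow> (finv \<phi> g, finv \<phi> h) \<in> parcs (cayley_digraph G S)"
    by (simp add: permutes_inverses(1)[OF perm])
qed

lemma pverts_cayley_digraph: "pverts (cayley_digraph G S) = carrier G"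
  unfolding cayley_digraph_def by simp

lemma (in group) parcs_cayley_digraph_subset:
  "S \<subseteq> carrier G \<Longrightarrow> parcs (cayley_digraph G S) \<subseteq> carrier G \<times> carrier G"
  unfolding cayley_digraph_def by auto

lemma (in group) cayley_map_of_digraph_isomorphism:
  assumes S: "S \<subseteq> carrier G"
    and iso: "pre_digraph.digraph_isomorphism (with_proj (cayley_digraph G S)) f"
    and eq: "with_proj (cayley_digraph G T) = app_iso f (with_proj (cayley_digraph G S))"
  shows "cayley_map G S T (iso_verts f)"
proof -
  let ?\<phi> = "iso_verts f" and ?S = "parcs (cayley_digraph G S)" and ?T = "parcs (cayley_digraph G T)"
  have inj: "inj_on ?\<phi> (carrier G)"
    using iso by (simp add: pre_digraph.digraph_isomorphism_def pverts_cayley_digraph)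
  have img: "?\<phi> ` carrier G = carrier G" using arg_cong[OF eq, of verts] by (simp add: pverts_cayley_digraph)
  have arcs: "?T = iso_arcs f ` ?S" using arg_cong[OF eq, of arcs] by simp
  have ends: "iso_tail f = fst" "iso_head f = snd" using arg_cong[OF eq, of tail] arg_cong[OF eq, of head] by simp_all
  have arc: "iso_arcs f a = (?\<phi> (fst a), ?\<phi> (snd a))" if "a \<in> ?S" for a
    using iso that unfolding pre_digraph.digraph_isomorphism_def ends by (simp add: prod_eq_iff)
  show ?thesis unfolding cayley_map_def
  proof (intro conjI ballI iffI)
    show "bij_betw ?\<phi> (carrier G) (carrier G)" using inj img unfolding bij_betw_def by blast
    fix g h assume g: "g \<in> carrier G" and h: "h \<in> carrier G"
    show "(?\<phi> g, ?\<phi> h) \<in> ?T" if "(g, h) \<in> ?S" unfolding arcs using arc[OF that] that by (intro image_eqI) simp_all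
    assume "(?\<phi> g, ?\<phi> h) \<in> ?T"
    then obtain a where a: "a \<in> ?S" "?\<phi> g = ?\<phi> (fst a)" "?\<phi> h = ?\<phi> (snd a)" unfolding arcs using arc by auto
    then have "fst a \<in> carrier G" "snd a \<in> carrier G" using parcs_cayley_digraph_subset[OF S] by auto
    then have "g = fst a" "h = snd a" using inj_onD[OF inj a(2) g] inj_onD[OF inj a(3) h] by auto
    then show "(g, h) \<in> ?S" using a(1) by simp
  qed
qed

lemma (in group) digraph_isomorphism_of_cayley_map:
  assumes S: "S \<subseteq> carrier G" and T: "T \<subseteq> carrier G" and \<phi>: "cayley_map G S T \<phi>"
  obtains f where "pre_digraph.digraph_isomorphism (with_proj (cayley_digraph G S)) f"
    "with_proj (cayley_digraph G T) = app_iso f (with_proj (cayley_digraph G S))" "iso_verts f = \<phi>"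
proof
  let ?S = "parcs (cayley_digraph G S)" and ?T = "parcs (cayley_digraph G T)"
  let ?f = "\<lparr>iso_verts = \<phi>, iso_arcs = map_prod \<phi> \<phi>, iso_head = snd, iso_tail = fst\<rparr>"
  note subset = parcs_cayley_digraph_subset[OF S] parcs_cayley_digraph_subset[OF T]
  have inj: "inj_on \<phi> (carrier G)" and img: "\<phi> ` carrier G = carrier G"
    using cayley_map_bij[OF \<phi>] unfolding bij_betw_def by auto
  have "map_prod \<phi> \<phi> ` ?S = ?T"
  proof (intro equalityI subsetI)
    fix a assume "a \<in> map_prod \<phi> \<phi> ` ?S"
    then show "a \<in> ?T" using cayley_map_arc_iff[OF \<phi>] subset(1) by auto
  next
    fix a assume a: "a \<in> ?T"
    then have "fst a \<in> \<phi> ` carrier G" "snd a \<in> \<phi> ` carrier G" using subset(2) img by auto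
    then obtain g h where gh: "g \<in> carrier G" "h \<in> carrier G" "a = map_prod \<phi> \<phi> (g, h)" by (auto simp: prod_eq_iff)
    then have "(g, h) \<in> ?S" using cayley_map_arc_iff[OF \<phi>] a by simp
    then show "a \<in> map_prod \<phi> \<phi> ` ?S" using gh(3) by (rule rev_image_eqI)
  qed
  then show "with_proj (cayley_digraph G T) = app_iso ?f (with_proj (cayley_digraph G S))"
    unfolding app_iso_def with_proj_def using img by (simp add: pverts_cayley_digraph)
  have "wf_digraph (with_proj (cayley_digraph G S))"
    by unfold_locales (use subset(1) in \<open>auto simp: pverts_cayley_digraph\<close>)
  moreover have "inj_on (map_prod \<phi> \<phi>) ?S" by (rule inj_on_subset[OF map_prod_inj_on[OF inj inj] subset(1)])
  ultimately show "pre_digraph.digraph_isomorphism (with_proj (cayley_digraph G S)) ?f"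
    unfolding pre_digraph.digraph_isomorphism_def using inj by (auto simp: pverts_cayley_digraph)
qed simp

context group
begin

lemma digraph_iso_iff_cayley_map:
  assumes "S \<subseteq> carrier G" "T \<subseteq> carrier G"
  shows "digraph_iso (with_proj (cayley_digraph G S)) (with_proj (cayley_digraph G T)) \<longleftrightarrow> (\<exists>\<phi>. cayley_map G S T \<phi>)"
  unfolding digraph_iso_def
  using cayley_map_of_digraph_isomorphism[OF assms(1)] digraph_isomorphism_of_cayley_map[OF assms] by metis

lemma cayley_isomorphic_iff_cayley_map:
  assumes "S \<subseteq> carrier G" "T \<subseteq> carrier G"
  shows "cayley_isomorphic G S T \<longleftrightarrow> (\<exists>\<phi>\<in>auto G. cayley_map G S T \<phi>)"
  unfolding cayley_isomorphic_def
  using cayley_map_of_digraph_isomorphism[OF assms(1)] digraph_isomorphism_of_cayley_map[OF assms] by metis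

lemma cayley_map_auto_mem_iff:
  assumes \<phi>: "cayley_map G S T \<phi>" "\<phi> \<in> auto G" and S: "S \<subseteq> carrier G" and T: "T \<subseteq> carrier G" and s: "s \<in> carrier G"
  shows "s \<in> S \<longleftrightarrow> \<phi> s \<in> T"
proof -
  have "\<phi> \<in> hom G G" using \<phi>(2) unfolding auto_def by blast
  then have one: "\<phi> \<one> = \<one>" using hom_one is_group by blast
  have arc: "(\<one>, u) \<in> parcs (cayley_digraph G U) \<longleftrightarrow> u \<in> U" if "U \<subseteq> carrier G" for u U
    unfolding cayley_arc_iff using that by (auto simp: subset_iff)
  show ?thesis using cayley_map_arc_iff[OF \<phi>(1) one_closed s] unfolding one arc[OF S] arc[OF T] by blast
qed

lemma cayley_arc_iff_involution:
  assumes g: "g \<in> carrier G" "g \<otimes> g = \<one>" and h: "h \<in> carrier G" and U: "U \<subseteq> carrier G"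
  shows "(g, h) \<in> parcs (cayley_digraph G U) \<longleftrightarrow> h \<otimes> g \<in> U"
proof -
  have cancel: "(u \<otimes> g) \<otimes> g = u" if "u \<in> carrier G" for u using that g by (simp add: m_assoc)
  show ?thesis
  proof
    assume "(g, h) \<in> parcs (cayley_digraph G U)"
    then obtain s where "s \<in> U" "h = s \<otimes> g" unfolding cayley_arc_iff by blast
    then show "h \<otimes> g \<in> U" using cancel U by auto
  next
    assume "h \<otimes> g \<in> U"
    then show "(g, h) \<in> parcs (cayley_digraph G U)"
      unfolding cayley_arc_iff using g(1) cancel[OF h] by (intro conjI bexI[of _ "h \<otimes> g"]) simp_all
  qed
qed

end

section \<open>The group for the prime 2\<close>

abbreviation "cube_times n \<equiv> group_power (integer_mod_group 2) 5 \<times>\<times> integer_mod_group n"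

lemma carrier_cube_times: "n > 0 \<Longrightarrow> carrier (cube_times n) = ({..<5} \<rightarrow>\<^sub>E {0..<2}) \<times> {0..<int n}"
  unfolding group_power_def by (simp add: carrier_integer_mod_group)

lemma fst_cube_times_mult: "fst (g \<otimes>\<^bsub>cube_times n\<^esub> h) = (\<lambda>i\<in>{..<5}. (fst g i + fst h i) mod 2)"
  and snd_cube_times_mult: "snd (g \<otimes>\<^bsub>cube_times n\<^esub> h) = (snd g + snd h) mod int n"
  unfolding group_power_def product_group_def by (simp_all add: DirProd_def split_beta)

lemma fst_cube_times_mult_at: "i < 5 \<Longrightarrow> fst (g \<otimes>\<^bsub>cube_times n\<^esub> h) i = (fst g i + fst h i) mod 2"
  by (simp add: fst_cube_times_mult)

lemma fst_cube_times_one: "fst \<one>\<^bsub>cube_times n\<^esub> = (\<lambda>i\<in>{..<5}. 0)" and snd_cube_times_one: "snd \<one>\<^bsub>cube_times n\<^esub> = 0"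
  unfolding group_power_def product_group_def by (simp_all add: DirProd_def)

lemma comm_group_cube_times: "comm_group (cube_times n)"
proof (rule group.group_comm_groupI)
  show "group (cube_times n)" unfolding group_power_def by (intro DirProd_group product_group group_integer_mod_group)
  show "g \<otimes>\<^bsub>cube_times n\<^esub> h = h \<otimes>\<^bsub>cube_times n\<^esub> g" for g h
    by (rule prod_eqI) (simp_all add: fst_cube_times_mult snd_cube_times_mult add.commute)
qed

lemmas group_cube_times = comm_group.axioms(2)[OF comm_group_cube_times]

lemma cube_times_2_mem_iff:
  "g \<in> carrier (cube_times 2) \<longleftrightarrow> fst g \<in> extensional {..<5} \<and> (\<forall>i<5. fst g i \<in> {0, 1}) \<and> snd g \<in> {0, 1}"
  using carrier_cube_times[of 2] by (cases g) (auto simp: PiE_def Pi_def extensional_def)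

lemma cube_times_2_square: "g \<otimes>\<^bsub>cube_times 2\<^esub> g = \<one>\<^bsub>cube_times 2\<^esub>"
  by (rule prod_eqI) (simp_all only: fst_cube_times_mult snd_cube_times_mult fst_cube_times_one snd_cube_times_one,
      simp_all add: restrict_def fun_eq_iff)

text \<open>With \<open>c = (x 0, x 1, x 2)\<close> and \<open>b = (x 3, x 4, y)\<close>, the quadric \<open>b \<cdot> c = 0\<close> and the cubic
  \<open>b \<cdot> c = c\<^sub>1 c\<^sub>2 c\<^sub>3\<close> define isomorphic Cayley digraphs via \<open>b \<mapsto> b + (c\<^sub>2 c\<^sub>3, c\<^sub>1 c\<^sub>3, c\<^sub>1 c\<^sub>2)\<close>. An automorphism
  preserves the degree of the indicator polynomial, which is detected by the points of a 3-dimensional subspace.\<close>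

definition pairing :: "(nat \<Rightarrow> int) \<times> int \<Rightarrow> (nat \<Rightarrow> int) \<times> int \<Rightarrow> int" where
  "pairing g h = fst g 0 * fst h 3 + fst g 1 * fst h 4 + fst g 2 * snd h"

definition triple_product :: "(nat \<Rightarrow> int) \<times> int \<Rightarrow> int" where
  "triple_product g = fst g 0 * fst g 1 * fst g 2"

definition quadric :: "((nat \<Rightarrow> int) \<times> int) set" where
  "quadric = {g \<in> carrier (cube_times 2). even (pairing g g)}"

definition cubic :: "((nat \<Rightarrow> int) \<times> int) set" where
  "cubic = {g \<in> carrier (cube_times 2). even (pairing g g + triple_product g)}"

lemma quadric_subset: "quadric \<subseteq> carrier (cube_times 2)" and cubic_subset: "cubic \<subseteq> carrier (cube_times 2)"
  unfolding quadric_def cubic_def by auto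

lemma even_pairing_mult_left:
  "even (pairing (g \<otimes>\<^bsub>cube_times 2\<^esub> h) w) \<longleftrightarrow> even (pairing g w + pairing h w)"
proof -
  have "even (pairing (g \<otimes>\<^bsub>cube_times 2\<^esub> h) w) \<longleftrightarrow>
      even ((fst g 0 + fst h 0) * fst w 3 + (fst g 1 + fst h 1) * fst w 4 + (fst g 2 + fst h 2) * snd w)"
    by (simp add: pairing_def fst_cube_times_mult_at)
  also have "\<dots> \<longleftrightarrow> even (pairing g w + pairing h w)" by (rule arg_cong[of _ _ even]) (simp add: pairing_def algebra_simps)
  finally show ?thesis .
qed

lemma even_pairing_mult_right:
  "even (pairing w (g \<otimes>\<^bsub>cube_times 2\<^esub> h)) \<longleftrightarrow> even (pairing w g + pairing w h)"
proof -
  have "even (pairing w (g \<otimes>\<^bsub>cube_times 2\<^esub> h)) \<longleftrightarrow>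
      even (fst w 0 * (fst g 3 + fst h 3) + fst w 1 * (fst g 4 + fst h 4) + fst w 2 * (snd g + snd h))"
    by (simp add: pairing_def fst_cube_times_mult_at snd_cube_times_mult)
  also have "\<dots> \<longleftrightarrow> even (pairing w g + pairing w h)" by (rule arg_cong[of _ _ even]) (simp add: pairing_def algebra_simps)
  finally show ?thesis .
qed

lemma even_pairing_triple:
  assumes "even (pairing x x)" "even (pairing y y)" "even (pairing w w)"
    and "even (pairing (x \<otimes>\<^bsub>cube_times 2\<^esub> y) (x \<otimes>\<^bsub>cube_times 2\<^esub> y))"
      "even (pairing (x \<otimes>\<^bsub>cube_times 2\<^esub> w) (x \<otimes>\<^bsub>cube_times 2\<^esub> w))"
      "even (pairing (y \<otimes>\<^bsub>cube_times 2\<^esub> w) (y \<otimes>\<^bsub>cube_times 2\<^esub> w))"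
  shows "even (pairing (x \<otimes>\<^bsub>cube_times 2\<^esub> y \<otimes>\<^bsub>cube_times 2\<^esub> w) (x \<otimes>\<^bsub>cube_times 2\<^esub> y \<otimes>\<^bsub>cube_times 2\<^esub> w))"
  using assms by (simp add: even_pairing_mult_left even_pairing_mult_right) blast

definition cubic_shear :: "(nat \<Rightarrow> int) \<times> int \<Rightarrow> (nat \<Rightarrow> int) \<times> int" where
  "cubic_shear g = (\<lambda>i\<in>{..<5}. if i = 3 then (fst g 3 + fst g 1 * fst g 2) mod 2
     else if i = 4 then (fst g 4 + fst g 0 * fst g 2) mod 2 else fst g i, (snd g + fst g 0 * fst g 1) mod 2)"

lemma cubic_shear_coords:
  "fst (cubic_shear g) 0 = fst g 0" "fst (cubic_shear g) 1 = fst g 1" "fst (cubic_shear g) 2 = fst g 2"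
  "fst (cubic_shear g) 3 = (fst g 3 + fst g 1 * fst g 2) mod 2" "fst (cubic_shear g) 4 = (fst g 4 + fst g 0 * fst g 2) mod 2"
  "snd (cubic_shear g) = (snd g + fst g 0 * fst g 1) mod 2"
  unfolding cubic_shear_def by simp_all

lemma cubic_shear_mem: assumes "g \<in> carrier (cube_times 2)" shows "cubic_shear g \<in> carrier (cube_times 2)"
proof -
  have mod2: "a mod 2 \<in> {0, 1}" for a :: int by auto
  show ?thesis using assms mod2 unfolding cube_times_2_mem_iff by (auto simp: cubic_shear_def)
qed

lemma cubic_shear_invol: assumes g: "g \<in> carrier (cube_times 2)" shows "cubic_shear (cubic_shear g) = g"
proof -
  have coords: "fst g \<in> extensional {..<5}" "\<And>i. i < 5 \<Longrightarrow> fst g i = 0 \<or> fst g i = 1" "snd g = 0 \<or> snd g = 1"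
    using g unfolding cube_times_2_mem_iff by auto
  have cancel: "((b + c) mod 2 + c) mod 2 = b" if "b = 0 \<or> b = 1" for b c :: int using that by presburger
  have "fst (cubic_shear (cubic_shear g)) i = fst g i" for i
    using coords(1,2) cancel unfolding cubic_shear_def by (auto simp: extensional_def)
  moreover have "snd (cubic_shear (cubic_shear g)) = snd g" unfolding cubic_shear_coords using coords(3) cancel by blast
  ultimately show ?thesis by (simp add: prod_eq_iff fun_eq_iff)
qed

lemma mult_mem_quadric_iff:
  assumes g: "g \<in> carrier (cube_times 2)" and h: "h \<in> carrier (cube_times 2)"
  shows "h \<otimes>\<^bsub>cube_times 2\<^esub> g \<in> quadric \<longleftrightarrow> cubic_shear h \<otimes>\<^bsub>cube_times 2\<^esub> cubic_shear g \<in> cubic"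
proof -
  interpret group "cube_times 2" by (rule group_cube_times)
  let ?q = "\<lambda>x. pairing x x" and ?g = "fst g" and ?h = "fst h"
  define q1 where "q1 = (?h 0 + ?g 0) * (?h 3 + ?g 3) + (?h 1 + ?g 1) * (?h 4 + ?g 4) + (?h 2 + ?g 2) * (snd h + snd g)"
  define q2 where "q2 = (?h 0 + ?g 0) * (?h 3 + ?h 1 * ?h 2 + (?g 3 + ?g 1 * ?g 2)) +
    (?h 1 + ?g 1) * (?h 4 + ?h 0 * ?h 2 + (?g 4 + ?g 0 * ?g 2)) +
    (?h 2 + ?g 2) * (snd h + ?h 0 * ?h 1 + (snd g + ?g 0 * ?g 1)) + (?h 0 + ?g 0) * (?h 1 + ?g 1) * (?h 2 + ?g 2)"
  have q2_eq: "q2 = q1 + 2 * (2 * ?h 0 * ?h 1 * ?h 2 + 2 * ?g 0 * ?g 1 * ?g 2 + ?h 0 * ?h 1 * ?g 2 + ?h 0 * ?g 1 * ?h 2 +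
    ?g 0 * ?h 1 * ?h 2 + ?g 0 * ?g 1 * ?h 2 + ?g 0 * ?h 1 * ?g 2 + ?h 0 * ?g 1 * ?g 2)"
    unfolding q1_def q2_def by (simp add: algebra_simps)
  note coords = fst_cube_times_mult_at snd_cube_times_mult of_nat_numeral
  have "even q1 \<longleftrightarrow> even q2" unfolding q2_eq by simp
  moreover have "even (?q (h \<otimes>\<^bsub>cube_times 2\<^esub> g)) \<longleftrightarrow> even q1"
    unfolding pairing_def q1_def by (simp add: coords)
  moreover have "even (?q (cubic_shear h \<otimes>\<^bsub>cube_times 2\<^esub> cubic_shear g) +
      triple_product (cubic_shear h \<otimes>\<^bsub>cube_times 2\<^esub> cubic_shear g)) \<longleftrightarrow> even q2"
    unfolding pairing_def triple_product_def q2_def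
    by (simp add: coords cubic_shear_coords cubic_shear_coords(2)[unfolded One_nat_def])
  ultimately show ?thesis unfolding quadric_def cubic_def using m_closed g h cubic_shear_mem by simp
qed

lemma cayley_map_cubic_shear: "cayley_map (cube_times 2) quadric cubic cubic_shear"
  unfolding cayley_map_def
proof (intro conjI ballI)
  interpret group "cube_times 2" by (rule group_cube_times)
  show "bij_betw cubic_shear (carrier (cube_times 2)) (carrier (cube_times 2))"
    by (rule bij_betwI[where g = cubic_shear]) (use cubic_shear_invol cubic_shear_mem in auto)
  fix g h assume g: "g \<in> carrier (cube_times 2)" and h: "h \<in> carrier (cube_times 2)"
  show "(g, h) \<in> parcs (cayley_digraph (cube_times 2) quadric) \<longleftrightarrow>
      (cubic_shear g, cubic_shear h) \<in> parcs (cayley_digraph (cube_times 2) cubic)"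
    unfolding cayley_arc_iff_involution[OF g cube_times_2_square h quadric_subset]
      cayley_arc_iff_involution[OF cubic_shear_mem[OF g] cube_times_2_square cubic_shear_mem[OF h] cubic_subset]
    by (rule mult_mem_quadric_iff[OF g h])
qed

definition unit_vector :: "nat \<Rightarrow> (nat \<Rightarrow> int) \<times> int" where
  "unit_vector k = (\<lambda>i\<in>{..<5}. if i = k then 1 else 0, 0)"

lemma not_cayley_isomorphic_quadric_cubic: "\<not> cayley_isomorphic (cube_times 2) quadric cubic"
proof
  let ?G = "cube_times 2" and ?e = unit_vector
  interpret group ?G by (rule group_cube_times)
  assume "cayley_isomorphic ?G quadric cubic"
  then obtain \<phi> where \<phi>: "cayley_map ?G quadric cubic \<phi>" "\<phi> \<in> auto ?G"
    using cayley_isomorphic_iff_cayley_map[OF quadric_subset cubic_subset] by blast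
  have hom: "\<phi> (g \<otimes>\<^bsub>?G\<^esub> h) = \<phi> g \<otimes>\<^bsub>?G\<^esub> \<phi> h" if "g \<in> carrier ?G" "h \<in> carrier ?G" for g h
    using \<phi>(2) that unfolding auto_def hom_def by auto
  have even_iff: "even (pairing g g) \<longleftrightarrow> even (pairing (\<phi> g) (\<phi> g) + triple_product (\<phi> g))" if g: "g \<in> carrier ?G" for g
    using cayley_map_auto_mem_iff[OF \<phi> quadric_subset cubic_subset g] g cayley_map_mem[OF \<phi>(1) g]
    unfolding quadric_def cubic_def by blast
  have "?e k \<in> carrier ?G" for k unfolding cube_times_2_mem_iff unit_vector_def by simp
  then have img: "?e k \<in> \<phi> ` carrier ?G" for k using cayley_map_bij[OF \<phi>(1)] unfolding bij_betw_def by simp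
  define f where "f k = inv_into (carrier ?G) \<phi> (?e k)" for k
  have f: "f k \<in> carrier ?G" "\<phi> (f k) = ?e k" for k
    unfolding f_def using inv_into_into[OF img] f_inv_into_f[OF img] .
  have f_mult: "\<phi> (f k \<otimes>\<^bsub>?G\<^esub> f l) = ?e k \<otimes>\<^bsub>?G\<^esub> ?e l" for k l unfolding hom[OF f(1) f(1)] f(2) ..
  have eval: "triple_product (?e k) = 0" "pairing (?e k) (?e k) = 0" "k \<noteq> l \<Longrightarrow> triple_product (?e k \<otimes>\<^bsub>?G\<^esub> ?e l) = 0"
    "pairing (?e k \<otimes>\<^bsub>?G\<^esub> ?e l) (?e k \<otimes>\<^bsub>?G\<^esub> ?e l) = 0" if "k \<in> {0, 1, 2}" "l \<in> {0, 1, 2}" for k l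
    unfolding pairing_def triple_product_def fst_cube_times_mult snd_cube_times_mult
    using that by (auto simp: unit_vector_def)
  have "even (pairing (f k) (f k))" if "k \<in> {0, 1, 2}" for k
    using even_iff[OF f(1)] eval[OF that that] by (simp add: f(2))
  moreover have "even (pairing (f k \<otimes>\<^bsub>?G\<^esub> f l) (f k \<otimes>\<^bsub>?G\<^esub> f l))" if "k \<in> {0, 1, 2}" "l \<in> {0, 1, 2}" "k \<noteq> l" for k l
    using even_iff[OF m_closed[OF f(1) f(1)]] eval[OF that(1,2)] that(3) by (simp add: f_mult)
  ultimately have "even (pairing (f 0 \<otimes>\<^bsub>?G\<^esub> f 1 \<otimes>\<^bsub>?G\<^esub> f 2) (f 0 \<otimes>\<^bsub>?G\<^esub> f 1 \<otimes>\<^bsub>?G\<^esub> f 2))"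
    by (intro even_pairing_triple) auto
  then show False
    unfolding even_iff[OF m_closed[OF m_closed[OF f(1) f(1)] f(1)]]
      hom[OF m_closed[OF f(1) f(1)] f(1)] f_mult f(2)
    unfolding pairing_def triple_product_def fst_cube_times_mult snd_cube_times_mult
    by (simp add: unit_vector_def)
qed

lemma not_DCI_group_cube_times_2: "\<not> DCI_group (cube_times 2)"
proof
  interpret group "cube_times 2" by (rule group_cube_times)
  assume "DCI_group (cube_times 2)"
  moreover have "digraph_iso (with_proj (cayley_digraph (cube_times 2) quadric)) (with_proj (cayley_digraph (cube_times 2) cubic))"
    using digraph_iso_iff_cayley_map[OF quadric_subset cubic_subset] cayley_map_cubic_shear by blast
  ultimately have "cayley_isomorphic (cube_times 2) quadric cubic"
    using quadric_subset cubic_subset unfolding DCI_group_def CI_subset_def by blast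
  then show False using not_cayley_isomorphic_quadric_cubic by blast
qed

section \<open>Babai's criterion\<close>

definition cayley_automorphisms :: "('a, 'b) monoid_scheme \<Rightarrow> 'a set \<Rightarrow> ('a \<Rightarrow> 'a) set" where
  "cayley_automorphisms G S = {a. a permutes carrier G \<and> cayley_map G S S a}"

lemma perm_group_cayley_automorphisms: "perm_group (carrier G) (cayley_automorphisms G S)"
proof (rule perm_groupI)
  show "id \<in> cayley_automorphisms G S" by (simp add: cayley_automorphisms_def cayley_map_def permutes_id)
  show "f \<circ> g \<in> cayley_automorphisms G S" if "f \<in> cayley_automorphisms G S" "g \<in> cayley_automorphisms G S" for f g
    using that permutes_compose cayley_map_comp unfolding cayley_automorphisms_def by blast
  show "finv f \<in> cayley_automorphisms G S" if "f \<in> cayley_automorphisms G S" for f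
    using that permutes_inv cayley_map_inv unfolding cayley_automorphisms_def by blast
qed (simp add: cayley_automorphisms_def)

lemma conj_perm_cayley_automorphisms:
  assumes perm: "\<phi> permutes carrier G" and \<phi>: "cayley_map G S T \<phi>" and a: "a \<in> cayley_automorphisms G S"
  shows "conj_perm \<phi> a \<in> cayley_automorphisms G T"
proof -
  have a': "a permutes carrier G" "cayley_map G S S a" using a unfolding cayley_automorphisms_def by auto
  have "\<phi> \<circ> a \<circ> finv \<phi> permutes carrier G"
    using permutes_compose[OF permutes_inv[OF perm] permutes_compose[OF a'(1) perm]] .
  moreover have "cayley_map G T T (\<phi> \<circ> a \<circ> finv \<phi>)"
    by (rule cayley_map_comp[OF cayley_map_inv[OF perm \<phi>] cayley_map_comp[OF a'(2) \<phi>]])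
  ultimately show ?thesis unfolding cayley_automorphisms_def conj_perm_def by blast
qed

lemma two_closed_group_cayley_automorphisms:
  assumes "finite (carrier G)" "prime p" "odd p"
  shows "two_closed_group (carrier G) (cayley_automorphisms G S) p"
proof
  show "perm_group (carrier G) (cayley_automorphisms G S)" by (rule perm_group_cayley_automorphisms)
  fix \<delta> assume perm: "\<delta> permutes carrier G"
    and pair: "\<And>x y. x \<in> carrier G \<Longrightarrow> y \<in> carrier G \<Longrightarrow> \<exists>a\<in>cayley_automorphisms G S. a x = \<delta> x \<and> a y = \<delta> y"
  have "(x, y) \<in> parcs (cayley_digraph G S) \<longleftrightarrow> (\<delta> x, \<delta> y) \<in> parcs (cayley_digraph G S)"
    if x: "x \<in> carrier G" and y: "y \<in> carrier G" for x y
  proof -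
    obtain a where "cayley_map G S S a" "a x = \<delta> x" "a y = \<delta> y"
      using pair[OF x y] unfolding cayley_automorphisms_def by blast
    then show ?thesis using cayley_map_arc_iff[of G S S a x y] x y by simp
  qed
  then show "\<delta> \<in> cayley_automorphisms G S"
    unfolding cayley_automorphisms_def cayley_map_def using perm permutes_imp_bij[OF perm] by blast
qed (use assms in auto)

definition translation :: "('a, 'b) monoid_scheme \<Rightarrow> 'a \<Rightarrow> 'a \<Rightarrow> 'a" where
  "translation G g x = (if x \<in> carrier G then g \<otimes>\<^bsub>G\<^esub> x else x)"

lemma (in group) translation_mult:
  "\<lbrakk>g \<in> carrier G; h \<in> carrier G\<rbrakk> \<Longrightarrow> translation G (g \<otimes> h) x = translation G g (translation G h x)"
  by (simp add: translation_def m_assoc)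

lemma (in group) translation_one: "translation G \<one> x = x"
  by (simp add: translation_def)

lemma (in group) translation_inv:
  assumes "g \<in> carrier G" shows "translation G (inv g) (translation G g x) = x" "translation G g (translation G (inv g) x) = x"
  using assms translation_one by (simp_all flip: translation_mult)

lemma (in group) translation_permutes: assumes g: "g \<in> carrier G" shows "translation G g permutes carrier G"
proof (rule bij_imp_permutes)
  show "bij_betw (translation G g) (carrier G) (carrier G)"
    by (rule bij_betwI[where g = "translation G (inv g)"]) (use g in \<open>auto simp: translation_inv\<close>, simp_all add: translation_def g)
qed (simp add: translation_def)

lemma (in comm_group) translation_mem_cayley_automorphisms:
  assumes g: "g \<in> carrier G" and S: "S \<subseteq> carrier G" shows "translation G g \<in> cayley_automorphisms G S"
proof -
  have arc: "(translation G g x, translation G g y) \<in> parcs (cayley_digraph G S)"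
    if g: "g \<in> carrier G" and xy: "(x, y) \<in> parcs (cayley_digraph G S)" for g x y
  proof -
    obtain s where s: "x \<in> carrier G" "s \<in> S" "y = s \<otimes> x" using xy unfolding cayley_arc_iff by blast
    then have "translation G g y = s \<otimes> translation G g x" using S g by (auto simp: translation_def m_lcomm)
    then show ?thesis unfolding cayley_arc_iff using s(1,2) g by (auto simp: translation_def)
  qed
  have "(x, y) \<in> parcs (cayley_digraph G S) \<longleftrightarrow> (translation G g x, translation G g y) \<in> parcs (cayley_digraph G S)" for x y
    using arc[OF g] arc[OF inv_closed[OF g], of "translation G g x" "translation G g y"] translation_inv[OF g] by auto
  then show ?thesis
    unfolding cayley_automorphisms_def cayley_map_def
    using translation_permutes[OF g] permutes_imp_bij[OF translation_permutes[OF g]] by blast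
qed

text \<open>A Cayley isomorphism that normalizes the translations becomes an automorphism after a translation.\<close>

lemma (in comm_group) cayley_isomorphic_if_normalizes:
  assumes S: "S \<subseteq> carrier G" and T: "T \<subseteq> carrier G" and \<chi>: "cayley_map G S T \<chi>"
    and normal: "\<And>g. g \<in> carrier G \<Longrightarrow> \<exists>h\<in>carrier G. \<forall>x\<in>carrier G. \<chi> (g \<otimes> x) = h \<otimes> \<chi> x"
  shows "cayley_isomorphic G S T"
proof -
  define c where "c = inv (\<chi> \<one>)"
  define \<alpha> where "\<alpha> = restrict (\<lambda>x. c \<otimes> \<chi> x) (carrier G)"
  note mem = cayley_map_mem[OF \<chi>]
  have c: "c \<in> carrier G" unfolding c_def using mem by simp
  have "\<alpha> (g \<otimes> x) = \<alpha> g \<otimes> \<alpha> x" if g: "g \<in> carrier G" and x: "x \<in> carrier G" for g x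
  proof -
    obtain h where h: "h \<in> carrier G" "\<And>x. x \<in> carrier G \<Longrightarrow> \<chi> (g \<otimes> x) = h \<otimes> \<chi> x" using normal[OF g] by blast
    have "\<alpha> g = c \<otimes> (h \<otimes> \<chi> \<one>)" unfolding \<alpha>_def using h(2)[OF one_closed] g by simp
    also have "\<dots> = h" unfolding c_def using h(1) mem[OF one_closed] by (simp add: m_lcomm)
    finally show ?thesis unfolding \<alpha>_def using h g x c mem[OF x] by (simp add: m_lcomm)
  qed
  moreover have map: "cayley_map G S T \<alpha>"
  proof (rule cayley_map_cong)
    show "cayley_map G S T (translation G c \<circ> \<chi>)"
      using cayley_map_comp[OF \<chi>] translation_mem_cayley_automorphisms[OF c T] unfolding cayley_automorphisms_def by blast
  qed (simp add: \<alpha>_def translation_def mem)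
  moreover note bij = cayley_map_bij[OF map]
  ultimately have "\<alpha> \<in> auto G"
    unfolding auto_def Bij_def hom_def using bij_betw_apply[OF bij] by (auto simp: \<alpha>_def)
  then show ?thesis using map cayley_isomorphic_iff_cayley_map[OF S T] by blast
qed

section \<open>The group for odd primes\<close>

typedef cube = "Pow {..<5 :: nat}" by auto

instantiation cube :: elementary_2_group
begin

definition "0 = Abs_cube {}"
definition "u + v = Abs_cube ((Rep_cube u - Rep_cube v) \<union> (Rep_cube v - Rep_cube u))"
definition "(u :: cube) - v = u + v"
definition "- (u :: cube) = u"

lemma Rep_cube_plus: "Rep_cube (u + v) = (Rep_cube u - Rep_cube v) \<union> (Rep_cube v - Rep_cube u)"
  unfolding plus_cube_def by (rule Abs_cube_inverse) (use Rep_cube[of u] Rep_cube[of v] in auto)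

lemma Rep_cube_zero: "Rep_cube 0 = {}"
  unfolding zero_cube_def by (rule Abs_cube_inverse) simp

instance
  by standard (auto simp: Rep_cube_inject[symmetric] Rep_cube_plus Rep_cube_zero minus_cube_def uminus_cube_def)

end

instance cube :: finite
proof
  have "finite (range Rep_cube)" by (simp add: type_definition.Rep_range[OF type_definition_cube])
  then show "finite (UNIV :: cube set)" by (rule finite_imageD) (simp add: inj_on_def Rep_cube_inject)
qed

lemma card_cube: "CARD(cube) = 32"
  by (simp add: type_definition.card[OF type_definition_cube] card_Pow)

definition cube_element :: "cube \<Rightarrow> (nat \<Rightarrow> int) \<times> int" where
  "cube_element v = (\<lambda>i\<in>{..<5}. if i \<in> Rep_cube v then 1 else 0, 0)"

definition cyclic_element :: "nat \<Rightarrow> nat \<Rightarrow> (nat \<Rightarrow> int) \<times> int" where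
  "cyclic_element p t = (\<lambda>i\<in>{..<5}. 0, int t mod int p)"

context
  fixes p :: nat
  assumes p: "p > 0"
begin

interpretation comm_group "cube_times p" by (rule comm_group_cube_times)

text \<open>So that elements of \<open>cube_times p\<close> are handled only through their coordinates.\<close>

declare carrier_DirProd [simp del] one_DirProd [simp del] mult_DirProd [simp del]

lemma cube_element_mem: "cube_element v \<in> carrier (cube_times p)"
  unfolding carrier_cube_times[OF p] cube_element_def using p by (auto simp: PiE_def)

lemma cyclic_element_mem: "cyclic_element p t \<in> carrier (cube_times p)"
  unfolding carrier_cube_times[OF p] cyclic_element_def using p by (auto simp: PiE_def)

lemma cube_element_add: "cube_element (u + v) = cube_element u \<otimes>\<^bsub>cube_times p\<^esub> cube_element v"
  by (rule prod_eqI) (auto simp: fst_cube_times_mult snd_cube_times_mult cube_element_def Rep_cube_plus fun_eq_iff)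

lemma cyclic_element_Suc: "cyclic_element p (Suc t) = cyclic_element p 1 \<otimes>\<^bsub>cube_times p\<^esub> cyclic_element p t"
  by (rule prod_eqI) (auto simp: fst_cube_times_mult snd_cube_times_mult cyclic_element_def fun_eq_iff mod_simps)

lemma cyclic_element_one: "t mod p = 0 \<Longrightarrow> cyclic_element p t = \<one>\<^bsub>cube_times p\<^esub>"
  by (rule prod_eqI) (simp_all add: fst_cube_times_one snd_cube_times_one cyclic_element_def flip: zmod_int)

lemma cube_times_decomposition:
  assumes g: "g \<in> carrier (cube_times p)"
  obtains v t where "g = cyclic_element p t \<otimes>\<^bsub>cube_times p\<^esub> cube_element v"
proof
  have coords: "fst g \<in> extensional {..<5}" "\<And>i. i < 5 \<Longrightarrow> fst g i = 0 \<or> fst g i = 1" "0 \<le> snd g" "snd g < int p"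
    using g unfolding carrier_cube_times[OF p] by (auto simp: PiE_def Pi_def)
  define v where "v = Abs_cube {i \<in> {..<5}. fst g i = 1}"
  have v: "Rep_cube v = {i \<in> {..<5}. fst g i = 1}" unfolding v_def by (rule Abs_cube_inverse) auto
  show "g = cyclic_element p (nat (snd g)) \<otimes>\<^bsub>cube_times p\<^esub> cube_element v"
  proof (rule prod_eqI)
    have "fst g i = fst (cyclic_element p (nat (snd g)) \<otimes>\<^bsub>cube_times p\<^esub> cube_element v) i" for i
      unfolding fst_cube_times_mult cyclic_element_def cube_element_def v
      using coords(1) coords(2)[of i] by (auto simp: extensional_def)
    then show "fst g = fst (cyclic_element p (nat (snd g)) \<otimes>\<^bsub>cube_times p\<^esub> cube_element v)" by (rule ext)
    show "snd g = snd (cyclic_element p (nat (snd g)) \<otimes>\<^bsub>cube_times p\<^esub> cube_element v)"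
      unfolding snd_cube_times_mult cyclic_element_def cube_element_def using coords(3,4) by simp
  qed
qed

lemma finite_carrier_cube_times: "finite (carrier (cube_times p))"
  unfolding carrier_cube_times[OF p] by (intro finite_cartesian_product finite_PiE) auto

lemma card_carrier_cube_times: "card (carrier (cube_times p)) = CARD(cube) * p"
  unfolding carrier_cube_times[OF p] by (simp add: card_cube card_cartesian_product card_PiE)

lemma translation_cyclic_element:
  "(translation (cube_times p) (cyclic_element p 1) ^^ t) x = translation (cube_times p) (cyclic_element p t) x"
proof (induction t)
  case 0
  then show ?case by (simp add: cyclic_element_one translation_one)
next
  case (Suc t)
  then show ?case using cyclic_element_Suc[of t] by (simp add: translation_mult cyclic_element_mem)
qed

lemma regular_rep_translations:
  assumes odd: "prime p" "odd p" and S: "S \<subseteq> carrier (cube_times p)"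
  shows "regular_rep (carrier (cube_times p)) (cayley_automorphisms (cube_times p) S) p
    (\<lambda>v. translation (cube_times p) (cube_element v)) (translation (cube_times p) (cyclic_element p 1))"
proof -
  let ?G = "cube_times p"
  interpret A: two_closed_group "carrier ?G" "cayley_automorphisms ?G S" p
    by (rule two_closed_group_cayley_automorphisms[OF finite_carrier_cube_times odd])
  show ?thesis
  proof (unfold_locales, unfold A.regular_rep_def, intro conjI allI ballI)
    show "translation ?G (cube_element v) \<in> cayley_automorphisms ?G S" for v
      by (rule translation_mem_cayley_automorphisms[OF cube_element_mem S])
    show "translation ?G (cyclic_element p 1) \<in> cayley_automorphisms ?G S"
      by (rule translation_mem_cayley_automorphisms[OF cyclic_element_mem S])
    show "translation ?G (cube_element (u + v)) x = translation ?G (cube_element u) (translation ?G (cube_element v) x)" for u v x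
      unfolding cube_element_add by (rule translation_mult[OF cube_element_mem cube_element_mem])
    show "translation ?G (cube_element v) (translation ?G (cyclic_element p 1) x)
        = translation ?G (cyclic_element p 1) (translation ?G (cube_element v) x)" for v x
      using m_comm[OF cube_element_mem cyclic_element_mem]
      by (simp add: cube_element_mem cyclic_element_mem flip: translation_mult)
    show "(translation ?G (cyclic_element p 1) ^^ p) x = x" for x
      unfolding translation_cyclic_element by (simp add: cyclic_element_one translation_one)
    show "card (carrier ?G) = CARD(cube) * p" by (rule card_carrier_cube_times)
    fix x y assume x: "x \<in> carrier ?G" and y: "y \<in> carrier ?G"
    then obtain v t where vt: "y \<otimes>\<^bsub>?G\<^esub> inv\<^bsub>?G\<^esub> x = cyclic_element p t \<otimes>\<^bsub>?G\<^esub> cube_element v"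
      using cube_times_decomposition[OF m_closed[OF y inv_closed[OF x]]] by blast
    have "y = translation ?G (y \<otimes>\<^bsub>?G\<^esub> inv\<^bsub>?G\<^esub> x) x" using x y by (simp add: translation_def m_assoc)
    then have "y = (translation ?G (cyclic_element p 1) ^^ t) (translation ?G (cube_element v) x)"
      unfolding vt translation_cyclic_element by (simp add: translation_mult cyclic_element_mem cube_element_mem)
    then show "\<exists>v t. y = (translation ?G (cyclic_element p 1) ^^ t) (translation ?G (cube_element v) x)" by blast
  qed
qed

lemma normalizes_translations:
  assumes \<chi>: "\<And>x. x \<in> carrier (cube_times p) \<Longrightarrow> \<chi> x \<in> carrier (cube_times p)"
    and cube: "\<And>v. \<exists>u. \<forall>x\<in>carrier (cube_times p).
      \<chi> (translation (cube_times p) (cube_element v) x) = translation (cube_times p) (cube_element u) (\<chi> x)"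
    and cyclic: "\<And>x. x \<in> carrier (cube_times p) \<Longrightarrow>
      \<chi> (translation (cube_times p) (cyclic_element p 1) x) = translation (cube_times p) (cyclic_element p k) (\<chi> x)"
    and g: "g \<in> carrier (cube_times p)"
  shows "\<exists>h\<in>carrier (cube_times p). \<forall>x\<in>carrier (cube_times p). \<chi> (g \<otimes>\<^bsub>cube_times p\<^esub> x) = h \<otimes>\<^bsub>cube_times p\<^esub> \<chi> x"
proof -
  let ?G = "cube_times p" and ?z = "translation (cube_times p) (cyclic_element p 1)"
  obtain v t where vt: "g = cyclic_element p t \<otimes>\<^bsub>?G\<^esub> cube_element v" using cube_times_decomposition[OF g] .
  obtain u where u: "\<And>x. x \<in> carrier ?G \<Longrightarrow> \<chi> (translation ?G (cube_element v) x) = translation ?G (cube_element u) (\<chi> x)"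
    using cube by blast
  have cyclic_pow: "\<chi> ((?z ^^ t) x) = (?z ^^ (t * k)) (\<chi> x)" if x: "x \<in> carrier ?G" for t x
  proof (induction t)
    case (Suc t)
    have "(?z ^^ t) x \<in> carrier ?G"
      unfolding translation_cyclic_element using x cyclic_element_mem by (simp add: translation_def)
    then have "\<chi> ((?z ^^ Suc t) x) = (?z ^^ k) ((?z ^^ (t * k)) (\<chi> x))"
      using cyclic Suc unfolding translation_cyclic_element[of k] by simp
    then show ?case by (simp add: funpow_funpow)
  qed simp
  let ?h = "cyclic_element p (t * k) \<otimes>\<^bsub>?G\<^esub> cube_element u"
  have "\<chi> (g \<otimes>\<^bsub>?G\<^esub> x) = ?h \<otimes>\<^bsub>?G\<^esub> \<chi> x" if x: "x \<in> carrier ?G" for x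
  proof -
    have "translation ?G (cube_element v) x \<in> carrier ?G" using x cube_element_mem by (simp add: translation_def)
    from cyclic_pow[OF this, of t] have "\<chi> (translation ?G g x) = translation ?G ?h (\<chi> x)"
      unfolding vt translation_cyclic_element u[OF x] by (simp add: translation_mult cyclic_element_mem cube_element_mem)
    then show ?thesis using x \<chi>[OF x] by (simp add: translation_def)
  qed
  then show ?thesis using cyclic_element_mem cube_element_mem by blast
qed

lemma cayley_isomorphic_cube_times_odd:
  assumes odd: "prime p" "odd p" and S: "S \<subseteq> carrier (cube_times p)" and T: "T \<subseteq> carrier (cube_times p)"
    and \<psi>: "cayley_map (cube_times p) S T \<psi>"
  shows "cayley_isomorphic (cube_times p) S T"
proof -
  let ?G = "cube_times p"
  let ?\<tau> = "\<lambda>v. translation ?G (cube_element v)" and ?z = "translation ?G (cyclic_element p 1)"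
  define \<phi> where "\<phi> x = (if x \<in> carrier ?G then \<psi> x else x)" for x
  have \<phi>: "cayley_map ?G S T \<phi>" by (rule cayley_map_cong[OF _ \<psi>]) (simp add: \<phi>_def)
  have perm: "\<phi> permutes carrier ?G" by (rule bij_imp_permutes[OF cayley_map_bij[OF \<phi>]]) (simp add: \<phi>_def)
  interpret S: regular_rep "carrier ?G" "cayley_automorphisms ?G S" p ?\<tau> ?z
    by (rule regular_rep_translations[OF odd S])
  interpret T: regular_rep "carrier ?G" "cayley_automorphisms ?G T" p ?\<tau> ?z
    by (rule regular_rep_translations[OF odd T])
  have "T.regular_rep (\<lambda>v. conj_perm \<phi> (?\<tau> v)) (conj_perm \<phi> ?z)"
    by (rule S.regular_rep_conj_into[OF T.two_closed_group_axioms perm conj_perm_cayley_automorphisms[OF perm \<phi>]])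
  then interpret P: two_reps "carrier ?G" "cayley_automorphisms ?G T" p ?\<tau> ?z "\<lambda>v. conj_perm \<phi> (?\<tau> v)" "conj_perm \<phi> ?z"
    by unfold_locales
  obtain \<delta> k where \<delta>: "\<delta> \<in> cayley_automorphisms ?G T"
      "\<And>v. \<exists>u. \<forall>x\<in>carrier ?G. \<delta> (conj_perm \<phi> (?\<tau> v) x) = ?\<tau> u (\<delta> x)"
      "\<And>x. x \<in> carrier ?G \<Longrightarrow> \<delta> (conj_perm \<phi> ?z x) = (?z ^^ k) (\<delta> x)"
    using P.regular_reps_conjugate[OF card_cube] unfolding T.conjugate_into_def by blast
  have conj: "conj_perm \<phi> f (\<phi> x) = \<phi> (f x)" for f x by (simp add: conj_perm_def permutes_inverses[OF perm])
  note mem = cayley_map_mem[OF \<phi>]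
  show ?thesis
  proof (rule cayley_isomorphic_if_normalizes[OF S T])
    show map: "cayley_map ?G S T (\<delta> \<circ> \<phi>)"
      using cayley_map_comp[OF \<phi>] \<delta>(1) unfolding cayley_automorphisms_def by blast
    show "\<exists>h\<in>carrier ?G. \<forall>x\<in>carrier ?G. (\<delta> \<circ> \<phi>) (g \<otimes>\<^bsub>?G\<^esub> x) = h \<otimes>\<^bsub>?G\<^esub> (\<delta> \<circ> \<phi>) x" if "g \<in> carrier ?G" for g
    proof (rule normalizes_translations[OF cayley_map_mem[OF map] _ _ that])
      show "\<exists>u. \<forall>x\<in>carrier ?G. (\<delta> \<circ> \<phi>) (?\<tau> v x) = ?\<tau> u ((\<delta> \<circ> \<phi>) x)" for v
        using \<delta>(2)[of v] mem by (metis conj comp_apply)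
      show "(\<delta> \<circ> \<phi>) (?z x) = translation ?G (cyclic_element p k) ((\<delta> \<circ> \<phi>) x)" if "x \<in> carrier ?G" for x
        using \<delta>(3)[OF mem[OF that]] unfolding conj translation_cyclic_element by simp
    qed
  qed
qed

lemma DCI_group_cube_times_odd: assumes "prime p" "odd p" shows "DCI_group (cube_times p)"
  unfolding DCI_group_def CI_subset_def
proof (intro conjI allI impI)
  fix S T assume S: "S \<subseteq> carrier (cube_times p)" and T: "T \<subseteq> carrier (cube_times p)"
    and "digraph_iso (with_proj (cayley_digraph (cube_times p) S)) (with_proj (cayley_digraph (cube_times p) T))"
  then obtain \<psi> where "cayley_map (cube_times p) S T \<psi>" unfolding digraph_iso_iff_cayley_map[OF S T] by (elim exE)
  then show "cayley_isomorphic (cube_times p) S T" by (rule cayley_isomorphic_cube_times_odd[OF assms S T])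
qed (use is_group finite_carrier_cube_times in auto)

end

theorem theorem1p1:
  fixes p :: nat
  assumes "prime p"
  shows "DCI_group (group_power (integer_mod_group 2) 5 \<times>\<times> integer_mod_group p) \<longleftrightarrow> p \<noteq> 2"
proof (cases "p = 2")
  case True
  then show ?thesis using not_DCI_group_cube_times_2 by simp
next
  case False
  then have "odd p" using primes_dvd_imp_eq[OF two_is_prime_nat assms] by blast
  then show ?thesis using DCI_group_cube_times_odd[OF prime_gt_0_nat[OF assms] assms] False by simp
qed

end
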